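(* Let $\mathbf{M}$ be a compact Riemannian manifold without boundary, let $L$ be a smooth self-adjoint non-negative second order elliptic differential operator in $L_2(\mathbf{M})$, and let $1\le p\le\infty$. The series $\sum_{j=0}^{\infty}G_j(\sqrt{L})$ converges strongly to the identity operator on $L_p(\mathbf{M})$, i.e. one has in the norm of $L_p(\mathbf{M})$ $$\sum_{j=0}^{\infty}G_j(\sqrt{L})f=f,\qquad f\in L_p(\mathbf{M}).$$
   Context: $\mathbf{M}$ is connected; $\sqrt{L}$ is the positive square root of $L$ and has spectrum $0=\lambda_0<\lambda_1\le\lambda_2\le\dots$ with a corresponding orthonormal basis of $L_2(\mathbf{M})$ consisting of real-valued eigenfunctions $u_l$; $F(\sqrt{L})f=\sum_l F(\lambda_l)\langle f,u_l\rangle u_l$ for compactly supported smooth $F$, defined for $f\in L_p(\mathbf{M})\subset L_1(\mathbf{M})$. Partition of unity: $g\in C^\infty(\mathbb{R}_+)$ is non-increasing, $\operatorname{supp}g\subset[0,2]$, $g=1$ on $[0,1]$, $0\le g\le1$; $h(\lambda)=g(\lambda)-g(2\lambda)$; $G_0(\lambda)=g(\lambda)$, $G_j(\lambda)=h(2^{-j}\lambda)$ for $j\ge1$. One has $\sum_{j\ge0}G_j(\lambda)=1$ for $\lambda\ge0$.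
   Formalization: For p = ∞ the space L_p(M) is read as the continuous functions C(M) with the supremum norm, since for a discontinuous bounded f the series of smooth partial sums cannot converge to f in L_∞(M). *)

theory Defs
  imports "HOL-Analysis.Analysis"
begin

section \<open>Smooth functions on open subsets of Euclidean spaces\<close>

primrec Ck_on :: "nat \<Rightarrow> ('a::euclidean_space \<Rightarrow> 'b::real_normed_vector) \<Rightarrow> 'a set \<Rightarrow> bool" where
  "Ck_on 0 f S = continuous_on S f"
| "Ck_on (Suc k) f S =
     (f differentiable_on S \<and> (\<forall>b\<in>Basis. Ck_on k (\<lambda>x. frechet_derivative f (at x) b) S))"

text \<open>The derivatives above are two-sided, so this is only meant for open \<open>S\<close>.\<close>

definition smooth_on :: "('a::euclidean_space \<Rightarrow> 'b::real_normed_vector) \<Rightarrow> 'a set \<Rightarrow> bool" where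
  "smooth_on f S \<longleftrightarrow> (\<forall>k. Ck_on k f S)"

definition partial :: "'n::finite \<Rightarrow> (real^'n \<Rightarrow> 'b::real_normed_vector) \<Rightarrow> real^'n \<Rightarrow> 'b" where
  "partial i f x = frechet_derivative f (at x) (axis i 1)"


section \<open>Compact Riemannian manifolds\<close>

text \<open>The manifold is (the universe of) the type \<open>'m\<close>. A chart is a pair of a domain and a
  coordinate map; only the values of the coordinate map on the domain matter.\<close>

type_synonym ('m, 'n) chart = "'m set \<times> ('m \<Rightarrow> real^'n)"

definition coord_inv :: "('m, 'n::finite) chart \<Rightarrow> real^'n \<Rightarrow> 'm" where
  "coord_inv c = inv_into (fst c) (snd c)"

definition coord_range :: "('m, 'n::finite) chart \<Rightarrow> (real^'n) set" where
  "coord_range c = snd c ` fst c"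

definition transition :: "('m, 'n::finite) chart \<Rightarrow> ('m, 'n) chart \<Rightarrow> real^'n \<Rightarrow> real^'n" where
  "transition c d = snd d \<circ> coord_inv c"

definition is_chart :: "('m::topological_space, 'n::finite) chart \<Rightarrow> bool" where
  "is_chart c \<longleftrightarrow> open (fst c) \<and> open (coord_range c) \<and>
     homeomorphism (fst c) (coord_range c) (snd c) (coord_inv c)"

definition smooth_atlas :: "('m::topological_space, 'n::finite) chart set \<Rightarrow> bool" where
  "smooth_atlas A \<longleftrightarrow> (\<forall>c\<in>A. is_chart c) \<and> (\<Union>c\<in>A. fst c) = UNIV \<and>
     (\<forall>c\<in>A. \<forall>d\<in>A. smooth_on (transition c d) (snd c ` (fst c \<inter> fst d)))"

definition smooth_fun ::
  "('m, 'n::finite) chart set \<Rightarrow> ('m \<Rightarrow> 'b::real_normed_vector) \<Rightarrow> bool" where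
  "smooth_fun A f \<longleftrightarrow> (\<forall>c\<in>A. smooth_on (f \<circ> coord_inv c) (coord_range c))"

text \<open>A Riemannian metric is given by its matrices \<open>G c x\<close> in the coordinates of each chart
  \<open>c\<close>; the last clause is the transformation law of a covariant 2-tensor.\<close>

definition riemannian_metric ::
  "('m, 'n::finite) chart set \<Rightarrow> (('m, 'n) chart \<Rightarrow> real^'n \<Rightarrow> real^'n^'n) \<Rightarrow> bool" where
  "riemannian_metric A G \<longleftrightarrow>
     (\<forall>c\<in>A. smooth_on (G c) (coord_range c) \<and>
        (\<forall>x\<in>coord_range c. transpose (G c x) = G c x \<and>
           (\<forall>v. v \<noteq> 0 \<longrightarrow> v \<bullet> (G c x *v v) > 0))) \<and>
     (\<forall>c\<in>A. \<forall>d\<in>A. \<forall>x \<in> snd c ` (fst c \<inter> fst d).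
        let J = matrix (frechet_derivative (transition c d) (at x))
        in G c x = transpose J ** G d (transition c d x) ** J)"

text \<open>The open coordinate ranges rule out boundary points.\<close>

definition compact_riemannian_manifold ::
  "('m::{t2_space, second_countable_topology}, 'n::finite) chart set \<Rightarrow>
     (('m, 'n) chart \<Rightarrow> real^'n \<Rightarrow> real^'n^'n) \<Rightarrow> bool" where
  "compact_riemannian_manifold A G \<longleftrightarrow>
     compact (UNIV :: 'm set) \<and> smooth_atlas A \<and> riemannian_metric A G"

text \<open>The following determines \<open>\<mu>\<close> uniquely.\<close>

definition riemannian_measure ::
  "('m::{t2_space, second_countable_topology}, 'n::finite) chart set \<Rightarrow>
     (('m, 'n) chart \<Rightarrow> real^'n \<Rightarrow> real^'n^'n) \<Rightarrow> 'm measure \<Rightarrow> bool" where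
  "riemannian_measure A G \<mu> \<longleftrightarrow> sets \<mu> = sets borel \<and>
     (\<forall>c\<in>A. \<forall>B\<in>sets borel. B \<subseteq> fst c \<longrightarrow>
        emeasure \<mu> B =
          (\<integral>\<^sup>+ x. ennreal (sqrt (det (G c x))) * indicator (snd c ` B) x \<partial>lborel))"


section \<open>The spaces \<open>L\<^sub>p\<close>\<close>

text \<open>Elements are represented by functions. For \<open>p = \<infinity>\<close> the space is, by convention, the
  space of continuous functions with the supremum norm: a norm limit in the space of all
  essentially bounded functions of finite sums of (continuous) eigenfunctions has a continuous
  representative, so norm-convergent spectral expansions require this reading.\<close>

definition Lp_space :: "'m::topological_space measure \<Rightarrow> ereal \<Rightarrow> ('m \<Rightarrow> complex) set" where
  "Lp_space \<mu> p =
     (if p = \<infinity> then {f. continuous_on UNIV f}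
      else {f \<in> borel_measurable \<mu>. integrable \<mu> (\<lambda>x. norm (f x) powr real_of_ereal p)})"

definition Lp_norm :: "'m::topological_space measure \<Rightarrow> ereal \<Rightarrow> ('m \<Rightarrow> complex) \<Rightarrow> real" where
  "Lp_norm \<mu> p f =
     (if p = \<infinity> then (SUP x. norm (f x))
      else (\<integral>x. norm (f x) powr real_of_ereal p \<partial>\<mu>) powr (1 / real_of_ereal p))"

definition pairing :: "'m measure \<Rightarrow> ('m \<Rightarrow> complex) \<Rightarrow> ('m \<Rightarrow> complex) \<Rightarrow> complex" where
  "pairing \<mu> f h = (\<integral>x. f x * cnj (h x) \<partial>\<mu>)"


section \<open>Unbounded operators in \<open>L\<^sub>2\<close>\<close>

text \<open>An operator in \<open>L\<^sub>2\<close> is represented by its graph. Functions stand for their classes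
  modulo null sets; the graphs produced by \<open>op_closure\<close> and \<open>op_adjoint\<close> are closed under
  changing either component on a null set.\<close>

type_synonym 'm graph = "(('m \<Rightarrow> complex) \<times> ('m \<Rightarrow> complex)) set"

definition op_closure :: "'m::topological_space measure \<Rightarrow> 'm graph \<Rightarrow> 'm graph" where
  "op_closure \<mu> T = {(f, h). f \<in> Lp_space \<mu> 2 \<and> h \<in> Lp_space \<mu> 2 \<and>
     (\<exists>F H. (\<forall>n::nat. (F n, H n) \<in> T) \<and>
        (\<lambda>n. Lp_norm \<mu> 2 (\<lambda>x. F n x - f x)) \<longlonglongrightarrow> 0 \<and>
        (\<lambda>n. Lp_norm \<mu> 2 (\<lambda>x. H n x - h x)) \<longlonglongrightarrow> 0)}"

definition op_adjoint :: "'m::topological_space measure \<Rightarrow> 'm graph \<Rightarrow> 'm graph" where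
  "op_adjoint \<mu> T = {(f, h). f \<in> Lp_space \<mu> 2 \<and> h \<in> Lp_space \<mu> 2 \<and>
     (\<forall>(v, w)\<in>T. pairing \<mu> w f = pairing \<mu> v h)}"

definition densely_defined :: "'m::topological_space measure \<Rightarrow> 'm graph \<Rightarrow> bool" where
  "densely_defined \<mu> T \<longleftrightarrow>
     (\<forall>f\<in>Lp_space \<mu> 2. \<forall>\<epsilon>>0. \<exists>v\<in>Domain T. Lp_norm \<mu> 2 (\<lambda>x. f x - v x) < \<epsilon>)"

definition self_adjoint :: "'m::topological_space measure \<Rightarrow> 'm graph \<Rightarrow> bool" where
  "self_adjoint \<mu> T \<longleftrightarrow> densely_defined \<mu> T \<and> op_adjoint \<mu> T = T"

definition non_negative :: "'m measure \<Rightarrow> 'm graph \<Rightarrow> bool" where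
  "non_negative \<mu> T \<longleftrightarrow>
     (\<forall>(v, w)\<in>T. Im (pairing \<mu> w v) = 0 \<and> Re (pairing \<mu> w v) \<ge> 0)"

text \<open>\<open>S\<close> is the positive square root of \<open>T\<close>; note that \<open>S O S\<close> is the graph of the composition
  of \<open>S\<close> with itself.\<close>

definition positive_sqrt :: "'m::topological_space measure \<Rightarrow> 'm graph \<Rightarrow> 'm graph \<Rightarrow> bool" where
  "positive_sqrt \<mu> T S \<longleftrightarrow> self_adjoint \<mu> S \<and> non_negative \<mu> S \<and> S O S = T"


section \<open>Second order elliptic differential operators\<close>

text \<open>Only the action of \<open>L\<close> on smooth functions is relevant. Ellipticity is the
  non-vanishing of the principal symbol at non-zero covectors.\<close>

definition elliptic_operator_2 ::
  "('m, 'n::finite) chart set \<Rightarrow> (('m \<Rightarrow> complex) \<Rightarrow> 'm \<Rightarrow> complex) \<Rightarrow> bool" where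
  "elliptic_operator_2 A L \<longleftrightarrow>
     (\<forall>c\<in>A. \<exists>(a :: 'n \<Rightarrow> 'n \<Rightarrow> real^'n \<Rightarrow> complex) (b :: 'n \<Rightarrow> real^'n \<Rightarrow> complex)
              (e :: real^'n \<Rightarrow> complex).
        (\<forall>i j. smooth_on (a i j) (coord_range c)) \<and>
        (\<forall>i. smooth_on (b i) (coord_range c)) \<and> smooth_on e (coord_range c) \<and>
        (\<forall>x\<in>coord_range c. \<forall>\<xi>. \<xi> \<noteq> 0 \<longrightarrow>
           (\<Sum>i\<in>UNIV. \<Sum>j\<in>UNIV. a i j x * of_real (\<xi> $ i * \<xi> $ j)) \<noteq> 0) \<and>
        (\<forall>f. smooth_fun A f \<longrightarrow> (\<forall>x\<in>coord_range c.
           L f (coord_inv c x) =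
             (\<Sum>i\<in>UNIV. \<Sum>j\<in>UNIV. a i j x * partial i (partial j (f \<circ> coord_inv c)) x)
             + (\<Sum>i\<in>UNIV. b i x * partial i (f \<circ> coord_inv c) x)
             + e x * f (coord_inv c x))))"

definition L2_realization ::
  "('m::topological_space, 'n::finite) chart set \<Rightarrow> 'm measure \<Rightarrow>
     (('m \<Rightarrow> complex) \<Rightarrow> 'm \<Rightarrow> complex) \<Rightarrow> 'm graph" where
  "L2_realization A \<mu> L = op_closure \<mu> {(f, L f) | f. smooth_fun A f}"


section \<open>Spectral resolution and functional calculus\<close>

text \<open>An orthonormal basis of \<open>L\<^sub>2\<close> consisting of smooth real eigenfunctions \<open>u l\<close> of \<open>S\<close>,
  whose eigenvalues, repeated according to multiplicity, are listed in non-decreasing order.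
  The condition \<open>\<lambda>\<^sub>l \<longlonglongrightarrow> \<infinity>\<close> (discreteness of the spectrum, finite multiplicities) makes
  \<open>spectral_fun\<close> below a finite sum when \<open>F\<close> has compact support. By elliptic regularity every
  eigenclass of \<open>\<surd>L\<close> has a unique smooth representative; it is the one that is meant.\<close>

definition eigenbasis ::
  "('m::topological_space, 'n::finite) chart set \<Rightarrow> 'm measure \<Rightarrow> 'm graph \<Rightarrow>
     (nat \<Rightarrow> real) \<Rightarrow> (nat \<Rightarrow> 'm \<Rightarrow> real) \<Rightarrow> bool" where
  "eigenbasis A \<mu> S lam u \<longleftrightarrow>
     mono lam \<and> filterlim lam at_top sequentially \<and>
     (\<forall>l. smooth_fun A (u l)) \<and>
     (\<forall>l. ((\<lambda>x. of_real (u l x)), (\<lambda>x. of_real (lam l * u l x))) \<in> S) \<and>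
     (\<forall>l m. (\<integral>x. u l x * u m x \<partial>\<mu>) = (if l = m then 1 else 0)) \<and>
     (\<forall>f\<in>Lp_space \<mu> 2.
        (\<lambda>N. Lp_norm \<mu> 2 (\<lambda>x. f x -
           (\<Sum>l<N. pairing \<mu> f (\<lambda>y. of_real (u l y)) * of_real (u l x)))) \<longlonglongrightarrow> 0)"

definition spectral_fun ::
  "'m measure \<Rightarrow> (nat \<Rightarrow> real) \<Rightarrow> (nat \<Rightarrow> 'm \<Rightarrow> real) \<Rightarrow> (real \<Rightarrow> real) \<Rightarrow>
     ('m \<Rightarrow> complex) \<Rightarrow> 'm \<Rightarrow> complex" where
  "spectral_fun \<mu> lam u F f x =
     (\<Sum>l. of_real (F (lam l)) * pairing \<mu> f (\<lambda>y. of_real (u l y)) * of_real (u l x))"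


section \<open>The partition of unity\<close>

text \<open>Only the values of \<open>g\<close> on \<open>[0, \<infinity>)\<close> matter. Since \<open>g = 1\<close> on \<open>[0, 1]\<close>, smoothness up to
  \<open>0\<close> is automatic.\<close>

definition cutoff :: "(real \<Rightarrow> real) \<Rightarrow> bool" where
  "cutoff g \<longleftrightarrow> smooth_on g {0<..} \<and> antimono_on {0..} g \<and>
     closure {x. x \<ge> 0 \<and> g x \<noteq> 0} \<subseteq> {0..2} \<and>
     (\<forall>x\<in>{0..1}. g x = 1) \<and> (\<forall>x\<ge>0. 0 \<le> g x \<and> g x \<le> 1)"

definition dyadic :: "(real \<Rightarrow> real) \<Rightarrow> nat \<Rightarrow> real \<Rightarrow> real" where
  "dyadic g j t =
     (let h = (\<lambda>s. g s - g (2 * s)) in if j = 0 then g t else h (t / 2 ^ j))"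

end

theory Submission
  imports Defs
begin

text \<open>
  The partial sums of the dyadic series telescope: \<open>G\<^sub>0 + \<dots> + G\<^sub>N = g (\<cdot> / 2 ^ N)\<close>. With
  \<open>\<epsilon> = 1 / 2 ^ N\<close> and \<open>\<phi> s = g (sqrt \<bar>s\<bar>)\<close>, a smooth function of compact support which is \<open>1\<close>
  near \<open>0\<close>, they are the operators \<open>\<phi> (\<epsilon>\<^sup>2 L)\<close>. Such an operator fixes a given finite
  combination of eigenfunctions as soon as \<open>\<epsilon>\<close> is small, so convergence follows from a uniform
  bound and a density argument.

  The uniform bound is \<open>\<integral> \<bar>K\<^sub>\<epsilon> (x, y)\<bar> d\<mu> (y) \<le> C\<close> for the integral kernels of \<open>\<phi> (\<epsilon>\<^sup>2 L)\<close>,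
  where \<open>\<phi>\<close> is any smooth function of compact support and \<open>\<epsilon> \<le> 1\<close> (\<open>kernel_L1_bound\<close>). By
  Schur's test it bounds the operators on every \<open>L\<^sub>p\<close>. It also gives uniform convergence: if
  \<open>m s = (\<phi> (s / 4) - \<phi> s) / s\<close> and \<open>f\<close> is smooth, then passing from \<open>\<epsilon>\<close> to \<open>\<epsilon> / 2\<close> changes
  \<open>\<phi> (\<epsilon>\<^sup>2 L) f\<close> by \<open>\<epsilon>\<^sup>2 m (\<epsilon>\<^sup>2 L) L f = O(\<epsilon>\<^sup>2)\<close>; the increments are summable, and the limit has
  the Fourier coefficients of \<open>f\<close> (\<open>multop_F_uniform\<close>). Smooth functions are dense in the
  continuous ones, and continuous functions are dense in \<open>L\<^sub>p\<close>.

  The kernel bound is proved with weights. Because the eigenfunctions are real and complete, \<open>L\<close>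
  maps real functions to real functions, and its principal part is described by the carre du
  champ \<open>\<Gamma>\<close>, a derivation in each argument. Non-negativity of \<open>L\<close>, tested on \<open>f cos (s w)\<close> and
  \<open>f sin (s w)\<close> for large \<open>s\<close>, shows \<open>\<Gamma> w w \<ge> 0\<close>, and ellipticity then makes \<open>\<Gamma> w w\<close> comparable
  with the squared gradient. Finitely many functions \<open>\<psi>\<^sub>k\<close> extending local coordinates give
  \<open>\<rho> = 1 + (\<Sum>k. ((\<psi>\<^sub>k - \<psi>\<^sub>k x) / \<epsilon>)\<^sup>2)\<close>, a substitute for one plus the squared distance from \<open>x\<close>
  in units of \<open>\<epsilon>\<close>: it satisfies \<open>\<epsilon>\<^sup>2 \<bar>L \<rho>\<bar> \<le> B \<rho>\<close>, \<open>\<epsilon>\<^sup>2 \<Gamma> \<rho> \<rho> \<le> B \<rho>\<close> and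
  \<open>\<integral> 1 / \<rho> ^ (2 n) d\<mu> \<le> C \<epsilon> ^ n\<close>, where \<open>n\<close> is the dimension (\<open>global_weights\<close>).

  Write \<open>\<phi> s = H (2 arctan s) exp (- s)\<close>. The factor \<open>exp (- \<epsilon>\<^sup>2 L)\<close> maps \<open>L\<^sub>1\<close> with weight
  \<open>\<rho> ^ n\<close> to \<open>L\<^sub>2\<close> with weight \<open>\<rho> ^ (2 n)\<close>, with norm \<open>O(\<epsilon> powr (- n / 2))\<close>; this is Nash's
  argument and needs a Nash inequality on the manifold, which is assembled from balls in charts
  (\<open>global_nash\<close>, \<open>heat_weighted_L2\<close>). For the factor \<open>H (2 arctan (\<epsilon>\<^sup>2 L))\<close> put
  \<open>\<beta> = 2 arctan (\<epsilon>\<^sup>2 L)\<close>: the functions \<open>cos (k \<beta>) f\<close> and \<open>sin (k \<beta>) f\<close> arise from \<open>f\<close> by \<open>k\<close>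
  steps of the Crank-Nicolson scheme, which is isometric in \<open>L\<^sub>2\<close> and increases weighted norms
  only polynomially in \<open>k\<close> (\<open>cn_growth\<close>), while the Fourier coefficients of \<open>H\<close> decay faster
  than any power (\<open>fourier_expansion\<close>). So \<open>H (2 arctan (\<epsilon>\<^sup>2 L))\<close> is bounded on the weighted
  \<open>L\<^sub>2\<close> space uniformly in \<open>\<epsilon>\<close>. The Cauchy-Schwarz inequality against \<open>\<rho> ^ (- 2 n)\<close> leads back
  to \<open>L\<^sub>1\<close> (\<open>multiplier_L1\<close>), and letting the argument concentrate at \<open>x\<close> yields the kernel
  bound.
\<close>

section \<open>Calculus of smooth functions\<close>

abbreviation cont :: "('a::topological_space \<Rightarrow> 'b::topological_space) \<Rightarrow> bool" where
  "cont \<equiv> continuous_on UNIV"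

text \<open>The definition of \<open>Ck_on\<close> speaks of one particular derivative; any derivative will do.
  The congruence rule that this requires is itself proved by induction from this lemma,
  hence its appearance as a hypothesis.\<close>

lemma Ck_on_SucI:
  assumes "open S" "\<And>x. x \<in> S \<Longrightarrow> (f has_derivative D x) (at x)"
    and "\<And>b. b \<in> Basis \<Longrightarrow> Ck_on k (\<lambda>x. D x b) S"
    and cong: "\<And>f g :: 'a::euclidean_space \<Rightarrow> 'b::real_normed_vector. Ck_on k f S \<Longrightarrow> (\<And>x. x \<in> S \<Longrightarrow> f x = g x) \<Longrightarrow> Ck_on k g S"
  shows "Ck_on (Suc k) (f :: 'a \<Rightarrow> 'b) S"
proof -
  have eq: "frechet_derivative f (at x) = D x" if "x \<in> S" for x
    using assms(2)[OF that] frechet_derivative_at by metis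
  have "f differentiable_on S"
    unfolding differentiable_on_def using assms(1,2)
    by (metis at_within_open differentiable_def)
  moreover have "Ck_on k (\<lambda>x. frechet_derivative f (at x) b) S" if "b \<in> Basis" for b
    by (rule cong[OF assms(3)[OF that]]) (simp add: eq)
  ultimately show ?thesis by simp
qed

lemma Ck_on_SucD:
  assumes "open S" "Ck_on (Suc k) f S" "x \<in> S"
  shows "(f has_derivative frechet_derivative f (at x)) (at x)"
  using assms frechet_derivative_works by (metis Ck_on.simps(2) at_within_open differentiable_on_def)

lemma Ck_on_cong:
  assumes "open S" "Ck_on k f S" "\<And>x. x \<in> S \<Longrightarrow> f x = g x"
  shows "Ck_on k g S"
  using assms(2,3)
proof (induction k arbitrary: f g)
  case 0
  then show ?case by (metis Ck_on.simps(1) continuous_on_cong)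
next
  case (Suc k)
  have "(g has_derivative frechet_derivative f (at x)) (at x)" if "x \<in> S" for x
    using Ck_on_SucD[OF \<open>open S\<close> Suc.prems(1) that] \<open>open S\<close> that Suc.prems(2)
    by (rule has_derivative_transform_within_open)
  then show ?case
    using Suc.prems(1) by (intro Ck_on_SucI[OF \<open>open S\<close> _ _ Suc.IH]) (assumption | simp)+
qed

lemma Ck_onI:
  assumes "open S" "\<And>x. x \<in> S \<Longrightarrow> (f has_derivative D x) (at x)"
    and "\<And>b. b \<in> Basis \<Longrightarrow> Ck_on k (\<lambda>x. D x b) S"
  shows "Ck_on (Suc k) f S"
  by (rule Ck_on_SucI[OF assms]) (auto intro: Ck_on_cong[OF assms(1)])

lemma Ck_on_subset:
  assumes "Ck_on k f S" "T \<subseteq> S"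
  shows "Ck_on k f T"
  using assms
  by (induction k arbitrary: f) (auto intro: continuous_on_subset differentiable_on_subset)

lemma Ck_on_Suc_imp: "Ck_on (Suc k) f S \<Longrightarrow> Ck_on k f S"
  by (induction k arbitrary: f) (auto intro: differentiable_imp_continuous_on)

lemma Ck_on_imp_continuous: "Ck_on k f S \<Longrightarrow> continuous_on S f"
  by (cases k) (auto intro: differentiable_imp_continuous_on)

lemma Ck_on_Un:
  assumes "open S" "open T" "Ck_on k f S" "Ck_on k f T"
  shows "Ck_on k f (S \<union> T)"
  using assms(3,4)
proof (induction k arbitrary: f)
  case 0
  then show ?case using assms(1,2) by (simp add: continuous_on_open_Un)
next
  case (Suc k)
  then have "f differentiable_on (S \<union> T)"
    by (auto simp: differentiable_on_eq_differentiable_at assms(1,2) open_Un)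
  with Suc show ?case by auto
qed

lemma Ck_on_const: "Ck_on k (\<lambda>x. c) S"
proof (induction k arbitrary: c)
  case (Suc k)
  show ?case using Suc by (simp add: frechet_derivative_const)
qed auto

lemma Ck_on_bounded_linear:
  assumes S: "open S" and h: "bounded_linear h"
  shows "Ck_on k f S \<Longrightarrow> Ck_on k (\<lambda>x. h (f x)) S"
proof (induction k arbitrary: f)
  case 0
  then show ?case using h by (auto intro: bounded_linear.continuous_on)
next
  case (Suc k)
  show ?case
  proof (rule Ck_onI[OF S])
    show "((\<lambda>x. h (f x)) has_derivative (\<lambda>v. h (frechet_derivative f (at x) v))) (at x)" if "x \<in> S" for x
      using Ck_on_SucD[OF S Suc.prems that] by (rule bounded_linear.has_derivative[OF h])
  qed (use Suc in auto)
qed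

lemma Ck_on_add:
  assumes S: "open S"
  shows "Ck_on k f S \<Longrightarrow> Ck_on k g S \<Longrightarrow> Ck_on k (\<lambda>x. f x + g x) S"
proof (induction k arbitrary: f g)
  case (Suc k)
  show ?case
  proof (rule Ck_onI[OF S])
    show "((\<lambda>x. f x + g x) has_derivative (\<lambda>v. frechet_derivative f (at x) v + frechet_derivative g (at x) v)) (at x)"
      if "x \<in> S" for x
      using Ck_on_SucD[OF S Suc.prems(1) that] Ck_on_SucD[OF S Suc.prems(2) that] by (rule has_derivative_add)
  qed (use Suc in auto)
qed (auto intro: continuous_intros)

lemma Ck_on_sum:
  assumes "open S" "\<And>i. i \<in> I \<Longrightarrow> Ck_on k (f i) S"
  shows "Ck_on k (\<lambda>x. \<Sum>i\<in>I. f i x) S"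
  using assms(2)
  by (induction I rule: infinite_finite_induct) (auto intro: Ck_on_add[OF assms(1)] Ck_on_const)

lemma Ck_on_bilinear:
  fixes bil :: "'b::real_normed_vector \<Rightarrow> 'c::real_normed_vector \<Rightarrow> 'd::real_normed_vector" 
  assumes S: "open S" and h: "bounded_bilinear bil"
  shows "Ck_on k f S \<Longrightarrow> Ck_on k g S \<Longrightarrow> Ck_on k (\<lambda>x. bil (f x) (g x)) S"
proof (induction k arbitrary: f g)
  case 0
  then show ?case using h by (auto intro: bounded_bilinear.continuous_on)
next
  case (Suc k)
  note IH = Suc.IH
  show ?case
  proof (rule Ck_onI[OF S])
    show "((\<lambda>x. bil (f x) (g x)) has_derivative
      (\<lambda>v. bil (f x) (frechet_derivative g (at x) v) + bil (frechet_derivative f (at x) v) (g x))) (at x)"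
      if "x \<in> S" for x
      using Ck_on_SucD[OF S Suc.prems(1) that] Ck_on_SucD[OF S Suc.prems(2) that]
      by (rule bounded_bilinear.FDERIV[OF h])
    show "Ck_on k (\<lambda>x. bil (f x) (frechet_derivative g (at x) b) + bil (frechet_derivative f (at x) b) (g x)) S"
      if "b \<in> Basis" for b
      using Suc.prems that by (intro Ck_on_add[OF S] IH) (auto intro: Ck_on_Suc_imp[of k f] Ck_on_Suc_imp[of k g])
  qed
qed

text \<open>By the chain rule a derivative of the composite is a finite sum of products of functions
  to which the induction hypothesis applies.\<close>

lemma Ck_on_compose:
  fixes f :: "'b::euclidean_space \<Rightarrow> 'c::real_normed_vector" and T :: "'a::euclidean_space \<Rightarrow> 'b"
  assumes S: "open S" and U: "open U" and TU: "T ` S \<subseteq> U"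
  shows "Ck_on k f U \<Longrightarrow> Ck_on k T S \<Longrightarrow> Ck_on k (\<lambda>x. f (T x)) S"
proof (induction k arbitrary: f)
  case 0
  then show ?case using TU by (auto intro: continuous_on_compose2)
next
  case (Suc k)
  note T = \<open>Ck_on (Suc k) T S\<close> and f = \<open>Ck_on (Suc k) f U\<close>
  let ?D = "\<lambda>x v. \<Sum>i\<in>Basis. (frechet_derivative T (at x) v \<bullet> i) *\<^sub>R frechet_derivative f (at (T x)) i"
  show ?case
  proof (rule Ck_onI[OF S])
    fix x assume x: "x \<in> S"
    have Tx: "T x \<in> U" using TU x by auto
    have df: "(f has_derivative frechet_derivative f (at (T x))) (at (T x))"
      by (rule Ck_on_SucD[OF U f Tx])
    interpret bounded_linear "frechet_derivative f (at (T x))" using df by (rule has_derivative_bounded_linear)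
    have lin: "frechet_derivative f (at (T x)) v = (\<Sum>i\<in>Basis. (v \<bullet> i) *\<^sub>R frechet_derivative f (at (T x)) i)" for v
      by (subst euclidean_representation[of v, symmetric]) (simp only: sum scaleR)
    have "((\<lambda>x. f (T x)) has_derivative (\<lambda>v. frechet_derivative f (at (T x)) (frechet_derivative T (at x) v))) (at x)"
      by (rule has_derivative_compose[OF Ck_on_SucD[OF S T x] df])
    then show "((\<lambda>x. f (T x)) has_derivative ?D x) (at x)" by (subst (asm) lin)
  next
    fix b :: 'a assume b: "b \<in> Basis"
    have "Ck_on k (\<lambda>x. frechet_derivative f (at (T x)) i) S" if "i \<in> Basis" for i
      using Suc.IH[of "\<lambda>y. frechet_derivative f (at y) i"] f Ck_on_Suc_imp[OF T] that by auto
    then show "Ck_on k (\<lambda>x. ?D x b) S"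
      using T b by (intro Ck_on_sum[OF S] Ck_on_bilinear[OF S bounded_bilinear_scaleR]
        Ck_on_bounded_linear[OF S bounded_linear_inner_left]) auto
  qed
qed

lemma Ck_on_id: "Ck_on k (\<lambda>x. x) S"
proof (cases k)
  case (Suc j)
  then show ?thesis by (simp add: Ck_on_const frechet_derivative_id[unfolded id_def])
qed (auto intro: continuous_intros)

lemma Ck_on_mult:
  fixes f g :: "'a::euclidean_space \<Rightarrow> 'b::real_normed_algebra"
  shows "open S \<Longrightarrow> Ck_on k f S \<Longrightarrow> Ck_on k g S \<Longrightarrow> Ck_on k (\<lambda>x. f x * g x) S"
  by (rule Ck_on_bilinear[OF _ bounded_bilinear_mult])

lemma Ck_on_realI:
  fixes f :: "real \<Rightarrow> real"
  assumes "open S" "\<And>x. x \<in> S \<Longrightarrow> (f has_real_derivative f' x) (at x)" "Ck_on k f' S"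
  shows "Ck_on (Suc k) f S"
proof (rule Ck_onI[OF assms(1)])
  show "(f has_derivative (*) (f' x)) (at x)" if "x \<in> S" for x
    using assms(2)[OF that] by (simp add: has_field_derivative_def)
qed (use assms(3) in simp)

lemma Ck_on_realD:
  fixes f :: "real \<Rightarrow> real"
  assumes "open S" "Ck_on (Suc k) f S"
  obtains f' where "\<And>x. x \<in> S \<Longrightarrow> (f has_real_derivative f' x) (at x)" "Ck_on k f' S"
proof
  show "Ck_on k (\<lambda>x. frechet_derivative f (at x) 1) S" using assms by simp
  show "(f has_real_derivative frechet_derivative f (at x) 1) (at x)" if "x \<in> S" for x
  proof -
    have d: "(f has_derivative frechet_derivative f (at x)) (at x)" by (rule Ck_on_SucD[OF assms that])
    then interpret bounded_linear "frechet_derivative f (at x)" by (rule has_derivative_bounded_linear)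
    have "frechet_derivative f (at x) v = frechet_derivative f (at x) 1 * v" for v
      using scaleR[of v 1] by (simp add: mult.commute)
    then have "frechet_derivative f (at x) = (*) (frechet_derivative f (at x) 1)" by (rule ext)
    with d show ?thesis by (simp add: has_field_derivative_def)
  qed
qed

lemma Ck_on_exp:
  assumes S: "open S"
  shows "Ck_on k (exp :: real \<Rightarrow> real) S"
proof (induction k)
  case (Suc k)
  show ?case by (rule Ck_on_realI[OF S DERIV_exp Suc])
qed (auto intro: continuous_intros)

lemma Ck_on_minus:
  fixes f :: "'a::euclidean_space \<Rightarrow> 'b::real_normed_vector"
  shows "open S \<Longrightarrow> Ck_on k f S \<Longrightarrow> Ck_on k (\<lambda>x. - f x) S"
  by (rule Ck_on_bounded_linear[OF _ bounded_linear_minus[OF bounded_linear_ident]])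

lemma Ck_on_diff:
  fixes f :: "'a::euclidean_space \<Rightarrow> 'b::real_normed_vector"
  shows "open S \<Longrightarrow> Ck_on k f S \<Longrightarrow> Ck_on k g S \<Longrightarrow> Ck_on k (\<lambda>x. f x - g x) S"
  using Ck_on_add[of S k f "\<lambda>x. - g x"] Ck_on_minus[of S k g] by simp

lemma Ck_on_sin_cos:
  assumes S: "open S"
  shows "Ck_on k (sin :: real \<Rightarrow> real) S \<and> Ck_on k (cos :: real \<Rightarrow> real) S"
proof (induction k)
  case (Suc k)
  have "Ck_on (Suc k) (sin :: real \<Rightarrow> real) S"
    using Suc by (intro Ck_on_realI[OF S, of _ cos]) (auto intro!: derivative_eq_intros)
  moreover have "Ck_on (Suc k) (cos :: real \<Rightarrow> real) S"
    using Suc by (intro Ck_on_realI[OF S, of _ "\<lambda>x. - sin x"] Ck_on_minus[OF S])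
      (auto intro!: derivative_eq_intros)
  ultimately show ?case by blast
qed (auto intro: continuous_intros)

lemma Ck_on_powr: "Ck_on k (\<lambda>x::real. x powr a) {0<..}"
proof (induction k arbitrary: a)
  case 0
  then show ?case by (auto intro!: continuous_intros)
next
  case (Suc k)
  show ?case
    by (rule Ck_on_realI[of _ _ "\<lambda>x. a * x powr (a - 1)"])
      (auto intro!: derivative_eq_intros Ck_on_mult Ck_on_const Suc)
qed

lemma Ck_on_sqrt: "Ck_on k sqrt {0<..}"
  by (rule Ck_on_cong[OF _ Ck_on_powr[of k "1/2"]]) (auto simp: powr_half_sqrt)

lemma Ck_on_inverse: "Ck_on k (inverse :: real \<Rightarrow> real) {0<..}"
  by (rule Ck_on_cong[OF _ Ck_on_powr[of k "-1"]]) (auto simp: powr_minus)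

lemma smooth_on_cong: "open S \<Longrightarrow> smooth_on f S \<Longrightarrow> (\<And>x. x \<in> S \<Longrightarrow> f x = g x) \<Longrightarrow> smooth_on g S"
  unfolding smooth_on_def using Ck_on_cong by blast

lemma smooth_on_subset: "smooth_on f S \<Longrightarrow> T \<subseteq> S \<Longrightarrow> smooth_on f T"
  unfolding smooth_on_def using Ck_on_subset by blast

lemma smooth_on_Un: "open S \<Longrightarrow> open T \<Longrightarrow> smooth_on f S \<Longrightarrow> smooth_on f T \<Longrightarrow> smooth_on f (S \<union> T)"
  unfolding smooth_on_def using Ck_on_Un by blast

lemma smooth_on_const: "smooth_on (\<lambda>x. c) S"
  unfolding smooth_on_def using Ck_on_const by blast

lemma smooth_on_bounded_linear:
  "open S \<Longrightarrow> bounded_linear h \<Longrightarrow> smooth_on f S \<Longrightarrow> smooth_on (\<lambda>x. h (f x)) S"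
  unfolding smooth_on_def using Ck_on_bounded_linear by blast

lemma smooth_on_add:
  "open S \<Longrightarrow> smooth_on f S \<Longrightarrow> smooth_on g S \<Longrightarrow> smooth_on (\<lambda>x. f x + g x) S"
  unfolding smooth_on_def using Ck_on_add by blast

lemma smooth_on_diff:
  "open S \<Longrightarrow> smooth_on f S \<Longrightarrow> smooth_on g S \<Longrightarrow> smooth_on (\<lambda>x. f x - g x) S"
  unfolding smooth_on_def using Ck_on_diff by blast

lemma smooth_on_mult:
  fixes f g :: "'a::euclidean_space \<Rightarrow> 'b::real_normed_algebra"
  shows "open S \<Longrightarrow> smooth_on f S \<Longrightarrow> smooth_on g S \<Longrightarrow> smooth_on (\<lambda>x. f x * g x) S"
  unfolding smooth_on_def using Ck_on_mult by blast

lemma smooth_on_compose: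
  fixes f :: "'b::euclidean_space \<Rightarrow> 'c::real_normed_vector" and T :: "'a::euclidean_space \<Rightarrow> 'b"
  shows "open S \<Longrightarrow> open U \<Longrightarrow> T ` S \<subseteq> U \<Longrightarrow> smooth_on f U \<Longrightarrow> smooth_on T S \<Longrightarrow> smooth_on (\<lambda>x. f (T x)) S"
  unfolding smooth_on_def using Ck_on_compose by blast

lemma smooth_on_id: "smooth_on (\<lambda>x. x) S"
  unfolding smooth_on_def using Ck_on_id by blast

lemma smooth_on_inner: 
  assumes "open S" shows "smooth_on (\<lambda>x. (x - a) \<bullet> (x - a)) S"
  unfolding smooth_on_def
  by (intro allI Ck_on_bilinear[OF assms bounded_bilinear_inner] Ck_on_diff[OF assms] Ck_on_id Ck_on_const)

lemma smooth_on_exp: "smooth_on (exp :: real \<Rightarrow> real) UNIV"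
  and smooth_on_sin: "smooth_on (sin :: real \<Rightarrow> real) UNIV"
  and smooth_on_cos: "smooth_on (cos :: real \<Rightarrow> real) UNIV"
  and smooth_on_sqrt: "smooth_on sqrt {0<..}"
  and smooth_on_inverse: "smooth_on (inverse :: real \<Rightarrow> real) {0<..}"
  unfolding smooth_on_def using Ck_on_exp Ck_on_sin_cos Ck_on_sqrt Ck_on_inverse by auto

section \<open>Operators with a carre du champ\<close>

text \<open>The discriminant criterion behind every form of the Cauchy-Schwarz inequality.\<close>

lemma quadratic_nonneg_discriminant:
  fixes A B C :: real
  assumes q: "\<And>t. 0 \<le> A + 2 * t * C + t\<^sup>2 * B" and B: "0 \<le> B"
  shows "\<bar>C\<bar> \<le> sqrt A * sqrt B"
proof -
  have "C\<^sup>2 \<le> A * B"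
  proof (cases "B = 0")
    case True
    have "C = 0"
    proof (rule ccontr)
      assume "C \<noteq> 0"
      then show False using q[of "- (A + 1) / (2 * C)"] True by (simp add: field_simps)
    qed
    then show ?thesis using True by simp
  next
    case False
    then have "B > 0" using B by simp
    then show ?thesis using q[of "- C / B"] by (simp add: field_simps power2_eq_square)
  qed
  then have "\<bar>C\<bar> \<le> sqrt (A * B)" by (simp add: real_le_rsqrt)
  then show ?thesis by (simp add: real_sqrt_mult)
qed

lemma (in finite_measure) integral_Cauchy_Schwarz:
  fixes a b :: "'a \<Rightarrow> real"
  assumes "integrable M (\<lambda>x. (a x)\<^sup>2)" "integrable M (\<lambda>x. (b x)\<^sup>2)" "integrable M (\<lambda>x. a x * b x)"
  shows "\<bar>\<integral>x. a x * b x \<partial>M\<bar> \<le> sqrt (LINT x|M. (a x)\<^sup>2) * sqrt (LINT x|M. (b x)\<^sup>2)"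
proof -
  let ?A = "LINT x|M. (a x)\<^sup>2" and ?B = "LINT x|M. (b x)\<^sup>2" and ?C = "LINT x|M. a x * b x"
  have q: "0 \<le> ?A + 2 * t * ?C + t\<^sup>2 * ?B" for t
  proof -
    have "0 \<le> (LINT x|M. (a x + t * b x)\<^sup>2)" by simp
    also have "\<dots> = (LINT x|M. (a x)\<^sup>2 + 2 * t * (a x * b x) + t\<^sup>2 * (b x)\<^sup>2)"
      by (intro Bochner_Integration.integral_cong) (auto simp: power2_eq_square algebra_simps)
    also have "\<dots> = ?A + 2 * t * ?C + t\<^sup>2 * ?B" using assms by simp
    finally show ?thesis .
  qed
  show ?thesis by (rule quadratic_nonneg_discriminant[OF q]) simp
qed

text \<open>The carre du champ of \<open>L\<close>, with the sign for which it is non-negative when \<open>L\<close> is. The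
  last term removes the contribution of the zero order part of \<open>L\<close>, so that only the
  principal part counts.\<close>

definition carre :: "(('m \<Rightarrow> real) \<Rightarrow> 'm \<Rightarrow> real) \<Rightarrow> ('m \<Rightarrow> real) \<Rightarrow> ('m \<Rightarrow> real) \<Rightarrow> 'm \<Rightarrow> real" where
  "carre L f h x = (f x * L h x + h x * L f x - L (\<lambda>y. f y * h y) x - f x * h x * L (\<lambda>_. 1) x) / 2"

locale compact_measure = finite_measure \<mu> for \<mu> :: "'m::t2_space measure" +
  assumes compact_UNIV: "compact (UNIV :: 'm set)"
    and sets_eq: "sets \<mu> = sets borel"
begin

lemma continuous_bounded:
  fixes f :: "'m \<Rightarrow> real"
  assumes "cont f"
  obtains B where "0 \<le> B" "\<And>x. \<bar>f x\<bar> \<le> B"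
proof -
  have "compact (f ` UNIV)" by (rule compact_continuous_image[OF assms compact_UNIV])
  then obtain B where B: "\<And>x. norm (f x) \<le> B" using compact_imp_bounded bounded_iff by (metis rangeI)
  show thesis by (rule that[of "max B 0"]) (use B in \<open>auto simp: le_max_iff_disj\<close>)
qed

lemma integrable_continuous:
  fixes f :: "'m \<Rightarrow> real"
  assumes "cont f" shows "integrable \<mu> f"
proof -
  obtain B where "\<And>x. \<bar>f x\<bar> \<le> B" using continuous_bounded[OF assms] by metis
  moreover have "f \<in> borel_measurable \<mu>"
    using borel_measurable_continuous_onI[OF assms] sets_eq by (simp cong: measurable_cong_sets)
  ultimately show ?thesis by (intro integrable_const_bound[of _ B]) auto
qed

lemma borel_measurable_continuous:
  fixes f :: "'m \<Rightarrow> real"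
  shows "cont f \<Longrightarrow> f \<in> borel_measurable \<mu>"
  using integrable_continuous by blast

lemma integrable_mult_continuous:
  fixes f h :: "'m \<Rightarrow> real"
  assumes "integrable \<mu> f" "cont h"
  shows "integrable \<mu> (\<lambda>x. f x * h x)"
proof -
  obtain B where B: "0 \<le> B" "\<And>x. \<bar>h x\<bar> \<le> B" using continuous_bounded[OF assms(2)] by metis
  show ?thesis
  proof (rule Bochner_Integration.integrable_bound[of \<mu> "\<lambda>x. B * f x"])
    show "AE x in \<mu>. norm (f x * h x) \<le> norm (B * f x)"
      using B by (auto simp: abs_mult mult.commute[of B] intro!: mult_left_mono AE_I2)
  qed (use assms borel_measurable_continuous in auto)
qed

end

text \<open>An abstract second order operator: \<open>F\<close> plays the role of the smooth functions, and
  \<open>carre_derivation\<close> says that \<open>L\<close> has order at most two. The functions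
  \<open>sqrt (f\<^sup>2 + d\<^sup>2)\<close> in \<open>F\<close> serve as smooth substitutes for \<open>\<bar>f\<bar>\<close>.\<close>

locale diffusion = compact_measure \<mu> for \<mu> :: "'m::t2_space measure" +
  fixes F :: "('m \<Rightarrow> real) set" and L :: "('m \<Rightarrow> real) \<Rightarrow> 'm \<Rightarrow> real"
  assumes F_const: "(\<lambda>_. c) \<in> F"
    and F_add: "f \<in> F \<Longrightarrow> h \<in> F \<Longrightarrow> (\<lambda>x. f x + h x) \<in> F"
    and F_mult: "f \<in> F \<Longrightarrow> h \<in> F \<Longrightarrow> (\<lambda>x. f x * h x) \<in> F"
    and F_sqrt: "f \<in> F \<Longrightarrow> d > 0 \<Longrightarrow> (\<lambda>x. sqrt ((f x)\<^sup>2 + d\<^sup>2)) \<in> F"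
    and F_continuous: "f \<in> F \<Longrightarrow> cont f"
    and L_continuous: "f \<in> F \<Longrightarrow> cont (L f)"
    and L_add: "f \<in> F \<Longrightarrow> h \<in> F \<Longrightarrow> L (\<lambda>x. f x + h x) = (\<lambda>x. L f x + L h x)"
    and L_cmult: "f \<in> F \<Longrightarrow> L (\<lambda>x. c * f x) = (\<lambda>x. c * L f x)"
    and L_sym: "f \<in> F \<Longrightarrow> h \<in> F \<Longrightarrow> (LINT x|\<mu>. f x * L h x) = (LINT x|\<mu>. h x * L f x)"
    and carre_derivation: "f \<in> F \<Longrightarrow> h \<in> F \<Longrightarrow> k \<in> F \<Longrightarrow>
      carre L (\<lambda>y. f y * h y) k x = f x * carre L h k x + h x * carre L f k x"
    and carre_nonneg: "f \<in> F \<Longrightarrow> 0 \<le> carre L f f x"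
begin

abbreviation \<Gamma> where "\<Gamma> \<equiv> carre L"

lemma F_cmult: "f \<in> F \<Longrightarrow> (\<lambda>x. c * f x) \<in> F"
  using F_mult[OF F_const] .

lemma F_diff: "f \<in> F \<Longrightarrow> h \<in> F \<Longrightarrow> (\<lambda>x. f x - h x) \<in> F"
  using F_add[of f "\<lambda>x. -1 * h x"] F_cmult[of h "-1"] by simp

lemma F_power: "f \<in> F \<Longrightarrow> (\<lambda>x. f x ^ j) \<in> F"
  by (induction j) (auto intro: F_mult F_const)

lemma F_sum: "(\<And>i. i \<in> I \<Longrightarrow> f i \<in> F) \<Longrightarrow> (\<lambda>x. \<Sum>i\<in>I. f i x) \<in> F"
  by (induction I rule: infinite_finite_induct) (auto intro: F_add F_const)

lemma L_zero: "L (\<lambda>_. 0) = (\<lambda>_. 0)"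
  using L_cmult[OF F_const[of 1], of 0] by simp

lemma L_sum: "(\<And>i. i \<in> I \<Longrightarrow> f i \<in> F) \<Longrightarrow> L (\<lambda>x. \<Sum>i\<in>I. f i x) = (\<lambda>x. \<Sum>i\<in>I. L (f i) x)"
  by (induction I rule: infinite_finite_induct) (auto simp: L_zero L_add F_sum)

lemmas F_intros = F_const F_add F_mult F_cmult F_diff F_power

lemma carre_sym: "\<Gamma> f h x = \<Gamma> h f x"
  unfolding carre_def by (simp add: mult.commute add.commute)

lemma carre_add_right: "f \<in> F \<Longrightarrow> h \<in> F \<Longrightarrow> k \<in> F \<Longrightarrow> \<Gamma> k (\<lambda>y. f y + h y) x = \<Gamma> k f x + \<Gamma> k h x"
  unfolding carre_def using L_add[of "\<lambda>y. k y * f y" "\<lambda>y. k y * h y"]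
  by (simp add: L_add F_mult algebra_simps add_divide_distrib diff_divide_distrib)

lemma carre_cmult_right: "f \<in> F \<Longrightarrow> k \<in> F \<Longrightarrow> \<Gamma> k (\<lambda>y. c * f y) x = c * \<Gamma> k f x"
  unfolding carre_def using L_cmult[of "\<lambda>y. k y * f y" c]
  by (simp add: L_cmult F_mult algebra_simps add_divide_distrib diff_divide_distrib)

lemma carre_const: "f \<in> F \<Longrightarrow> \<Gamma> f (\<lambda>_. c) x = 0"
  using carre_cmult_right[of "\<lambda>_. 1" f c x] F_const by (simp add: carre_def)

lemma L_mult: "L (\<lambda>y. f y * h y) x = f x * L h x + h x * L f x - 2 * \<Gamma> f h x - f x * h x * L (\<lambda>_. 1) x"
  unfolding carre_def by (simp add: field_simps)

lemma carre_continuous: "f \<in> F \<Longrightarrow> h \<in> F \<Longrightarrow> cont (\<Gamma> f h)"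
  unfolding carre_def[abs_def]
  by (intro continuous_intros F_continuous L_continuous F_mult F_const) auto

lemmas cont_intros = F_continuous L_continuous carre_continuous F_intros

lemma carre_Cauchy_Schwarz:
  assumes "f \<in> F" "h \<in> F"
  shows "\<bar>\<Gamma> f h x\<bar> \<le> sqrt (\<Gamma> f f x) * sqrt (\<Gamma> h h x)"
proof -
  let ?A = "\<Gamma> f f x" and ?B = "\<Gamma> h h x" and ?C = "\<Gamma> f h x"
  have q: "0 \<le> ?A + 2 * t * ?C + t\<^sup>2 * ?B" for t
  proof -
    let ?k = "\<lambda>y. f y + t * h y"
    have k: "?k \<in> F" using assms by (intro F_intros)
    have 1: "\<Gamma> ?k ?k x = \<Gamma> ?k f x + t * \<Gamma> ?k h x"
      using carre_add_right[OF assms(1) F_cmult[OF assms(2)] k] carre_cmult_right[OF assms(2) k] by simp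
    have 2: "\<Gamma> ?k f x = \<Gamma> f f x + t * \<Gamma> f h x"
      using carre_add_right[OF assms(1) F_cmult[OF assms(2)] assms(1)] carre_cmult_right[OF assms(2,1)]
      by (simp add: carre_sym[of ?k f])
    have 3: "\<Gamma> ?k h x = \<Gamma> f h x + t * \<Gamma> h h x"
      using carre_add_right[OF assms(1) F_cmult[OF assms(2)] assms(2)] carre_cmult_right[OF assms(2,2)]
      by (simp add: carre_sym[of ?k h] carre_sym[of h f])
    show ?thesis using carre_nonneg[OF k, of x] unfolding 1 2 3 by (simp add: algebra_simps power2_eq_square)
  qed
  show ?thesis by (rule quadratic_nonneg_discriminant[OF q carre_nonneg[OF assms(2)]])
qed

text \<open>Symmetry of \<open>L\<close> moves it from \<open>f\<^sup>2\<close> to the weight \<open>W\<close>.\<close>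

lemma integral_carre:
  assumes "W \<in> F" "f \<in> F"
  shows "(LINT x|\<mu>. W x * \<Gamma> f f x) =
    (LINT x|\<mu>. W x * f x * L f x) - (LINT x|\<mu>. (f x)\<^sup>2 * (W x * L (\<lambda>_. 1) x + L W x)) / 2"
proof -
  have c: "cont (L (\<lambda>y. f y * f y))" "cont W" "cont f"
    "cont (L f)" "cont (L W)" "cont (L (\<lambda>_. 1))"
    using assms by (auto intro: cont_intros)
  have "(LINT x|\<mu>. W x * \<Gamma> f f x) = (LINT x|\<mu>. W x * f x * L f x - W x * L (\<lambda>y. f y * f y) x / 2
      - W x * (f x)\<^sup>2 * L (\<lambda>_. 1) x / 2)"
    by (intro Bochner_Integration.integral_cong) (auto simp: carre_def power2_eq_square field_simps)
  also have "\<dots> = (LINT x|\<mu>. W x * f x * L f x) - (LINT x|\<mu>. W x * L (\<lambda>y. f y * f y) x) / 2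
      - (LINT x|\<mu>. W x * (f x)\<^sup>2 * L (\<lambda>_. 1) x) / 2"
    using c by (simp add: integrable_continuous continuous_intros)
  also have "(LINT x|\<mu>. W x * L (\<lambda>y. f y * f y) x) = (LINT x|\<mu>. (f x)\<^sup>2 * L W x)"
    using L_sym[OF assms(1) F_mult[OF assms(2,2)]] by (simp add: power2_eq_square)
  also have "(LINT x|\<mu>. W x * f x * L f x) - (LINT x|\<mu>. (f x)\<^sup>2 * L W x) / 2 - (LINT x|\<mu>. W x * (f x)\<^sup>2 * L (\<lambda>_. 1) x) / 2
    = (LINT x|\<mu>. W x * f x * L f x) - (LINT x|\<mu>. (f x)\<^sup>2 * (W x * L (\<lambda>_. 1) x + L W x)) / 2"
    using c by (simp add: integrable_continuous continuous_intros algebra_simps add_divide_distrib)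
  finally show ?thesis .
qed

text \<open>For \<open>W = 1\<close> both sides vanish by symmetry. In general only first derivatives of the
  weight survive; the terms in which \<open>L\<close> falls on \<open>W\<close> cancel.\<close>

lemma integral_weighted_antisym:
  assumes W: "W \<in> F" and f: "f \<in> F" and h: "h \<in> F"
  shows "(LINT x|\<mu>. W x * (f x * L h x - h x * L f x)) = (LINT x|\<mu>. f x * \<Gamma> W h x - h x * \<Gamma> W f x)"
proof -
  have c: "cont W" "cont f" "cont h" "cont (L (\<lambda>_. 1))"
    "cont (L f)" "cont (L h)" "cont (L W)"
    "cont (\<Gamma> W f)" "cont (\<Gamma> W h)"
    using assms by (auto intro: cont_intros)
  have swap: "(LINT x|\<mu>. W x * f x * L h x) = (LINT x|\<mu>. W x * h x * L f x) + (LINT x|\<mu>. h x * f x * L W x)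
     - 2 * (LINT x|\<mu>. h x * \<Gamma> W f x) - (LINT x|\<mu>. h x * W x * f x * L (\<lambda>_. 1) x)"
    if f: "f \<in> F" and h: "h \<in> F" and c: "cont f" "cont h"
    "cont (L f)" "cont (L h)"
    "cont (\<Gamma> W f)"  for f h
  proof -
    have "(LINT x|\<mu>. W x * f x * L h x) = (LINT x|\<mu>. h x * L (\<lambda>y. W y * f y) x)"
      using L_sym[OF F_mult[OF W f] h] by simp
    also have "\<dots> = (LINT x|\<mu>. W x * h x * L f x + h x * f x * L W x
     - 2 * (h x * \<Gamma> W f x) - h x * W x * f x * L (\<lambda>_. 1) x)"
      by (intro Bochner_Integration.integral_cong) (auto simp: L_mult algebra_simps)
    also have "\<dots> = (LINT x|\<mu>. W x * h x * L f x) + (LINT x|\<mu>. h x * f x * L W x)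
     - 2 * (LINT x|\<mu>. h x * \<Gamma> W f x) - (LINT x|\<mu>. h x * W x * f x * L (\<lambda>_. 1) x)"
      using c \<open>cont W\<close> \<open>cont (L W)\<close> \<open>cont (L (\<lambda>_. 1))\<close>
      by (simp add: integrable_continuous continuous_intros)
    finally show ?thesis .
  qed
  have "(LINT x|\<mu>. W x * (f x * L h x - h x * L f x)) = (LINT x|\<mu>. W x * f x * L h x) - (LINT x|\<mu>. W x * h x * L f x)"
    using c by (simp add: integrable_continuous continuous_intros algebra_simps)
  moreover have "(LINT x|\<mu>. f x * \<Gamma> W h x - h x * \<Gamma> W f x) = (LINT x|\<mu>. f x * \<Gamma> W h x) - (LINT x|\<mu>. h x * \<Gamma> W f x)"
    using c by (simp add: integrable_continuous continuous_intros)
  moreover have "(LINT x|\<mu>. h x * f x * L W x) = (LINT x|\<mu>. f x * h x * L W x)"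
    "(LINT x|\<mu>. h x * W x * f x * L (\<lambda>_. 1) x) = (LINT x|\<mu>. f x * W x * h x * L (\<lambda>_. 1) x)"
    by (simp_all add: mult_ac)
  ultimately show ?thesis using swap[OF f h c(2,3,5,6,8)] swap[OF h f c(3,2,6,5,9)] by linarith
qed

section \<open>Weights and Crank-Nicolson steps\<close>

text \<open>The model is \<open>\<rho> y = 1 + d(x, y)\<^sup>2 / \<epsilon>\<^sup>2\<close>: applying \<open>L\<close> to it, or its carre du champ,
  costs a factor \<open>1 / \<epsilon>\<^sup>2\<close> but does not increase the growth at large distance. The zero
  order part of \<open>L\<close> is kept under control by the same constant.\<close>

definition weight :: "real \<Rightarrow> real \<Rightarrow> ('m \<Rightarrow> real) \<Rightarrow> bool" where
  "weight B \<epsilon> \<rho> \<longleftrightarrow> \<rho> \<in> F \<and> 0 < \<epsilon> \<and> \<epsilon> \<le> 1 \<and> 0 \<le> B \<and>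
     (\<forall>x. 1 \<le> \<rho> x \<and> \<epsilon>\<^sup>2 * \<bar>L \<rho> x\<bar> \<le> B * \<rho> x \<and> \<epsilon>\<^sup>2 * \<Gamma> \<rho> \<rho> x \<le> B * \<rho> x \<and> \<bar>L (\<lambda>_. 1) x\<bar> \<le> B)"

lemma weightD:
  assumes "weight B \<epsilon> \<rho>"
  shows "\<rho> \<in> F" "0 < \<epsilon>" "\<epsilon> \<le> 1" "0 \<le> B" "1 \<le> \<rho> x" "0 < \<rho> x" "\<epsilon>\<^sup>2 * \<bar>L \<rho> x\<bar> \<le> B * \<rho> x"
    "\<epsilon>\<^sup>2 * \<Gamma> \<rho> \<rho> x \<le> B * \<rho> x" "\<bar>L (\<lambda>_. 1) x\<bar> \<le> B" "\<epsilon>\<^sup>2 \<le> 1"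
proof -
  show "1 \<le> \<rho> x" using assms by (auto simp: weight_def)
  then show "0 < \<rho> x" by linarith
  show "\<epsilon>\<^sup>2 \<le> 1" using assms by (simp add: weight_def power_le_one)
qed (use assms in \<open>auto simp: weight_def\<close>)

lemma carre_power:
  assumes "f \<in> F" "h \<in> F"
  shows "\<Gamma> (\<lambda>y. f y ^ Suc j) h x = real (Suc j) * f x ^ j * \<Gamma> f h x"
proof (induction j)
  case (Suc j)
  have "\<Gamma> (\<lambda>y. f y ^ Suc (Suc j)) h x = \<Gamma> (\<lambda>y. f y * f y ^ Suc j) h x" by simp
  also have "\<dots> = f x * \<Gamma> (\<lambda>y. f y ^ Suc j) h x + f x ^ Suc j * \<Gamma> f h x"
    by (rule carre_derivation[OF assms(1) F_power[OF assms(1)] assms(2)])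
  finally show ?case unfolding Suc by (simp add: algebra_simps)
qed simp

text \<open>Powers of a weight obey the same estimate, with a constant quadratic in the exponent.\<close>

lemma weight_power_L:
  assumes w: "weight B \<epsilon> \<rho>"
  shows "\<epsilon>\<^sup>2 * \<bar>L (\<lambda>y. \<rho> y ^ j) x\<bar> \<le> B * (real j + 1)\<^sup>2 * \<rho> x ^ j"
proof (induction j)
  case 0
  have "\<epsilon>\<^sup>2 * \<bar>L (\<lambda>_. 1) x\<bar> \<le> 1 * B" using weightD[OF w] by (intro mult_mono) auto
  then show ?case by simp
next
  case (Suc j)
  note W = weightD(1-4)[OF w] weightD(5-9)[OF w, of x] weightD(10)[OF w]
  have g: "\<epsilon>\<^sup>2 * \<bar>\<Gamma> \<rho> (\<lambda>y. \<rho> y ^ j) x\<bar> \<le> real j * B * \<rho> x ^ Suc j"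
  proof (cases j)
    case 0
    then show ?thesis using carre_const[OF W(1), of 1] by simp
  next
    case (Suc i)
    have "\<Gamma> \<rho> (\<lambda>y. \<rho> y ^ j) x = real j * \<rho> x ^ i * \<Gamma> \<rho> \<rho> x"
      unfolding Suc carre_sym[of \<rho> "\<lambda>y. \<rho> y ^ Suc i"] by (rule carre_power[OF W(1,1)])
    then have "\<epsilon>\<^sup>2 * \<bar>\<Gamma> \<rho> (\<lambda>y. \<rho> y ^ j) x\<bar> = (real j * \<rho> x ^ i) * (\<epsilon>\<^sup>2 * \<Gamma> \<rho> \<rho> x)"
      using carre_nonneg[OF W(1)] W by (simp add: abs_mult)
    also have "\<dots> \<le> (real j * \<rho> x ^ i) * (B * \<rho> x)" using W by (intro mult_left_mono) auto
    also have "\<dots> = real j * B * \<rho> x ^ j" by (simp add: Suc)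
    also have "\<dots> \<le> real j * B * \<rho> x ^ Suc j"
      using W by (intro mult_left_mono) auto
    finally show ?thesis .
  qed
  have "L (\<lambda>y. \<rho> y ^ Suc j) x = \<rho> x * L (\<lambda>y. \<rho> y ^ j) x + \<rho> x ^ j * L \<rho> x
      - 2 * \<Gamma> \<rho> (\<lambda>y. \<rho> y ^ j) x - \<rho> x ^ Suc j * L (\<lambda>_. 1) x"
    using L_mult[of \<rho> "\<lambda>y. \<rho> y ^ j" x] by simp
  also have "\<bar>\<dots>\<bar> \<le> \<rho> x * \<bar>L (\<lambda>y. \<rho> y ^ j) x\<bar> + \<rho> x ^ j * \<bar>L \<rho> x\<bar>
      + 2 * \<bar>\<Gamma> \<rho> (\<lambda>y. \<rho> y ^ j) x\<bar> + \<rho> x ^ Suc j * \<bar>L (\<lambda>_. 1) x\<bar>"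
    using W by (intro order_trans[OF abs_triangle_ineq4] add_mono order_trans[OF abs_triangle_ineq])
      (auto simp: abs_mult)
  finally have "\<epsilon>\<^sup>2 * \<bar>L (\<lambda>y. \<rho> y ^ Suc j) x\<bar> \<le> \<epsilon>\<^sup>2 * \<dots>" by (rule mult_left_mono) simp
  also have "\<dots> = \<rho> x * (\<epsilon>\<^sup>2 * \<bar>L (\<lambda>y. \<rho> y ^ j) x\<bar>) + \<rho> x ^ j * (\<epsilon>\<^sup>2 * \<bar>L \<rho> x\<bar>)
      + 2 * (\<epsilon>\<^sup>2 * \<bar>\<Gamma> \<rho> (\<lambda>y. \<rho> y ^ j) x\<bar>) + \<rho> x ^ Suc j * (\<epsilon>\<^sup>2 * \<bar>L (\<lambda>_. 1) x\<bar>)"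
    by (simp add: algebra_simps)
  also have "\<dots> \<le> \<rho> x * (B * (real j + 1)\<^sup>2 * \<rho> x ^ j) + \<rho> x ^ j * (B * \<rho> x)
      + 2 * (real j * B * \<rho> x ^ Suc j) + \<rho> x ^ Suc j * (1 * B)"
  proof -
    have "\<epsilon>\<^sup>2 * \<bar>L (\<lambda>_. 1) x\<bar> \<le> 1 * B" using W by (intro mult_mono) auto
    then show ?thesis using W Suc g by (intro add_mono mult_left_mono) auto
  qed
  also have "\<dots> = B * ((real j + 1)\<^sup>2 + 2 * real j + 2) * \<rho> x ^ Suc j" by (simp add: algebra_simps)
  also have "\<dots> \<le> B * (real (Suc j) + 1)\<^sup>2 * \<rho> x ^ Suc j"
    using W by (intro mult_right_mono mult_left_mono) (auto simp: power2_eq_square algebra_simps)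
  finally show ?case .
qed

text \<open>Differentiating \<open>\<rho> ^ (j + 1)\<close> lowers the power by one half only, since \<open>\<Gamma> \<rho> \<rho>\<close> is of the
  size of \<open>\<rho>\<close> and not smaller; with \<open>h\<close> measured by \<open>\<rho> ^ j\<close> a factor \<open>sqrt \<rho>\<close> is left.\<close>

lemma weight_carre_sqrt:
  assumes w: "weight B \<epsilon> \<rho>" and h: "h \<in> F"
  shows "\<epsilon> * \<bar>\<Gamma> (\<lambda>y. \<rho> y ^ Suc j) h x\<bar> \<le> real (Suc j) * sqrt B * \<rho> x ^ j * sqrt (\<rho> x) * sqrt (\<Gamma> h h x)"
proof -
  note W = weightD(1-4)[OF w] weightD(5-9)[OF w, of x] weightD(10)[OF w]
  have "\<epsilon> * sqrt (\<Gamma> \<rho> \<rho> x) = sqrt (\<epsilon>\<^sup>2 * \<Gamma> \<rho> \<rho> x)" using W by (simp add: real_sqrt_mult)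
  also have "\<dots> \<le> sqrt (B * \<rho> x)" using W by simp
  finally have 1: "\<epsilon> * sqrt (\<Gamma> \<rho> \<rho> x) \<le> sqrt B * sqrt (\<rho> x)" by (simp add: real_sqrt_mult)
  have "\<epsilon> * \<bar>\<Gamma> (\<lambda>y. \<rho> y ^ Suc j) h x\<bar> = (real (Suc j) * \<rho> x ^ j) * (\<epsilon> * \<bar>\<Gamma> \<rho> h x\<bar>)"
    unfolding carre_power[OF W(1) h] using W by (simp add: abs_mult)
  also have "\<dots> \<le> (real (Suc j) * \<rho> x ^ j) * (\<epsilon> * (sqrt (\<Gamma> \<rho> \<rho> x) * sqrt (\<Gamma> h h x)))"
    using W carre_Cauchy_Schwarz[OF W(1) h, of x] by (intro mult_left_mono) auto
  also have "\<dots> = (real (Suc j) * \<rho> x ^ j) * ((\<epsilon> * sqrt (\<Gamma> \<rho> \<rho> x)) * sqrt (\<Gamma> h h x))" by (simp add: mult_ac)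
  also have "\<dots> \<le> (real (Suc j) * \<rho> x ^ j) * ((sqrt B * sqrt (\<rho> x)) * sqrt (\<Gamma> h h x))"
    using W 1 carre_nonneg[OF h] by (intro mult_left_mono mult_right_mono) auto
  finally show ?thesis by (simp add: mult_ac)
qed

definition pair_sq :: "('m \<Rightarrow> real) \<Rightarrow> nat \<Rightarrow> ('m \<Rightarrow> real) \<Rightarrow> ('m \<Rightarrow> real) \<Rightarrow> real" where
  "pair_sq \<rho> j f h = (LINT x|\<mu>. \<rho> x ^ j * ((f x)\<^sup>2 + (h x)\<^sup>2))"

lemma pair_sq_nonneg: "weight B \<epsilon> \<rho> \<Longrightarrow> 0 \<le> pair_sq \<rho> j f h"
  unfolding pair_sq_def by (intro Bochner_Integration.integral_nonneg) (simp add: weightD less_imp_le)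

lemma pair_sq_mono:
  assumes "weight B \<epsilon> \<rho>" "f \<in> F" "h \<in> F"
  shows "pair_sq \<rho> j f h \<le> pair_sq \<rho> (Suc j) f h"
proof -
  note W = weightD[OF assms(1)]
  have c: "cont \<rho>" "cont f" "cont h"
    using assms W by (auto intro: cont_intros)
  show ?thesis unfolding pair_sq_def
  proof (intro integral_mono integrable_continuous continuous_intros c mult_right_mono)
    show "\<rho> x ^ j \<le> \<rho> x ^ Suc j" for x
      using W(5)[of x] by (intro power_increasing) auto
  qed auto
qed

text \<open>One step of the Crank-Nicolson scheme for \<open>dz/dt = i L z\<close> with step size \<open>2 \<epsilon>\<^sup>2\<close>,
  written for the real and imaginary parts of \<open>z = f + i h\<close>.\<close>

definition cn_step where
  "cn_step \<epsilon> f h f' h' \<longleftrightarrow> f \<in> F \<and> h \<in> F \<and> f' \<in> F \<and> h' \<in> F \<and>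
    (\<forall>x. f' x - f x = - (\<epsilon>\<^sup>2 * L (\<lambda>y. h' y + h y) x)) \<and>
    (\<forall>x. h' x - h x = \<epsilon>\<^sup>2 * L (\<lambda>y. f' y + f y) x)"

text \<open>Integration by parts; the error terms, where \<open>L\<close> falls on the weight, are of order
  \<open>1 / \<epsilon>\<^sup>2\<close> times the weight itself.\<close>

lemma weighted_energy:
  assumes w: "weight B \<epsilon> \<rho>" and q: "q \<in> F"
  shows "\<epsilon>\<^sup>2 * (LINT x|\<mu>. \<rho> x ^ j * \<Gamma> q q x) \<le>
    (LINT x|\<mu>. \<rho> x ^ j * (\<epsilon>\<^sup>2 * (q x * L q x) + B * (1 + (real j + 1)\<^sup>2) / 2 * (q x)\<^sup>2))"
proof -
  note W = weightD[OF w]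
  define K where "K = B * (1 + (real j + 1)\<^sup>2)"
  let ?V = "\<lambda>x. \<rho> x ^ j * L (\<lambda>_. 1) x + L (\<lambda>y. \<rho> y ^ j) x"
  have F: "(\<lambda>x. \<rho> x ^ j) \<in> F" using W(1) by (rule F_power)
  have c: "cont q" "cont (L q)" "cont \<rho>" "cont (L (\<lambda>y. \<rho> y ^ j))"
    "cont (L (\<lambda>y. 1))" using q F W(1) by (auto intro: cont_intros)
  have "\<epsilon>\<^sup>2 * (LINT x|\<mu>. \<rho> x ^ j * \<Gamma> q q x) = (LINT x|\<mu>. \<epsilon>\<^sup>2 * (\<rho> x ^ j * q x * L q x) - \<epsilon>\<^sup>2 / 2 * ((q x)\<^sup>2 * ?V x))"
    unfolding integral_carre[OF F q] using c by (simp add: integrable_continuous continuous_intros right_diff_distrib)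
  also have "\<dots> \<le> (LINT x|\<mu>. \<rho> x ^ j * (\<epsilon>\<^sup>2 * (q x * L q x) + K / 2 * (q x)\<^sup>2))"
  proof (intro integral_mono integrable_continuous continuous_intros c)
    fix x
    have "\<epsilon>\<^sup>2 * - ?V x \<le> \<epsilon>\<^sup>2 * \<bar>?V x\<bar>" by (intro mult_left_mono) auto
    also have "\<dots> \<le> \<epsilon>\<^sup>2 * (\<rho> x ^ j * \<bar>L (\<lambda>_. 1) x\<bar> + \<bar>L (\<lambda>y. \<rho> y ^ j) x\<bar>)"
      using W(6)[of x] by (intro mult_left_mono order_trans[OF abs_triangle_ineq]) (auto simp: abs_mult)
    also have "\<dots> = \<rho> x ^ j * (\<epsilon>\<^sup>2 * \<bar>L (\<lambda>_. 1) x\<bar>) + \<epsilon>\<^sup>2 * \<bar>L (\<lambda>y. \<rho> y ^ j) x\<bar>" by (simp add: algebra_simps)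
    also have "\<dots> \<le> \<rho> x ^ j * (1 * B) + B * (real j + 1)\<^sup>2 * \<rho> x ^ j"
      using W(6)[of x] W(4,10) W(9)[of x] mult_mono[of "\<epsilon>\<^sup>2" 1 "\<bar>L (\<lambda>_. 1) x\<bar>" B]
      by (intro add_mono weight_power_L[OF w] mult_left_mono) auto
    also have "\<dots> = K * \<rho> x ^ j" by (simp add: K_def algebra_simps)
    finally have "(q x)\<^sup>2 / 2 * (\<epsilon>\<^sup>2 * - ?V x) \<le> (q x)\<^sup>2 / 2 * (K * \<rho> x ^ j)"
      by (rule mult_left_mono) simp
    then show "\<epsilon>\<^sup>2 * (\<rho> x ^ j * q x * L q x) - \<epsilon>\<^sup>2 / 2 * ((q x)\<^sup>2 * ?V x) \<le> \<rho> x ^ j * (\<epsilon>\<^sup>2 * (q x * L q x) + K / 2 * (q x)\<^sup>2)"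
      by (simp add: algebra_simps)
  qed
  finally show ?thesis by (simp add: K_def)
qed

lemma square_sum_le: "(a + b)\<^sup>2 + (c + d)\<^sup>2 \<le> 2 * ((b\<^sup>2 + d\<^sup>2) + (a\<^sup>2 + c\<^sup>2))" for a b c d :: real
  using zero_le_power2[of "a - b"] zero_le_power2[of "c - d"] by (simp add: power2_eq_square algebra_simps)

text \<open>On the sums \<open>f' + f\<close> and \<open>h' + h\<close> the scheme expresses \<open>\<epsilon>\<^sup>2 L\<close> by differences of the
  iterates, so the energy is bounded by norms without derivatives. This is the smoothing
  that an implicit scheme provides.\<close>

lemma cn_energy:
  assumes w: "weight B \<epsilon> \<rho>" and cn: "cn_step \<epsilon> f h f' h'"
  defines "p \<equiv> \<lambda>x. f' x + f x" and "r \<equiv> \<lambda>x. h' x + h x"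
  shows "\<epsilon>\<^sup>2 * (LINT x|\<mu>. \<rho> x ^ j * (\<Gamma> p p x + \<Gamma> r r x))
    \<le> (1 + B * (1 + (real j + 1)\<^sup>2)) * (pair_sq \<rho> j f h + pair_sq \<rho> j f' h')"
proof -
  note W = weightD[OF w]
  have F: "f \<in> F" "h \<in> F" "f' \<in> F" "h' \<in> F" "p \<in> F" "r \<in> F"
    using cn W by (auto simp: cn_step_def p_def r_def intro!: F_intros)
  have eqs: "\<epsilon>\<^sup>2 * L r x = f x - f' x" "\<epsilon>\<^sup>2 * L p x = h' x - h x" for x
    using cn by (auto simp: cn_step_def p_def r_def algebra_simps)
  define K where "K = B * (1 + (real j + 1)\<^sup>2)"
  have K0: "K \<ge> 0" using W(4) by (simp add: K_def)
  let ?e = "\<lambda>q x. \<rho> x ^ j * (\<epsilon>\<^sup>2 * (q x * L q x) + K / 2 * (q x)\<^sup>2)"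
  have c: "cont f" "cont h" "cont f'" "cont h'"
    "cont p" "cont r" "cont \<rho>" "cont (L p)" "cont (L r)"
    "cont (\<Gamma> p p)" "cont (\<Gamma> r r)"
    using F W(1) by (auto intro: cont_intros)
  have "\<epsilon>\<^sup>2 * (LINT x|\<mu>. \<rho> x ^ j * (\<Gamma> p p x + \<Gamma> r r x)) =
     \<epsilon>\<^sup>2 * (LINT x|\<mu>. \<rho> x ^ j * \<Gamma> p p x) + \<epsilon>\<^sup>2 * (LINT x|\<mu>. \<rho> x ^ j * \<Gamma> r r x)"
    using c by (simp add: integrable_continuous continuous_intros distrib_left)
  also have "\<dots> \<le> (LINT x|\<mu>. ?e p x) + (LINT x|\<mu>. ?e r x)"
    unfolding K_def by (intro add_mono weighted_energy[OF w] F)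
  also have "\<dots> = (LINT x|\<mu>. ?e p x + ?e r x)"
    by (intro Bochner_Integration.integral_add[symmetric] integrable_continuous continuous_intros c) auto
  also have "\<dots> \<le> (LINT x|\<mu>. (1 + K) * (\<rho> x ^ j * ((f x)\<^sup>2 + (h x)\<^sup>2) + \<rho> x ^ j * ((f' x)\<^sup>2 + (h' x)\<^sup>2)))"
  proof (intro integral_mono integrable_continuous continuous_intros c)
    fix x
    let ?s = "((f x)\<^sup>2 + (h x)\<^sup>2) + ((f' x)\<^sup>2 + (h' x)\<^sup>2)"
    have "\<epsilon>\<^sup>2 * (p x * L p x) + \<epsilon>\<^sup>2 * (r x * L r x) = p x * (\<epsilon>\<^sup>2 * L p x) + r x * (\<epsilon>\<^sup>2 * L r x)" by simp
    also have "\<dots> = 2 * f x * h' x - 2 * f' x * h x" unfolding eqs by (simp add: p_def r_def algebra_simps)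
    also have "\<dots> \<le> ?s" using zero_le_power2[of "f x - h' x"] zero_le_power2[of "f' x + h x"] unfolding power2_eq_square
      by (simp add: algebra_simps)
    finally have 1: "\<epsilon>\<^sup>2 * (p x * L p x) + \<epsilon>\<^sup>2 * (r x * L r x) \<le> ?s" .
    have 2: "K / 2 * ((p x)\<^sup>2 + (r x)\<^sup>2) \<le> K / 2 * (2 * ?s)"
      unfolding p_def r_def using K0 by (intro mult_left_mono square_sum_le) auto
    have "\<rho> x ^ j * ((\<epsilon>\<^sup>2 * (p x * L p x) + \<epsilon>\<^sup>2 * (r x * L r x)) + K / 2 * ((p x)\<^sup>2 + (r x)\<^sup>2)) \<le> \<rho> x ^ j * (?s + K / 2 * (2 * ?s))"
      using W(6)[of x] by (intro mult_left_mono add_mono 1 2) auto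
    then show "?e p x + ?e r x \<le> (1 + K) * (\<rho> x ^ j * ((f x)\<^sup>2 + (h x)\<^sup>2) + \<rho> x ^ j * ((f' x)\<^sup>2 + (h' x)\<^sup>2))"
      by (simp add: algebra_simps)
  qed
  also have "\<dots> = (1 + K) * (pair_sq \<rho> j f h + pair_sq \<rho> j f' h')"
    unfolding pair_sq_def using c by (simp add: integrable_continuous continuous_intros)
  finally show ?thesis unfolding K_def by simp
qed

text \<open>The change of \<open>\<bar>z\<bar>\<^sup>2\<close> in one step is \<open>\<epsilon>\<^sup>2 (r L p - p L r)\<close>, whose integral against \<open>W\<close>
  contains \<open>W\<close> only through its first derivatives.\<close>

lemma cn_balance:
  assumes cn: "cn_step \<epsilon> f h f' h'" and W: "W \<in> F"
  defines "p \<equiv> \<lambda>x. f' x + f x" and "r \<equiv> \<lambda>x. h' x + h x"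
  shows "(LINT x|\<mu>. W x * ((f' x)\<^sup>2 + (h' x)\<^sup>2)) - (LINT x|\<mu>. W x * ((f x)\<^sup>2 + (h x)\<^sup>2)) =
    (LINT x|\<mu>. \<epsilon>\<^sup>2 * (r x * \<Gamma> W p x - p x * \<Gamma> W r x))"
proof -
  have F: "f \<in> F" "h \<in> F" "f' \<in> F" "h' \<in> F" "p \<in> F" "r \<in> F"
    using cn by (auto simp: cn_step_def p_def r_def intro!: F_intros)
  have eqs: "f' x - f x = - (\<epsilon>\<^sup>2 * L r x)" "h' x - h x = \<epsilon>\<^sup>2 * L p x" for x
    using cn by (auto simp: cn_step_def p_def r_def)
  have c: "cont W" "cont f" "cont h" "cont f'" "cont h'"
    using F W by (auto intro: cont_intros)
  have "(LINT x|\<mu>. W x * ((f' x)\<^sup>2 + (h' x)\<^sup>2)) - (LINT x|\<mu>. W x * ((f x)\<^sup>2 + (h x)\<^sup>2))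
    = (LINT x|\<mu>. W x * (((f' x)\<^sup>2 + (h' x)\<^sup>2) - ((f x)\<^sup>2 + (h x)\<^sup>2)))"
    unfolding right_diff_distrib
    by (intro Bochner_Integration.integral_diff[symmetric] integrable_continuous continuous_intros c)
  also have "\<dots> = (LINT x|\<mu>. \<epsilon>\<^sup>2 * (W x * (r x * L p x - p x * L r x)))"
  proof (intro Bochner_Integration.integral_cong refl)
    fix x
    have "((f' x)\<^sup>2 + (h' x)\<^sup>2) - ((f x)\<^sup>2 + (h x)\<^sup>2) = (f' x - f x) * p x + (h' x - h x) * r x"
      unfolding p_def r_def by (simp add: power2_eq_square algebra_simps)
    also have "\<dots> = \<epsilon>\<^sup>2 * (r x * L p x - p x * L r x)" unfolding eqs by (simp add: algebra_simps)
    finally show "W x * (((f' x)\<^sup>2 + (h' x)\<^sup>2) - ((f x)\<^sup>2 + (h x)\<^sup>2)) = \<epsilon>\<^sup>2 * (W x * (r x * L p x - p x * L r x))"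
      by (simp only: mult.left_commute)
  qed
  finally show ?thesis unfolding integral_mult_right_zero integral_weighted_antisym[OF W F(6,5)] .
qed

lemma cn_isometry:
  assumes "cn_step \<epsilon> f h f' h'" shows "pair_sq \<rho> 0 f' h' = pair_sq \<rho> 0 f h"
proof -
  have "(\<lambda>y. f' y + f y) \<in> F" "(\<lambda>y. h' y + h y) \<in> F" using assms by (auto simp: cn_step_def intro: F_intros)
  then have "\<Gamma> (\<lambda>_. 1) (\<lambda>y. f' y + f y) x = 0" "\<Gamma> (\<lambda>_. 1) (\<lambda>y. h' y + h y) x = 0" for x
    unfolding carre_sym[of "\<lambda>_. 1"] by (auto simp: carre_const)
  then show ?thesis using cn_balance[OF assms F_const[of 1]] by (simp add: pair_sq_def)
qed

text \<open>The factor \<open>\<Gamma> (\<rho> ^ (j + 1))\<close> in the balance is split as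
  \<open>sqrt (\<rho> ^ (j + 1)) * sqrt (\<rho> ^ j)\<close>: one part goes with the functions, the other with
  their energy, which is a norm of the lower weight \<open>\<rho> ^ j\<close>. So a step increases the
  norm with weight \<open>\<rho> ^ (j + 1)\<close> by an amount governed by the norm with weight \<open>\<rho> ^ j\<close>;
  this makes the growth polynomial rather than exponential.\<close>

lemma cn_step_growth:
  assumes w: "weight B \<epsilon> \<rho>" and cn: "cn_step \<epsilon> f h f' h'"
  shows "\<bar>pair_sq \<rho> (Suc j) f' h' - pair_sq \<rho> (Suc j) f h\<bar> \<le>
    (real (Suc j) * sqrt B * sqrt 2 * sqrt (1 + B * (1 + (real j + 1)\<^sup>2))) *
      (sqrt (pair_sq \<rho> (Suc j) f h + pair_sq \<rho> (Suc j) f' h') * sqrt (pair_sq \<rho> j f h + pair_sq \<rho> j f' h'))"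
    (is "_ \<le> ?C * _")
proof -
  note W = weightD[OF w]
  define p r where "p = (\<lambda>x. f' x + f x)" and "r = (\<lambda>x. h' x + h x)"
  have F: "f \<in> F" "h \<in> F" "f' \<in> F" "h' \<in> F" "p \<in> F" "r \<in> F" "(\<lambda>x. \<rho> x ^ j) \<in> F" "(\<lambda>x. \<rho> x ^ Suc j) \<in> F"
    using cn W by (auto simp: cn_step_def p_def r_def intro!: F_intros simp del: power_Suc)
  have c: "cont f" "cont h" "cont f'" "cont h'"
    "cont p" "cont r" "cont \<rho>" 
    "cont (L p)" "cont (L r)"
    "cont (\<Gamma> p p)" "cont (\<Gamma> r r)"
    "cont (\<Gamma> (\<lambda>y. \<rho> y ^ Suc j) p)" "cont (\<Gamma> (\<lambda>y. \<rho> y ^ Suc j) r)"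
    using F W(1) by (auto intro: cont_intros simp del: power_Suc)
  let ?W = "\<lambda>x. \<rho> x ^ Suc j"
  have eq: "pair_sq \<rho> (Suc j) f' h' - pair_sq \<rho> (Suc j) f h = (LINT x|\<mu>. \<epsilon>\<^sup>2 * (r x * \<Gamma> ?W p x - p x * \<Gamma> ?W r x))"
    unfolding pair_sq_def p_def r_def by (rule cn_balance[OF cn F(8)])
  define a where "a = (\<lambda>x. sqrt (\<rho> x ^ Suc j) * sqrt ((p x)\<^sup>2 + (r x)\<^sup>2))"
  define b where "b = (\<lambda>x. \<epsilon> * (sqrt (\<rho> x ^ j) * sqrt (\<Gamma> p p x + \<Gamma> r r x)))"
  have ca: "cont a" "cont b"
    unfolding a_def b_def using c by (auto intro!: continuous_intros simp del: power_Suc)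
  let ?k = "real (Suc j) * sqrt B"
  have k0: "0 \<le> ?k" using W(4) by simp
  have pt: "\<bar>\<epsilon>\<^sup>2 * (r x * \<Gamma> ?W p x - p x * \<Gamma> ?W r x)\<bar> \<le> ?k * (a x * b x)" for x
  proof -
    let ?P = "sqrt (\<Gamma> p p x)" and ?R = "sqrt (\<Gamma> r r x)"
    let ?m = "?k * \<rho> x ^ j * sqrt (\<rho> x)"
    have "\<bar>r x * \<Gamma> ?W p x - p x * \<Gamma> ?W r x\<bar> \<le> \<bar>r x\<bar> * \<bar>\<Gamma> ?W p x\<bar> + \<bar>p x\<bar> * \<bar>\<Gamma> ?W r x\<bar>"
      by (rule order_trans[OF abs_triangle_ineq4]) (simp add: abs_mult)
    then have "\<epsilon>\<^sup>2 * \<bar>r x * \<Gamma> ?W p x - p x * \<Gamma> ?W r x\<bar> \<le> \<epsilon>\<^sup>2 * (\<bar>r x\<bar> * \<bar>\<Gamma> ?W p x\<bar> + \<bar>p x\<bar> * \<bar>\<Gamma> ?W r x\<bar>)"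
      by (rule mult_left_mono) simp
    also have "\<dots> = \<epsilon> * (\<bar>r x\<bar> * (\<epsilon> * \<bar>\<Gamma> ?W p x\<bar>) + \<bar>p x\<bar> * (\<epsilon> * \<bar>\<Gamma> ?W r x\<bar>))"
      by (simp add: power2_eq_square algebra_simps)
    also have "\<dots> \<le> \<epsilon> * (\<bar>r x\<bar> * (?m * ?P) + \<bar>p x\<bar> * (?m * ?R))"
      using W(2) weight_carre_sqrt[OF w F(5), of j x] weight_carre_sqrt[OF w F(6), of j x]
      by (intro mult_left_mono add_mono) auto
    also have "\<dots> = \<epsilon> * ?m * (\<bar>r x\<bar> * ?P + \<bar>p x\<bar> * ?R)" by (simp add: algebra_simps)
    also have "\<dots> \<le> \<epsilon> * ?m * (sqrt ((p x)\<^sup>2 + (r x)\<^sup>2) * sqrt (\<Gamma> p p x + \<Gamma> r r x))"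
    proof (intro mult_left_mono)
      have "(\<bar>r x\<bar> * ?P + \<bar>p x\<bar> * ?R)\<^sup>2 + (\<bar>r x\<bar> * ?R - \<bar>p x\<bar> * ?P)\<^sup>2 = (\<bar>p x\<bar>\<^sup>2 + \<bar>r x\<bar>\<^sup>2) * (?P\<^sup>2 + ?R\<^sup>2)"
        unfolding power2_eq_square by algebra
      then have "(\<bar>r x\<bar> * ?P + \<bar>p x\<bar> * ?R)\<^sup>2 + (\<bar>r x\<bar> * ?R - \<bar>p x\<bar> * ?P)\<^sup>2 = ((p x)\<^sup>2 + (r x)\<^sup>2) * (?P\<^sup>2 + ?R\<^sup>2)"
        by (simp only: power2_abs)
      then have "(\<bar>r x\<bar> * ?P + \<bar>p x\<bar> * ?R)\<^sup>2 \<le> ((p x)\<^sup>2 + (r x)\<^sup>2) * (\<Gamma> p p x + \<Gamma> r r x)"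
        using carre_nonneg[OF F(5)] carre_nonneg[OF F(6)] by (smt (verit) real_sqrt_pow2 zero_le_power2)
      then show "\<bar>r x\<bar> * ?P + \<bar>p x\<bar> * ?R \<le> sqrt ((p x)\<^sup>2 + (r x)\<^sup>2) * sqrt (\<Gamma> p p x + \<Gamma> r r x)"
        unfolding real_sqrt_mult[symmetric] by (rule real_le_rsqrt)
    qed (use W(2) W(6)[of x] k0 in auto)
    also have "\<dots> = ?k * (a x * b x)"
    proof -
      have "sqrt (\<rho> x ^ Suc j) * sqrt (\<rho> x ^ j) = sqrt (\<rho> x) * (sqrt (\<rho> x ^ j) * sqrt (\<rho> x ^ j))"
        by (simp add: real_sqrt_mult)
      also have "\<dots> = \<rho> x ^ j * sqrt (\<rho> x)" using W(6)[of x] by (simp)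
      finally have "sqrt (\<rho> x ^ Suc j) * sqrt (\<rho> x ^ j) = \<rho> x ^ j * sqrt (\<rho> x)" .
      moreover have "?k * (a x * b x) = \<epsilon> * (?k * (sqrt (\<rho> x ^ Suc j) * sqrt (\<rho> x ^ j))) *
         (sqrt ((p x)\<^sup>2 + (r x)\<^sup>2) * sqrt (\<Gamma> p p x + \<Gamma> r r x))" unfolding a_def b_def by (simp only: mult_ac)
      ultimately show ?thesis by (simp only: mult_ac)
    qed
    finally show ?thesis by (simp add: abs_mult)
  qed
  have "\<bar>pair_sq \<rho> (Suc j) f' h' - pair_sq \<rho> (Suc j) f h\<bar> \<le> (LINT x|\<mu>. \<bar>\<epsilon>\<^sup>2 * (r x * \<Gamma> ?W p x - p x * \<Gamma> ?W r x)\<bar>)"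
    unfolding eq by (rule integral_abs_bound)
  also have "\<dots> \<le> (LINT x|\<mu>. ?k * (a x * b x))"
    by (intro integral_mono pt integrable_continuous continuous_intros c ca)
  also have "\<dots> = ?k * (LINT x|\<mu>. a x * b x)" by simp
  also have "\<dots> \<le> ?k * (sqrt (LINT x|\<mu>. (a x)\<^sup>2) * sqrt (LINT x|\<mu>. (b x)\<^sup>2))"
    by (intro mult_left_mono k0 order_trans[OF abs_ge_self integral_Cauchy_Schwarz] integrable_continuous continuous_intros ca)
  also have "\<dots> \<le> ?k * (sqrt (2 * (pair_sq \<rho> (Suc j) f h + pair_sq \<rho> (Suc j) f' h')) *
      sqrt ((1 + B * (1 + (real j + 1)\<^sup>2)) * (pair_sq \<rho> j f h + pair_sq \<rho> j f' h')))"
  proof (intro mult_left_mono mult_mono real_sqrt_le_mono k0)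
    have "(LINT x|\<mu>. (a x)\<^sup>2) \<le> (LINT x|\<mu>. 2 * (\<rho> x ^ Suc j * ((f x)\<^sup>2 + (h x)\<^sup>2) + \<rho> x ^ Suc j * ((f' x)\<^sup>2 + (h' x)\<^sup>2)))"
    proof (intro integral_mono integrable_continuous continuous_intros c ca)
      fix x
      have "(p x)\<^sup>2 + (r x)\<^sup>2 \<le> 2 * (((f x)\<^sup>2 + (h x)\<^sup>2) + ((f' x)\<^sup>2 + (h' x)\<^sup>2))"
        unfolding p_def r_def by (rule square_sum_le)
      then have "\<rho> x ^ Suc j * ((p x)\<^sup>2 + (r x)\<^sup>2) \<le> \<rho> x ^ Suc j * (2 * (((f x)\<^sup>2 + (h x)\<^sup>2) + ((f' x)\<^sup>2 + (h' x)\<^sup>2)))"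
        using W(6)[of x] by (intro mult_left_mono) auto
      then show "(a x)\<^sup>2 \<le> 2 * (\<rho> x ^ Suc j * ((f x)\<^sup>2 + (h x)\<^sup>2) + \<rho> x ^ Suc j * ((f' x)\<^sup>2 + (h' x)\<^sup>2))"
        unfolding a_def power_mult_distrib using W(6)[of x] by (simp add: algebra_simps)
    qed
    also have "\<dots> = 2 * (pair_sq \<rho> (Suc j) f h + pair_sq \<rho> (Suc j) f' h')"
      unfolding pair_sq_def using c by (simp add: integrable_continuous continuous_intros del: power_Suc)
    finally show "(LINT x|\<mu>. (a x)\<^sup>2) \<le> \<dots>" .
    have "(LINT x|\<mu>. (b x)\<^sup>2) = \<epsilon>\<^sup>2 * (LINT x|\<mu>. \<rho> x ^ j * (\<Gamma> p p x + \<Gamma> r r x))"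
      unfolding integral_mult_right_zero[symmetric] b_def power_mult_distrib
      using W(6) carre_nonneg[OF F(5)] carre_nonneg[OF F(6)]
      by (intro Bochner_Integration.integral_cong refl) (simp add: less_imp_le)
    also have "\<dots> \<le> (1 + B * (1 + (real j + 1)\<^sup>2)) * (pair_sq \<rho> j f h + pair_sq \<rho> j f' h')"
      unfolding p_def r_def by (rule cn_energy[OF w cn])
    finally show "(LINT x|\<mu>. (b x)\<^sup>2) \<le> \<dots>" .
  qed (use pair_sq_nonneg[OF w] W(4) in \<open>auto intro!: integral_nonneg add_nonneg_nonneg\<close>)
  finally show ?thesis by (simp only: real_sqrt_mult mult_ac)
qed

section \<open>Spectral multipliers on weighted spaces\<close>

primrec cn_const :: "real \<Rightarrow> nat \<Rightarrow> real" where
  "cn_const B 0 = 1"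
| "cn_const B (Suc j) = 1 + 2 * (real (Suc j) * sqrt B * sqrt 2 * sqrt (1 + B * (1 + (real j + 1)\<^sup>2))) * cn_const B j"

lemma cn_const_ge: "0 \<le> B \<Longrightarrow> 1 \<le> cn_const B j"
  by (induction j) auto

text \<open>Induction on \<open>j\<close>. If the norm with weight \<open>\<rho> ^ j\<close> grows at most like \<open>k ^ j\<close>, then the
  increments of the norm with weight \<open>\<rho> ^ (j + 1)\<close> are \<open>O(k ^ j)\<close>, and summing \<open>k\<close> of
  them gives \<open>k ^ (j + 1)\<close>. The unweighted norm is constant.\<close>

lemma cn_growth:
  assumes w: "weight B \<epsilon> \<rho>" and cn: "\<And>k. cn_step \<epsilon> (f k) (h k) (f (Suc k)) (h (Suc k))"
  shows "sqrt (pair_sq \<rho> j (f k) (h k)) \<le> cn_const B j * (1 + real k) ^ j * sqrt (pair_sq \<rho> j (f 0) (h 0))"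
proof (induction j arbitrary: k)
  case 0
  have "pair_sq \<rho> 0 (f k) (h k) = pair_sq \<rho> 0 (f 0) (h 0)"
    by (induction k) (auto simp: cn_isometry[OF cn])
  then show ?case by simp
next
  case (Suc j)
  have B: "0 \<le> B" using weightD(4)[OF w] .
  define C where "C = real (Suc j) * sqrt B * sqrt 2 * sqrt (1 + B * (1 + (real j + 1)\<^sup>2))"
  define D where "D = cn_const B j"
  define q where "q k = sqrt (pair_sq \<rho> (Suc j) (f k) (h k))" for k
  define s where "s k = sqrt (pair_sq \<rho> j (f k) (h k))" for k
  have C: "0 \<le> C" using B by (simp add: C_def)
  have D: "1 \<le> D" using cn_const_ge[OF B] by (simp add: D_def)
  have pos: "0 \<le> q k" "0 \<le> s k" for k using pair_sq_nonneg[OF w] by (auto simp: q_def s_def)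
  have sq: "(q k)\<^sup>2 = pair_sq \<rho> (Suc j) (f k) (h k)" "(s k)\<^sup>2 = pair_sq \<rho> j (f k) (h k)" for k
    using pair_sq_nonneg[OF w] by (auto simp: q_def s_def)
  have F: "f 0 \<in> F" "h 0 \<in> F" using cn[of 0] by (auto simp: cn_step_def)
  have s0: "s 0 \<le> q 0" unfolding s_def q_def using pair_sq_mono[OF w F] by simp
  have s: "s k \<le> D * (1 + real k) ^ j * q 0" for k
  proof -
    have "s k \<le> D * (1 + real k) ^ j * s 0" using Suc.IH[of k] by (simp add: s_def D_def)
    also have "\<dots> \<le> D * (1 + real k) ^ j * q 0" using D s0 by (intro mult_left_mono) auto
    finally show ?thesis .
  qed
  have sqrt_sum: "sqrt (a\<^sup>2 + b\<^sup>2) \<le> a + b" if "0 \<le> a" "0 \<le> b" for a b :: real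
    using that by (intro real_le_lsqrt) (auto simp: power2_eq_square algebra_simps)
  have step: "q (Suc k) \<le> q k + C * (s k + s (Suc k))" for k
  proof -
    have "\<bar>(q (Suc k))\<^sup>2 - (q k)\<^sup>2\<bar> \<le> C * (sqrt ((q k)\<^sup>2 + (q (Suc k))\<^sup>2) * sqrt ((s k)\<^sup>2 + (s (Suc k))\<^sup>2))"
      unfolding sq C_def by (rule cn_step_growth[OF w cn])
    also have "\<dots> \<le> C * ((q k + q (Suc k)) * (s k + s (Suc k)))"
      by (intro mult_left_mono mult_mono sqrt_sum pos C add_nonneg_nonneg) auto
    finally have *: "(q (Suc k) - q k) * (q k + q (Suc k)) \<le> (C * (s k + s (Suc k))) * (q k + q (Suc k))"
      by (simp add: power2_eq_square algebra_simps abs_le_iff)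
    show ?thesis
    proof (cases "q k + q (Suc k) = 0")
      case True
      then show ?thesis using pos[of k] pos[of "Suc k"] C by (smt (verit) mult_nonneg_nonneg)
    next
      case False
      then have "q k + q (Suc k) > 0" using pos[of k] pos[of "Suc k"] by simp
      then show ?thesis using * by (simp only: mult_le_cancel_right_pos)
    qed
  qed
  have "q k \<le> q 0 * (1 + 2 * C * D * real k * (1 + real k) ^ j)"
  proof (induction k)
    case (Suc k)
    have m: "(1 + real k) ^ j \<le> (1 + real (Suc k)) ^ j" by (intro power_mono) auto
    have "q (Suc k) \<le> q k + C * (s k + s (Suc k))" by (rule step)
    also have "\<dots> \<le> q 0 * (1 + 2 * C * D * real k * (1 + real k) ^ j) +
        C * (D * (1 + real k) ^ j * q 0 + D * (1 + real (Suc k)) ^ j * q 0)"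
      by (intro add_mono Suc mult_left_mono s C)
    also have "\<dots> \<le> q 0 * (1 + 2 * C * D * real k * (1 + real (Suc k)) ^ j) +
        C * (D * (1 + real (Suc k)) ^ j * q 0 + D * (1 + real (Suc k)) ^ j * q 0)"
      using C D pos m by (intro add_mono mult_left_mono mult_right_mono order_refl) auto
    also have "\<dots> = q 0 * (1 + 2 * C * D * real (Suc k) * (1 + real (Suc k)) ^ j)"
      by (simp add: algebra_simps)
    finally show ?case .
  qed simp
  also have "\<dots> \<le> q 0 * ((1 + 2 * C * D) * (1 + real k) ^ Suc j)"
  proof (intro mult_left_mono pos)
    have "1 + 2 * C * D * real k * (1 + real k) ^ j \<le> (1 + real k) ^ Suc j + 2 * C * D * (1 + real k) * (1 + real k) ^ j"
      using C D by (intro add_mono one_le_power mult_right_mono mult_left_mono) auto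
    then show "1 + 2 * C * D * real k * (1 + real k) ^ j \<le> (1 + 2 * C * D) * (1 + real k) ^ Suc j"
      by (simp add: algebra_simps)
  qed
  finally show ?case by (simp add: q_def C_def D_def mult_ac)
qed

definition wL2 :: "('m \<Rightarrow> real) \<Rightarrow> nat \<Rightarrow> ('m \<Rightarrow> real) \<Rightarrow> real" where
  "wL2 \<rho> j f = sqrt (LINT x|\<mu>. \<rho> x ^ j * (f x)\<^sup>2)"

lemma wL2_nonneg: "weight B \<epsilon> \<rho> \<Longrightarrow> 0 \<le> wL2 \<rho> j f"
  unfolding wL2_def by (intro real_sqrt_ge_zero Bochner_Integration.integral_nonneg) (simp add: weightD less_imp_le)

lemma wL2_triangle:
  assumes w: "weight B \<epsilon> \<rho>" and "f \<in> F" "h \<in> F"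
  shows "wL2 \<rho> j (\<lambda>x. f x + h x) \<le> wL2 \<rho> j f + wL2 \<rho> j h"
proof -
  note W = weightD[OF w]
  let ?a = "\<lambda>x. sqrt (\<rho> x ^ j) * f x" and ?b = "\<lambda>x. sqrt (\<rho> x ^ j) * h x"
  have c: "cont \<rho>" "cont f" "cont h"
    using assms W by (auto intro: cont_intros)
  have s: "sqrt (\<rho> x ^ j) * sqrt (\<rho> x ^ j) = \<rho> x ^ j" for x using W(6)[of x] by simp
  have cs: "\<bar>\<integral>x. ?a x * ?b x \<partial>\<mu>\<bar> \<le> wL2 \<rho> j f * wL2 \<rho> j h"
  proof -
    have "\<bar>\<integral>x. ?a x * ?b x \<partial>\<mu>\<bar> \<le> sqrt (LINT x|\<mu>. (?a x)\<^sup>2) * sqrt (LINT x|\<mu>. (?b x)\<^sup>2)"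
      by (intro integral_Cauchy_Schwarz integrable_continuous continuous_intros c)
    then show ?thesis unfolding wL2_def using W(6) by (simp add: power_mult_distrib less_imp_le)
  qed
  have "(LINT x|\<mu>. \<rho> x ^ j * (f x + h x)\<^sup>2) = (LINT x|\<mu>. \<rho> x ^ j * (f x)\<^sup>2 + \<rho> x ^ j * (h x)\<^sup>2 + 2 * (?a x * ?b x))"
  proof (intro Bochner_Integration.integral_cong refl)
    fix x
    have e: "?a x * ?b x = \<rho> x ^ j * (f x * h x)" using s[of x] by (metis mult.assoc mult.left_commute)
    show "\<rho> x ^ j * (f x + h x)\<^sup>2 = \<rho> x ^ j * (f x)\<^sup>2 + \<rho> x ^ j * (h x)\<^sup>2 + 2 * (?a x * ?b x)"
      unfolding e by (simp add: power2_eq_square algebra_simps)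
  qed
  also have "\<dots> = (LINT x|\<mu>. \<rho> x ^ j * (f x)\<^sup>2) + (LINT x|\<mu>. \<rho> x ^ j * (h x)\<^sup>2) + 2 * (LINT x|\<mu>. ?a x * ?b x)"
    using c by (simp add: integrable_continuous continuous_intros)
  also have "\<dots> \<le> (wL2 \<rho> j f)\<^sup>2 + (wL2 \<rho> j h)\<^sup>2 + 2 * (wL2 \<rho> j f * wL2 \<rho> j h)"
    using cs W(6) by (intro add_mono) (auto simp: wL2_def less_imp_le)
  also have "\<dots> = (wL2 \<rho> j f + wL2 \<rho> j h)\<^sup>2" by (simp add: power2_eq_square algebra_simps)
  finally show ?thesis unfolding wL2_def[of _ _ "\<lambda>x. f x + h x"]
    using wL2_nonneg[OF w] by (intro real_le_lsqrt) auto
qed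

lemma wL2_cmult: "wL2 \<rho> j (\<lambda>x. c * f x) = \<bar>c\<bar> * wL2 \<rho> j f"
proof -
  have "(LINT x|\<mu>. \<rho> x ^ j * (c * f x)\<^sup>2) = c\<^sup>2 * (LINT x|\<mu>. \<rho> x ^ j * (f x)\<^sup>2)"
    unfolding integral_mult_right_zero[symmetric] by (simp add: power_mult_distrib mult_ac)
  then show ?thesis by (simp add: wL2_def real_sqrt_mult)
qed

lemma wL2_sum:
  assumes w: "weight B \<epsilon> \<rho>" and "\<And>i. i \<in> I \<Longrightarrow> f i \<in> F"
  shows "wL2 \<rho> j (\<lambda>x. \<Sum>i\<in>I. f i x) \<le> (\<Sum>i\<in>I. wL2 \<rho> j (f i))"
  using assms(2)
proof (induction I rule: infinite_finite_induct)
  case (insert a I)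
  then have "wL2 \<rho> j (\<lambda>x. f a x + (\<Sum>i\<in>I. f i x)) \<le> wL2 \<rho> j (f a) + wL2 \<rho> j (\<lambda>x. \<Sum>i\<in>I. f i x)"
    by (intro wL2_triangle[OF w]) (auto intro: F_sum)
  with insert show ?case by auto
qed (auto simp: wL2_def)

lemma wL2_le_pair_sq:
  assumes "weight B \<epsilon> \<rho>" "f \<in> F" "h \<in> F"
  shows "wL2 \<rho> j f \<le> sqrt (pair_sq \<rho> j f h)" "wL2 \<rho> j h \<le> sqrt (pair_sq \<rho> j f h)"
proof -
  note W = weightD[OF assms(1)]
  have c: "cont \<rho>" "cont f" "cont h"
    using assms W by (auto intro: cont_intros)
  show "wL2 \<rho> j f \<le> sqrt (pair_sq \<rho> j f h)" "wL2 \<rho> j h \<le> sqrt (pair_sq \<rho> j f h)"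
    unfolding wL2_def pair_sq_def using W(6)
    by (auto intro!: integral_mono integrable_continuous continuous_intros c simp: less_imp_le)
qed

end

locale spectral_diffusion = diffusion +
  fixes \<nu> :: "nat \<Rightarrow> real" and u :: "nat \<Rightarrow> 'a \<Rightarrow> real"
  assumes u_F: "u l \<in> F"
    and \<nu>_nonneg: "0 \<le> \<nu> l"
    and L_u: "L (u l) = (\<lambda>x. \<nu> l * u l x)"
    and orthonormal: "(LINT x|\<mu>. u l x * u m x) = (if l = m then 1 else 0)"
begin

definition comb :: "nat \<Rightarrow> (nat \<Rightarrow> real) \<Rightarrow> 'a \<Rightarrow> real" where
  "comb N c x = (\<Sum>l<N. c l * u l x)"

lemma comb_F: "comb N c \<in> F"
  unfolding comb_def[abs_def] by (intro F_sum F_cmult u_F)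

lemma L_comb: "L (comb N c) = comb N (\<lambda>l. \<nu> l * c l)"
proof -
  have "L (comb N c) = L (\<lambda>x. \<Sum>l<N. c l * u l x)" by (simp add: comb_def[abs_def])
  also have "\<dots> = (\<lambda>x. \<Sum>l<N. L (\<lambda>x. c l * u l x) x)" by (rule L_sum) (intro F_cmult u_F)
  also have "\<dots> = comb N (\<lambda>l. \<nu> l * c l)" by (simp add: comb_def[abs_def] L_cmult u_F L_u mult_ac)
  finally show ?thesis .
qed

lemma comb_add: "comb N c x + comb N d x = comb N (\<lambda>l. c l + d l) x"
  by (simp add: comb_def distrib_right sum.distrib)

lemma comb_diff: "comb N c x - comb N d x = comb N (\<lambda>l. c l - d l) x"
  by (simp add: comb_def left_diff_distrib sum_subtractf)

lemma comb_cmult: "a * comb N c x = comb N (\<lambda>l. a * c l) x"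
  by (simp add: comb_def sum_distrib_left mult_ac)

text \<open>The Cayley transform turns the eigenvalue \<open>\<nu>\<close> into the rotation by this angle.\<close>

definition angle :: "real \<Rightarrow> nat \<Rightarrow> real" where
  "angle \<epsilon> l = 2 * arctan (\<epsilon>\<^sup>2 * \<nu> l)"

definition rotated :: "(real \<Rightarrow> real) \<Rightarrow> real \<Rightarrow> nat \<Rightarrow> (nat \<Rightarrow> real) \<Rightarrow> nat \<Rightarrow> 'a \<Rightarrow> real" where
  "rotated t \<epsilon> N c k = comb N (\<lambda>l. t (real k * angle \<epsilon> l) * c l)"

text \<open>Rotating each spectral component by its angle is a Crank-Nicolson step; this is the
  identity \<open>tan (\<beta> / 2) = \<epsilon>\<^sup>2 \<nu>\<close> in disguise.\<close>

lemma cn_step_rotated: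
  "cn_step \<epsilon> (rotated cos \<epsilon> N c k) (rotated sin \<epsilon> N c k) (rotated cos \<epsilon> N c (Suc k)) (rotated sin \<epsilon> N c (Suc k))"
proof -
  have tri: "cos (real (Suc k) * angle \<epsilon> l) - cos (real k * angle \<epsilon> l) =
      - (\<epsilon>\<^sup>2 * \<nu> l * (sin (real (Suc k) * angle \<epsilon> l) + sin (real k * angle \<epsilon> l)))"
    "sin (real (Suc k) * angle \<epsilon> l) - sin (real k * angle \<epsilon> l) =
      \<epsilon>\<^sup>2 * \<nu> l * (cos (real (Suc k) * angle \<epsilon> l) + cos (real k * angle \<epsilon> l))" for l
  proof -
    define a where "a = arctan (\<epsilon>\<^sup>2 * \<nu> l)"
    define m where "m = (2 * real k + 1) * a"
    have e: "real (Suc k) * angle \<epsilon> l = m + a" "real k * angle \<epsilon> l = m - a"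
      by (simp_all add: m_def a_def angle_def algebra_simps)
    have ca: "cos a \<noteq> 0" by (simp add: a_def cos_arctan_not_zero)
    have t: "\<epsilon>\<^sup>2 * \<nu> l = sin a / cos a" using tan_arctan[of "\<epsilon>\<^sup>2 * \<nu> l"] by (simp add: a_def tan_def)
    show "cos (real (Suc k) * angle \<epsilon> l) - cos (real k * angle \<epsilon> l) =
      - (\<epsilon>\<^sup>2 * \<nu> l * (sin (real (Suc k) * angle \<epsilon> l) + sin (real k * angle \<epsilon> l)))"
      "sin (real (Suc k) * angle \<epsilon> l) - sin (real k * angle \<epsilon> l) =
      \<epsilon>\<^sup>2 * \<nu> l * (cos (real (Suc k) * angle \<epsilon> l) + cos (real k * angle \<epsilon> l))"
      unfolding e t using ca by (simp_all add: cos_add cos_diff sin_add sin_diff)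
  qed
  show ?thesis
    unfolding cn_step_def rotated_def comb_add L_comb comb_diff left_diff_distrib[symmetric] tri
    unfolding comb_def sum_distrib_left sum_negf[symmetric]
    by (intro conjI allI comb_F[unfolded comb_def[abs_def]] sum.cong refl) (simp_all add: algebra_simps)
qed

text \<open>Each term of the Fourier series of \<open>H\<close> acts through Crank-Nicolson iterates, whose
  weighted norms grow like \<open>(1 + k) ^ j\<close>; the summability hypothesis absorbs this
  growth. The passage to the limit is harmless because only finitely many eigenfunctions
  occur.\<close>

lemma multiplier_wL2:
  assumes w: "weight B \<epsilon> \<rho>"
    and summ: "\<And>K. (\<Sum>k<K. (\<bar>a k\<bar> + \<bar>b k\<bar>) * (1 + real k) ^ j) \<le> S"
    and lim: "\<And>l. (\<lambda>K. \<Sum>k<K. a k * cos (real k * angle \<epsilon> l) + b k * sin (real k * angle \<epsilon> l)) \<longlonglongrightarrow> H (angle \<epsilon> l)"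
  shows "wL2 \<rho> j (comb N (\<lambda>l. H (angle \<epsilon> l) * c l)) \<le> S * cn_const B j * wL2 \<rho> j (comb N c)"
proof -
  have B: "0 \<le> B" using weightD(4)[OF w] .
  define f where "f = rotated cos \<epsilon> N c"
  define h where "h = rotated sin \<epsilon> N c"
  have fh: "f k \<in> F" "h k \<in> F" for k by (auto simp: f_def h_def rotated_def comb_F)
  have z: "f 0 = comb N c" "h 0 = (\<lambda>_. 0)" by (auto simp: f_def h_def rotated_def comb_def)
  have w0: "sqrt (pair_sq \<rho> j (f 0) (h 0)) = wL2 \<rho> j (comb N c)" by (simp add: z pair_sq_def wL2_def)
  have g: "wL2 \<rho> j (f k) \<le> cn_const B j * (1 + real k) ^ j * wL2 \<rho> j (comb N c)"
    "wL2 \<rho> j (h k) \<le> cn_const B j * (1 + real k) ^ j * wL2 \<rho> j (comb N c)" for k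
    using cn_growth[OF w, of f h j k] cn_step_rotated[of \<epsilon> N] wL2_le_pair_sq[OF w fh, of j k k]
    unfolding w0 by (auto simp: f_def h_def)
  define d where "d K l = (\<Sum>k<K. a k * cos (real k * angle \<epsilon> l) + b k * sin (real k * angle \<epsilon> l))" for K l
  have part: "wL2 \<rho> j (comb N (\<lambda>l. d K l * c l)) \<le> S * cn_const B j * wL2 \<rho> j (comb N c)" for K
  proof -
    have "comb N (\<lambda>l. d K l * c l) = (\<lambda>x. \<Sum>k<K. a k * f k x + b k * h k x)"
    proof
      fix x
      have "comb N (\<lambda>l. d K l * c l) x = (\<Sum>l<N. \<Sum>k<K. a k * (cos (real k * angle \<epsilon> l) * c l * u l x)
         + b k * (sin (real k * angle \<epsilon> l) * c l * u l x))"
        unfolding comb_def d_def sum_distrib_right by (simp add: algebra_simps)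
      also have "\<dots> = (\<Sum>k<K. a k * f k x + b k * h k x)"
        unfolding f_def h_def rotated_def comb_def sum_distrib_left sum.distrib[symmetric] by (rule sum.swap)
      finally show "comb N (\<lambda>l. d K l * c l) x = (\<Sum>k<K. a k * f k x + b k * h k x)" .
    qed
    then have "wL2 \<rho> j (comb N (\<lambda>l. d K l * c l)) \<le> (\<Sum>k<K. wL2 \<rho> j (\<lambda>x. a k * f k x + b k * h k x))"
      using wL2_sum[OF w, of "{..<K}" "\<lambda>k x. a k * f k x + b k * h k x"] fh by (simp add: F_intros)
    also have "\<dots> \<le> (\<Sum>k<K. (\<bar>a k\<bar> + \<bar>b k\<bar>) * (1 + real k) ^ j * (cn_const B j * wL2 \<rho> j (comb N c)))"
    proof (intro sum_mono)
      fix k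
      have "wL2 \<rho> j (\<lambda>x. a k * f k x + b k * h k x) \<le> \<bar>a k\<bar> * wL2 \<rho> j (f k) + \<bar>b k\<bar> * wL2 \<rho> j (h k)"
        using wL2_triangle[OF w F_cmult[OF fh(1)] F_cmult[OF fh(2)]] by (simp add: wL2_cmult)
      also have "\<dots> \<le> \<bar>a k\<bar> * (cn_const B j * (1 + real k) ^ j * wL2 \<rho> j (comb N c)) +
          \<bar>b k\<bar> * (cn_const B j * (1 + real k) ^ j * wL2 \<rho> j (comb N c))"
        by (intro add_mono mult_left_mono g) auto
      finally show "wL2 \<rho> j (\<lambda>x. a k * f k x + b k * h k x) \<le>
        (\<bar>a k\<bar> + \<bar>b k\<bar>) * (1 + real k) ^ j * (cn_const B j * wL2 \<rho> j (comb N c))" by (simp add: algebra_simps)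
    qed
    also have "\<dots> \<le> S * (cn_const B j * wL2 \<rho> j (comb N c))"
      unfolding sum_distrib_right[symmetric] using cn_const_ge[OF B, of j] wL2_nonneg[OF w]
      by (intro mult_right_mono summ) auto
    finally show ?thesis by (simp add: mult_ac)
  qed
  have "wL2 \<rho> j (comb N (\<lambda>l. H (angle \<epsilon> l) * c l)) \<le> (\<Sum>l<N. \<bar>(H (angle \<epsilon> l) - d K l) * c l\<bar> * wL2 \<rho> j (u l)) +
      S * cn_const B j * wL2 \<rho> j (comb N c)" (is "?X \<le> ?R K") for K
  proof -
    have "?X = wL2 \<rho> j (\<lambda>x. comb N (\<lambda>l. (H (angle \<epsilon> l) - d K l) * c l) x + comb N (\<lambda>l. d K l * c l) x)"
      unfolding comb_add by (simp add: algebra_simps)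
    also have "\<dots> \<le> wL2 \<rho> j (comb N (\<lambda>l. (H (angle \<epsilon> l) - d K l) * c l)) + wL2 \<rho> j (comb N (\<lambda>l. d K l * c l))"
      by (rule wL2_triangle[OF w comb_F comb_F])
    also have "wL2 \<rho> j (comb N (\<lambda>l. (H (angle \<epsilon> l) - d K l) * c l)) \<le>
       (\<Sum>l<N. wL2 \<rho> j (\<lambda>x. (H (angle \<epsilon> l) - d K l) * c l * u l x))"
      unfolding comb_def[abs_def] by (intro wL2_sum[OF w] F_cmult u_F)
    finally show ?thesis unfolding wL2_cmult using part[of K] by linarith
  qed
  moreover have "?R \<longlonglongrightarrow> (\<Sum>l<N. \<bar>(H (angle \<epsilon> l) - H (angle \<epsilon> l)) * c l\<bar> * wL2 \<rho> j (u l)) + S * cn_const B j * wL2 \<rho> j (comb N c)"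
    unfolding d_def by (intro tendsto_intros lim)
  ultimately show ?thesis using LIMSEQ_le_const by fastforce
qed

end

section \<open>Fourier series of smooth functions vanishing near the ends of a period\<close>

lemma integral_times_sin:
  fixes f f' :: "real \<Rightarrow> real"
  assumes ab: "a \<le> b" and d: "\<And>x. (f has_real_derivative f' x) (at x)" and c: "cont f'" and v: "v \<noteq> 0"
  shows "integral {a..b} (\<lambda>x. f x * sin (v * x + \<theta>)) =
    (f a * cos (v * a + \<theta>) - f b * cos (v * b + \<theta>)) / v + integral {a..b} (\<lambda>x. f' x * cos (v * x + \<theta>)) / v"
proof -
  have "((\<lambda>x. f x * sin (v * x + \<theta>) - f' x * cos (v * x + \<theta>) / v) has_integral
    (- f b * cos (v * b + \<theta>) / v - - f a * cos (v * a + \<theta>) / v)) {a..b}"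
  proof (rule fundamental_theorem_of_calculus[OF ab])
    fix x
    have "((\<lambda>x. - f x * cos (v * x + \<theta>) / v) has_real_derivative f x * sin (v * x + \<theta>) - f' x * cos (v * x + \<theta>) / v) (at x)"
      using v by (auto intro!: derivative_eq_intros d simp: field_simps)
    then show "((\<lambda>x. - f x * cos (v * x + \<theta>) / v) has_vector_derivative f x * sin (v * x + \<theta>) - f' x * cos (v * x + \<theta>) / v) (at x within {a..b})"
      unfolding has_real_derivative_iff_has_vector_derivative by (rule has_vector_derivative_at_within)
  qed
  moreover have i: "(\<lambda>x. f' x * cos (v * x + \<theta>) / v) integrable_on {a..b}"
    using v by (intro integrable_continuous_real continuous_intros continuous_on_subset[OF c]) auto
  ultimately have "((\<lambda>x. f x * sin (v * x + \<theta>)) has_integral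
    (- f b * cos (v * b + \<theta>) / v - - f a * cos (v * a + \<theta>) / v) + integral {a..b} (\<lambda>x. f' x * cos (v * x + \<theta>) / v)) {a..b}"
    using has_integral_add[OF _ integrable_integral[OF i]] by fastforce
  then show ?thesis by (simp add: integral_unique diff_divide_distrib)
qed

text \<open>For a polynomial the bound \<open>O(1 / w)\<close> comes from one integration by parts; a continuous
  function differs from a polynomial by little on the whole interval.\<close>

lemma Riemann_Lebesgue:
  fixes q :: "real \<Rightarrow> real"
  assumes c: "continuous_on {a..b} q" and ab: "a < b" and w: "filterlim w at_top sequentially"
  shows "(\<lambda>n. integral {a..b} (\<lambda>x. q x * sin (w n * x + \<theta> n))) \<longlonglongrightarrow> 0"
proof (rule LIMSEQ_I)
  fix r :: real assume r: "r > 0"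
  define e where "e = r / (2 * (b - a))"
  have e: "e > 0" using r ab by (simp add: e_def)
  obtain P where P: "real_polynomial_function P" "\<And>x. x \<in> {a..b} \<Longrightarrow> \<bar>q x - P x\<bar> < e"
    using Stone_Weierstrass_real_polynomial_function[OF compact_Icc c e] by blast
  obtain P' where P': "real_polynomial_function P'" "\<And>x. (P has_real_derivative P' x) (at x)"
    using has_real_derivative_polynomial_function[OF P(1)] by blast
  have cP: "continuous_on S P" "continuous_on S P'" for S
    using P(1) P'(1) by (auto intro: continuous_on_polymonial_function simp: real_polynomial_function_eq)
  have "bounded (P' ` {a..b})" by (intro compact_imp_bounded compact_continuous_image cP compact_Icc)
  then obtain M where M: "\<And>x. x \<in> {a..b} \<Longrightarrow> \<bar>P' x\<bar> \<le> M"
    unfolding bounded_iff by (metis image_eqI real_norm_def)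
  define C where "C = \<bar>P a\<bar> + \<bar>P b\<bar> + M * (b - a)"
  have poly: "\<bar>integral {a..b} (\<lambda>x. P x * sin (v * x + t))\<bar> \<le> C / v" if v: "0 < v" for v t
  proof -
    have "norm (integral {a..b} (\<lambda>x. P' x * cos (v * x + t))) \<le> M * (b - a)"
    proof (intro integral_bound continuous_intros cP)
      fix x assume "x \<in> {a..b}"
      then have "\<bar>P' x\<bar> * \<bar>cos (v * x + t)\<bar> \<le> M * 1" using M[of x] by (intro mult_mono) auto
      then show "norm (P' x * cos (v * x + t)) \<le> M" by (simp add: abs_mult)
    qed (use ab in auto)
    moreover have "\<bar>P a * cos (v * a + t)\<bar> \<le> \<bar>P a\<bar>" "\<bar>P b * cos (v * b + t)\<bar> \<le> \<bar>P b\<bar>"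
      by (auto simp: abs_mult intro!: mult_right_le_one_le)
    ultimately have "\<bar>P a * cos (v * a + t) - P b * cos (v * b + t) + integral {a..b} (\<lambda>x. P' x * cos (v * x + t))\<bar> \<le> C"
      unfolding C_def real_norm_def by linarith
    then show ?thesis
      unfolding integral_times_sin[OF less_imp_le[OF ab] P'(2) cP(2) less_imp_neq[OF v, symmetric]] add_divide_distrib[symmetric]
      using v by (simp add: abs_divide divide_right_mono)
  qed
  obtain N where N: "\<And>n. n \<ge> N \<Longrightarrow> 2 * \<bar>C\<bar> / r + 1 \<le> w n"
    using w unfolding filterlim_at_top eventually_sequentially by blast
  have "norm (integral {a..b} (\<lambda>x. q x * sin (w n * x + \<theta> n)) - 0) < r" if n: "n \<ge> N" for n
  proof -
    let ?t = "\<lambda>x. sin (w n * x + \<theta> n)"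
    have w0: "0 < w n" using N[OF n] r by (smt (verit) divide_nonneg_pos zero_le_mult_iff)
    have "C / w n < r / 2"
    proof -
      have "2 * \<bar>C\<bar> / r < w n" using N[OF n] by linarith
      then show ?thesis using r w0 by (simp add: field_simps)
    qed
    then have 1: "\<bar>integral {a..b} (\<lambda>x. P x * ?t x)\<bar> < r / 2" using poly[OF w0, of "\<theta> n"] by linarith
    have i: "(\<lambda>x. q x * ?t x) integrable_on {a..b}" "(\<lambda>x. P x * ?t x) integrable_on {a..b}"
      by (intro integrable_continuous_real continuous_intros c cP)+
    have 2: "integral {a..b} (\<lambda>x. q x * ?t x) - integral {a..b} (\<lambda>x. P x * ?t x) = integral {a..b} (\<lambda>x. (q x - P x) * ?t x)"
      using integral_diff[OF i] by (simp add: left_diff_distrib)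
    have "norm (integral {a..b} (\<lambda>x. (q x - P x) * ?t x)) \<le> e * (b - a)"
    proof (intro integral_bound continuous_intros c cP)
      fix x assume x: "x \<in> {a..b}"
      have "\<bar>q x - P x\<bar> * \<bar>?t x\<bar> \<le> e * 1" using P(2)[OF x] e by (intro mult_mono) auto
      then show "norm ((q x - P x) * ?t x) \<le> e" by (simp add: abs_mult)
    qed (use ab in auto)
    also have "e * (b - a) = r / 2" using ab by (simp add: e_def field_simps)
    finally show ?thesis using 1 2 by simp
  qed
  then show "\<exists>no. \<forall>n\<ge>no. norm (integral {a..b} (\<lambda>x. q x * sin (w n * x + \<theta> n)) - 0) < r" by blast
qed

lemma Dirichlet_kernel:
  fixes z :: real
  shows "(1 + 2 * (\<Sum>k\<in>{1..<Suc n}. cos (real k * z))) * sin (z / 2) = sin ((real n + 1 / 2) * z)"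
proof (induction n)
  case (Suc n)
  let ?m = "real (Suc n) * z"
  have "sin (?m + z / 2) - sin (?m - z / 2) = 2 * cos ?m * sin (z / 2)" by (simp add: sin_add sin_diff)
  moreover have "?m + z / 2 = (real (Suc n) + 1 / 2) * z" "?m - z / 2 = (real n + 1 / 2) * z" by (simp_all add: algebra_simps)
  ultimately show ?case using Suc by (simp add: algebra_simps)
qed simp

definition fourier_cos :: "(real \<Rightarrow> real) \<Rightarrow> nat \<Rightarrow> real" where
  "fourier_cos H k = (if k = 0 then 1 else 2) * integral {-pi..pi} (\<lambda>x. H x * cos (real k * x)) / (2 * pi)"

definition fourier_sin :: "(real \<Rightarrow> real) \<Rightarrow> nat \<Rightarrow> real" where
  "fourier_sin H k = (if k = 0 then 1 else 2) * integral {-pi..pi} (\<lambda>x. H x * sin (real k * x)) / (2 * pi)"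

text \<open>The partial sums are convolutions with the Dirichlet kernel.\<close>

lemma fourier_partial_sum:
  assumes c: "continuous_on {-pi..pi} H"
  shows "(\<Sum>k<Suc n. fourier_cos H k * cos (real k * y) + fourier_sin H k * sin (real k * y))
    = integral {-pi..pi} (\<lambda>x. H x * (1 + 2 * (\<Sum>k\<in>{1..<Suc n}. cos (real k * (x - y))))) / (2 * pi)"
proof -
  have i: "(\<lambda>x. H x * cos (real k * x)) integrable_on {-pi..pi}" "(\<lambda>x. H x * sin (real k * x)) integrable_on {-pi..pi}" for k
    by (intro integrable_continuous_real continuous_intros c)+
  have trm: "fourier_cos H k * cos (real k * y) + fourier_sin H k * sin (real k * y) =
     integral {-pi..pi} (\<lambda>x. H x * ((if k = 0 then 1 else 2) * cos (real k * (x - y)))) / (2 * pi)" for k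
  proof -
    let ?d = "if k = 0 then 1 else (2::real)"
    have "integral {-pi..pi} (\<lambda>x. H x * (?d * cos (real k * (x - y))))
      = integral {-pi..pi} (\<lambda>x. (?d * cos (real k * y)) * (H x * cos (real k * x)) + (?d * sin (real k * y)) * (H x * sin (real k * x)))"
      by (intro integral_cong) (simp add: right_diff_distrib cos_diff algebra_simps)
    also have "\<dots> = (?d * cos (real k * y)) * integral {-pi..pi} (\<lambda>x. H x * cos (real k * x))
       + (?d * sin (real k * y)) * integral {-pi..pi} (\<lambda>x. H x * sin (real k * x))"
      using i i[of 0] by (subst integral_add) (auto simp del: integrable_on_mult_right_iff intro!: integrable_on_mult_right)
    finally show ?thesis unfolding fourier_cos_def fourier_sin_def by (simp add: add_divide_distrib mult_ac)
  qed
  have "(\<Sum>k<Suc n. fourier_cos H k * cos (real k * y) + fourier_sin H k * sin (real k * y))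
    = (\<Sum>k<Suc n. integral {-pi..pi} (\<lambda>x. H x * ((if k = 0 then 1 else 2) * cos (real k * (x - y)))) / (2 * pi))"
    unfolding trm ..
  also have "\<dots> = integral {-pi..pi} (\<lambda>x. \<Sum>k<Suc n. H x * ((if k = 0 then 1 else 2) * cos (real k * (x - y)))) / (2 * pi)"
    unfolding sum_divide_distrib[symmetric]
    by (subst integral_sum) (auto intro!: integrable_continuous_real continuous_intros c)
  also have "(\<lambda>x. \<Sum>k<Suc n. H x * ((if k = 0 then 1 else 2) * cos (real k * (x - y))))
    = (\<lambda>x. H x * (1 + 2 * (\<Sum>k\<in>{1..<Suc n}. cos (real k * (x - y)))))"
  proof
    fix x
    have "(\<Sum>k<Suc n. (if k = 0 then 1 else 2) * cos (real k * (x - y))) = 1 + (\<Sum>k\<in>{1..<Suc n}. 2 * cos (real k * (x - y)))"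
      unfolding lessThan_atLeast0 by (subst sum.atLeast_Suc_lessThan) (auto intro!: sum.cong)
    then show "(\<Sum>k<Suc n. H x * ((if k = 0 then 1 else 2) * cos (real k * (x - y)))) =
      H x * (1 + 2 * (\<Sum>k\<in>{1..<Suc n}. cos (real k * (x - y))))"
      by (simp only: sum_distrib_left[symmetric])
  qed
  finally show ?thesis .
qed

text \<open>The error of a partial sum is the integral of a continuous quotient against a high frequency
  sine.\<close>

lemma fourier_converges:
  assumes c: "continuous_on {-pi..pi} H" and d: "(H has_real_derivative D) (at y)" and y: "\<bar>y\<bar> < pi"
  shows "(\<lambda>K. \<Sum>k<K. fourier_cos H k * cos (real k * y) + fourier_sin H k * sin (real k * y)) \<longlonglongrightarrow> H y"
proof -
  \<comment> \<open>The value at \<open>y\<close> is the limit of the quotient.\<close>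
  define q where "q x = (if x = y then 2 * D else (H x - H y) / sin ((x - y) / 2))" for x
  have sn: "sin ((x - y) / 2) \<noteq> 0" if "x \<in> {-pi..pi}" "x \<noteq> y" for x
  proof
    assume "sin ((x - y) / 2) = 0"
    moreover have "\<bar>(x - y) / 2\<bar> < pi" using that y by auto
    ultimately have "(x - y) / 2 = 0" using sin_eq_0_pi[of "(x - y) / 2"] by auto
    then show False using that by simp
  qed
  have cq: "continuous_on {-pi..pi} q"
    unfolding continuous_on_def
  proof
    fix x assume x: "x \<in> {-pi..pi}"
    show "(q \<longlongrightarrow> q x) (at x within {-pi..pi})"
    proof (cases "x = y")
      case False
      have "((\<lambda>x. (H x - H y) / sin ((x - y) / 2)) \<longlongrightarrow> (H x - H y) / sin ((x - y) / 2)) (at x within {-pi..pi})"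
        using sn[OF x False] c x by (intro tendsto_intros) (auto simp: continuous_on_def)
      moreover have "eventually (\<lambda>z. (H z - H y) / sin ((z - y) / 2) = q z) (at x within {-pi..pi})"
        using eventually_neq_at_within[of y x "{-pi..pi}"] by eventually_elim (auto simp: q_def)
      ultimately have "(q \<longlongrightarrow> (H x - H y) / sin ((x - y) / 2)) (at x within {-pi..pi})"
        by (rule Lim_transform_eventually)
      then show ?thesis using False by (simp add: q_def)
    next
      case True
      have "((\<lambda>z. sin ((z - y) / 2)) has_real_derivative 1/2) (at y)"
        by (auto intro!: derivative_eq_intros)
      then have l1: "((\<lambda>z. sin ((z - y) / 2) / (z - y)) \<longlongrightarrow> 1/2) (at y)"
        by (simp add: has_field_derivative_iff)
      have l2: "((\<lambda>z. (H z - H y) / (z - y)) \<longlongrightarrow> D) (at y)" using d by (simp only: has_field_derivative_iff)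
      have "((\<lambda>z. ((H z - H y) / (z - y)) / (sin ((z - y) / 2) / (z - y))) \<longlongrightarrow> D / (1/2)) (at y)"
        by (rule tendsto_divide[OF l2 l1]) simp
      moreover have "eventually (\<lambda>z. ((H z - H y) / (z - y)) / (sin ((z - y) / 2) / (z - y)) = q z) (at y)"
        unfolding eventually_at_filter by (intro always_eventually) (auto simp: q_def)
      ultimately have "(q \<longlongrightarrow> D / (1/2)) (at y)" by (rule Lim_transform_eventually)
      then have "(q \<longlongrightarrow> D / (1/2)) (at y within {-pi..pi})" by (rule tendsto_within_subset) simp
      moreover have "q x = D / (1/2)" using True by (simp add: q_def)
      ultimately show ?thesis using True by simp
    qed
  qed
  let ?I = "\<lambda>f. integral {-pi..pi} f"
  let ?S = "\<lambda>K. \<Sum>k<K. fourier_cos H k * cos (real k * y) + fourier_sin H k * sin (real k * y)"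
  let ?DK = "\<lambda>n x. 1 + 2 * (\<Sum>k\<in>{1..<Suc n}. cos (real k * (x - y)))"
  have one: "?I (\<lambda>x. H y * ?DK n x) = H y * (2 * pi)" for n
  proof -
    have "?I (\<lambda>x. cos (real k * (x - y))) = 0" if "k \<in> {1..<Suc n}" for k
    proof -
      have "((\<lambda>x. cos (real k * (x - y))) has_integral (sin (real k * (pi - y)) / k - sin (real k * (-pi - y)) / k)) {-pi..pi}"
        using that by (intro fundamental_theorem_of_calculus)
          (auto intro!: derivative_eq_intros simp: has_real_derivative_iff_has_vector_derivative[symmetric])
      moreover have "sin (real k * (pi - y)) = sin (real k * (-pi - y))"
        by (simp add: right_diff_distrib sin_diff)
      ultimately show ?thesis by (simp add: integral_unique)
    qed
    then have z: "?I (\<lambda>x. \<Sum>k\<in>{1..<Suc n}. cos (real k * (x - y))) = 0"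
      by (subst integral_sum) (auto intro!: integrable_continuous_real continuous_intros)
    have "?I (?DK n) = ?I (\<lambda>x. 1) + ?I (\<lambda>x. 2 * (\<Sum>k\<in>{1..<Suc n}. cos (real k * (x - y))))"
      by (intro integral_add integrable_continuous_real continuous_intros)
    also have "\<dots> = 2 * pi" using z by simp
    finally show ?thesis by simp
  qed
  let ?w = "\<lambda>n. real n + 1 / 2"
  have error: "?S (Suc n) = ?I (\<lambda>x. q x * sin (?w n * x + - (?w n * y))) / (2 * pi) + H y" for n
  proof -
    have i: "(\<lambda>x. H x * ?DK n x) integrable_on {-pi..pi}" "(\<lambda>x. H y * ?DK n x) integrable_on {-pi..pi}"
      by (intro integrable_continuous_real continuous_intros c)+
    have "?S (Suc n) - H y = (?I (\<lambda>x. H x * ?DK n x) - ?I (\<lambda>x. H y * ?DK n x)) / (2 * pi)"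
      unfolding fourier_partial_sum[OF c] one by (simp add: diff_divide_distrib)
    also have "?I (\<lambda>x. H x * ?DK n x) - ?I (\<lambda>x. H y * ?DK n x) = ?I (\<lambda>x. (H x - H y) * ?DK n x)"
      unfolding left_diff_distrib by (rule integral_diff[OF i, symmetric])
    also have "\<dots> = ?I (\<lambda>x. q x * sin (?w n * x + - (?w n * y)))"
    proof (intro integral_cong)
      fix x assume x: "x \<in> {-pi..pi}"
      have "(H x - H y) * ?DK n x = q x * (?DK n x * sin ((x - y) / 2))"
        using sn[OF x] by (cases "x = y") (auto simp: q_def)
      also have "\<dots> = q x * sin (?w n * (x - y))" unfolding Dirichlet_kernel ..
      finally show "(H x - H y) * ?DK n x = q x * sin (?w n * x + - (?w n * y))" by (simp add: right_diff_distrib)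
    qed
    finally show ?thesis by simp
  qed
  have "filterlim (\<lambda>n. 1 / 2 + real n) at_top sequentially"
    by (rule filterlim_tendsto_add_at_top[OF tendsto_const filterlim_real_sequentially])
  then have "(\<lambda>n. ?I (\<lambda>x. q x * sin (?w n * x + - (?w n * y)))) \<longlonglongrightarrow> 0"
    by (intro Riemann_Lebesgue[OF cq]) (auto simp: add.commute)
  then have "(\<lambda>n. ?S (Suc n)) \<longlonglongrightarrow> 0 / (2 * pi) + H y" unfolding error by (intro tendsto_intros) auto
  then show ?thesis by (simp add: LIMSEQ_imp_Suc)
qed

text \<open>Each of the integrations by parts gains a factor \<open>1 / k\<close>; there are no boundary terms,
  since \<open>H\<close> and its derivatives vanish at the ends of the interval. The free phase \<open>\<theta>\<close> covers sine
  and cosine at once.\<close>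

lemma fourier_decay:
  fixes H :: "real \<Rightarrow> real"
  assumes "Ck_on m H UNIV" "b < pi" "\<And>x. \<bar>x\<bar> \<ge> b \<Longrightarrow> H x = 0"
  shows "\<exists>C\<ge>0. \<forall>k\<ge>(1::nat). \<forall>\<theta>. \<bar>integral {-pi..pi} (\<lambda>x. H x * sin (real k * x + \<theta>))\<bar> \<le> C / real k ^ m"
  using assms
proof (induction m arbitrary: H b)
  case 0
  have c: "continuous_on S H" for S using 0(1) continuous_on_subset by auto
  have "bounded (H ` {-pi..pi})" by (intro compact_imp_bounded compact_continuous_image c compact_Icc)
  then obtain M where M: "\<And>x. x \<in> {-pi..pi} \<Longrightarrow> \<bar>H x\<bar> \<le> M"
    unfolding bounded_iff by (metis image_eqI real_norm_def)
  have M0: "0 \<le> M" using M[of 0] by force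
  have "norm (integral {-pi..pi} (\<lambda>x. H x * sin (real k * x + \<theta>))) \<le> M * (pi - (-pi))" for k \<theta>
  proof (intro integral_bound continuous_intros c)
    fix x assume x: "x \<in> {-pi..pi}"
    have "\<bar>H x\<bar> * \<bar>sin (real k * x + \<theta>)\<bar> \<le> M * 1" using M[OF x] M0 by (intro mult_mono) auto
    then show "norm (H x * sin (real k * x + \<theta>)) \<le> M" by (simp add: abs_mult)
  qed simp
  then show ?case using M0 by (intro exI[of _ "M * (pi - (-pi))"]) auto
next
  case (Suc m)
  obtain H' where H': "\<And>x. (H has_real_derivative H' x) (at x)" "Ck_on m H' UNIV"
    by (rule Ck_on_realD[OF open_UNIV Suc.prems(1)]) auto
  define b' where "b' = (b + pi) / 2"
  have b': "b < b'" "b' < pi" using Suc.prems(2) by (auto simp: b'_def)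
  have z: "H' x = 0" if "\<bar>x\<bar> \<ge> b'" for x
  proof -
    have "((\<lambda>x. 0) has_real_derivative H' x) (at x)"
    proof (rule has_field_derivative_transform_within_open[OF H'(1)])
      show "open {x::real. b < \<bar>x\<bar>}" by (intro open_Collect_less continuous_intros)
    qed (use that b' Suc.prems(3) in auto)
    then show ?thesis using DERIV_unique[OF _ DERIV_const] by blast
  qed
  obtain C where C: "C \<ge> 0" "\<And>k \<theta>. k \<ge> (1::nat) \<Longrightarrow> \<bar>integral {-pi..pi} (\<lambda>x. H' x * sin (real k * x + \<theta>))\<bar> \<le> C / real k ^ m"
    using Suc.IH[OF H'(2) b'(2) z] by blast
  have end0: "H pi = 0" "H (-pi) = 0" using Suc.prems(2,3) by auto
  have "\<bar>integral {-pi..pi} (\<lambda>x. H x * sin (real k * x + \<theta>))\<bar> \<le> C / real k ^ Suc m" if k: "k \<ge> 1" for k :: nat and \<theta>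
  proof -
    have "cos t = sin (t + pi / 2)" for t :: real by (simp add: sin_add)
    then have "integral {-pi..pi} (\<lambda>x. H x * sin (real k * x + \<theta>)) = integral {-pi..pi} (\<lambda>x. H' x * sin (real k * x + (\<theta> + pi / 2))) / k"
      using integral_times_sin[of "-pi" pi H H' "real k" \<theta>] H'(1) Ck_on_imp_continuous[OF H'(2)] k end0 by (simp add: add.assoc)
    then have "\<bar>integral {-pi..pi} (\<lambda>x. H x * sin (real k * x + \<theta>))\<bar> = \<bar>integral {-pi..pi} (\<lambda>x. H' x * sin (real k * x + (\<theta> + pi / 2)))\<bar> / k"
      by (simp add: abs_divide)
    also have "\<dots> \<le> C / real k ^ m / k" by (intro divide_right_mono C(2)[OF k]) simp
    finally show ?thesis by (simp add: mult.commute)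
  qed
  then show ?case using C(1) by blast
qed

text \<open>With two more derivatives than the polynomial weight requires, the coefficients are
  dominated by \<open>1 / k\<^sup>2\<close>.\<close>

lemma fourier_expansion:
  fixes H :: "real \<Rightarrow> real"
  assumes "smooth_on H UNIV" "b < pi" "\<And>x. \<bar>x\<bar> \<ge> b \<Longrightarrow> H x = 0"
  obtains S a c where "\<And>K. (\<Sum>k<K. (\<bar>a k\<bar> + \<bar>c k\<bar>) * (1 + real k) ^ j) \<le> S"
    "\<And>y. \<bar>y\<bar> < pi \<Longrightarrow> (\<lambda>K. \<Sum>k<K. a k * cos (real k * y) + c k * sin (real k * y)) \<longlonglongrightarrow> H y"
proof
  obtain C where C: "C \<ge> 0" "\<And>k \<theta>. k \<ge> (1::nat) \<Longrightarrow> \<bar>integral {-pi..pi} (\<lambda>x. H x * sin (real k * x + \<theta>))\<bar> \<le> C / real k ^ (j + 2)"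
    using fourier_decay[of "j + 2" H b] assms unfolding smooth_on_def by blast
  have Ck: "Ck_on m H UNIV" for m using assms(1) by (simp add: smooth_on_def)
  have co: "continuous_on A H" for A
    using Ck_on_imp_continuous[OF Ck] continuous_on_subset by blast
  obtain H' where H': "\<And>x. (H has_real_derivative H' x) (at x)"
    by (rule Ck_on_realD[OF open_UNIV Ck[of "Suc 0"]]) auto
  show "(\<lambda>K. \<Sum>k<K. fourier_cos H k * cos (real k * y) + fourier_sin H k * sin (real k * y)) \<longlonglongrightarrow> H y"
    if "\<bar>y\<bar> < pi" for y
    by (rule fourier_converges[OF co H' that])
  let ?t = "\<lambda>k. (\<bar>fourier_cos H k\<bar> + \<bar>fourier_sin H k\<bar>) * (1 + real k) ^ j"
  have bd: "?t (Suc k) \<le> (2 * C * 2 ^ j) * inverse (real (Suc k) ^ 2)" for k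
  proof -
    let ?k = "real (Suc k)"
    have k1: "?k \<ge> 1" by simp
    have "\<bar>fourier_cos H (Suc k)\<bar> \<le> C / ?k ^ (j + 2)" "\<bar>fourier_sin H (Suc k)\<bar> \<le> C / ?k ^ (j + 2)"
    proof -
      have *: "\<bar>2 * I / (2 * pi)\<bar> \<le> R" if "\<bar>I\<bar> \<le> R" for I R :: real
      proof -
        have "\<bar>2 * I / (2 * pi)\<bar> = \<bar>I\<bar> / pi" by (simp add: abs_divide)
        also have "\<dots> \<le> \<bar>I\<bar> / 1" using pi_gt3 by (intro divide_left_mono) auto
        finally show ?thesis using that by simp
      qed
      show "\<bar>fourier_cos H (Suc k)\<bar> \<le> C / ?k ^ (j + 2)" "\<bar>fourier_sin H (Suc k)\<bar> \<le> C / ?k ^ (j + 2)"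
        using *[OF C(2)[of "Suc k" "pi / 2"]] *[OF C(2)[of "Suc k" 0]]
        by (auto simp: fourier_cos_def fourier_sin_def sin_add)
    qed
    then have "?t (Suc k) \<le> (C / ?k ^ (j + 2) + C / ?k ^ (j + 2)) * (2 * ?k) ^ j"
      using C(1) by (intro mult_mono add_mono power_mono) auto
    also have "\<dots> = (2 * C * 2 ^ j) * inverse (?k ^ 2)"
    proof -
      have k0: "?k > 0" by simp
      have "(C / ?k ^ (j + 2) + C / ?k ^ (j + 2)) * (2 * ?k) ^ j = (2 * C * 2 ^ j) * (?k ^ j / (?k ^ j * ?k ^ 2))"
        unfolding power_add power_mult_distrib by (simp add: add_divide_distrib[symmetric])
      also have "?k ^ j / (?k ^ j * ?k ^ 2) = inverse (?k ^ 2)" using k0 by (simp add: divide_simps)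
      finally show ?thesis .
    qed
    finally show ?thesis .
  qed
  have sm: "summable (\<lambda>k. (2 * C * 2 ^ j) * inverse (real (Suc k) ^ 2))"
    using inverse_power_summable[of 2, where 'a=real]
    by (intro summable_mult) (rule summable_Suc_iff[THEN iffD2], simp)
  have "summable ?t"
    unfolding summable_Suc_iff[symmetric, of ?t]
    by (rule summable_comparison_test'[OF sm, of 0]) (use bd in auto)
  then show "(\<Sum>k<K. ?t k) \<le> suminf ?t" for K
    by (intro sum_le_suminf) auto
qed

section \<open>The heat semigroup on weighted spaces\<close>

text \<open>Differentiation under the integral sign: difference quotients are bounded by the mean
  value theorem, so dominated convergence applies.\<close>

lemma (in finite_measure) has_real_derivative_integral:
  fixes \<phi> :: "real \<Rightarrow> 'a \<Rightarrow> real"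
  assumes t: "t \<in> {a<..<b}"
    and int: "\<And>s. integrable M (\<phi> s)" and int': "\<phi>' t \<in> borel_measurable M"
    and d: "\<And>s x. s \<in> {a<..<b} \<Longrightarrow> ((\<lambda>s. \<phi> s x) has_real_derivative \<phi>' s x) (at s)"
    and bd: "\<And>s x. s \<in> {a<..<b} \<Longrightarrow> \<bar>\<phi>' s x\<bar> \<le> B"
  shows "((\<lambda>s. LINT x|M. \<phi> s x) has_real_derivative (LINT x|M. \<phi>' t x)) (at t)"
  unfolding has_field_derivative_iff tendsto_at_iff_sequentially
proof (intro allI impI)
  fix X :: "nat \<Rightarrow> real"
  assume ne: "\<forall>i. X i \<in> UNIV - {t}" and X: "X \<longlonglongrightarrow> t"
  have "eventually (\<lambda>i. X i \<in> {a<..<b}) sequentially" using X t by (intro topological_tendstoD) auto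
  then obtain k where k: "\<And>i. i \<ge> k \<Longrightarrow> X i \<in> {a<..<b}" unfolding eventually_sequentially by blast
  define Y where "Y i = X (i + k)" for i
  have Y: "Y i \<in> {a<..<b}" "Y i \<noteq> t" "Y \<longlonglongrightarrow> t" for i
    using k ne LIMSEQ_ignore_initial_segment[OF X, of k] by (auto simp: Y_def[abs_def])
  have mvt: "\<bar>\<phi> s x - \<phi> t x\<bar> \<le> B * \<bar>s - t\<bar>" if "s \<in> {a<..<b}" for s x
    using field_differentiable_bound[of "{a<..<b}" "\<lambda>s. \<phi> s x" "\<lambda>s. \<phi>' s x" B s t] d bd that t
    by (auto intro: has_field_derivative_at_within)
  have "(\<lambda>i. LINT x|M. (\<phi> (Y i) x - \<phi> t x) / (Y i - t)) \<longlonglongrightarrow> (LINT x|M. \<phi>' t x)"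
  proof (rule integral_dominated_convergence[where w = "\<lambda>_. B"])
    show "AE x in M. (\<lambda>i. (\<phi> (Y i) x - \<phi> t x) / (Y i - t)) \<longlonglongrightarrow> \<phi>' t x"
      using d[OF t] Y unfolding has_field_derivative_iff tendsto_at_iff_sequentially comp_def by auto
    show "AE x in M. norm ((\<phi> (Y i) x - \<phi> t x) / (Y i - t)) \<le> B" for i
      using mvt[OF Y(1)[of i]] Y(2)[of i] by (auto simp: abs_divide pos_divide_le_eq)
  qed (use int int' in auto)
  moreover have "(LINT x|M. (\<phi> (Y i) x - \<phi> t x) / (Y i - t)) = ((LINT x|M. \<phi> (Y i) x) - (LINT x|M. \<phi> t x)) / (Y i - t)" for i
    using int by simp
  ultimately have "(\<lambda>i. ((LINT x|M. \<phi> (X (i + k)) x) - (LINT x|M. \<phi> t x)) / (X (i + k) - t)) \<longlonglongrightarrow> (LINT x|M. \<phi>' t x)"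
    unfolding Y_def by (simp only:)
  then show "((\<lambda>y. ((LINT x|M. \<phi> y x) - (LINT x|M. \<phi> t x)) / (y - t)) \<circ> X) \<longlonglongrightarrow> (LINT x|M. \<phi>' t x)"
    unfolding comp_def by (rule LIMSEQ_offset)
qed

context diffusion
begin

definition nash_inequality :: "nat \<Rightarrow> real \<Rightarrow> bool" where
  "nash_inequality n C \<longleftrightarrow> (\<forall>h \<delta>. h \<in> F \<longrightarrow> 0 < \<delta> \<longrightarrow> \<delta> \<le> 1 \<longrightarrow>
     (LINT x|\<mu>. (h x)\<^sup>2) \<le> C * (\<delta>\<^sup>2 * (LINT x|\<mu>. \<Gamma> h h x) + (LINT x|\<mu>. \<bar>h x\<bar>)\<^sup>2 / \<delta> ^ n))"

text \<open>Kato's inequality \<open>\<bar>f\<bar> L \<bar>f\<bar> \<le> f L f\<close>, with \<open>\<bar>f\<bar>\<close> regularised to \<open>q = sqrt (f\<^sup>2 + d\<^sup>2)\<close>.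
  It holds because \<open>q\<^sup>2\<close> and \<open>f\<^sup>2\<close> differ by a constant while \<open>\<Gamma> q q \<le> \<Gamma> f f\<close>.\<close>

lemma carre_sqrt_le:
  assumes f: "f \<in> F" and d: "d > 0"
  defines "q \<equiv> \<lambda>x. sqrt ((f x)\<^sup>2 + d\<^sup>2)"
  shows "q x * L q x \<le> f x * L f x + d\<^sup>2 * L (\<lambda>_. 1) x"
proof -
  have q: "q \<in> F" unfolding q_def by (rule F_sqrt[OF f d])
  have qq: "(\<lambda>y. q y * q y) = (\<lambda>y. f y * f y + d\<^sup>2 * 1)" by (simp add: q_def power2_eq_square fun_eq_iff)
  have qpos: "q y > 0" for y using d by (simp add: q_def add_nonneg_pos)
  have Lqq: "L (\<lambda>y. q y * q y) x = L (\<lambda>y. f y * f y) x + d\<^sup>2 * L (\<lambda>_. 1) x"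
    unfolding qq using L_add[OF F_mult[OF f f] F_cmult[OF F_const[of 1]], of "d\<^sup>2"] L_cmult[OF F_const[of 1], of "d\<^sup>2"] by simp
  have der: "q x * \<Gamma> q h x = f x * \<Gamma> f h x" if h: "h \<in> F" for h
  proof -
    have "2 * (q x * \<Gamma> q h x) = \<Gamma> (\<lambda>y. q y * q y) h x" using carre_derivation[OF q q h, of x] by simp
    also have "\<dots> = \<Gamma> (\<lambda>y. f y * f y) h x"
      unfolding qq using carre_add_right[OF F_mult[OF f f] F_const[of "d\<^sup>2 * 1"] h, of x] carre_const[OF h, of "d\<^sup>2 * 1" x]
      by (simp add: carre_sym[of _ h])
    also have "\<dots> = 2 * (f x * \<Gamma> f h x)" using carre_derivation[OF f f h, of x] by simp
    finally show ?thesis by simp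
  qed
  have "(q x * q x) * \<Gamma> q q x = (f x * f x) * \<Gamma> f f x"
  proof -
    have "(q x * q x) * \<Gamma> q q x = q x * (f x * \<Gamma> f q x)" using der[OF q] by (simp add: mult.assoc)
    also have "\<dots> = f x * (q x * \<Gamma> q f x)" using carre_sym[of f q x] by simp
    finally show ?thesis using der[OF f] by simp
  qed
  also have "\<dots> \<le> (q x * q x) * \<Gamma> f f x"
    using carre_nonneg[OF f, of x] by (intro mult_right_mono) (auto simp: q_def power2_eq_square)
  finally have "\<Gamma> q q x \<le> \<Gamma> f f x" using qpos[of x] by simp
  moreover have "q x * q x = f x * f x + d\<^sup>2" using fun_cong[OF qq, of x] by simp
  ultimately show ?thesis
    using Lqq L_mult[of q q x] L_mult[of f f x] by (simp add: algebra_simps)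
qed

end

context spectral_diffusion
begin

text \<open>The heat semigroup at time \<open>\<tau>\<^sup>2\<close>: with this parameter \<open>\<tau>\<close> has the dimension of a length,
  like \<open>\<epsilon>\<close>.\<close>

definition heat :: "nat \<Rightarrow> (nat \<Rightarrow> real) \<Rightarrow> real \<Rightarrow> 'a \<Rightarrow> real" where
  "heat N c \<tau> = comb N (\<lambda>l. exp (- (\<tau>\<^sup>2 * \<nu> l)) * c l)"

lemma heat_F: "heat N c \<tau> \<in> F"
  by (simp add: heat_def comb_F)

lemma heat_0: "heat N c 0 = comb N c"
  by (simp add: heat_def)

lemma comb_deriv:
  assumes "\<And>l. ((\<lambda>s. a s l) has_real_derivative a' l) (at t)"
  shows "((\<lambda>s. comb N (a s) x) has_real_derivative comb N a' x) (at t)"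
  unfolding comb_def by (intro DERIV_sum DERIV_cmult_right assms)

lemma heat_deriv: "((\<lambda>\<tau>. heat N c \<tau> x) has_real_derivative (- 2 * \<tau> * L (heat N c \<tau>) x)) (at \<tau>)"
proof -
  have "((\<lambda>\<tau>. heat N c \<tau> x) has_real_derivative comb N (\<lambda>l. - 2 * \<tau> * (\<nu> l * (exp (- (\<tau>\<^sup>2 * \<nu> l)) * c l))) x) (at \<tau>)"
    unfolding heat_def by (rule comb_deriv) (auto intro!: derivative_eq_intros)
  then show ?thesis by (simp add: heat_def L_comb comb_cmult)
qed

lemma heat_bounded:
  obtains U where "0 \<le> U" "\<And>\<tau> x. \<bar>heat N c \<tau> x\<bar> \<le> U" "\<And>\<tau> x. \<bar>L (heat N c \<tau>) x\<bar> \<le> U"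
proof -
  have "\<exists>B\<ge>0. \<forall>x. \<bar>u l x\<bar> \<le> B" for l
    using continuous_bounded[OF F_continuous[OF u_F[of l]]] by metis
  then obtain M where M: "\<And>l. 0 \<le> M l" "\<And>l x. \<bar>u l x\<bar> \<le> M l" by metis
  have e: "exp (- (\<tau>\<^sup>2 * \<nu> l)) \<le> 1" for \<tau> l using \<nu>_nonneg by simp
  have 1: "\<bar>heat N c \<tau> x\<bar> \<le> (\<Sum>l<N. \<bar>c l\<bar> * M l)" for \<tau> x
    unfolding heat_def comb_def
    by (rule order_trans[OF sum_abs sum_mono]) (auto simp: abs_mult intro!: mult_mono mult_left_le_one_le e M)
  have 2: "\<bar>L (heat N c \<tau>) x\<bar> \<le> (\<Sum>l<N. (\<nu> l * \<bar>c l\<bar>) * M l)" for \<tau> x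
    unfolding heat_def L_comb unfolding comb_def
    by (rule order_trans[OF sum_abs sum_mono]) (auto simp: abs_mult \<nu>_nonneg intro!: mult_mono mult_left_le_one_le e M)
  have "0 \<le> (\<Sum>l<N. \<bar>c l\<bar> * M l)" "0 \<le> (\<Sum>l<N. (\<nu> l * \<bar>c l\<bar>) * M l)"
    using M \<nu>_nonneg by (auto intro!: sum_nonneg)
  then show thesis
    by (intro that[of "(\<Sum>l<N. \<bar>c l\<bar> * M l) + (\<Sum>l<N. (\<nu> l * \<bar>c l\<bar>) * M l)"]
      add_nonneg_nonneg add_increasing2[OF _ 1] add_increasing[OF _ 2])
qed

text \<open>Kato's inequality lets \<open>L\<close> be moved from \<open>\<bar>heat\<bar>\<close> to the weight, which bounds the
  derivative of the weighted \<open>L\<^sub>1\<close> norm by a multiple of \<open>\<tau> / \<epsilon>\<^sup>2\<close> times the norm.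
  Integrating this up to \<open>\<tau> = \<epsilon>\<close> costs a constant factor. The regularisation \<open>d\<close> tends
  to \<open>0\<close> at the end.\<close>

lemma heat_weighted_L1:
  assumes w: "weight B \<epsilon> \<rho>" and \<tau>: "0 \<le> \<tau>" "\<tau> \<le> \<epsilon>"
  shows "(LINT x|\<mu>. \<rho> x ^ n * \<bar>heat N c \<tau> x\<bar>) \<le> exp (B * (real n + 1)\<^sup>2) * (LINT x|\<mu>. \<rho> x ^ n * \<bar>comb N c x\<bar>)"
proof -
  note W = weightD[OF w]
  define K where "K = B * (real n + 1)\<^sup>2"
  have K: "0 \<le> K" using W(4) by (simp add: K_def)
  define m where "m = (LINT x|\<mu>. \<rho> x ^ n)"
  have m: "0 \<le> m" unfolding m_def using W(6) by (intro Bochner_Integration.integral_nonneg) (simp add: less_imp_le)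
  have Wn: "(\<lambda>x. \<rho> x ^ n) \<in> F" using W by (intro F_power)
  have c: "cont \<rho>" "cont (heat N c s)" "cont (L (heat N c s))"
    "cont (L (\<lambda>y. \<rho> y ^ n))" "cont (L (\<lambda>_. 1))" "cont (comb N c)" for s
    using W heat_F comb_F Wn by (auto intro: cont_intros)
  have main: "(LINT x|\<mu>. \<rho> x ^ n * \<bar>heat N c \<tau> x\<bar>) \<le> exp K * ((LINT x|\<mu>. \<rho> x ^ n * \<bar>comb N c x\<bar>) + d * (m + B * m))" if d: "d > 0" for d
  proof -
    define q where "q s x = sqrt ((heat N c s x)\<^sup>2 + d\<^sup>2)" for s x
    define \<Phi> where "\<Phi> s = (LINT x|\<mu>. \<rho> x ^ n * q s x)" for s
    have q: "q s \<in> F" for s unfolding q_def by (rule F_sqrt[OF heat_F d])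
    have cq: "cont (q s)" "cont (L (q s))" for s using q by (auto intro: cont_intros)
    have qd: "d \<le> q s x" "\<bar>heat N c s x\<bar> \<le> q s x" for s x
      unfolding q_def using d by (auto intro!: real_le_rsqrt)
    have qpos: "0 < q s x" for s x using qd(1)[of s x] d by linarith
    obtain U where U: "0 \<le> U" "\<And>\<tau> x. \<bar>heat N c \<tau> x\<bar> \<le> U" "\<And>\<tau> x. \<bar>L (heat N c \<tau>) x\<bar> \<le> U"
      using heat_bounded by metis
    obtain R where R: "0 \<le> R" "\<And>x. \<bar>\<rho> x ^ n\<bar> \<le> R"
      using continuous_bounded[OF F_continuous[OF Wn]] by metis
    let ?\<phi>' = "\<lambda>s x. \<rho> x ^ n * (heat N c s x / q s x * (- 2 * s * L (heat N c s) x))"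
    have d\<Phi>: "(\<Phi> has_real_derivative (LINT x|\<mu>. ?\<phi>' s x)) (at s)" for s
      unfolding \<Phi>_def
    proof (rule has_real_derivative_integral[of s "s - 1" "s + 1"])
      fix r x assume r: "r \<in> {s - 1<..<s + 1}"
      have "((\<lambda>s. sqrt ((heat N c s x)\<^sup>2 + d\<^sup>2)) has_real_derivative
         (2 * heat N c r x * (- 2 * r * L (heat N c r) x) * (inverse (q r x) / 2))) (at r)"
        using qpos[of r x] unfolding q_def
        by (auto intro!: derivative_eq_intros heat_deriv simp: field_simps)
      then have "((\<lambda>s. q s x) has_real_derivative (heat N c r x / q r x * (- 2 * r * L (heat N c r) x))) (at r)"
        unfolding q_def[abs_def] by (simp add: field_simps)
      then show "((\<lambda>s. \<rho> x ^ n * q s x) has_real_derivative ?\<phi>' r x) (at r)"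
        by (rule DERIV_cmult)
      have 1: "\<bar>heat N c r x / q r x\<bar> \<le> 1" using qd[where s=r and x=x] qpos[of r x] by (simp add: abs_divide)
      have r1: "\<bar>r\<bar> \<le> \<bar>s\<bar> + 1" using r by auto
      have "\<bar>?\<phi>' r x\<bar> = \<bar>\<rho> x ^ n\<bar> * (\<bar>heat N c r x / q r x\<bar> * (2 * \<bar>r\<bar> * \<bar>L (heat N c r) x\<bar>))"
        by (simp add: abs_mult)
      also have "\<dots> \<le> R * (1 * (2 * (\<bar>s\<bar> + 1) * U))"
        by (intro mult_mono R U 1 r1 mult_nonneg_nonneg) auto
      finally show "\<bar>?\<phi>' r x\<bar> \<le> R * (1 * (2 * (\<bar>s\<bar> + 1) * U))" .
    qed (use qpos in \<open>auto intro!: integrable_continuous borel_measurable_continuous continuous_intros c cq simp: less_imp_neq[symmetric]\<close>)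
    have d\<Phi>_le: "(LINT x|\<mu>. ?\<phi>' s x) \<le> 2 * s * (K / \<epsilon>\<^sup>2 * \<Phi> s + d * B * m)" if s: "0 \<le> s" for s
    proof -
      have pt: "\<rho> x ^ n * (L (q s) x - d * B) \<le> \<rho> x ^ n * (heat N c s x / q s x * L (heat N c s) x)" for x
      proof (rule mult_left_mono)
        have "q s x * L (q s) x \<le> heat N c s x * L (heat N c s) x + d\<^sup>2 * L (\<lambda>_. 1) x"
          unfolding q_def[abs_def] by (rule carre_sqrt_le[OF heat_F d])
        also have "d\<^sup>2 * L (\<lambda>_. 1) x \<le> (q s x * d) * B"
        proof -
          have "d\<^sup>2 * L (\<lambda>_. 1) x \<le> d\<^sup>2 * B" using W(9)[of x] by (intro mult_left_mono) auto
          also have "\<dots> \<le> (q s x * d) * B" unfolding power2_eq_square using qd(1) d W(4) by (intro mult_right_mono) auto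
          finally show ?thesis .
        qed
        finally show "L (q s) x - d * B \<le> heat N c s x / q s x * L (heat N c s) x"
          using qpos[of s x] by (simp add: field_simps)
      qed (use W(6)[of x] in simp)
      have "(LINT x|\<mu>. \<rho> x ^ n * L (q s) x) - d * B * m = (LINT x|\<mu>. \<rho> x ^ n * (L (q s) x - d * B))"
        unfolding m_def using c cq by (simp add: integrable_continuous continuous_intros right_diff_distrib mult.commute)
      also have "\<dots> \<le> (LINT x|\<mu>. \<rho> x ^ n * (heat N c s x / q s x * L (heat N c s) x))" (is "_ \<le> ?J")
        using qpos by (intro integral_mono pt integrable_continuous continuous_intros c cq) (auto simp: less_imp_neq[symmetric])
      finally have 1: "(LINT x|\<mu>. \<rho> x ^ n * L (q s) x) - d * B * m \<le> ?J" .
      have "(LINT x|\<mu>. \<rho> x ^ n * L (q s) x) = (LINT x|\<mu>. q s x * L (\<lambda>y. \<rho> y ^ n) x)" by (rule L_sym[OF Wn q])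
      also have "\<dots> \<ge> (LINT x|\<mu>. - (K / \<epsilon>\<^sup>2 * (\<rho> x ^ n * q s x)))"
      proof (intro integral_mono integrable_continuous continuous_intros c cq)
        fix x
        have "\<bar>L (\<lambda>y. \<rho> y ^ n) x\<bar> \<le> K / \<epsilon>\<^sup>2 * \<rho> x ^ n"
          using weight_power_L[OF w, of n x] W(2) by (simp add: K_def field_simps)
        then have "- (K / \<epsilon>\<^sup>2 * \<rho> x ^ n) \<le> L (\<lambda>y. \<rho> y ^ n) x" by linarith
        then have "q s x * - (K / \<epsilon>\<^sup>2 * \<rho> x ^ n) \<le> q s x * L (\<lambda>y. \<rho> y ^ n) x"
          using qpos[of s x] by (intro mult_left_mono) auto
        then show "- (K / \<epsilon>\<^sup>2 * (\<rho> x ^ n * q s x)) \<le> q s x * L (\<lambda>y. \<rho> y ^ n) x" by (simp add: mult_ac)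
      qed
      finally have 2: "- (K / \<epsilon>\<^sup>2 * \<Phi> s) \<le> (LINT x|\<mu>. \<rho> x ^ n * L (q s) x)" by (simp add: \<Phi>_def)
      have "(LINT x|\<mu>. ?\<phi>' s x) = (LINT x|\<mu>. (- 2 * s) * (\<rho> x ^ n * (heat N c s x / q s x * L (heat N c s) x)))"
        by (intro Bochner_Integration.integral_cong) (auto simp: mult_ac)
      also have "\<dots> = - 2 * s * ?J" by (rule integral_mult_right_zero)
      also have "\<dots> \<le> 2 * s * (K / \<epsilon>\<^sup>2 * \<Phi> s + d * B * m)"
      proof -
        have "2 * s * (- ?J) \<le> 2 * s * (K / \<epsilon>\<^sup>2 * \<Phi> s + d * B * m)"
          using 1 2 s by (intro mult_left_mono) auto
        then show ?thesis by simp
      qed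
      finally show ?thesis .
    qed
    \<comment> \<open>Gronwall's lemma: the integrating factor makes this function decrease.\<close>
    define \<Psi> where "\<Psi> s = exp (- (K / \<epsilon>\<^sup>2 * s\<^sup>2)) * \<Phi> s - d * B * m * s\<^sup>2" for s
    have "\<Psi> \<tau> \<le> \<Psi> 0"
    proof (rule DERIV_nonpos_imp_nonincreasing[OF \<tau>(1)])
      fix s assume s: "0 \<le> s" "s \<le> \<tau>"
      let ?e = "exp (- (K / \<epsilon>\<^sup>2 * s\<^sup>2))" and ?D = "LINT x|\<mu>. ?\<phi>' s x"
      have d1: "(\<Psi> has_real_derivative ?e * (?D - 2 * s * (K / \<epsilon>\<^sup>2 * \<Phi> s)) - 2 * s * (d * B * m)) (at s)"
        unfolding \<Psi>_def using W(2) by (auto intro!: derivative_eq_intros d\<Phi> simp: algebra_simps power2_eq_square)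
      moreover have "?e * (?D - 2 * s * (K / \<epsilon>\<^sup>2 * \<Phi> s)) \<le> ?e * (2 * s * (d * B * m))"
        using d\<Phi>_le[OF s(1)] by (intro mult_left_mono) (auto simp: algebra_simps)
      moreover have "?e * (2 * s * (d * B * m)) \<le> 1 * (2 * s * (d * B * m))"
        using K s d W(4) m by (intro mult_right_mono) auto
      ultimately have "?e * (?D - 2 * s * (K / \<epsilon>\<^sup>2 * \<Phi> s)) - 2 * s * (d * B * m) \<le> 0" by linarith
      with d1 show "\<exists>y. (\<Psi> has_real_derivative y) (at s) \<and> y \<le> 0" by blast
    qed
    then have "exp (- (K / \<epsilon>\<^sup>2 * \<tau>\<^sup>2)) * \<Phi> \<tau> \<le> \<Phi> 0 + d * B * m * \<tau>\<^sup>2" by (simp add: \<Psi>_def)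
    also have "\<dots> \<le> \<Phi> 0 + d * B * m * 1"
      using \<tau> W d m by (intro add_left_mono mult_left_mono) (auto simp: power_le_one)
    finally have 3: "exp (- (K / \<epsilon>\<^sup>2 * \<tau>\<^sup>2)) * \<Phi> \<tau> \<le> \<Phi> 0 + d * B * m" by simp
    have \<Phi>0: "0 \<le> \<Phi> s" for s
      unfolding \<Phi>_def using W(6) qpos by (intro Bochner_Integration.integral_nonneg) (simp add: less_imp_le)
    have "exp (- K) * \<Phi> \<tau> \<le> exp (- (K / \<epsilon>\<^sup>2 * \<tau>\<^sup>2)) * \<Phi> \<tau>"
    proof (intro mult_right_mono \<Phi>0)
      have "\<tau>\<^sup>2 / \<epsilon>\<^sup>2 \<le> 1" using \<tau> W(2) by (simp add: power_mono)
      then have "K * (\<tau>\<^sup>2 / \<epsilon>\<^sup>2) \<le> K * 1" using K by (rule mult_left_mono)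
      then show "exp (- K) \<le> exp (- (K / \<epsilon>\<^sup>2 * \<tau>\<^sup>2))" by simp
    qed
    with 3 have "exp (- K) * \<Phi> \<tau> \<le> \<Phi> 0 + d * B * m" by linarith
    then have 4: "\<Phi> \<tau> \<le> exp K * (\<Phi> 0 + d * B * m)" by (simp add: exp_minus field_simps)
    have "\<Phi> 0 \<le> (LINT x|\<mu>. \<rho> x ^ n * \<bar>comb N c x\<bar> + d * \<rho> x ^ n)"
      unfolding \<Phi>_def
    proof (intro integral_mono integrable_continuous continuous_intros c cq)
      fix x
      have "q 0 x \<le> \<bar>comb N c x\<bar> + d"
        unfolding q_def heat_0 using d by (intro real_le_lsqrt) (auto simp: power2_eq_square algebra_simps)
      then have "\<rho> x ^ n * q 0 x \<le> \<rho> x ^ n * (\<bar>comb N c x\<bar> + d)" using W(6)[of x] by (intro mult_left_mono) auto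
      then show "\<rho> x ^ n * q 0 x \<le> \<rho> x ^ n * \<bar>comb N c x\<bar> + d * \<rho> x ^ n" by (simp add: algebra_simps)
    qed
    also have "\<dots> = (LINT x|\<mu>. \<rho> x ^ n * \<bar>comb N c x\<bar>) + d * m"
      unfolding m_def using c by (simp add: integrable_continuous continuous_intros)
    finally have 5: "\<Phi> 0 \<le> (LINT x|\<mu>. \<rho> x ^ n * \<bar>comb N c x\<bar>) + d * m" .
    have "(LINT x|\<mu>. \<rho> x ^ n * \<bar>heat N c \<tau> x\<bar>) \<le> \<Phi> \<tau>"
      unfolding \<Phi>_def using qd(2) W(6) by (intro integral_mono integrable_continuous continuous_intros c cq mult_left_mono) (auto simp: less_imp_le)
    also note 4
    also have "exp K * (\<Phi> 0 + d * B * m) \<le> exp K * ((LINT x|\<mu>. \<rho> x ^ n * \<bar>comb N c x\<bar>) + d * (m + B * m))"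
      using 5 by (intro mult_left_mono) (auto simp: algebra_simps)
    finally show ?thesis .
  qed
  have lim: "((\<lambda>d. exp K * ((LINT x|\<mu>. \<rho> x ^ n * \<bar>comb N c x\<bar>) + d * (m + B * m))) \<longlongrightarrow>
    exp K * ((LINT x|\<mu>. \<rho> x ^ n * \<bar>comb N c x\<bar>) + 0 * (m + B * m))) (at_right 0)"
    by (intro tendsto_intros)
  have "(LINT x|\<mu>. \<rho> x ^ n * \<bar>heat N c \<tau> x\<bar>) \<le> exp K * ((LINT x|\<mu>. \<rho> x ^ n * \<bar>comb N c x\<bar>) + 0 * (m + B * m))"
    by (rule tendsto_lowerbound[OF lim]) (auto simp: eventually_at_filter intro!: always_eventually main)
  then show ?thesis by (simp add: K_def)
qed

text \<open>The energy of the heat flow with weight \<open>\<rho> ^ (2 n)\<close> dominates, up to lower order terms,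
  the energy of \<open>\<rho> ^ n\<close> times the flow, the function to which Nash's inequality will be
  applied.\<close>

lemma heat_weighted_L2_deriv:
  fixes c :: "nat \<Rightarrow> real" and N n :: nat
  assumes w: "weight B \<epsilon> \<rho>" and \<tau>: "0 \<le> \<tau>"
  defines "z \<equiv> \<lambda>\<tau>. LINT x|\<mu>. \<rho> x ^ (2 * n) * (heat N c \<tau> x)\<^sup>2"
    and "h \<equiv> \<lambda>x. \<rho> x ^ n * heat N c \<tau> x"
  shows "\<exists>D. (z has_real_derivative D) (at \<tau>) \<and>
    D \<le> - 2 * \<tau> * (LINT x|\<mu>. \<Gamma> h h x) + 4 * \<tau> * (B * (real n)\<^sup>2 + B * (1 + (2 * real n + 1)\<^sup>2) / 2) / \<epsilon>\<^sup>2 * z \<tau>"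
proof -
  note W = weightD[OF w]
  let ?f = "heat N c \<tau>"
  have f: "?f \<in> F" by (rule heat_F)
  have Wn: "(\<lambda>x. \<rho> x ^ n) \<in> F" "(\<lambda>x. \<rho> x ^ (2 * n)) \<in> F" using W by (auto intro: F_power)
  have h: "h \<in> F" unfolding h_def by (rule F_mult[OF Wn(1) f])
  have c: "cont \<rho>" "cont (heat N c s)" "cont (L (heat N c s))"
    "cont (\<Gamma> h h)" "cont (\<Gamma> (heat N c s) (heat N c s))"
    "cont (\<Gamma> (\<lambda>y. \<rho> y ^ n) (\<lambda>y. \<rho> y ^ n))" for s
    using W(1) heat_F f h Wn by (auto intro: cont_intros)
  obtain U where U: "0 \<le> U" "\<And>\<tau> x. \<bar>heat N c \<tau> x\<bar> \<le> U" "\<And>\<tau> x. \<bar>L (heat N c \<tau>) x\<bar> \<le> U"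
    using heat_bounded by metis
  obtain R where R: "0 \<le> R" "\<And>x. \<bar>\<rho> x ^ (2 * n)\<bar> \<le> R"
    using continuous_bounded[OF F_continuous[OF Wn(2)]] by metis
  let ?\<phi>' = "\<lambda>s x. \<rho> x ^ (2 * n) * (2 * heat N c s x * (- 2 * s * L (heat N c s) x))"
  have d: "(z has_real_derivative (LINT x|\<mu>. ?\<phi>' \<tau> x)) (at \<tau>)"
    unfolding z_def
  proof (rule has_real_derivative_integral[of \<tau> "\<tau> - 1" "\<tau> + 1"])
    fix r x assume r: "r \<in> {\<tau> - 1<..<\<tau> + 1}"
    have "((\<lambda>s. (heat N c s x)\<^sup>2) has_real_derivative (2 * heat N c r x * (- 2 * r * L (heat N c r) x))) (at r)"
      using DERIV_power[OF heat_deriv, where n=2] by (simp add: mult_ac)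
    then show "((\<lambda>s. \<rho> x ^ (2 * n) * (heat N c s x)\<^sup>2) has_real_derivative ?\<phi>' r x) (at r)"
      by (rule DERIV_cmult)
    have r1: "\<bar>r\<bar> \<le> \<bar>\<tau>\<bar> + 1" using r by auto
    have "\<bar>?\<phi>' r x\<bar> = \<bar>\<rho> x ^ (2 * n)\<bar> * ((2 * \<bar>heat N c r x\<bar>) * (2 * \<bar>r\<bar> * \<bar>L (heat N c r) x\<bar>))"
      by (simp add: abs_mult)
    also have "\<dots> \<le> R * ((2 * U) * (2 * (\<bar>\<tau>\<bar> + 1) * U))"
      by (intro mult_mono R U r1 mult_nonneg_nonneg) auto
    finally show "\<bar>?\<phi>' r x\<bar> \<le> R * ((2 * U) * (2 * (\<bar>\<tau>\<bar> + 1) * U))" .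
  qed (auto intro!: integrable_continuous borel_measurable_continuous continuous_intros c)
  define J where "J = (LINT x|\<mu>. \<rho> x ^ (2 * n) * ?f x * L ?f x)"
  have D: "(LINT x|\<mu>. ?\<phi>' \<tau> x) = - 4 * \<tau> * J"
    unfolding J_def integral_mult_right_zero[symmetric] by (intro Bochner_Integration.integral_cong) auto
  define K1 where "K1 = B * (real n)\<^sup>2"
  define K2 where "K2 = B * (1 + (2 * real n + 1)\<^sup>2)"
  have \<epsilon>2: "\<epsilon>\<^sup>2 > 0" using W(2) by simp
  have pw: "\<rho> x ^ (2 * n) = \<rho> x ^ n * \<rho> x ^ n" for x by (simp add: mult_2 power_add)
  have gW: "\<Gamma> (\<lambda>y. \<rho> y ^ n) (\<lambda>y. \<rho> y ^ n) x \<le> K1 / \<epsilon>\<^sup>2 * \<rho> x ^ (2 * n)" for x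
  proof (cases n)
    case 0
    then show ?thesis using carre_const[OF F_const, of 1 1 x] by (simp add: K1_def)
  next
    case (Suc k)
    have "\<Gamma> (\<lambda>y. \<rho> y ^ n) (\<lambda>y. \<rho> y ^ n) x = (real n * \<rho> x ^ k) * (real n * \<rho> x ^ k) * \<Gamma> \<rho> \<rho> x"
      unfolding Suc carre_power[OF W(1) F_power[OF W(1)]] carre_sym[of \<rho> "\<lambda>y. \<rho> y ^ Suc k"] carre_power[OF W(1,1)] by simp
    also have "\<dots> \<le> (real n * \<rho> x ^ k) * (real n * \<rho> x ^ k) * (B * \<rho> x / \<epsilon>\<^sup>2)"
      using W(8)[of x] \<epsilon>2 by (intro mult_left_mono) (auto simp: field_simps)
    also have "\<dots> = (B * (real n)\<^sup>2 / \<epsilon>\<^sup>2) * (\<rho> x ^ k * \<rho> x ^ k * \<rho> x)" by (simp add: power2_eq_square)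
    also have "\<dots> \<le> (B * (real n)\<^sup>2 / \<epsilon>\<^sup>2) * (\<rho> x ^ k * \<rho> x ^ k * \<rho> x * \<rho> x)"
      using W(4) W(5)[of x] by (intro mult_left_mono) auto
    also have "\<rho> x ^ k * \<rho> x ^ k * \<rho> x * \<rho> x = \<rho> x ^ (2 * n)" unfolding pw Suc by (simp add: mult_ac power_mult power2_eq_square)
    finally show ?thesis unfolding K1_def .
  qed
  have 1: "(LINT x|\<mu>. \<Gamma> h h x) \<le> 2 * (LINT x|\<mu>. \<rho> x ^ (2 * n) * \<Gamma> ?f ?f x) + 2 * (K1 / \<epsilon>\<^sup>2) * z \<tau>"
  proof -
    have "\<Gamma> h h x \<le> 2 * (\<rho> x ^ (2 * n) * \<Gamma> ?f ?f x) + 2 * (K1 / \<epsilon>\<^sup>2) * (\<rho> x ^ (2 * n) * (?f x)\<^sup>2)" for x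
    proof -
      let ?W = "\<lambda>y. \<rho> y ^ n"
      let ?a = "sqrt (\<Gamma> ?f ?f x)" and ?b = "sqrt (\<Gamma> ?W ?W x)"
      have ab: "?a\<^sup>2 = \<Gamma> ?f ?f x" "?b\<^sup>2 = \<Gamma> ?W ?W x" using carre_nonneg[OF f] carre_nonneg[OF Wn(1)] by auto
      have e1: "\<Gamma> h k x = \<rho> x ^ n * \<Gamma> ?f k x + ?f x * \<Gamma> ?W k x" if "k \<in> F" for k
        unfolding h_def by (rule carre_derivation[OF Wn(1) f that])
      have s1: "\<Gamma> h h x = (\<rho> x ^ n)\<^sup>2 * \<Gamma> ?f ?f x + 2 * (\<rho> x ^ n * ?f x * \<Gamma> ?f ?W x) + (?f x)\<^sup>2 * \<Gamma> ?W ?W x"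
        unfolding e1[OF h] carre_sym[of ?f h] carre_sym[of ?W h] e1[OF f] e1[OF Wn(1)] carre_sym[of ?W ?f]
        by (simp add: power2_eq_square algebra_simps)
      have s2: "\<rho> x ^ n * ?f x * \<Gamma> ?f ?W x \<le> (\<rho> x ^ n * ?a) * (\<bar>?f x\<bar> * ?b)"
      proof -
        have "\<rho> x ^ n * (?f x * \<Gamma> ?f ?W x) \<le> \<rho> x ^ n * (\<bar>?f x\<bar> * (?a * ?b))"
        proof (rule mult_left_mono)
          have "?f x * \<Gamma> ?f ?W x \<le> \<bar>?f x\<bar> * \<bar>\<Gamma> ?f ?W x\<bar>" by (metis abs_ge_self abs_mult)
          also have "\<dots> \<le> \<bar>?f x\<bar> * (?a * ?b)" by (intro mult_left_mono carre_Cauchy_Schwarz f Wn) auto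
          finally show "?f x * \<Gamma> ?f ?W x \<le> \<bar>?f x\<bar> * (?a * ?b)" .
        qed (use W(6)[of x] in simp)
        then show ?thesis by (simp add: mult_ac)
      qed
      have s3: "2 * ((\<rho> x ^ n * ?a) * (\<bar>?f x\<bar> * ?b)) \<le> (\<rho> x ^ n * ?a)\<^sup>2 + (\<bar>?f x\<bar> * ?b)\<^sup>2"
        using sum_squares_bound[of "\<rho> x ^ n * ?a" "\<bar>?f x\<bar> * ?b"] by simp
      have "\<Gamma> h h x \<le> 2 * ((\<rho> x ^ n)\<^sup>2 * \<Gamma> ?f ?f x) + 2 * ((?f x)\<^sup>2 * \<Gamma> ?W ?W x)"
        using s1 s2 s3 unfolding power_mult_distrib ab power2_abs by linarith
      moreover have "(?f x)\<^sup>2 * \<Gamma> ?W ?W x \<le> (?f x)\<^sup>2 * (K1 / \<epsilon>\<^sup>2 * \<rho> x ^ (2 * n))"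
        by (intro mult_left_mono gW) auto
      ultimately have "\<Gamma> h h x \<le> 2 * ((\<rho> x ^ n)\<^sup>2 * \<Gamma> ?f ?f x) + 2 * ((?f x)\<^sup>2 * (K1 / \<epsilon>\<^sup>2 * \<rho> x ^ (2 * n)))" by linarith
      then show ?thesis unfolding pw by (simp only: power2_eq_square mult_ac)
    qed
    then have "(LINT x|\<mu>. \<Gamma> h h x) \<le> (LINT x|\<mu>. 2 * (\<rho> x ^ (2 * n) * \<Gamma> ?f ?f x) + 2 * (K1 / \<epsilon>\<^sup>2) * (\<rho> x ^ (2 * n) * (?f x)\<^sup>2))"
      by (intro integral_mono integrable_continuous continuous_intros c)
    also have "\<dots> = 2 * (LINT x|\<mu>. \<rho> x ^ (2 * n) * \<Gamma> ?f ?f x) + 2 * (K1 / \<epsilon>\<^sup>2) * z \<tau>"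
    proof -
      have "integrable \<mu> (\<lambda>x. 2 * (\<rho> x ^ (2 * n) * \<Gamma> ?f ?f x))" "integrable \<mu> (\<lambda>x. 2 * (K1 / \<epsilon>\<^sup>2) * (\<rho> x ^ (2 * n) * (?f x)\<^sup>2))"
        by (intro integrable_continuous continuous_intros c)+
      then show ?thesis unfolding z_def by (simp only: Bochner_Integration.integral_add integral_mult_right_zero)
    qed
    finally show ?thesis .
  qed
  have 2: "(LINT x|\<mu>. \<rho> x ^ (2 * n) * \<Gamma> ?f ?f x) \<le> J + K2 / 2 / \<epsilon>\<^sup>2 * z \<tau>"
  proof -
    have "\<epsilon>\<^sup>2 * (LINT x|\<mu>. \<rho> x ^ (2 * n) * \<Gamma> ?f ?f x) \<le> (LINT x|\<mu>. \<rho> x ^ (2 * n) * (\<epsilon>\<^sup>2 * (?f x * L ?f x) + K2 / 2 * (?f x)\<^sup>2))"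
      using weighted_energy[OF w f, of "2 * n"] by (simp add: K2_def)
    also have "\<dots> = (LINT x|\<mu>. \<epsilon>\<^sup>2 * (\<rho> x ^ (2 * n) * ?f x * L ?f x) + K2 / 2 * (\<rho> x ^ (2 * n) * (?f x)\<^sup>2))"
      by (intro Bochner_Integration.integral_cong) (auto simp: algebra_simps)
    also have "\<dots> = \<epsilon>\<^sup>2 * J + K2 / 2 * z \<tau>"
      unfolding J_def z_def using c by (simp add: integrable_continuous continuous_intros)
    finally show ?thesis using \<epsilon>2 by (simp add: field_simps)
  qed
  have "2 * (- J) \<le> - (LINT x|\<mu>. \<Gamma> h h x) + 2 * ((K1 + K2 / 2) / \<epsilon>\<^sup>2) * z \<tau>"
    using 1 2 by (simp add: add_divide_distrib algebra_simps)
  then have "(2 * \<tau>) * (2 * (- J)) \<le> (2 * \<tau>) * (- (LINT x|\<mu>. \<Gamma> h h x) + 2 * ((K1 + K2 / 2) / \<epsilon>\<^sup>2) * z \<tau>)"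
    using \<tau> by (intro mult_left_mono) auto
  moreover define X where "X = (K1 + K2 / 2) / \<epsilon>\<^sup>2"
  ultimately have "- 4 * \<tau> * J \<le> - 2 * \<tau> * (LINT x|\<mu>. \<Gamma> h h x) + 4 * \<tau> * X * z \<tau>"
    by (simp add: algebra_simps)
  then have "- 4 * \<tau> * J \<le> - 2 * \<tau> * (LINT x|\<mu>. \<Gamma> h h x) + 4 * \<tau> * (K1 + K2 / 2) / \<epsilon>\<^sup>2 * z \<tau>"
    by (simp add: X_def)
  with d show ?thesis unfolding D K1_def K2_def by blast
qed

text \<open>Nash's argument. The inequality with \<open>\<delta> = \<kappa> \<tau>\<close>, together with the bound of the weighted
  \<open>L\<^sub>1\<close> norm by \<open>b\<close>, turns the energy estimate into the differential inequality
  \<open>\<tau> z' \<le> - 2 n z + C b\<^sup>2 / \<tau> ^ n\<close> for the weighted square norm \<open>z\<close>. So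
  \<open>\<tau> ^ (2 n) z - C b\<^sup>2 \<tau> ^ n / n\<close> decreases, and it vanishes for \<open>\<tau> = 0\<close>.\<close>

lemma heat_weighted_L2:
  assumes n: "n \<ge> (1::nat)" and CN: "0 < CN"
    and nash: "nash_inequality n CN"
    and B: "0 \<le> B"
  shows "\<exists>C\<ge>0. \<forall>\<epsilon> \<rho> N c. weight B \<epsilon> \<rho> \<longrightarrow>
    (LINT x|\<mu>. \<rho> x ^ (2 * n) * (heat N c \<epsilon> x)\<^sup>2) \<le> C / \<epsilon> ^ n * (LINT x|\<mu>. \<rho> x ^ n * \<bar>comb N c x\<bar>)\<^sup>2"
proof -
  define K where "K = 4 * (B * (real n)\<^sup>2 + B * (1 + (2 * real n + 1)\<^sup>2) / 2)"
  have K: "0 \<le> K" using B by (simp add: K_def)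
  define A where "A = CN * (K + 2 * real n) + 2"
  have A: "A \<ge> 2" using CN K by (simp add: A_def)
  \<comment> \<open>This size of \<open>\<kappa>\<close> lets Nash's inequality absorb the lower order terms and still leave \<open>- 2 n z\<close>.\<close>
  define \<kappa> where "\<kappa> = sqrt (2 / A)"
  have \<kappa>: "0 < \<kappa>" "\<kappa> \<le> 1" "\<kappa>\<^sup>2 = 2 / A" using A by (auto simp: \<kappa>_def)
  have \<kappa>2: "2 / (CN * \<kappa>\<^sup>2) \<ge> K + 2 * real n" unfolding \<kappa>(3) using A CN by (simp add: A_def field_simps)
  define E where "E = exp (B * (real n + 1)\<^sup>2)"
  define C where "C = 2 / \<kappa> ^ (n + 2) / real n * E\<^sup>2"
  have "(LINT x|\<mu>. \<rho> x ^ (2 * n) * (heat N c \<epsilon> x)\<^sup>2) \<le> C / \<epsilon> ^ n * (LINT x|\<mu>. \<rho> x ^ n * \<bar>comb N c x\<bar>)\<^sup>2"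
    if w: "weight B \<epsilon> \<rho>" for \<epsilon> \<rho> N c
  proof -
    note W = weightD[OF w]
    define b where "b = E * (LINT x|\<mu>. \<rho> x ^ n * \<bar>comb N c x\<bar>)"
    define z where "z \<tau> = (LINT x|\<mu>. \<rho> x ^ (2 * n) * (heat N c \<tau> x)\<^sup>2)" for \<tau>
    define h where "h \<tau> x = \<rho> x ^ n * heat N c \<tau> x" for \<tau> x
    define D where "D \<tau> = (SOME D. (z has_real_derivative D) (at \<tau>) \<and>
      D \<le> - 2 * \<tau> * (LINT x|\<mu>. \<Gamma> (h \<tau>) (h \<tau>) x) + 4 * \<tau> * (B * (real n)\<^sup>2 + B * (1 + (2 * real n + 1)\<^sup>2) / 2) / \<epsilon>\<^sup>2 * z \<tau>)" for \<tau>
    have D: "(z has_real_derivative D \<tau>) (at \<tau>)"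
      "D \<tau> \<le> - 2 * \<tau> * (LINT x|\<mu>. \<Gamma> (h \<tau>) (h \<tau>) x) + \<tau> * K / \<epsilon>\<^sup>2 * z \<tau>" if "0 \<le> \<tau>" for \<tau>
      using someI_ex[OF heat_weighted_L2_deriv[OF w that, of n N c], folded z_def h_def, folded D_def]
      by (auto simp: K_def mult_ac)
    have z0: "0 \<le> z \<tau>" for \<tau>
      unfolding z_def using W(6) by (intro Bochner_Integration.integral_nonneg) (simp add: less_imp_le)
    have hF: "h \<tau> \<in> F" for \<tau> unfolding h_def[abs_def] using W by (intro F_mult F_power heat_F)
    have hz: "(LINT x|\<mu>. (h \<tau> x)\<^sup>2) = z \<tau>" for \<tau>
      unfolding h_def z_def by (simp add: power_mult_distrib power_mult[symmetric] mult.commute)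
    have hb: "(LINT x|\<mu>. \<bar>h \<tau> x\<bar>)\<^sup>2 \<le> b\<^sup>2" if "0 \<le> \<tau>" "\<tau> \<le> \<epsilon>" for \<tau>
    proof (rule power_mono)
      have "(LINT x|\<mu>. \<bar>h \<tau> x\<bar>) = (LINT x|\<mu>. \<rho> x ^ n * \<bar>heat N c \<tau> x\<bar>)"
        unfolding h_def using W(6) by (intro Bochner_Integration.integral_cong) (auto simp: abs_mult less_imp_le)
      then show "(LINT x|\<mu>. \<bar>h \<tau> x\<bar>) \<le> b" unfolding b_def E_def using heat_weighted_L1[OF w that] by simp
    qed simp
    have Dbd: "\<tau> * D \<tau> \<le> - (2 * real n) * z \<tau> + 2 * b\<^sup>2 / (\<kappa> ^ (n + 2) * \<tau> ^ n)" if \<tau>: "0 < \<tau>" "\<tau> \<le> \<epsilon>" for \<tau>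
    proof -
      let ?G = "LINT x|\<mu>. \<Gamma> (h \<tau>) (h \<tau>) x"
      have \<delta>: "0 < \<kappa> * \<tau>" "\<kappa> * \<tau> \<le> 1" using \<kappa> \<tau> W by (auto intro: mult_le_one)
      have "z \<tau> \<le> CN * ((\<kappa> * \<tau>)\<^sup>2 * ?G + (LINT x|\<mu>. \<bar>h \<tau> x\<bar>)\<^sup>2 / (\<kappa> * \<tau>) ^ n)"
        using nash[unfolded nash_inequality_def, rule_format, OF hF \<delta>] unfolding hz .
      also have "\<dots> \<le> CN * ((\<kappa> * \<tau>)\<^sup>2 * ?G + b\<^sup>2 / (\<kappa> * \<tau>) ^ n)"
        using CN hb \<tau> \<delta> by (intro mult_left_mono add_left_mono divide_right_mono) auto
      finally have "z \<tau> * (2 / (CN * \<kappa>\<^sup>2)) \<le> CN * ((\<kappa> * \<tau>)\<^sup>2 * ?G + b\<^sup>2 / (\<kappa> * \<tau>) ^ n) * (2 / (CN * \<kappa>\<^sup>2))"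
        using CN \<kappa>(1) by (intro mult_right_mono) auto
      also have "\<dots> = 2 * \<tau>\<^sup>2 * ?G + 2 * b\<^sup>2 / (\<kappa> ^ (n + 2) * \<tau> ^ n)"
        using CN \<kappa>(1) \<tau> by (simp add: field_simps power_add power_mult_distrib power2_eq_square)
      finally have 1: "z \<tau> * (2 / (CN * \<kappa>\<^sup>2)) \<le> 2 * \<tau>\<^sup>2 * ?G + 2 * b\<^sup>2 / (\<kappa> ^ (n + 2) * \<tau> ^ n)" .
      have 2: "z \<tau> * (K + 2 * real n) \<le> z \<tau> * (2 / (CN * \<kappa>\<^sup>2))" by (intro mult_left_mono \<kappa>2 z0)
      have "\<tau> * D \<tau> \<le> \<tau> * (- 2 * \<tau> * ?G + \<tau> * K / \<epsilon>\<^sup>2 * z \<tau>)" using D(2) \<tau> by (intro mult_left_mono) auto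
      also have "\<dots> = - (2 * \<tau>\<^sup>2 * ?G) + (\<tau>\<^sup>2 / \<epsilon>\<^sup>2) * (K * z \<tau>)" by (simp add: power2_eq_square algebra_simps)
      also have "(\<tau>\<^sup>2 / \<epsilon>\<^sup>2) * (K * z \<tau>) \<le> 1 * (K * z \<tau>)"
        using \<tau> W(2) K z0 by (intro mult_right_mono) (auto simp: power_mono)
      finally have "\<tau> * D \<tau> \<le> - (2 * \<tau>\<^sup>2 * ?G) + K * z \<tau>" by simp
      also have "\<dots> \<le> - (2 * real n) * z \<tau> + 2 * b\<^sup>2 / (\<kappa> ^ (n + 2) * \<tau> ^ n)" using 1 2 by (simp add: algebra_simps)
      finally show ?thesis .
    qed
    define c1 where "c1 = 2 * b\<^sup>2 / \<kappa> ^ (n + 2)"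
    \<comment> \<open>Only the singularity at \<open>\<tau> = 0\<close> requires care; the power \<open>\<tau> ^ (2 n)\<close> removes it.\<close>
    define \<Psi> where "\<Psi> \<tau> = \<tau> ^ (2 * n) * z \<tau> - c1 / n * \<tau> ^ n" for \<tau>
    have "\<Psi> \<epsilon> \<le> \<Psi> 0"
    proof (rule DERIV_nonpos_imp_decreasing_open[where f = \<Psi> and a = 0 and b = \<epsilon>])
      have "isCont z \<tau>" if "0 \<le> \<tau>" for \<tau> using D(1)[OF that] by (rule DERIV_isCont)
      then have "continuous_on {0..\<epsilon>} z" by (intro continuous_at_imp_continuous_on) auto
      then show "continuous_on {0..\<epsilon>} \<Psi>" unfolding \<Psi>_def by (intro continuous_intros)
      fix \<tau> assume \<tau>: "0 < \<tau>" "\<tau> < \<epsilon>"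
      have "(\<Psi> has_real_derivative (2 * n * \<tau> ^ (2 * n - 1) * z \<tau> + \<tau> ^ (2 * n) * D \<tau> - c1 / n * (n * \<tau> ^ (n - 1)))) (at \<tau>)"
        unfolding \<Psi>_def using \<tau> by (auto intro!: derivative_eq_intros D(1))
      moreover have "2 * n * \<tau> ^ (2 * n - 1) * z \<tau> + \<tau> ^ (2 * n) * D \<tau> - c1 / n * (n * \<tau> ^ (n - 1)) \<le> 0"
      proof -
        obtain k where k: "n = Suc k" using n by (cases n) auto
        have p: "\<tau> ^ (2 * n - 1) = \<tau> ^ k * \<tau> ^ n" "\<tau> ^ (2 * n) = \<tau> ^ k * \<tau> ^ n * \<tau>" "\<tau> ^ (n - 1) = \<tau> ^ k"
          by (simp_all add: k mult_2 power_add)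
        have "2 * n * \<tau> ^ (2 * n - 1) * z \<tau> + \<tau> ^ (2 * n) * D \<tau> - c1 / n * (n * \<tau> ^ (n - 1))
          = \<tau> ^ k * \<tau> ^ n * (2 * real n * z \<tau> + \<tau> * D \<tau>) - c1 * \<tau> ^ k"
          unfolding p using n by (simp add: algebra_simps)
        also have "\<tau> ^ k * \<tau> ^ n * (2 * real n * z \<tau> + \<tau> * D \<tau>) \<le> \<tau> ^ k * \<tau> ^ n * (2 * b\<^sup>2 / (\<kappa> ^ (n + 2) * \<tau> ^ n))"
          using Dbd[of \<tau>] \<tau> by (intro mult_left_mono) auto
        also have "\<dots> = c1 * \<tau> ^ k" using \<tau> \<kappa>(1) by (simp add: c1_def field_simps)
        finally show ?thesis by simp
      qed
      ultimately show "\<exists>y. (\<Psi> has_real_derivative y) (at \<tau>) \<and> y \<le> 0" by blast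
    qed (use W in auto)
    then have "\<epsilon> ^ n * \<epsilon> ^ n * z \<epsilon> \<le> c1 / n * \<epsilon> ^ n" using n by (simp add: \<Psi>_def mult_2 power_add power_0_left)
    then have "\<epsilon> ^ n * (\<epsilon> ^ n * z \<epsilon>) \<le> \<epsilon> ^ n * (c1 / n)" by (simp only: mult_ac)
    then have "\<epsilon> ^ n * z \<epsilon> \<le> c1 / n" using W(2) by (simp only: mult_le_cancel_left_pos[OF zero_less_power[OF W(2)]])
    then have "z \<epsilon> \<le> c1 / n / \<epsilon> ^ n" unfolding pos_le_divide_eq[OF zero_less_power[OF W(2)]] by (simp only: mult.commute)
    also have "\<dots> = C / \<epsilon> ^ n * (LINT x|\<mu>. \<rho> x ^ n * \<bar>comb N c x\<bar>)\<^sup>2"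
      by (simp add: c1_def C_def b_def power_mult_distrib)
    finally show ?thesis by (simp add: z_def)
  qed
  moreover have "0 \<le> C" using \<kappa>(1) by (simp add: C_def)
  ultimately show ?thesis by blast
qed

end

text \<open>The function \<open>H \<beta> = \<phi> (tan (\<beta> / 2)) exp (tan (\<beta> / 2))\<close> vanishes near \<open>\<plusminus> \<pi>\<close>, as \<open>\<phi>\<close> has
  compact support.\<close>

lemma smooth_cayley:
  fixes \<phi> :: "real \<Rightarrow> real"
  assumes "smooth_on \<phi> UNIV" "0 < R" "\<And>s. \<bar>s\<bar> \<ge> R \<Longrightarrow> \<phi> s = 0"
  shows "\<exists>H b. smooth_on H UNIV \<and> b < pi \<and> (\<forall>x. \<bar>x\<bar> \<ge> b \<longrightarrow> H x = (0::real)) \<and> (\<forall>s. H (2 * arctan s) = \<phi> s * exp s)"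
proof (intro exI conjI allI impI)
  define b where "b = 2 * arctan R"
  define H where "H x = (if \<bar>x\<bar> < b then \<phi> (tan (x / 2)) * exp (tan (x / 2)) else 0)" for x
  have b: "0 < b" "b < pi" using assms(2) arctan_ubound[of R] by (auto simp: b_def)
  show "b < pi" by fact
  show "H x = 0" if "\<bar>x\<bar> \<ge> b" for x using that by (simp add: H_def)
  have Hs: "H (2 * arctan s) = \<phi> s * exp s" for s
  proof (cases "\<bar>s\<bar> < R")
    case True
    then have "\<bar>2 * arctan s\<bar> < b" unfolding b_def by (metis abs_arctan abs_mult abs_numeral arctan_less_iff mult_less_cancel_left_pos zero_less_numeral)
    then show ?thesis by (simp add: H_def tan_arctan)
  next
    case False
    then have "\<not> \<bar>2 * arctan s\<bar> < b" unfolding b_def by (metis abs_arctan abs_mult abs_numeral arctan_less_iff mult_less_cancel_left_pos zero_less_numeral)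
    then show ?thesis using False assms(3)[of s] by (simp add: H_def)
  qed
  then show "H (2 * arctan s) = \<phi> s * exp s" for s .
  have cospos: "cos (x / 2) > 0" if "x \<in> {-pi<..<pi}" for x :: real
    using that by (intro cos_gt_zero_pi) auto
  let ?S = "{-pi<..<pi}"
  have half: "smooth_on (\<lambda>x. x / 2) ?S" for S :: "real set"
    using smooth_on_bounded_linear[OF _ bounded_linear_divide smooth_on_id, of ?S 2] by simp
  have "smooth_on (\<lambda>x. sin (x / 2) * inverse (cos (x / 2))) ?S"
    using cospos by (intro smooth_on_mult smooth_on_compose[OF _ _ _ smooth_on_sin half]
      smooth_on_compose[OF _ _ _ smooth_on_inverse] smooth_on_compose[OF _ _ _ smooth_on_cos half]) auto
  then have t: "smooth_on (\<lambda>x. tan (x / 2)) ?S"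
    by (rule smooth_on_cong[rotated]) (auto simp: tan_def field_simps)
  have "smooth_on (\<lambda>x. \<phi> (tan (x / 2)) * exp (tan (x / 2))) ?S"
    by (intro smooth_on_mult smooth_on_compose[OF _ _ _ assms(1) t] smooth_on_compose[OF _ _ _ smooth_on_exp t]) auto
  then have 1: "smooth_on H ?S"
  proof (rule smooth_on_cong[rotated])
    fix x assume x: "x \<in> ?S"
    have "x = 2 * arctan (tan (x / 2))" using x by (subst arctan_tan) auto
    then show "\<phi> (tan (x / 2)) * exp (tan (x / 2)) = H x" using Hs[of "tan (x / 2)"] by simp
  qed simp
  have o: "open {x::real. b < \<bar>x\<bar>}" by (intro open_Collect_less continuous_intros)
  have 2: "smooth_on H {x. b < \<bar>x\<bar>}"
    by (rule smooth_on_cong[OF o smooth_on_const[of 0]]) (auto simp: H_def)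
  have "?S \<union> {x. b < \<bar>x\<bar>} = UNIV" using b by auto
  then show "smooth_on H UNIV" using smooth_on_Un[OF _ o 1 2] by simp
qed

context spectral_diffusion
begin

text \<open>Factor the multiplier as \<open>H (2 arctan (\<epsilon>\<^sup>2 L))\<close> after \<open>exp (- \<epsilon>\<^sup>2 L)\<close>: the heat factor
  maps weighted \<open>L\<^sub>1\<close> to weighted \<open>L\<^sub>2\<close>, the other one is bounded there, and the
  Cauchy-Schwarz inequality leads to unweighted \<open>L\<^sub>1\<close>. The powers of \<open>\<epsilon>\<close> from the heat
  factor and from the volume of the weight cancel.\<close>

lemma multiplier_L1:
  assumes n: "n \<ge> (1::nat)" and CN: "0 < CN"
    and nash: "nash_inequality n CN"
    and B: "0 \<le> B" and CV: "0 \<le> CV"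
    and \<phi>: "smooth_on \<phi> UNIV" "0 < R" "\<And>s. \<bar>s\<bar> \<ge> R \<Longrightarrow> \<phi> s = (0::real)"
  shows "\<exists>C\<ge>0. \<forall>\<epsilon> \<rho> N c. weight B \<epsilon> \<rho> \<longrightarrow> (LINT x|\<mu>. 1 / \<rho> x ^ (2 * n)) \<le> CV * \<epsilon> ^ n \<longrightarrow>
    (LINT x|\<mu>. \<bar>comb N (\<lambda>l. \<phi> (\<epsilon>\<^sup>2 * \<nu> l) * c l) x\<bar>) \<le> C * (LINT x|\<mu>. \<rho> x ^ n * \<bar>comb N c x\<bar>)"
proof -
  obtain H b where H: "smooth_on H UNIV" "b < pi" "\<And>x. \<bar>x\<bar> \<ge> b \<Longrightarrow> H x = (0::real)" "\<And>s. H (2 * arctan s) = \<phi> s * exp s"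
    using smooth_cayley[OF \<phi>] by blast
  obtain S a d where S: "\<And>K. (\<Sum>k<K. (\<bar>a k\<bar> + \<bar>d k\<bar>) * (1 + real k) ^ (2 * n)) \<le> S"
    and lim: "\<And>y. \<bar>y\<bar> < pi \<Longrightarrow> (\<lambda>K. \<Sum>k<K. a k * cos (real k * y) + d k * sin (real k * y)) \<longlonglongrightarrow> H y"
    by (rule fourier_expansion[OF H(1-3), where j = "2 * n"]) auto
  have S0: "0 \<le> S" using S[of 0] by simp
  obtain CH where CH: "0 \<le> CH" "\<And>\<epsilon> \<rho> N c. weight B \<epsilon> \<rho> \<Longrightarrow>
    (LINT x|\<mu>. \<rho> x ^ (2 * n) * (heat N c \<epsilon> x)\<^sup>2) \<le> CH / \<epsilon> ^ n * (LINT x|\<mu>. \<rho> x ^ n * \<bar>comb N c x\<bar>)\<^sup>2"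
    using heat_weighted_L2[OF n CN nash B] by blast
  define C where "C = sqrt CV * (S * cn_const B (2 * n) * sqrt CH)"
  have cn0: "0 \<le> cn_const B (2 * n)" using cn_const_ge[OF B, of "2 * n"] by simp
  have C0: "0 \<le> C" using CV S0 CH(1) cn0 by (simp add: C_def)
  have "(LINT x|\<mu>. \<bar>comb N (\<lambda>l. \<phi> (\<epsilon>\<^sup>2 * \<nu> l) * c l) x\<bar>) \<le> C * (LINT x|\<mu>. \<rho> x ^ n * \<bar>comb N c x\<bar>)"
    if w: "weight B \<epsilon> \<rho>" and vol: "(LINT x|\<mu>. 1 / \<rho> x ^ (2 * n)) \<le> CV * \<epsilon> ^ n" for \<epsilon> \<rho> N c
  proof -
    note W = weightD[OF w]
    let ?g = "comb N (\<lambda>l. \<phi> (\<epsilon>\<^sup>2 * \<nu> l) * c l)"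
    let ?I = "LINT x|\<mu>. \<rho> x ^ n * \<bar>comb N c x\<bar>"
    have I0: "0 \<le> ?I" using W(6) by (intro Bochner_Integration.integral_nonneg) (simp add: less_imp_le)
    have cc: "cont \<rho>" "cont ?g"
      using W comb_F by (auto intro: cont_intros)
    have geq: "?g = comb N (\<lambda>l. H (angle \<epsilon> l) * (exp (- (\<epsilon>\<^sup>2 * \<nu> l)) * c l))"
      unfolding comb_def[abs_def] angle_def H(4) by (intro ext sum.cong) (auto simp: exp_minus)
    have ang: "\<bar>angle \<epsilon> l\<bar> < pi" for l
      using arctan_bounded[of "\<epsilon>\<^sup>2 * \<nu> l"] by (auto simp: angle_def abs_less_iff)
    have "wL2 \<rho> (2 * n) ?g \<le> S * cn_const B (2 * n) * wL2 \<rho> (2 * n) (comb N (\<lambda>l. exp (- (\<epsilon>\<^sup>2 * \<nu> l)) * c l))"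
      unfolding geq by (rule multiplier_wL2[OF w S lim[OF ang]])
    also have "wL2 \<rho> (2 * n) (comb N (\<lambda>l. exp (- (\<epsilon>\<^sup>2 * \<nu> l)) * c l)) \<le> sqrt (CH / \<epsilon> ^ n * ?I\<^sup>2)"
      unfolding wL2_def using CH(2)[OF w, of N c] unfolding heat_def by simp
    also have "sqrt (CH / \<epsilon> ^ n * ?I\<^sup>2) = sqrt CH / sqrt (\<epsilon> ^ n) * ?I"
      using I0 by (simp add: real_sqrt_mult real_sqrt_divide)
    finally have 1: "wL2 \<rho> (2 * n) ?g \<le> S * cn_const B (2 * n) * (sqrt CH / sqrt (\<epsilon> ^ n) * ?I)"
      using S0 cn0 by (simp add: mult_left_mono)
    have sq: "sqrt (\<rho> x ^ (2 * n)) = \<rho> x ^ n" for x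
      using W(6)[of x] by (simp add: power_mult power_commutes mult.commute[of 2] real_sqrt_power[symmetric] power_even_eq)
    have pw: "\<rho> x ^ (2 * n) = (\<rho> x ^ n)\<^sup>2" for x by (simp add: power_even_eq)
    have rne: "\<rho> x \<noteq> 0" for x using W(6)[of x] by simp
    have "(LINT x|\<mu>. \<bar>?g x\<bar>) = (LINT x|\<mu>. (1 / \<rho> x ^ n) * (\<rho> x ^ n * \<bar>?g x\<bar>))"
      using rne by (intro Bochner_Integration.integral_cong) auto
    also have "\<dots> \<le> sqrt (LINT x|\<mu>. (1 / \<rho> x ^ n)\<^sup>2) * sqrt (LINT x|\<mu>. (\<rho> x ^ n * \<bar>?g x\<bar>)\<^sup>2)"
      using rne by (intro order_trans[OF abs_ge_self integral_Cauchy_Schwarz] integrable_continuous continuous_intros cc) auto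
    also have "\<dots> = sqrt (LINT x|\<mu>. 1 / \<rho> x ^ (2 * n)) * wL2 \<rho> (2 * n) ?g"
      unfolding wL2_def pw by (simp add: power_mult_distrib power_divide)
    also have "\<dots> \<le> sqrt (CV * \<epsilon> ^ n) * (S * cn_const B (2 * n) * (sqrt CH / sqrt (\<epsilon> ^ n) * ?I))"
      using vol CV W(2) by (intro mult_mono 1 real_sqrt_le_mono wL2_nonneg[OF w]) auto
    also have "\<dots> = C * ?I" using W(2) by (simp add: C_def real_sqrt_mult)
    finally show ?thesis .
  qed
  then show ?thesis using C0 by blast
qed

end

section \<open>Integral kernels of spectral multipliers\<close>

text \<open>What the convergence proof needs to know about the manifold and the operator: a Nash
  inequality in dimension \<open>n\<close>, weights centred at each point with the volume growth of
  dimension \<open>n\<close>, completeness of the eigenfunctions in \<open>L\<^sub>2\<close>, and the compatibility of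
  measure and topology.\<close>

locale nash_diffusion = spectral_diffusion +
  fixes n :: nat and CN CV B :: real and wt :: "real \<Rightarrow> 'a \<Rightarrow> 'a \<Rightarrow> real"
  assumes n: "n \<ge> 1" and CN: "0 < CN" and B: "0 \<le> B" and CV: "0 \<le> CV"
    and nash: "nash_inequality n CN"
    and wt: "0 < \<epsilon> \<Longrightarrow> \<epsilon> \<le> 1 \<Longrightarrow> weight B \<epsilon> (wt \<epsilon> x)"
    and wt_self: "wt \<epsilon> x x = 1"
    and wt_volume: "0 < \<epsilon> \<Longrightarrow> \<epsilon> \<le> 1 \<Longrightarrow> (LINT y|\<mu>. 1 / wt \<epsilon> x y ^ (2 * n)) \<le> CV * \<epsilon> ^ n"
    and complete: "f \<in> borel_measurable \<mu> \<Longrightarrow> integrable \<mu> (\<lambda>x. (f x)\<^sup>2) \<Longrightarrow>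
      (\<lambda>N. LINT x|\<mu>. (f x - comb N (\<lambda>l. LINT y|\<mu>. f y * u l y) x)\<^sup>2) \<longlonglongrightarrow> 0"
    and \<nu>_unbounded: "filterlim \<nu> at_top sequentially"
    and open_pos: "open U \<Longrightarrow> U \<noteq> {} \<Longrightarrow> 0 < measure \<mu> U"
    and F_dense: "cont f \<Longrightarrow> 0 < e \<Longrightarrow> \<exists>h\<in>F. \<forall>x. \<bar>f x - h x\<bar> < e"
begin

definition coef :: "('a \<Rightarrow> real) \<Rightarrow> nat \<Rightarrow> real" where
  "coef f l = (LINT y|\<mu>. f y * u l y)"

definition cut_index :: "(real \<Rightarrow> real) \<Rightarrow> real \<Rightarrow> nat" where
  "cut_index \<phi> \<epsilon> = (LEAST N. \<forall>l\<ge>N. \<phi> (\<epsilon>\<^sup>2 * \<nu> l) = 0)"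

definition mult_kernel :: "(real \<Rightarrow> real) \<Rightarrow> real \<Rightarrow> 'a \<Rightarrow> 'a \<Rightarrow> real" where
  "mult_kernel \<phi> \<epsilon> x y = comb (cut_index \<phi> \<epsilon>) (\<lambda>l. \<phi> (\<epsilon>\<^sup>2 * \<nu> l) * u l x) y"

definition multop :: "(real \<Rightarrow> real) \<Rightarrow> real \<Rightarrow> ('a \<Rightarrow> real) \<Rightarrow> 'a \<Rightarrow> real" where
  "multop \<phi> \<epsilon> f = comb (cut_index \<phi> \<epsilon>) (\<lambda>l. \<phi> (\<epsilon>\<^sup>2 * \<nu> l) * coef f l)"

definition bump_symbol :: "(real \<Rightarrow> real) \<Rightarrow> bool" where
  "bump_symbol \<phi> \<longleftrightarrow> smooth_on \<phi> UNIV \<and> (\<exists>R>0. \<forall>s. \<bar>s\<bar> \<ge> R \<longrightarrow> \<phi> s = 0)"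

lemma cut_index:
  assumes "bump_symbol \<phi>" "0 < \<epsilon>" "cut_index \<phi> \<epsilon> \<le> l"
  shows "\<phi> (\<epsilon>\<^sup>2 * \<nu> l) = 0"
proof -
  obtain R where R: "R > 0" "\<And>s. \<bar>s\<bar> \<ge> R \<Longrightarrow> \<phi> s = 0" using assms(1) by (auto simp: bump_symbol_def)
  obtain N where N: "\<And>l. l \<ge> N \<Longrightarrow> R / \<epsilon>\<^sup>2 \<le> \<nu> l"
    using \<nu>_unbounded unfolding filterlim_at_top eventually_sequentially by blast
  have "\<forall>l\<ge>N. \<phi> (\<epsilon>\<^sup>2 * \<nu> l) = 0"
  proof (intro allI impI R(2))
    fix l assume "N \<le> l"
    then have "R \<le> \<epsilon>\<^sup>2 * \<nu> l" using N[of l] assms(2) by (simp add: field_simps)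
    then show "R \<le> \<bar>\<epsilon>\<^sup>2 * \<nu> l\<bar>" by linarith
  qed
  then have "\<forall>l\<ge>cut_index \<phi> \<epsilon>. \<phi> (\<epsilon>\<^sup>2 * \<nu> l) = 0" unfolding cut_index_def by (rule LeastI)
  then show ?thesis using assms(3) by blast
qed

lemma comb_cut:
  assumes "bump_symbol \<phi>" "0 < \<epsilon>" "cut_index \<phi> \<epsilon> \<le> N"
  shows "comb N (\<lambda>l. \<phi> (\<epsilon>\<^sup>2 * \<nu> l) * c l) = comb (cut_index \<phi> \<epsilon>) (\<lambda>l. \<phi> (\<epsilon>\<^sup>2 * \<nu> l) * c l)"
proof
  fix x
  have "{..<N} = {..<cut_index \<phi> \<epsilon>} \<union> {cut_index \<phi> \<epsilon>..<N}" using assms(3) by auto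
  then show "comb N (\<lambda>l. \<phi> (\<epsilon>\<^sup>2 * \<nu> l) * c l) x = comb (cut_index \<phi> \<epsilon>) (\<lambda>l. \<phi> (\<epsilon>\<^sup>2 * \<nu> l) * c l) x"
    unfolding comb_def using assms by (intro sum.mono_neutral_right) (auto simp: cut_index)
qed

lemma u_continuous: "cont (u l)"
  by (rule F_continuous[OF u_F])

lemma comb_continuous: "cont (comb N c)"
  by (rule F_continuous[OF comb_F])

text \<open>Apply the weighted multiplier bound to spectral truncations of the normalised indicator
  function \<open>h\<close> of a small neighbourhood \<open>U\<close> of \<open>x\<close>. There the weight centred at \<open>x\<close> is
  close to \<open>1\<close>, so that the right hand side stays bounded, and the coefficients of \<open>h\<close>
  are close to the values \<open>u l x\<close>, which are the coefficients of the kernel.\<close>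

lemma kernel_L1_bound:
  assumes \<phi>: "bump_symbol \<phi>"
  shows "\<exists>C\<ge>0. \<forall>\<epsilon> x. 0 < \<epsilon> \<longrightarrow> \<epsilon> \<le> 1 \<longrightarrow> (LINT y|\<mu>. \<bar>mult_kernel \<phi> \<epsilon> x y\<bar>) \<le> C"
proof -
  obtain R where R: "R > 0" "\<And>s. \<bar>s\<bar> \<ge> R \<Longrightarrow> \<phi> s = 0" using \<phi> by (auto simp: bump_symbol_def)
  obtain C where C: "0 \<le> C" "\<And>\<epsilon> \<rho> N c. weight B \<epsilon> \<rho> \<Longrightarrow> (LINT x|\<mu>. 1 / \<rho> x ^ (2 * n)) \<le> CV * \<epsilon> ^ n \<Longrightarrow>
    (LINT x|\<mu>. \<bar>comb N (\<lambda>l. \<phi> (\<epsilon>\<^sup>2 * \<nu> l) * c l) x\<bar>) \<le> C * (LINT x|\<mu>. \<rho> x ^ n * \<bar>comb N c x\<bar>)"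
  proof -
    have "smooth_on \<phi> UNIV" using \<phi> by (simp add: bump_symbol_def)
    from multiplier_L1[OF n CN nash B CV this R] show thesis using that by blast
  qed
  have "(LINT y|\<mu>. \<bar>mult_kernel \<phi> \<epsilon> x y\<bar>) \<le> C * 2" if \<epsilon>: "0 < \<epsilon>" "\<epsilon> \<le> 1" for \<epsilon> x
  proof -
    define \<rho> where "\<rho> = wt \<epsilon> x"
    define N where "N = cut_index \<phi> \<epsilon>"
    have w: "weight B \<epsilon> \<rho>" unfolding \<rho>_def by (rule wt[OF \<epsilon>])
    note W = weightD[OF w]
    have c\<rho>: "cont \<rho>" using W by (intro F_continuous)
    have vol: "(LINT y|\<mu>. 1 / \<rho> y ^ (2 * n)) \<le> CV * \<epsilon> ^ n" unfolding \<rho>_def by (rule wt_volume[OF \<epsilon>])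
    define S where "S = (\<Sum>l<N. \<bar>\<phi> (\<epsilon>\<^sup>2 * \<nu> l)\<bar> * (LINT y|\<mu>. \<bar>u l y\<bar>))"
    have S: "0 \<le> S" unfolding S_def by (intro sum_nonneg) auto
    have main: "(LINT y|\<mu>. \<bar>mult_kernel \<phi> \<epsilon> x y\<bar>) \<le> C * 2 + \<delta> * S" if \<delta>: "\<delta> > 0" for \<delta>
    proof -
      \<comment> \<open>The second condition concerns only the finitely many \<open>l\<close> which the multiplier does not annihilate.\<close>
      define U where "U = {y. \<rho> y ^ n < 2} \<inter> (\<Inter>l\<in>{..<N}. {y. \<bar>u l y - u l x\<bar> < \<delta>})"
      have oU: "open U" unfolding U_def
        by (auto intro!: open_Int open_INT open_Collect_less continuous_intros c\<rho> u_continuous)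
      have xU: "x \<in> U" using \<delta> by (auto simp: U_def \<rho>_def wt_self)
      have m: "0 < measure \<mu> U" by (rule open_pos[OF oU]) (use xU in auto)
      have Um: "U \<in> sets \<mu>" using oU by (simp add: sets_eq)
      define h where "h y = indicator U y / measure \<mu> U" for y
      have hm: "h \<in> borel_measurable \<mu>" unfolding h_def using Um by measurable
      have h0: "0 \<le> h y" for y using m by (simp add: h_def)
      have h1: "h y \<le> 1 / measure \<mu> U" for y using m by (auto simp: h_def indicator_def)
      have hi: "integrable \<mu> h" by (rule integrable_const_bound[of _ "1 / measure \<mu> U"]) (use hm h0 h1 in auto)
      have hh: "integrable \<mu> (\<lambda>x. (h x)\<^sup>2)"
        by (rule integrable_const_bound[of _ "(1 / measure \<mu> U)\<^sup>2"]) (use hm h0 h1 in \<open>auto intro!: power_mono\<close>)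
      have inth: "(LINT y|\<mu>. h y) = 1" unfolding h_def using m Um by simp
      define c where "c = coef h"
      let ?f = "comb N (\<lambda>l. \<phi> (\<epsilon>\<^sup>2 * \<nu> l) * c l)"
      define V where "V = measure \<mu> UNIV"
      obtain P where P: "0 \<le> P" "\<And>y. \<bar>\<rho> y ^ n\<bar> \<le> P"
        using continuous_bounded[OF continuous_on_power[OF c\<rho>]] by metis
      define E where "E M = (LINT y|\<mu>. (h y - comb M c y)\<^sup>2)" for M
      have E: "E \<longlonglongrightarrow> 0" unfolding E_def c_def coef_def[abs_def] by (rule complete[OF hm hh])
      have Cc: "\<bar>c l - u l x\<bar> \<le> \<delta>" if l: "l < N" for l
      proof -
        have "c l - u l x = (LINT y|\<mu>. h y * u l y) - (LINT y|\<mu>. h y * u l x)"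
          using inth by (simp add: c_def coef_def)
        also have "\<dots> = (LINT y|\<mu>. h y * (u l y - u l x))"
          unfolding right_diff_distrib using hi integrable_mult_continuous[OF hi u_continuous]
          by (intro Bochner_Integration.integral_diff[symmetric]) auto
        also have "\<bar>\<dots>\<bar> \<le> (LINT y|\<mu>. \<bar>h y * (u l y - u l x)\<bar>)" by (rule integral_abs_bound)
        also have "\<dots> \<le> (LINT y|\<mu>. h y * \<delta>)"
        proof (rule integral_mono)
          show "integrable \<mu> (\<lambda>y. \<bar>h y * (u l y - u l x)\<bar>)"
            by (intro integrable_abs integrable_mult_continuous[OF hi] continuous_intros u_continuous)
          show "\<bar>h y * (u l y - u l x)\<bar> \<le> h y * \<delta>" for y
          proof (cases "y \<in> U")
            case True
            then have "\<bar>u l y - u l x\<bar> \<le> \<delta>" using l by (force simp: U_def)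
            then show ?thesis using h0[of y] by (simp add: abs_mult mult_left_mono)
          qed (simp add: h_def)
        qed (use hi in auto)
        also have "\<dots> = \<delta>" using inth by simp
        finally show ?thesis .
      qed
      have 1: "(LINT y|\<mu>. \<bar>?f y\<bar>) \<le> C * (2 + P * (sqrt (E M) * sqrt V))" if M: "M \<ge> N" for M
      proof -
        have ci: "integrable \<mu> (comb M c)" by (rule integrable_continuous[OF comb_continuous])
        have sqi: "integrable \<mu> (\<lambda>y. (h y - comb M c y)\<^sup>2)"
        proof -
          have "(\<lambda>y. (h y - comb M c y)\<^sup>2) = (\<lambda>y. (h y)\<^sup>2 - 2 * (h y * comb M c y) + (comb M c y)\<^sup>2)"
            by (auto simp: power2_eq_square algebra_simps)
          then show ?thesis
            using hh integrable_mult_continuous[OF hi comb_continuous[of M c]]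
              integrable_continuous[OF continuous_on_power[OF comb_continuous[of M c], of 2]] by simp
        qed
        have "?f = comb M (\<lambda>l. \<phi> (\<epsilon>\<^sup>2 * \<nu> l) * c l)"
          using comb_cut[OF \<phi> \<epsilon>(1) M[unfolded N_def]] by (simp add: N_def)
        then have "(LINT y|\<mu>. \<bar>?f y\<bar>) \<le> C * (LINT y|\<mu>. \<rho> y ^ n * \<bar>comb M c y\<bar>)"
          using C(2)[OF w vol] by simp
        also have "(LINT y|\<mu>. \<rho> y ^ n * \<bar>comb M c y\<bar>) \<le> (LINT y|\<mu>. 2 * h y + P * (\<bar>h y - comb M c y\<bar> * 1))"
        proof (rule integral_mono)
          show "integrable \<mu> (\<lambda>y. \<rho> y ^ n * \<bar>comb M c y\<bar>)"
            by (intro integrable_continuous continuous_intros c\<rho> comb_continuous)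
          show "integrable \<mu> (\<lambda>y. 2 * h y + P * (\<bar>h y - comb M c y\<bar> * 1))" using hi ci by auto
          fix y
          have "\<rho> y ^ n * \<bar>comb M c y\<bar> \<le> \<rho> y ^ n * (\<bar>h y\<bar> + \<bar>h y - comb M c y\<bar>)"
            using W(6)[of y] by (intro mult_left_mono) auto
          also have "\<dots> \<le> 2 * h y + P * (\<bar>h y - comb M c y\<bar> * 1)"
          proof -
            have "\<rho> y ^ n * \<bar>h y\<bar> \<le> 2 * h y"
              using h0[of y] m by (auto simp: h_def U_def indicator_def intro!: divide_right_mono)
            moreover have "\<rho> y ^ n * \<bar>h y - comb M c y\<bar> \<le> P * \<bar>h y - comb M c y\<bar>"
              using P(2)[of y] by (intro mult_right_mono) auto
            ultimately show ?thesis by (simp add: distrib_left)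
          qed
          finally show "\<rho> y ^ n * \<bar>comb M c y\<bar> \<le> 2 * h y + P * (\<bar>h y - comb M c y\<bar> * 1)" .
        qed
        also have "\<dots> = 2 + P * (LINT y|\<mu>. \<bar>h y - comb M c y\<bar> * 1)" using hi ci inth by simp
        also have "(LINT y|\<mu>. \<bar>h y - comb M c y\<bar> * 1) \<le> sqrt (LINT y|\<mu>. (\<bar>h y - comb M c y\<bar>)\<^sup>2) * sqrt (LINT y|\<mu>. 1\<^sup>2)"
          using sqi hi ci by (intro order_trans[OF abs_ge_self integral_Cauchy_Schwarz]) auto
        also have "\<dots> = sqrt (E M) * sqrt V" using sets_eq_imp_space_eq[OF sets_eq] by (simp add: E_def V_def)
        finally show ?thesis using C(1) P(1) by (simp add: mult_left_mono)
      qed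
      have "(\<lambda>M. C * (2 + P * (sqrt (E M) * sqrt V))) \<longlonglongrightarrow> C * (2 + P * (sqrt 0 * sqrt V))"
        by (intro tendsto_intros E)
      then have "(LINT y|\<mu>. \<bar>?f y\<bar>) \<le> C * (2 + P * (sqrt 0 * sqrt V))"
        by (rule LIMSEQ_le_const) (use 1 in blast)
      then have 2: "(LINT y|\<mu>. \<bar>?f y\<bar>) \<le> C * 2" by simp
      have "(LINT y|\<mu>. \<bar>mult_kernel \<phi> \<epsilon> x y\<bar>) \<le> (LINT y|\<mu>. \<bar>?f y\<bar> +
          (\<Sum>l<N. (\<bar>\<phi> (\<epsilon>\<^sup>2 * \<nu> l)\<bar> * \<delta>) * \<bar>u l y\<bar>))"
      proof (intro integral_mono integrable_continuous continuous_intros comb_continuous u_continuous)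
        show "cont (mult_kernel \<phi> \<epsilon> x)" unfolding mult_kernel_def by (rule comb_continuous)
        fix y
        have e1: "mult_kernel \<phi> \<epsilon> x y = ?f y + (\<Sum>l<N. \<phi> (\<epsilon>\<^sup>2 * \<nu> l) * (u l x - c l) * u l y)"
          unfolding mult_kernel_def N_def[symmetric] comb_def sum.distrib[symmetric] by (intro sum.cong) (auto simp: algebra_simps)
        have "\<bar>\<Sum>l<N. \<phi> (\<epsilon>\<^sup>2 * \<nu> l) * (u l x - c l) * u l y\<bar> \<le> (\<Sum>l<N. (\<bar>\<phi> (\<epsilon>\<^sup>2 * \<nu> l)\<bar> * \<delta>) * \<bar>u l y\<bar>)"
        proof (intro order_trans[OF sum_abs sum_mono])
          fix l assume "l \<in> {..<N}"
          then have "\<bar>u l x - c l\<bar> \<le> \<delta>" using Cc[of l] by (simp add: abs_minus_commute)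
          then show "\<bar>\<phi> (\<epsilon>\<^sup>2 * \<nu> l) * (u l x - c l) * u l y\<bar> \<le> (\<bar>\<phi> (\<epsilon>\<^sup>2 * \<nu> l)\<bar> * \<delta>) * \<bar>u l y\<bar>"
            unfolding abs_mult by (intro mult_right_mono mult_left_mono) auto
        qed
        then show "\<bar>mult_kernel \<phi> \<epsilon> x y\<bar> \<le> \<bar>?f y\<bar> + (\<Sum>l<N. (\<bar>\<phi> (\<epsilon>\<^sup>2 * \<nu> l)\<bar> * \<delta>) * \<bar>u l y\<bar>)"
          unfolding e1 by linarith
      qed
      also have "\<dots> = (LINT y|\<mu>. \<bar>?f y\<bar>) + (\<Sum>l<N. (\<bar>\<phi> (\<epsilon>\<^sup>2 * \<nu> l)\<bar> * \<delta>) * (LINT y|\<mu>. \<bar>u l y\<bar>))"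
        by (subst Bochner_Integration.integral_add)
          (auto intro!: integrable_continuous continuous_intros comb_continuous u_continuous simp: Bochner_Integration.integral_sum integrable_continuous continuous_intros u_continuous)
      also have "(\<Sum>l<N. (\<bar>\<phi> (\<epsilon>\<^sup>2 * \<nu> l)\<bar> * \<delta>) * (LINT y|\<mu>. \<bar>u l y\<bar>)) = \<delta> * S"
        unfolding S_def sum_distrib_left by (intro sum.cong) (auto simp: mult_ac)
      finally show ?thesis using 2 by linarith
    qed
    have lim: "((\<lambda>\<delta>. C * 2 + \<delta> * S) \<longlongrightarrow> C * 2 + 0 * S) (at_right 0)" by (intro tendsto_intros)
    have "(LINT y|\<mu>. \<bar>mult_kernel \<phi> \<epsilon> x y\<bar>) \<le> C * 2 + 0 * S"
      by (rule tendsto_lowerbound[OF lim]) (auto simp: eventually_at_filter intro!: always_eventually main)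
    then show ?thesis by simp
  qed
  then show ?thesis using C(1) by (intro exI[of _ "C * 2"]) auto
qed

lemma mult_kernel_sym: "mult_kernel \<phi> \<epsilon> x y = mult_kernel \<phi> \<epsilon> y x"
  unfolding mult_kernel_def comb_def by (intro sum.cong) (auto simp: mult_ac)

lemma multop_kernel:
  assumes f: "integrable \<mu> f"
  shows "multop \<phi> \<epsilon> f x = (LINT y|\<mu>. mult_kernel \<phi> \<epsilon> x y * f y)"
proof -
  have "(LINT y|\<mu>. mult_kernel \<phi> \<epsilon> x y * f y) = (LINT y|\<mu>. (\<Sum>l<cut_index \<phi> \<epsilon>. \<phi> (\<epsilon>\<^sup>2 * \<nu> l) * u l x * (f y * u l y)))"
    unfolding mult_kernel_def comb_def sum_distrib_right by (intro Bochner_Integration.integral_cong sum.cong) (auto simp: mult_ac)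
  also have "\<dots> = (\<Sum>l<cut_index \<phi> \<epsilon>. \<phi> (\<epsilon>\<^sup>2 * \<nu> l) * u l x * coef f l)"
    unfolding coef_def using integrable_mult_continuous[OF f u_continuous] by (subst Bochner_Integration.integral_sum) auto
  also have "\<dots> = multop \<phi> \<epsilon> f x" unfolding multop_def comb_def by (intro sum.cong) (auto simp: mult_ac)
  finally show ?thesis ..
qed

lemma multop_continuous: "cont (multop \<phi> \<epsilon> f)"
  unfolding multop_def by (rule comb_continuous)

lemma coef_diff: "integrable \<mu> f \<Longrightarrow> integrable \<mu> h \<Longrightarrow> coef (\<lambda>x. f x - h x) l = coef f l - coef h l"
  unfolding coef_def left_diff_distrib using integrable_mult_continuous[OF _ u_continuous]
  by (intro Bochner_Integration.integral_diff) auto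

lemma multop_diff: "integrable \<mu> f \<Longrightarrow> integrable \<mu> h \<Longrightarrow>
   multop \<phi> \<epsilon> (\<lambda>x. f x - h x) x = multop \<phi> \<epsilon> f x - multop \<phi> \<epsilon> h x"
  unfolding multop_def comb_diff by (simp add: coef_diff right_diff_distrib)

lemma multop_sup:
  assumes \<phi>: "bump_symbol \<phi>"
  obtains C where "0 \<le> C" "\<forall>\<epsilon> f b. 0 < \<epsilon> \<longrightarrow> \<epsilon> \<le> 1 \<longrightarrow> integrable \<mu> f \<longrightarrow> (\<forall>x. \<bar>f x\<bar> \<le> b) \<longrightarrow> (\<forall>x. \<bar>multop \<phi> \<epsilon> f x\<bar> \<le> C * b)"
proof -
  obtain C where C: "0 \<le> C" "\<And>\<epsilon> x. 0 < \<epsilon> \<Longrightarrow> \<epsilon> \<le> 1 \<Longrightarrow> (LINT y|\<mu>. \<bar>mult_kernel \<phi> \<epsilon> x y\<bar>) \<le> C"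
    using kernel_L1_bound[OF \<phi>] by blast
  have "\<bar>multop \<phi> \<epsilon> f x\<bar> \<le> C * b" if \<epsilon>: "0 < \<epsilon>" "\<epsilon> \<le> 1" and f: "integrable \<mu> f" "\<And>x. \<bar>f x\<bar> \<le> b" for \<epsilon> f b x
  proof -
    have b: "0 \<le> b" using f(2)[of undefined] by linarith
    have ck: "cont (mult_kernel \<phi> \<epsilon> x)" unfolding mult_kernel_def by (rule comb_continuous)
    have "\<bar>multop \<phi> \<epsilon> f x\<bar> \<le> (LINT y|\<mu>. \<bar>mult_kernel \<phi> \<epsilon> x y * f y\<bar>)"
      unfolding multop_kernel[OF f(1)] by (rule integral_abs_bound)
    also have "\<dots> \<le> (LINT y|\<mu>. \<bar>mult_kernel \<phi> \<epsilon> x y\<bar> * b)"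
    proof (rule integral_mono)
      show "integrable \<mu> (\<lambda>y. \<bar>mult_kernel \<phi> \<epsilon> x y * f y\<bar>)"
        using integrable_mult_continuous[OF f(1) ck] by (simp add: mult.commute)
      show "integrable \<mu> (\<lambda>y. \<bar>mult_kernel \<phi> \<epsilon> x y\<bar> * b)"
        by (intro integrable_continuous continuous_intros ck)
    qed (use f in \<open>auto simp: abs_mult intro!: mult_left_mono\<close>)
    also have "\<dots> \<le> C * b" using C(2)[OF \<epsilon>] b by (simp add: mult_right_mono)
    finally show ?thesis .
  qed
  then show ?thesis using C(1) that by blast
qed

end

section \<open>Schur's test and powers\<close>

lemma powr_three:
  fixes a b c p :: real
  assumes "1 \<le> p"
  shows "\<bar>a + b + c\<bar> powr p \<le> 3 powr p * (\<bar>a\<bar> powr p + \<bar>b\<bar> powr p + \<bar>c\<bar> powr p)"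
proof -
  define m where "m = max \<bar>a\<bar> (max \<bar>b\<bar> \<bar>c\<bar>)"
  have "\<bar>a + b + c\<bar> \<le> 3 * m" unfolding m_def by linarith
  then have "\<bar>a + b + c\<bar> powr p \<le> (3 * m) powr p" using assms by (intro powr_mono2) auto
  also have "\<dots> = 3 powr p * m powr p" by (rule powr_mult)
  also have "m powr p \<le> \<bar>a\<bar> powr p + \<bar>b\<bar> powr p + \<bar>c\<bar> powr p"
    unfolding m_def max_def by auto
  finally show ?thesis by simp
qed

text \<open>The graph of \<open>s powr p\<close> lies above its tangent at \<open>t\<close>. Solved for \<open>s\<close> this is Young's
  inequality in a form which is affine in \<open>s powr p\<close> and hence can be integrated.\<close>

lemma Young_tangent:
  fixes s t p :: real
  assumes "1 \<le> p" "0 \<le> s" "0 < t"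
  shows "s \<le> s powr p / (p * t powr (p - 1)) + t * (1 - 1 / p)"
proof -
  have "p * (s / t) \<le> (s / t) powr p + (p - 1)"
  proof (cases "s = 0")
    case False
    then have x: "0 < s / t" using assms by simp
    have c: "convex_on {0<..} (\<lambda>x::real. x powr p)" by (rule powr_convex[OF assms(1)])
    have d: "((\<lambda>x. x powr p) has_real_derivative p) (at 1)"
      by (auto intro!: derivative_eq_intros)
    have "(s / t) powr p - 1 powr p \<ge> p * (s / t - 1)"
      by (rule convex_on_imp_above_tangent[OF c]) (use x d in \<open>auto intro: has_field_derivative_at_within simp: interior_open\<close>)
    then show ?thesis by (simp add: algebra_simps)
  qed (use assms in simp)
  then have "t * (p * (s / t)) \<le> t * ((s / t) powr p + (p - 1))" using assms by (intro mult_left_mono) auto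
  then have "p * s \<le> t * ((s / t) powr p) + t * (p - 1)" using assms by (simp add: distrib_left)
  also have "t * ((s / t) powr p) = s powr p / t powr (p - 1)"
    using assms by (simp add: powr_divide powr_diff)
  finally have "s \<le> (s powr p / t powr (p - 1) + t * (p - 1)) / p" using assms by (simp add: pos_le_divide_eq mult.commute)
  also have "\<dots> = s powr p / (p * t powr (p - 1)) + t * (1 - 1 / p)"
    using assms by (simp add: add_divide_distrib right_diff_distrib diff_divide_distrib mult.commute)
  finally show ?thesis .
qed

text \<open>Integrating Young's inequality against \<open>K x\<close> and choosing \<open>t\<close> proportional to the value
  of the integral gives
  \<open>(\<integral> K x y * a y) powr p \<le> C powr (p - 1) * (\<integral> K x y * a y powr p)\<close>; then integrate
  over \<open>x\<close>.\<close>

lemma (in finite_measure) Schur_test: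
  fixes K :: "'a \<Rightarrow> 'a \<Rightarrow> real" and a :: "'a \<Rightarrow> real"
  assumes p: "1 \<le> p" and Km: "(\<lambda>(x, y). K x y) \<in> borel_measurable (M \<Otimes>\<^sub>M M)"
    and K0: "\<And>x y. 0 \<le> K x y" and Kb: "\<And>x y. K x y \<le> R"
    and K1: "\<And>x. (LINT y|M. K x y) \<le> C" and K2: "\<And>y. (LINT x|M. K x y) \<le> C" and C: "0 < C"
    and a: "a \<in> borel_measurable M" "\<And>x. 0 \<le> a x" and ai: "integrable M a" "integrable M (\<lambda>x. a x powr p)"
  shows "integrable M (\<lambda>x. (LINT y|M. K x y * a y) powr p)"
    and "(LINT x|M. (LINT y|M. K x y * a y) powr p) \<le> C powr p * (LINT x|M. a x powr p)"
proof -
  interpret pair_sigma_finite M M ..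
  define A where "A x = (LINT y|M. K x y * a y)" for x
  define D where "D x = (LINT y|M. K x y * a y powr p)" for x
  note Km[measurable] note a(1)[measurable]
  have Kx: "K x \<in> borel_measurable M" if "x \<in> space M" for x
    using measurable_compose[OF measurable_Pair1'[OF that] Km] by simp
  have Ka: "integrable M (\<lambda>y. K x y * h y)" if h: "integrable M h" "x \<in> space M" for h x
  proof (rule Bochner_Integration.integrable_bound[of M "\<lambda>y. R * h y"])
    show "AE y in M. norm (K x y * h y) \<le> norm (R * h y)"
      using K0 Kb by (auto simp: abs_mult intro!: AE_I2 mult_right_mono order_trans[OF Kb abs_ge_self])
  qed (use h Kx in auto)
  have R: "0 \<le> R" if "x \<in> space M" for x using K0[of x x] Kb[of x x] by linarith
  have Ki: "integrable M (K x)" if "x \<in> space M" for x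
    using Ka[OF integrable_const[of 1] that] by simp
  have A0: "0 \<le> A x" for x unfolding A_def using K0 a by (intro Bochner_Integration.integral_nonneg) auto
  have D0: "0 \<le> D x" for x unfolding D_def using K0 a by (intro Bochner_Integration.integral_nonneg) auto
  have AD: "A x powr p \<le> C powr (p - 1) * D x" if x: "x \<in> space M" for x
  proof (cases "A x = 0")
    case True
    then show ?thesis using D0 by simp
  next
    case False
    then have A: "0 < A x" using A0[of x] by simp
    \<comment> \<open>The value of \<open>t\<close> that makes the constant \<open>C powr (p - 1)\<close> come out.\<close>
    define t where "t = A x / C"
    have t: "0 < t" using A C by (simp add: t_def)
    have "A x \<le> (LINT y|M. (K x y * a y powr p) * (1 / (p * t powr (p - 1))) + K x y * (t * (1 - 1 / p)))"
      unfolding A_def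
    proof (rule integral_mono)
      fix y
      have "K x y * a y \<le> K x y * (a y powr p / (p * t powr (p - 1)) + t * (1 - 1 / p))"
        by (intro mult_left_mono Young_tangent p a t K0)
      then show "K x y * a y \<le> (K x y * a y powr p) * (1 / (p * t powr (p - 1))) + K x y * (t * (1 - 1 / p))"
        by (simp add: distrib_left)
    qed (use Ka ai Ki x in auto)
    also have "\<dots> = D x * (1 / (p * t powr (p - 1))) + (LINT y|M. K x y) * (t * (1 - 1 / p))"
      unfolding D_def using Ka[OF ai(2) x] Ki[OF x] by (subst Bochner_Integration.integral_add) auto
    also have "(LINT y|M. K x y) * (t * (1 - 1 / p)) \<le> C * (t * (1 - 1 / p))"
      using p t by (intro mult_right_mono K1) auto
    also have "C * (t * (1 - 1 / p)) = A x - A x / p" using C by (simp add: t_def right_diff_distrib)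
    finally have "A x / p \<le> D x / (p * t powr (p - 1))" by simp
    then have "A x * t powr (p - 1) \<le> D x" using p t by (simp add: field_simps)
    then have "C powr (p - 1) * (A x * t powr (p - 1)) \<le> C powr (p - 1) * D x" using C by (intro mult_left_mono) auto
    also have "C powr (p - 1) * (A x * t powr (p - 1)) = A x * A x powr (p - 1)"
      using C A by (simp add: t_def powr_divide)
    also have "\<dots> = A x powr p" using A by (simp add: powr_diff)
    finally show ?thesis .
  qed
  have Am[measurable]: "A \<in> borel_measurable M" unfolding A_def by measurable
  have "(\<integral>\<^sup>+x. ennreal (A x powr p) \<partial>M) \<le> (\<integral>\<^sup>+x. ennreal (C powr (p - 1)) * (\<integral>\<^sup>+y. ennreal (K x y * a y powr p) \<partial>M) \<partial>M)"
  proof (rule nn_integral_mono)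
    fix x assume x: "x \<in> space M"
    have "ennreal (A x powr p) \<le> ennreal (C powr (p - 1)) * ennreal (D x)"
      using AD[OF x] D0 by (simp add: ennreal_mult[symmetric] ennreal_leI)
    also have "ennreal (D x) = (\<integral>\<^sup>+y. ennreal (K x y * a y powr p) \<partial>M)"
      unfolding D_def using Ka[OF ai(2) x] K0 by (intro nn_integral_eq_integral[symmetric]) auto
    finally show "ennreal (A x powr p) \<le> ennreal (C powr (p - 1)) * (\<integral>\<^sup>+y. ennreal (K x y * a y powr p) \<partial>M)" .
  qed
  also have "\<dots> = ennreal (C powr (p - 1)) * (\<integral>\<^sup>+x. \<integral>\<^sup>+y. ennreal (K x y * a y powr p) \<partial>M \<partial>M)"
    by (rule nn_integral_cmult) measurable
  also have "(\<integral>\<^sup>+x. \<integral>\<^sup>+y. ennreal (K x y * a y powr p) \<partial>M \<partial>M) = (\<integral>\<^sup>+y. \<integral>\<^sup>+x. ennreal (K x y * a y powr p) \<partial>M \<partial>M)"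
    by (rule Fubini') measurable
  also have "\<dots> \<le> (\<integral>\<^sup>+y. ennreal C * ennreal (a y powr p) \<partial>M)"
  proof (rule nn_integral_mono)
    fix y assume y: "y \<in> space M"
    have Ky[measurable]: "(\<lambda>x. K x y) \<in> borel_measurable M"
      using measurable_compose[OF measurable_Pair2'[OF y] Km] by simp
    have Kyi: "integrable M (\<lambda>x. K x y)"
      by (rule integrable_const_bound[of _ R]) (use K0 Kb in auto)
    have "(\<integral>\<^sup>+x. ennreal (K x y * a y powr p) \<partial>M) = (\<integral>\<^sup>+x. ennreal (K x y) \<partial>M) * ennreal (a y powr p)"
      using K0 by (subst nn_integral_multc[symmetric]) (auto simp: ennreal_mult)
    also have "(\<integral>\<^sup>+x. ennreal (K x y) \<partial>M) = ennreal (LINT x|M. K x y)"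
      using Kyi K0 by (intro nn_integral_eq_integral) auto
    also have "\<dots> \<le> ennreal C" by (intro ennreal_leI K2)
    finally show "(\<integral>\<^sup>+x. ennreal (K x y * a y powr p) \<partial>M) \<le> ennreal C * ennreal (a y powr p)"
      by (simp add: mult_right_mono)
  qed
  also have "\<dots> = ennreal C * (\<integral>\<^sup>+y. ennreal (a y powr p) \<partial>M)" by (rule nn_integral_cmult) measurable
  also have "(\<integral>\<^sup>+y. ennreal (a y powr p) \<partial>M) = ennreal (LINT x|M. a x powr p)"
    using ai(2) by (intro nn_integral_eq_integral) auto
  also have "ennreal (C powr (p - 1)) * (ennreal C * ennreal (LINT x|M. a x powr p)) = ennreal (C powr p * (LINT x|M. a x powr p))"
    using C by (simp add: ennreal_mult[symmetric] powr_diff)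
  finally have fin: "(\<integral>\<^sup>+x. ennreal (A x powr p) \<partial>M) \<le> ennreal (C powr p * (LINT x|M. a x powr p))"
    by (simp add: mult_left_mono)
  have i: "integrable M (\<lambda>x. A x powr p)"
    by (rule integrableI_nonneg) (use fin in \<open>auto intro: le_less_trans\<close>)
  then show "integrable M (\<lambda>x. (LINT y|M. K x y * a y) powr p)" by (simp add: A_def)
  have "ennreal (LINT x|M. A x powr p) \<le> ennreal (C powr p * (LINT x|M. a x powr p))"
    using fin nn_integral_eq_integral[OF i] by simp
  then have "(LINT x|M. A x powr p) \<le> C powr p * (LINT x|M. a x powr p)"
    by (subst (asm) ennreal_le_iff) (auto intro!: mult_nonneg_nonneg Bochner_Integration.integral_nonneg)
  then show "(LINT x|M. (LINT y|M. K x y * a y) powr p) \<le> C powr p * (LINT x|M. a x powr p)" by (simp add: A_def)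
qed

lemma smooth_quotient:
  fixes \<psi> :: "real \<Rightarrow> real"
  assumes s: "smooth_on \<psi> UNIV" and r: "0 < r" "\<And>s. \<bar>s\<bar> < r \<Longrightarrow> \<psi> s = 0"
  shows "smooth_on (\<lambda>s. \<psi> s / s) UNIV"
proof -
  have 1: "smooth_on (\<lambda>s. \<psi> s / s) {0<..}"
  proof (rule smooth_on_cong)
    show "smooth_on (\<lambda>s. \<psi> s * inverse s) {0<..}"
      by (intro smooth_on_mult smooth_on_subset[OF s] smooth_on_inverse) auto
  qed (auto simp: divide_inverse)
  have 2: "smooth_on (\<lambda>s. \<psi> s / s) {..<0}"
  proof (rule smooth_on_cong)
    show "smooth_on (\<lambda>s. - (\<psi> s * inverse (- s))) {..<0}"
      by (intro smooth_on_mult smooth_on_bounded_linear[OF _ bounded_linear_minus[OF bounded_linear_ident]]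
         smooth_on_subset[OF s] smooth_on_compose[OF _ _ _ smooth_on_inverse] smooth_on_id) auto
  qed (auto simp: divide_inverse)
  have 3: "smooth_on (\<lambda>s. \<psi> s / s) {-r<..<r}"
    by (rule smooth_on_cong[OF _ smooth_on_const[of 0]]) (use r in auto)
  have "{0<..} \<union> {..<0} \<union> {-r<..<r} = (UNIV :: real set)" using r(1) by auto
  then show ?thesis using smooth_on_Un[OF _ _ smooth_on_Un[OF _ _ 1 2] 3] by (simp add: open_Un)
qed

section \<open>Convergence of smoothed spectral expansions\<close>

lemma continuous_square_zero:
  fixes h :: "'a::topological_space \<Rightarrow> real" and M :: "'a measure"
  assumes fin: "finite_measure M" and sets_eq: "sets M = sets borel" and open_pos: "\<And>U. open U \<Longrightarrow> U \<noteq> {} \<Longrightarrow> 0 < measure M U"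
    and h: "cont h" and hi: "integrable M (\<lambda>x. (h x)\<^sup>2)" and z: "(LINT x|M. (h x)\<^sup>2) = 0"
  shows "h x = 0"
proof (rule ccontr)
  interpret finite_measure M by (rule fin)
  assume nz: "h x \<noteq> 0"
  define e where "e = \<bar>h x\<bar> / 2"
  have e: "0 < e" "e < \<bar>h x\<bar>" using nz by (auto simp: e_def)
  define U where "U = {y. e < \<bar>h y\<bar>}"
  have U: "open U" unfolding U_def by (intro open_Collect_less continuous_intros h)
  have m: "0 < measure M U" by (rule open_pos[OF U]) (use e in \<open>auto simp: U_def\<close>)
  have "e\<^sup>2 * measure M U = (LINT y|M. e\<^sup>2 * indicator U y)" using U sets_eq by simp
  also have "\<dots> \<le> (LINT y|M. (h y)\<^sup>2)"
  proof (rule integral_mono)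
    show "e\<^sup>2 * indicator U y \<le> (h y)\<^sup>2" for y
      using e by (auto simp: U_def indicator_def abs_le_square_iff[symmetric])
  qed (use U sets_eq in \<open>auto intro!: hi simp: emeasure_eq_measure\<close>)
  finally show False using m e z by (simp add: mult_le_0_iff)
qed

context nash_diffusion
begin

lemma coef_comb: "coef (comb N c) l = (if l < N then c l else 0)"
proof -
  have "coef (comb N c) l = (\<Sum>k<N. c k * (LINT y|\<mu>. u k y * u l y))"
    unfolding coef_def comb_def sum_distrib_right
    by (subst Bochner_Integration.integral_sum) (auto simp: mult.assoc intro!: integrable_continuous continuous_intros u_continuous)
  also have "\<dots> = (\<Sum>k<N. if k = l then c k else 0)" unfolding orthonormal by (intro sum.cong) auto
  also have "\<dots> = (if l < N then c l else 0)" by (subst sum.delta) auto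
  finally show ?thesis .
qed

lemma coef_multop: "bump_symbol \<phi> \<Longrightarrow> 0 < \<epsilon> \<Longrightarrow> coef (multop \<phi> \<epsilon> f) l = \<phi> (\<epsilon>\<^sup>2 * \<nu> l) * coef f l"
  unfolding multop_def coef_comb using cut_index[of \<phi> \<epsilon> l] by auto

lemma coef_L: "f \<in> F \<Longrightarrow> coef (L f) l = \<nu> l * coef f l"
proof -
  assume f: "f \<in> F"
  have "coef (L f) l = (LINT x|\<mu>. u l x * L f x)" unfolding coef_def by (simp add: mult.commute)
  also have "\<dots> = (LINT x|\<mu>. f x * L (u l) x)" by (rule L_sym[OF u_F f])
  also have "\<dots> = (LINT x|\<mu>. \<nu> l * (f x * u l x))" by (simp add: L_u mult_ac)
  finally show ?thesis by (simp add: coef_def)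
qed

definition approx_id :: "(real \<Rightarrow> real) \<Rightarrow> bool" where
  "approx_id \<phi> \<longleftrightarrow> bump_symbol \<phi> \<and> (\<forall>s. \<bar>s\<bar> \<le> 1 \<longrightarrow> \<phi> s = 1)"

lemma approx_id_eventually:
  assumes "approx_id \<phi>"
  shows "eventually (\<lambda>j. \<forall>l<N. \<phi> ((1 / 2 ^ j)\<^sup>2 * \<nu> l) = 1) sequentially"
proof -
  have "eventually (\<lambda>j. \<phi> ((1 / 2 ^ j)\<^sup>2 * \<nu> l) = 1) sequentially" for l
  proof -
    have "(\<lambda>j. (1/4)^j * \<nu> l) \<longlonglongrightarrow> 0 * \<nu> l" by (intro tendsto_mult LIMSEQ_realpow_zero tendsto_const) auto
    then have "eventually (\<lambda>j. (1/4)^j * \<nu> l < 1) sequentially" by (intro order_tendstoD(2)[of _ "0 * \<nu> l"]) auto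
    then show ?thesis
    proof eventually_elim
      case (elim j)
      have "(1 / 2 ^ j :: real)\<^sup>2 = (1/4)^j" by (simp add: power2_eq_square power_divide power_mult_distrib[symmetric])
      then show ?case using elim assms \<nu>_nonneg[of l] by (simp add: approx_id_def)
    qed
  qed
  then show ?thesis by (intro eventually_ball_finite[of "{..<N}", unfolded lessThan_iff Ball_def, simplified]) auto
qed

text \<open>The increments of the sequence are \<open>\<epsilon>\<^sup>2 m (\<epsilon>\<^sup>2 L) L f\<close> with
  \<open>m s = (\<phi> (s / 4) - \<phi> s) / s\<close>, which is smooth because \<open>\<phi> = 1\<close> near \<open>0\<close>. Hence the
  sequence converges uniformly at a geometric rate. The limit is continuous and has the
  coefficients of \<open>f\<close>, so it is \<open>f\<close> by completeness.\<close>

lemma multop_F_uniform: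
  assumes \<phi>: "approx_id \<phi>" and f: "f \<in> F"
  shows "\<exists>D\<ge>0. \<forall>j x. \<bar>multop \<phi> (1 / 2 ^ j) f x - f x\<bar> \<le> D / 4 ^ j"
proof -
  have b\<phi>: "bump_symbol \<phi>" using \<phi> by (simp add: approx_id_def)
  obtain R where R: "R > 0" "\<And>s. \<bar>s\<bar> \<ge> R \<Longrightarrow> \<phi> s = 0" using b\<phi> by (auto simp: bump_symbol_def)
  have s\<phi>: "smooth_on \<phi> UNIV" using b\<phi> by (simp add: bump_symbol_def)
  define \<psi> where "\<psi> s = \<phi> (s / 4) - \<phi> s" for s
  \<comment> \<open>At \<open>s = 0\<close> the quotient is \<open>0 / 0 = 0\<close>, which is the smooth continuation.\<close>
  define m where "m s = \<psi> s / s" for s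
  have "smooth_on (\<lambda>s. s / 4) (UNIV :: real set)"
    using smooth_on_bounded_linear[OF open_UNIV bounded_linear_divide smooth_on_id, of 4] by simp
  then have "smooth_on \<psi> UNIV"
    unfolding \<psi>_def by (intro smooth_on_diff smooth_on_compose[OF _ _ _ s\<phi>] s\<phi>) auto
  then have "smooth_on m UNIV" unfolding m_def
    by (rule smooth_quotient[of _ 1]) (use \<phi> in \<open>auto simp: \<psi>_def approx_id_def\<close>)
  moreover have "m s = 0" if "\<bar>s\<bar> \<ge> 4 * R" for s
    using that R(1) R(2)[of s] R(2)[of "s / 4"] by (simp add: m_def \<psi>_def)
  ultimately have bm: "bump_symbol m" unfolding bump_symbol_def using R(1) by (intro conjI exI[of _ "4 * R"]) auto
  have m: "s * m s = \<phi> (s / 4) - \<phi> s" for s by (simp add: m_def \<psi>_def)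
  obtain C where C0: "0 \<le> C" and C1: "\<forall>\<epsilon> f b. 0 < \<epsilon> \<longrightarrow> \<epsilon> \<le> 1 \<longrightarrow> integrable \<mu> f \<longrightarrow> (\<forall>x. \<bar>f x\<bar> \<le> b) \<longrightarrow> (\<forall>x. \<bar>multop m \<epsilon> f x\<bar> \<le> C * b)"
    by (rule multop_sup[OF bm])
  note C = C0 C1[rule_format]
  obtain b where b: "0 \<le> b" "\<And>x. \<bar>L f x\<bar> \<le> b" using continuous_bounded[OF L_continuous[OF f]] by metis
  define a where "a j = multop \<phi> (1 / 2 ^ j) f" for j
  define D where "D = C * b"
  have D: "0 \<le> D" using C b by (simp add: D_def)
  have step: "\<bar>a (Suc j) x - a j x\<bar> \<le> D / 4 ^ j" for j x
  proof -
    define \<epsilon> :: real where "\<epsilon> = 1 / 2 ^ j"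
    have \<epsilon>: "0 < \<epsilon>" "\<epsilon> \<le> 1" "1 / 2 ^ Suc j = \<epsilon> / 2" "\<epsilon>\<^sup>2 = 1 / 4 ^ j"
      by (auto simp: \<epsilon>_def power2_eq_square power_mult_distrib[symmetric])
    define N where "N = max (cut_index m \<epsilon>) (max (cut_index \<phi> \<epsilon>) (cut_index \<phi> (\<epsilon> / 2)))"
    have N: "cut_index m \<epsilon> \<le> N" "cut_index \<phi> \<epsilon> \<le> N" "cut_index \<phi> (\<epsilon> / 2) \<le> N" by (auto simp: N_def)
    have "a (Suc j) x - a j x = comb N (\<lambda>l. \<phi> ((\<epsilon> / 2)\<^sup>2 * \<nu> l) * coef f l) x - comb N (\<lambda>l. \<phi> (\<epsilon>\<^sup>2 * \<nu> l) * coef f l) x"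
      unfolding a_def multop_def \<epsilon>(3) \<epsilon>_def[symmetric]
      using comb_cut[OF b\<phi> _ N(2)] comb_cut[OF b\<phi> _ N(3)] \<epsilon>(1) by simp
    also have "\<dots> = comb N (\<lambda>l. \<epsilon>\<^sup>2 * (m (\<epsilon>\<^sup>2 * \<nu> l) * coef (L f) l)) x"
    proof -
      have "\<phi> ((\<epsilon> / 2)\<^sup>2 * \<nu> l) * coef f l - \<phi> (\<epsilon>\<^sup>2 * \<nu> l) * coef f l = \<epsilon>\<^sup>2 * (m (\<epsilon>\<^sup>2 * \<nu> l) * coef (L f) l)" for l
      proof -
        have e: "(\<epsilon> / 2)\<^sup>2 * \<nu> l = \<epsilon>\<^sup>2 * \<nu> l / 4" by (simp add: power_divide)
        show ?thesis unfolding left_diff_distrib[symmetric] e m[symmetric] coef_L[OF f] by simp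
      qed
      then show ?thesis unfolding comb_diff by simp
    qed
    also have "\<dots> = \<epsilon>\<^sup>2 * multop m \<epsilon> (L f) x"
      unfolding comb_cmult[symmetric] multop_def using comb_cut[OF bm \<epsilon>(1) N(1)] by simp
    also have "\<bar>\<dots>\<bar> \<le> \<epsilon>\<^sup>2 * D"
      using C(2)[OF \<epsilon>(1,2) integrable_continuous[OF L_continuous[OF f]] b(2)] by (simp add: abs_mult D_def mult_left_mono)
    finally show ?thesis by (simp add: \<epsilon>(4))
  qed
  \<comment> \<open>The exact remainder of the geometric series makes the induction work.\<close>
  have tail: "\<bar>a (j + k) x - a j x\<bar> \<le> 2 * D / 4 ^ j * (1 - 1 / 4 ^ k)" for j k x
  proof (induction k)
    case (Suc k)
    have "\<bar>a (j + Suc k) x - a j x\<bar> \<le> \<bar>a (Suc (j + k)) x - a (j + k) x\<bar> + \<bar>a (j + k) x - a j x\<bar>" by simp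
    also have "\<dots> \<le> D / 4 ^ (j + k) + 2 * D / 4 ^ j * (1 - 1 / 4 ^ k)" using step[of "j + k" x] Suc by linarith
    also have "\<dots> = D / 4 ^ j * (2 - 1 / 4 ^ k)" by (simp add: power_add field_simps)
    also have "\<dots> \<le> D / 4 ^ j * (2 - 1 / (2 * 4 ^ k))" using D by (intro mult_left_mono) (auto simp: field_simps)
    also have "\<dots> = 2 * D / 4 ^ j * (1 - 1 / 4 ^ Suc k)" by (simp add: field_simps)
    finally show ?case .
  qed simp
  have tail': "\<bar>a (j + k) x - a j x\<bar> \<le> 2 * D / 4 ^ j" for j k x
  proof -
    have "2 * D / 4 ^ j * (1 - 1 / 4 ^ k) \<le> 2 * D / 4 ^ j * 1" using D by (intro mult_left_mono) auto
    with tail[where j=j and k=k and x=x] show ?thesis by simp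
  qed
  have z: "(\<lambda>j. 2 * D / 4 ^ j) \<longlonglongrightarrow> 0"
    using tendsto_mult[OF tendsto_const[of "2 * D"] LIMSEQ_inverse_realpow_zero[of 4]] by (simp add: divide_inverse power_inverse)
  have "Cauchy (\<lambda>j. a j x)" for x
  proof (rule CauchyI)
    fix e :: real assume "0 < e"
    then obtain J where J: "2 * D / 4 ^ J < e / 2" using order_tendstoD(2)[OF z, of "e / 2"] eventually_sequentially by fastforce
    have "norm (a i x - a k x) < e" if "i \<ge> J" "k \<ge> J" for i k
      using tail'[of J "i - J" x] tail'[of J "k - J" x] J that by simp
    then show "\<exists>M. \<forall>m\<ge>M. \<forall>n\<ge>M. norm (a m x - a n x) < e" by blast
  qed
  then have "\<forall>x. \<exists>l. (\<lambda>j. a j x) \<longlonglongrightarrow> l" using real_Cauchy_convergent convergent_def by blast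
  then obtain g where g: "\<And>x. (\<lambda>j. a j x) \<longlonglongrightarrow> g x" by metis
  have ag: "\<bar>a j x - g x\<bar> \<le> 2 * D / 4 ^ j" for j x
  proof -
    have "(\<lambda>k. \<bar>a (k + j) x - a j x\<bar>) \<longlonglongrightarrow> \<bar>g x - a j x\<bar>" by (intro tendsto_intros LIMSEQ_ignore_initial_segment g)
    then have "\<bar>g x - a j x\<bar> \<le> 2 * D / 4 ^ j"
      by (rule LIMSEQ_le_const2) (use tail'[of j _ x] in \<open>auto simp: add.commute\<close>)
    then show ?thesis by (simp add: abs_minus_commute)
  qed
  have "uniform_limit UNIV a g sequentially"
  proof (rule uniform_limitI)
    fix e :: real assume "0 < e"
    then have "eventually (\<lambda>j. 2 * D / 4 ^ j < e) sequentially" by (rule order_tendstoD(2)[OF z])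
    then show "\<forall>\<^sub>F n in sequentially. \<forall>x\<in>UNIV. dist (a n x) (g x) < e"
      by eventually_elim (use ag in \<open>auto simp: dist_real_def intro: le_less_trans\<close>)
  qed
  then have gc: "cont g"
    by (rule uniform_limit_theorem[rotated]) (auto simp: a_def multop_continuous)
  have coefg: "coef g l = coef f l" for l
  proof (rule LIMSEQ_unique)
    show "(\<lambda>j. coef (a j) l) \<longlonglongrightarrow> coef f l"
    proof (rule tendsto_eventually)
      show "\<forall>\<^sub>F j in sequentially. coef (a j) l = coef f l"
        using approx_id_eventually[OF \<phi>, of "Suc l"] by eventually_elim (simp add: a_def coef_multop[OF b\<phi>])
    qed
    have "(\<lambda>j. coef (a j) l - coef g l) \<longlonglongrightarrow> 0"
    proof (rule Lim_null_comparison)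
      show "(\<lambda>j. 2 * D / 4 ^ j * (LINT y|\<mu>. \<bar>u l y\<bar>)) \<longlonglongrightarrow> 0" using tendsto_mult_left_zero[OF z] by simp
      show "\<forall>\<^sub>F j in sequentially. norm (coef (a j) l - coef g l) \<le> 2 * D / 4 ^ j * (LINT y|\<mu>. \<bar>u l y\<bar>)"
      proof (rule always_eventually, rule allI)
        fix j
        have ac: "cont (a j)" by (simp add: a_def multop_continuous)
        have "coef (a j) l - coef g l = coef (\<lambda>x. a j x - g x) l"
          by (rule coef_diff[symmetric]) (intro integrable_continuous ac gc)+
        also have "\<bar>\<dots>\<bar> \<le> (LINT y|\<mu>. \<bar>(a j y - g y) * u l y\<bar>)" unfolding coef_def by (rule integral_abs_bound)
        also have "\<dots> \<le> (LINT y|\<mu>. 2 * D / 4 ^ j * \<bar>u l y\<bar>)"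
          unfolding abs_mult
        proof (intro integral_mono integrable_continuous continuous_intros ac gc u_continuous)
          show "\<bar>a j y - g y\<bar> * \<bar>u l y\<bar> \<le> 2 * D / 4 ^ j * \<bar>u l y\<bar>" for y by (intro mult_right_mono ag) auto
        qed
        finally show "norm (coef (a j) l - coef g l) \<le> 2 * D / 4 ^ j * (LINT y|\<mu>. \<bar>u l y\<bar>)" by simp
      qed
    qed
    then show "(\<lambda>j. coef (a j) l) \<longlonglongrightarrow> coef g l" by (rule LIM_zero_cancel)
  qed
  have fc: "cont f" by (rule F_continuous[OF f])
  define h where "h x = g x - f x" for x
  have hc: "cont h" unfolding h_def by (intro continuous_intros gc fc)
  have coefh: "coef h l = 0" for l
    using coef_diff[OF integrable_continuous[OF gc] integrable_continuous[OF fc], of l] coefg by (simp add: h_def[abs_def])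
  have "(\<lambda>N. LINT x|\<mu>. (h x - comb N (coef h) x)\<^sup>2) \<longlonglongrightarrow> 0"
    using complete[OF borel_measurable_continuous[OF hc] integrable_continuous[OF continuous_on_power[OF hc]]]
    unfolding coef_def[abs_def] .
  then have "(LINT x|\<mu>. (h x)\<^sup>2) = 0" by (simp add: coefh comb_def LIMSEQ_const_iff)
  then have "h x = 0" for x
    using continuous_square_zero[OF finite_measure_axioms sets_eq _ hc integrable_continuous[OF continuous_on_power[OF hc]]] open_pos by blast
  then have gf: "g = f" by (auto simp: h_def)
  then show ?thesis using ag D unfolding a_def gf by (intro exI[of _ "2 * D"]) auto
qed

lemma multop_uniform:
  assumes \<phi>: "approx_id \<phi>" and f: "cont f" and e: "0 < e"
  shows "eventually (\<lambda>j. \<forall>x. \<bar>multop \<phi> (1 / 2 ^ j) f x - f x\<bar> < e) sequentially"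
proof -
  have b\<phi>: "bump_symbol \<phi>" using \<phi> by (simp add: approx_id_def)
  obtain C where C0: "0 \<le> C" and C1: "\<forall>\<epsilon> f b. 0 < \<epsilon> \<longrightarrow> \<epsilon> \<le> 1 \<longrightarrow> integrable \<mu> f \<longrightarrow> (\<forall>x. \<bar>f x\<bar> \<le> b) \<longrightarrow> (\<forall>x. \<bar>multop \<phi> \<epsilon> f x\<bar> \<le> C * b)"
    by (rule multop_sup[OF b\<phi>])
  note C = C0 C1[rule_format]
  define d where "d = e / (2 * (C + 1))"
  have d: "0 < d" "(C + 1) * d = e / 2" using e C by (auto simp: d_def field_simps)
  obtain h where h: "h \<in> F" "\<And>x. \<bar>f x - h x\<bar> < d" using F_dense[OF f d(1)] by blast
  obtain D where D: "\<And>j x. \<bar>multop \<phi> (1 / 2 ^ j) h x - h x\<bar> \<le> D / 4 ^ j" using multop_F_uniform[OF \<phi> h(1)] by blast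
  have fi: "integrable \<mu> f" "integrable \<mu> h" by (intro integrable_continuous f F_continuous h)+
  have "(\<lambda>j. D / 4 ^ j) \<longlonglongrightarrow> 0"
    using tendsto_mult[OF tendsto_const[of D] LIMSEQ_inverse_realpow_zero[of 4]] by (simp add: divide_inverse power_inverse)
  then have "eventually (\<lambda>j. D / 4 ^ j < e / 2) sequentially" using e by (intro order_tendstoD(2)) auto
  then show ?thesis
  proof eventually_elim
    case (elim j)
    show ?case
    proof
      fix x
      have "\<bar>multop \<phi> (1 / 2 ^ j) (\<lambda>x. f x - h x) x\<bar> \<le> C * d"
        using h(2) fi by (intro C(2)) (auto intro: less_imp_le)
      then show "\<bar>multop \<phi> (1 / 2 ^ j) f x - f x\<bar> < e"
        using multop_diff[OF fi, of \<phi> "1 / 2 ^ j" x] D[of j x] elim h(2)[of x] d(2)[unfolded distrib_right mult_1] by linarith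
    qed
  qed
qed

text \<open>The kernel is symmetric, so one bound serves both hypotheses of Schur's test.\<close>

lemma multop_Lp_bound:
  assumes \<phi>: "bump_symbol \<phi>" and p: "1 \<le> p"
  obtains C where "0 \<le> C" "\<forall>\<epsilon> f. 0 < \<epsilon> \<longrightarrow> \<epsilon> \<le> 1 \<longrightarrow> integrable \<mu> f \<longrightarrow> integrable \<mu> (\<lambda>x. \<bar>f x\<bar> powr p) \<longrightarrow>
    (LINT x|\<mu>. \<bar>multop \<phi> \<epsilon> f x\<bar> powr p) \<le> C * (LINT x|\<mu>. \<bar>f x\<bar> powr p)"
proof -
  obtain C where C: "0 \<le> C" "\<And>\<epsilon> x. 0 < \<epsilon> \<Longrightarrow> \<epsilon> \<le> 1 \<Longrightarrow> (LINT y|\<mu>. \<bar>mult_kernel \<phi> \<epsilon> x y\<bar>) \<le> C"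
    using kernel_L1_bound[OF \<phi>] by blast
  have "(LINT x|\<mu>. \<bar>multop \<phi> \<epsilon> f x\<bar> powr p) \<le> (C + 1) powr p * (LINT x|\<mu>. \<bar>f x\<bar> powr p)"
    if \<epsilon>: "0 < \<epsilon>" "\<epsilon> \<le> 1" and f: "integrable \<mu> f" "integrable \<mu> (\<lambda>x. \<bar>f x\<bar> powr p)" for \<epsilon> f
  proof -
    let ?K = "\<lambda>x y. \<bar>mult_kernel \<phi> \<epsilon> x y\<bar>"
    have um[measurable]: "u l \<in> borel_measurable \<mu>" for l by (rule borel_measurable_continuous[OF u_continuous])
    have Km: "(\<lambda>(x, y). ?K x y) \<in> borel_measurable (\<mu> \<Otimes>\<^sub>M \<mu>)"
      unfolding mult_kernel_def comb_def by measurable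
    have "\<exists>B\<ge>0. \<forall>x. \<bar>u l x\<bar> \<le> B" for l using continuous_bounded[OF u_continuous[of l]] by metis
    then obtain M where M: "\<And>l. 0 \<le> M l" "\<And>l x. \<bar>u l x\<bar> \<le> M l" by metis
    have Kb: "?K x y \<le> (\<Sum>l<cut_index \<phi> \<epsilon>. \<bar>\<phi> (\<epsilon>\<^sup>2 * \<nu> l)\<bar> * M l * M l)" for x y
      unfolding mult_kernel_def comb_def
      by (rule order_trans[OF sum_abs sum_mono]) (auto simp: abs_mult intro!: mult_mono mult_nonneg_nonneg M)
    have K1: "(LINT y|\<mu>. ?K x y) \<le> C + 1" for x using C(2)[OF \<epsilon>, of x] by simp
    have K2: "(LINT x|\<mu>. ?K x y) \<le> C + 1" for y using K1[of y] by (simp add: mult_kernel_sym[of _ _ _ y])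
    note S = Schur_test[where K = ?K and a = "\<lambda>x. \<bar>f x\<bar>" and C = "C + 1", OF p Km abs_ge_zero Kb K1 K2 _ _ abs_ge_zero _ f(2)]
    have i: "integrable \<mu> (\<lambda>x. (LINT y|\<mu>. ?K x y * \<bar>f y\<bar>) powr p)"
      by (rule S(1)) (use C(1) f(1) in auto)
    have "(LINT x|\<mu>. \<bar>multop \<phi> \<epsilon> f x\<bar> powr p) \<le> (LINT x|\<mu>. (LINT y|\<mu>. ?K x y * \<bar>f y\<bar>) powr p)"
    proof (rule integral_mono)
      show "integrable \<mu> (\<lambda>x. \<bar>multop \<phi> \<epsilon> f x\<bar> powr p)"
        using p by (intro integrable_continuous continuous_on_powr' continuous_intros multop_continuous) auto
      show "\<bar>multop \<phi> \<epsilon> f x\<bar> powr p \<le> (LINT y|\<mu>. ?K x y * \<bar>f y\<bar>) powr p" for x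
      proof (rule powr_mono2)
        show "\<bar>multop \<phi> \<epsilon> f x\<bar> \<le> (LINT y|\<mu>. ?K x y * \<bar>f y\<bar>)"
          unfolding multop_kernel[OF f(1)] abs_mult[symmetric] by (rule integral_abs_bound)
      qed (use p in auto)
    qed (rule i)
    also have "\<dots> \<le> (C + 1) powr p * (LINT x|\<mu>. \<bar>f x\<bar> powr p)"
      by (rule S(2)) (use C(1) f(1) in auto)
    finally show ?thesis .
  qed
  then show ?thesis using that[of "(C + 1) powr p"] by simp
qed

lemma powr_add_le:
  assumes "1 \<le> p" shows "\<bar>a + b :: real\<bar> powr p \<le> 3 powr p * (\<bar>a\<bar> powr p + \<bar>b\<bar> powr p)"
  using powr_three[OF assms, of a b 0] by simp

lemma integrable_powr_add:
  fixes f h :: "'a \<Rightarrow> real"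
  assumes p: "1 \<le> p" and m: "f \<in> borel_measurable \<mu>" "h \<in> borel_measurable \<mu>"
    and i: "integrable \<mu> (\<lambda>x. \<bar>f x\<bar> powr p)" "integrable \<mu> (\<lambda>x. \<bar>h x\<bar> powr p)"
  shows "integrable \<mu> (\<lambda>x. \<bar>f x + h x\<bar> powr p)"
proof (rule Bochner_Integration.integrable_bound)
  show "integrable \<mu> (\<lambda>x. 3 powr p * (\<bar>f x\<bar> powr p + \<bar>h x\<bar> powr p))" using i by simp
  show "AE x in \<mu>. norm (\<bar>f x + h x\<bar> powr p) \<le> norm (3 powr p * (\<bar>f x\<bar> powr p + \<bar>h x\<bar> powr p))"
    using powr_add_le[OF p] by (auto intro!: AE_I2)
qed (use m in measurable)

lemma integrable_powr_continuous:
  fixes f :: "'a \<Rightarrow> real"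
  assumes p: "1 \<le> p" and f: "cont f"
  shows "integrable \<mu> (\<lambda>x. \<bar>f x\<bar> powr p)"
  using p by (intro integrable_continuous continuous_on_powr' continuous_intros f) auto

lemma integrable_powr_imp:
  fixes f :: "'a \<Rightarrow> real"
  assumes p: "1 \<le> p" and f: "f \<in> borel_measurable \<mu>" "integrable \<mu> (\<lambda>x. \<bar>f x\<bar> powr p)"
  shows "integrable \<mu> f"
proof (rule Bochner_Integration.integrable_bound)
  show "integrable \<mu> (\<lambda>x. 1 + \<bar>f x\<bar> powr p)" using f by simp
  show "AE x in \<mu>. norm (f x) \<le> norm (1 + \<bar>f x\<bar> powr p)"
  proof (rule AE_I2)
    fix x
    show "norm (f x) \<le> norm (1 + \<bar>f x\<bar> powr p)"
    proof (cases "\<bar>f x\<bar> \<le> 1")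
      case False
      then have "\<bar>f x\<bar> powr 1 \<le> \<bar>f x\<bar> powr p" using p by (intro powr_mono) auto
      then show ?thesis by simp
    qed (simp add: add_increasing2)
  qed
qed (use f in auto)

definition clip :: "real \<Rightarrow> real \<Rightarrow> real" where
  "clip R s = max (- R) (min R s)"

lemma clip_bounds: "0 \<le> R \<Longrightarrow> \<bar>clip R s\<bar> \<le> R" "0 \<le> R \<Longrightarrow> \<bar>clip R s\<bar> \<le> \<bar>s\<bar>"
  "\<bar>s\<bar> \<le> R \<Longrightarrow> clip R s = s" "0 \<le> R \<Longrightarrow> \<bar>clip R s - clip R t\<bar> \<le> \<bar>s - t\<bar>" "0 \<le> R \<Longrightarrow> \<bar>s - clip R s\<bar> \<le> \<bar>s\<bar>"
  by (auto simp: clip_def)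

text \<open>Truncate \<open>f\<close> to a bounded function and approximate that in \<open>L\<^sub>2\<close> by a combination of
  eigenfunctions, truncated at the same height. For functions bounded by \<open>R\<close> smallness
  in \<open>L\<^sub>2\<close> implies smallness in \<open>L\<^sub>p\<close>: where the difference exceeds \<open>s\<close>, its \<open>p\<close>-th
  power is at most a multiple of its square.\<close>

lemma continuous_dense_Lp:
  fixes f :: "'a \<Rightarrow> real"
  assumes p: "1 \<le> p" and f: "f \<in> borel_measurable \<mu>" "integrable \<mu> (\<lambda>x. \<bar>f x\<bar> powr p)" and e: "0 < e"
  shows "\<exists>w. cont w \<and> (LINT x|\<mu>. \<bar>f x - w x\<bar> powr p) < e"
proof -
  define e1 where "e1 = e / (3 powr p * 3)"
  have e1: "0 < e1" "3 powr p * (2 * e1) < e" using e by (auto simp: e1_def field_simps)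
  have clip_m[measurable]: "clip R \<in> borel_measurable borel" for R unfolding clip_def[abs_def] by measurable
  note f(1)[measurable]
  have "(\<lambda>k. LINT x|\<mu>. \<bar>f x - clip (real k) (f x)\<bar> powr p) \<longlonglongrightarrow> (LINT x|\<mu>. 0)"
  proof (rule integral_dominated_convergence[where w = "\<lambda>x. \<bar>f x\<bar> powr p"])
    show "AE x in \<mu>. (\<lambda>k. \<bar>f x - clip (real k) (f x)\<bar> powr p) \<longlonglongrightarrow> 0"
    proof (rule AE_I2, rule tendsto_eventually)
      fix x
      obtain k0 where "\<bar>f x\<bar> \<le> real k0" using real_arch_simple by blast
      then show "\<forall>\<^sub>F k in sequentially. \<bar>f x - clip (real k) (f x)\<bar> powr p = 0"
        unfolding eventually_sequentially by (intro exI[of _ k0]) (auto simp: clip_bounds)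
    qed
    show "AE x in \<mu>. norm (\<bar>f x - clip (real k) (f x)\<bar> powr p) \<le> \<bar>f x\<bar> powr p" for k
      using p by (auto intro!: AE_I2 powr_mono2 clip_bounds)
  qed (use f in auto)
  then have "eventually (\<lambda>k. (LINT x|\<mu>. \<bar>f x - clip (real k) (f x)\<bar> powr p) < e1) sequentially"
    using e1 by (intro order_tendstoD(2)) auto
  then obtain k where k: "(LINT x|\<mu>. \<bar>f x - clip (real k) (f x)\<bar> powr p) < e1"
    using eventually_sequentially by auto
  define R where "R = real k"
  have R: "0 \<le> R" by (simp add: R_def)
  define fR where "fR x = clip R (f x)" for x
  have fR: "fR \<in> borel_measurable \<mu>" "\<And>x. \<bar>fR x\<bar> \<le> R" unfolding fR_def using R by (auto simp: clip_bounds)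
  note fR(1)[measurable]
  have fRi: "integrable \<mu> fR" by (rule integrable_const_bound[of _ R]) (use fR in auto)
  have fR2: "integrable \<mu> (\<lambda>x. (fR x)\<^sup>2)"
    by (rule integrable_const_bound[of _ "R\<^sup>2"]) (use fR R in \<open>auto simp: abs_le_square_iff[symmetric]\<close>)
  define V where "V = measure \<mu> (space \<mu>) + 1"
  have V: "0 < V" "measure \<mu> (space \<mu>) < V" by (auto simp: V_def add_pos_nonneg add_nonneg_pos)
  \<comment> \<open>Differences of size at most \<open>s\<close> contribute at most \<open>e1 / 2\<close>.\<close>
  define s where "s = (e1 / (2 * V)) powr (1 / p)"
  have s: "0 < s" "s powr p = e1 / (2 * V)" using e1 V p by (auto simp: s_def powr_powr)
  define Q where "Q = (2 * R) powr p / s\<^sup>2"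
  have Q: "0 \<le> Q" by (simp add: Q_def)
  have "(\<lambda>N. Q * (LINT x|\<mu>. (fR x - comb N (coef fR) x)\<^sup>2)) \<longlonglongrightarrow> Q * 0"
    using complete[OF fR(1) fR2] unfolding coef_def[abs_def] by (intro tendsto_intros)
  then have "eventually (\<lambda>N. Q * (LINT x|\<mu>. (fR x - comb N (coef fR) x)\<^sup>2) < e1 / 2) sequentially"
    using e1 by (intro order_tendstoD(2)) auto
  then obtain N where N: "Q * (LINT x|\<mu>. (fR x - comb N (coef fR) x)\<^sup>2) < e1 / 2"
    using eventually_sequentially by auto
  define v where "v = comb N (coef fR)"
  have vc: "cont v" unfolding v_def by (rule comb_continuous)
  note N = N[folded v_def]
  define w where "w x = clip R (v x)" for x
  have wc: "cont w" unfolding w_def clip_def by (intro continuous_intros vc)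
  have wm[measurable]: "w \<in> borel_measurable \<mu>" by (rule borel_measurable_continuous[OF wc])
  have fRc: "fR x = clip R (fR x)" for x using fR(2)[of x] by (simp add: clip_bounds)
  have pt: "\<bar>fR x - w x\<bar> powr p \<le> s powr p + Q * (fR x - v x)\<^sup>2" for x
  proof (cases "\<bar>fR x - w x\<bar> \<le> s")
    case True
    then have "\<bar>fR x - w x\<bar> powr p \<le> s powr p" using p by (intro powr_mono2) auto
    then show ?thesis using Q by (simp add: add_increasing2)
  next
    case False
    have "\<bar>fR x - w x\<bar> \<le> 2 * R" using fR(2)[of x] clip_bounds(1)[OF R, of "v x"] by (simp add: w_def)
    then have 1: "\<bar>fR x - w x\<bar> powr p \<le> (2 * R) powr p" using p by (intro powr_mono2) auto
    have "s \<le> \<bar>fR x - v x\<bar>"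
      using False clip_bounds(4)[OF R, of "fR x" "v x"] fRc[of x] by (simp add: w_def)
    then have "s\<^sup>2 \<le> (fR x - v x)\<^sup>2" using s(1) by (simp add: abs_le_square_iff[symmetric])
    then have "(2 * R) powr p * s\<^sup>2 \<le> (2 * R) powr p * (fR x - v x)\<^sup>2" by (intro mult_left_mono) auto
    then have "(2 * R) powr p \<le> Q * (fR x - v x)\<^sup>2" using s(1) by (simp add: Q_def pos_le_divide_eq)
    with 1 show ?thesis by (simp add: add_increasing)
  qed
  have sq: "integrable \<mu> (\<lambda>x. (fR x - v x)\<^sup>2)"
  proof -
    have "(\<lambda>y. (fR y - v y)\<^sup>2) = (\<lambda>y. (fR y)\<^sup>2 - 2 * (fR y * v y) + (v y)\<^sup>2)"
      by (auto simp: power2_eq_square algebra_simps)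
    then show ?thesis
      using fR2 integrable_mult_continuous[OF fRi vc]
        integrable_continuous[OF continuous_on_power[OF vc, of 2]] by simp
  qed
  have ip: "integrable \<mu> (\<lambda>x. \<bar>fR x - w x\<bar> powr p)"
    by (rule Bochner_Integration.integrable_bound[of \<mu> "\<lambda>x. s powr p + Q * (fR x - v x)\<^sup>2"])
      (use sq order_trans[OF pt abs_ge_self] in auto)
  have "(LINT x|\<mu>. \<bar>fR x - w x\<bar> powr p) \<le> (LINT x|\<mu>. s powr p + Q * (fR x - v x)\<^sup>2)"
    by (intro integral_mono pt ip) (use sq in auto)
  also have "\<dots> = s powr p * measure \<mu> (space \<mu>) + Q * (LINT x|\<mu>. (fR x - v x)\<^sup>2)"
    using sq by simp
  also have "s powr p * measure \<mu> (space \<mu>) \<le> s powr p * V" using V by (intro mult_left_mono) auto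
  also have "s powr p * V = e1 / 2" using V s by simp
  finally have b2: "(LINT x|\<mu>. \<bar>fR x - w x\<bar> powr p) \<le> e1" using N by simp
  have i1: "integrable \<mu> (\<lambda>x. \<bar>f x - fR x\<bar> powr p)"
    by (rule Bochner_Integration.integrable_bound[OF f(2)])
      (use p R in \<open>auto intro!: AE_I2 powr_mono2 clip_bounds simp: fR_def\<close>)
  have "(LINT x|\<mu>. \<bar>f x - w x\<bar> powr p) \<le> (LINT x|\<mu>. 3 powr p * (\<bar>f x - fR x\<bar> powr p + \<bar>fR x - w x\<bar> powr p))"
  proof (rule integral_mono)
    show "integrable \<mu> (\<lambda>x. \<bar>f x - w x\<bar> powr p)"
      using integrable_powr_add[OF p _ _ i1 ip] by simp
    show "\<bar>f x - w x\<bar> powr p \<le> 3 powr p * (\<bar>f x - fR x\<bar> powr p + \<bar>fR x - w x\<bar> powr p)" for x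
      using powr_add_le[OF p, of "f x - fR x" "fR x - w x"] by simp
  qed (use i1 ip in auto)
  also have "\<dots> = 3 powr p * ((LINT x|\<mu>. \<bar>f x - fR x\<bar> powr p) + (LINT x|\<mu>. \<bar>fR x - w x\<bar> powr p))"
    using i1 ip by simp
  also have "\<dots> \<le> 3 powr p * (2 * e1)"
    using k b2 by (intro mult_left_mono) (auto simp: fR_def R_def)
  finally show ?thesis using wc e1 by (intro exI[of _ w]) auto
qed

text \<open>Approximate \<open>f\<close> by a continuous function, for which the convergence is uniform; the
  operators are uniformly bounded on the remainder.\<close>

lemma multop_Lp_converges:
  fixes f :: "'a \<Rightarrow> real"
  assumes \<phi>: "approx_id \<phi>" and p: "1 \<le> p" and f: "f \<in> borel_measurable \<mu>" "integrable \<mu> (\<lambda>x. \<bar>f x\<bar> powr p)"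
  shows "(\<lambda>j. LINT x|\<mu>. \<bar>multop \<phi> (1 / 2 ^ j) f x - f x\<bar> powr p) \<longlonglongrightarrow> 0"
proof (rule LIMSEQ_I)
  fix e :: real assume e: "0 < e"
  have b\<phi>: "bump_symbol \<phi>" using \<phi> by (simp add: approx_id_def)
  obtain C where C0: "0 \<le> C" and C1: "\<forall>\<epsilon> f. 0 < \<epsilon> \<longrightarrow> \<epsilon> \<le> 1 \<longrightarrow> integrable \<mu> f \<longrightarrow> integrable \<mu> (\<lambda>x. \<bar>f x\<bar> powr p) \<longrightarrow>
    (LINT x|\<mu>. \<bar>multop \<phi> \<epsilon> f x\<bar> powr p) \<le> C * (LINT x|\<mu>. \<bar>f x\<bar> powr p)"
    by (rule multop_Lp_bound[OF b\<phi> p])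
  define V where "V = measure \<mu> (space \<mu>) + 1"
  have V: "0 < V" "measure \<mu> (space \<mu>) \<le> V" by (auto simp: V_def add_nonneg_pos)
  define A where "A = 3 powr p * (C + 2)"
  have A: "0 < A" using C0 by (simp add: A_def)
  define d where "d = e / (2 * A)"
  have d: "0 < d" "A * d < e" using A e by (auto simp: d_def field_simps)
  define s where "s = (d / V) powr (1 / p)"
  have s: "0 < s" "s powr p = d / V" using d V p by (auto simp: s_def powr_powr)
  obtain w where w: "cont w" "(LINT x|\<mu>. \<bar>f x - w x\<bar> powr p) < d"
    using continuous_dense_Lp[OF p f d(1)] by blast
  have wm: "w \<in> borel_measurable \<mu>" by (rule borel_measurable_continuous[OF w(1)])
  have fi: "integrable \<mu> f" by (rule integrable_powr_imp[OF p f])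
  have wi: "integrable \<mu> w" by (rule integrable_continuous[OF w(1)])
  define h where "h x = f x - w x" for x
  have hi: "integrable \<mu> h" unfolding h_def using fi wi by simp
  have hp: "integrable \<mu> (\<lambda>x. \<bar>h x\<bar> powr p)"
    using integrable_powr_add[OF p f(1), of "\<lambda>x. - w x"] wm f(2) integrable_powr_continuous[OF p w(1)] by (simp add: h_def)
  obtain J where J: "\<And>j x. j \<ge> J \<Longrightarrow> \<bar>multop \<phi> (1 / 2 ^ j) w x - w x\<bar> < s"
    using multop_uniform[OF \<phi> w(1) s(1)] unfolding eventually_sequentially by blast
  have "norm ((LINT x|\<mu>. \<bar>multop \<phi> (1 / 2 ^ j) f x - f x\<bar> powr p) - 0) < e" if j: "j \<ge> J" for j
  proof -
    let ?\<epsilon> = "1 / 2 ^ j :: real"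
    have \<epsilon>: "0 < ?\<epsilon>" "?\<epsilon> \<le> 1" by auto
    have Tc: "cont (multop \<phi> ?\<epsilon> k)" for k by (rule multop_continuous)
    have i1: "integrable \<mu> (\<lambda>x. \<bar>multop \<phi> ?\<epsilon> h x\<bar> powr p)" by (rule integrable_powr_continuous[OF p Tc])
    have b1: "(LINT x|\<mu>. \<bar>multop \<phi> ?\<epsilon> h x\<bar> powr p) \<le> C * (LINT x|\<mu>. \<bar>h x\<bar> powr p)"
      using C1 \<epsilon> hi hp by blast
    have "(LINT x|\<mu>. \<bar>multop \<phi> ?\<epsilon> f x - f x\<bar> powr p) \<le> (LINT x|\<mu>. 3 powr p * (\<bar>multop \<phi> ?\<epsilon> h x\<bar> powr p + s powr p + \<bar>h x\<bar> powr p))"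
    proof (rule integral_mono)
      show "integrable \<mu> (\<lambda>x. \<bar>multop \<phi> ?\<epsilon> f x - f x\<bar> powr p)"
        using integrable_powr_add[OF p borel_measurable_continuous[OF Tc], of "\<lambda>x. - f x"] f integrable_powr_continuous[OF p Tc] by simp
      fix x
      have "multop \<phi> ?\<epsilon> f x - f x = multop \<phi> ?\<epsilon> h x + (multop \<phi> ?\<epsilon> w x - w x) + - h x"
        using multop_diff[OF fi wi, of \<phi> ?\<epsilon> x] by (simp add: h_def[abs_def])
      then have "\<bar>multop \<phi> ?\<epsilon> f x - f x\<bar> powr p \<le> 3 powr p * (\<bar>multop \<phi> ?\<epsilon> h x\<bar> powr p + \<bar>multop \<phi> ?\<epsilon> w x - w x\<bar> powr p + \<bar>h x\<bar> powr p)"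
        using powr_three[OF p, of "multop \<phi> ?\<epsilon> h x" "multop \<phi> ?\<epsilon> w x - w x" "- h x"] by simp
      also have "\<dots> \<le> 3 powr p * (\<bar>multop \<phi> ?\<epsilon> h x\<bar> powr p + s powr p + \<bar>h x\<bar> powr p)"
        using J[OF j, of x] p by (intro mult_left_mono add_mono powr_mono2) auto
      finally show "\<bar>multop \<phi> ?\<epsilon> f x - f x\<bar> powr p \<le> 3 powr p * (\<bar>multop \<phi> ?\<epsilon> h x\<bar> powr p + s powr p + \<bar>h x\<bar> powr p)" .
    qed (use i1 hp in auto)
    also have "\<dots> = 3 powr p * ((LINT x|\<mu>. \<bar>multop \<phi> ?\<epsilon> h x\<bar> powr p) + s powr p * measure \<mu> (space \<mu>) + (LINT x|\<mu>. \<bar>h x\<bar> powr p))"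
      using i1 hp by simp
    also have "\<dots> \<le> 3 powr p * (C * d + d + d)"
    proof (intro mult_left_mono add_mono)
      have "C * (LINT x|\<mu>. \<bar>h x\<bar> powr p) \<le> C * d" using w(2) C0 by (intro mult_left_mono) (auto simp: h_def)
      with b1 show "(LINT x|\<mu>. \<bar>multop \<phi> ?\<epsilon> h x\<bar> powr p) \<le> C * d" by linarith
      have "s powr p * measure \<mu> (space \<mu>) \<le> d / V * V" unfolding s(2) using V d by (intro mult_left_mono) auto
      then show "s powr p * measure \<mu> (space \<mu>) \<le> d" using V by simp
    qed (use w(2) in \<open>auto simp: h_def\<close>)
    also have "\<dots> = A * d" by (simp add: A_def algebra_simps)
    finally have "(LINT x|\<mu>. \<bar>multop \<phi> ?\<epsilon> f x - f x\<bar> powr p) < e" using d(2) by linarith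
    then show ?thesis by simp
  qed
  then show "\<exists>no. \<forall>j\<ge>no. norm ((LINT x|\<mu>. \<bar>multop \<phi> (1 / 2 ^ j) f x - f x\<bar> powr p) - 0) < e" by blast
qed

end

section \<open>Partial derivatives\<close>

lemma axis_Basis: "axis i (1::real) \<in> Basis"
  by (simp add: axis_in_Basis_iff)

lemma smooth_on_has_derivative:
  "open S \<Longrightarrow> smooth_on f S \<Longrightarrow> x \<in> S \<Longrightarrow> (f has_derivative frechet_derivative f (at x)) (at x)"
  unfolding smooth_on_def using Ck_on_SucD by blast

lemma smooth_on_partial:
  assumes "smooth_on f S" shows "smooth_on (partial i f) S"
  unfolding smooth_on_def
proof
  fix k
  have "Ck_on (Suc k) f S" using assms by (simp add: smooth_on_def)
  then have "Ck_on k (\<lambda>x. frechet_derivative f (at x) (axis i 1)) S" using axis_Basis[of i] by auto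
  then show "Ck_on k (partial i f) S" by (simp add: partial_def[abs_def])
qed

lemma smooth_on_continuous: "smooth_on f S \<Longrightarrow> continuous_on S f"
  unfolding smooth_on_def using Ck_on_imp_continuous by blast

lemma partial_eqI: "(f has_derivative f') (at x) \<Longrightarrow> partial i f x = f' (axis i 1)"
  unfolding partial_def using frechet_derivative_at by metis

lemma partial_cong:
  assumes "open S" "x \<in> S" "smooth_on f S" "\<And>y. y \<in> S \<Longrightarrow> f y = h y"
  shows "partial i f x = partial i h x"
proof -
  have "(f has_derivative frechet_derivative f (at x)) (at x)" by (rule smooth_on_has_derivative[OF assms(1,3,2)])
  then have "(h has_derivative frechet_derivative f (at x)) (at x)"
    by (rule has_derivative_transform_within_open[OF _ assms(1,2)]) (use assms(4) in auto)
  then show ?thesis using partial_eqI by (metis partial_def)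
qed

lemma partial_add:
  assumes "open S" "x \<in> S" "smooth_on f S" "smooth_on h S"
  shows "partial i (\<lambda>y. f y + h y) x = partial i f x + partial i h x"
  unfolding partial_def[of i f] partial_def[of i h]
  by (rule partial_eqI[OF has_derivative_add]) (intro smooth_on_has_derivative[OF assms(1)] assms)+

lemma partial_mult:
  fixes f h :: "real^'n::finite \<Rightarrow> real"
  assumes "open S" "x \<in> S" "smooth_on f S" "smooth_on h S"
  shows "partial i (\<lambda>y. f y * h y) x = f x * partial i h x + h x * partial i f x"
proof -
  have "((\<lambda>y. f y * h y) has_derivative (\<lambda>v. f x * frechet_derivative h (at x) v + frechet_derivative f (at x) v * h x)) (at x)"
    by (intro has_derivative_mult smooth_on_has_derivative[OF assms(1)] assms)
  from partial_eqI[OF this, of i] show ?thesis by (simp add: partial_def mult.commute)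
qed

lemma partial_const: "partial i (\<lambda>y. c) x = 0"
  by (rule partial_eqI) (rule has_derivative_const)

lemma partial_of_real:
  assumes "open S" "x \<in> S" "smooth_on f S"
  shows "partial i (\<lambda>y. of_real (f y) :: complex) x = of_real (partial i f x)"
proof -
  have "((\<lambda>y. of_real (f y) :: complex) has_derivative (\<lambda>v. of_real (frechet_derivative f (at x) v))) (at x)"
    by (rule bounded_linear.has_derivative[OF bounded_linear_of_real smooth_on_has_derivative[OF assms(1,3,2)]])
  from partial_eqI[OF this, of i] show ?thesis by (simp add: partial_def)
qed

lemma partial_compose:
  fixes \<eta> :: "real \<Rightarrow> real"
  assumes "open S" "x \<in> S" "smooth_on f S" "(\<eta> has_real_derivative d) (at (f x))"
  shows "partial i (\<lambda>y. \<eta> (f y)) x = d * partial i f x"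
proof -
  have "((\<lambda>y. \<eta> (f y)) has_derivative (\<lambda>v. d * frechet_derivative f (at x) v)) (at x)"
    using has_derivative_compose[OF smooth_on_has_derivative[OF assms(1,3,2)] assms(4)[unfolded has_field_derivative_def]] .
  from partial_eqI[OF this, of i] show ?thesis by (simp add: partial_def)
qed

lemma partial_linear: "partial i (\<lambda>y. y \<bullet> \<xi>) x = \<xi> $ i"
proof -
  have "((\<lambda>y. y \<bullet> \<xi>) has_derivative (\<lambda>v. v \<bullet> \<xi>)) (at x)"
    by (rule bounded_linear_imp_has_derivative[OF bounded_linear_inner_left])
  from partial_eqI[OF this, of i] show ?thesis by (simp add: inner_axis' )
qed

section \<open>Second order operators in coordinates\<close>

text \<open>A second order operator with coefficients frozen at the point where it is evaluated, so
  that \<open>a\<close>, \<open>b\<close>, \<open>e\<close> are numbers.\<close>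

definition dop :: "('n::finite \<Rightarrow> 'n \<Rightarrow> real) \<Rightarrow> ('n \<Rightarrow> real) \<Rightarrow> real \<Rightarrow> (real^'n \<Rightarrow> real) \<Rightarrow> real^'n \<Rightarrow> real" where
  "dop a b e f x = (\<Sum>i\<in>UNIV. \<Sum>j\<in>UNIV. a i j * partial i (partial j f) x) + (\<Sum>i\<in>UNIV. b i * partial i f x) + e * f x"

text \<open>The principal symbol, polarised and evaluated on the differentials of \<open>f\<close> and \<open>h\<close>. Both
  orders of the indices occur because \<open>a\<close> may be any matrix.\<close>

definition symb :: "('n::finite \<Rightarrow> 'n \<Rightarrow> real) \<Rightarrow> (real^'n \<Rightarrow> real) \<Rightarrow> (real^'n \<Rightarrow> real) \<Rightarrow> real^'n \<Rightarrow> real" where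
  "symb a f h x = (\<Sum>i\<in>UNIV. \<Sum>j\<in>UNIV. a i j * (partial i f x * partial j h x + partial j f x * partial i h x))"

lemma dop_const: "dop a b e (\<lambda>_. c) x = e * c"
  unfolding dop_def partial_const by (simp add: partial_const[abs_def] partial_const)

lemma dop_add:
  assumes S: "open S" "x \<in> S" and f: "smooth_on f S" and h: "smooth_on h S"
  shows "dop a b e (\<lambda>y. f y + h y) x = dop a b e f x + dop a b e h x"
proof -
  have "partial i (partial j (\<lambda>y. f y + h y)) x = partial i (partial j f) x + partial i (partial j h) x" for i j
  proof -
    have "partial i (partial j (\<lambda>y. f y + h y)) x = partial i (\<lambda>y. partial j f y + partial j h y) x"
      by (rule partial_cong[OF S]) (auto intro!: smooth_on_partial smooth_on_add S f h simp: partial_add[OF S(1) _ f h])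
    also have "\<dots> = partial i (partial j f) x + partial i (partial j h) x"
      by (rule partial_add[OF S]) (intro smooth_on_partial f h)+
    finally show ?thesis .
  qed
  then show ?thesis
    unfolding dop_def partial_add[OF S f h] by (simp add: sum.distrib algebra_simps)
qed

lemma dop_mult:
  assumes S: "open S" "x \<in> S" and f: "smooth_on f S" and h: "smooth_on h S"
  shows "dop a b e (\<lambda>y. f y * h y) x = f x * dop a b e h x + h x * dop a b e f x + symb a f h x - e * (f x * h x)"
proof -
  have pp: "partial i (partial j (\<lambda>y. f y * h y)) x = f x * partial i (partial j h) x + h x * partial i (partial j f) x
     + (partial i f x * partial j h x + partial j f x * partial i h x)" for i j
  proof -
    have sp: "smooth_on (partial j f) S" "smooth_on (partial j h) S" by (intro smooth_on_partial f h)+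
    have "partial i (partial j (\<lambda>y. f y * h y)) x = partial i (\<lambda>y. f y * partial j h y + h y * partial j f y) x"
      by (rule partial_cong[OF S]) (auto intro!: smooth_on_partial smooth_on_mult S f h simp: partial_mult[OF S(1) _ f h])
    also have "\<dots> = partial i (\<lambda>y. f y * partial j h y) x + partial i (\<lambda>y. h y * partial j f y) x"
      by (rule partial_add[OF S]) (intro smooth_on_mult f h sp S)+
    also have "\<dots> = (f x * partial i (partial j h) x + partial j h x * partial i f x) + (h x * partial i (partial j f) x + partial j f x * partial i h x)"
      unfolding partial_mult[OF S f sp(2)] partial_mult[OF S h sp(1)] ..
    finally show ?thesis by (simp add: algebra_simps)
  qed
  have 1: "(\<Sum>i\<in>UNIV. \<Sum>j\<in>UNIV. a i j * partial i (partial j (\<lambda>y. f y * h y)) x) =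
    f x * (\<Sum>i\<in>UNIV. \<Sum>j\<in>UNIV. a i j * partial i (partial j h) x) + h x * (\<Sum>i\<in>UNIV. \<Sum>j\<in>UNIV. a i j * partial i (partial j f) x) + symb a f h x"
    unfolding pp symb_def sum_distrib_left sum.distrib[symmetric] by (intro sum.cong refl) (simp add: algebra_simps)
  have 2: "(\<Sum>i\<in>UNIV. b i * partial i (\<lambda>y. f y * h y) x) = f x * (\<Sum>i\<in>UNIV. b i * partial i h x) + h x * (\<Sum>i\<in>UNIV. b i * partial i f x)"
    unfolding partial_mult[OF S f h] sum_distrib_left sum.distrib[symmetric] by (intro sum.cong refl) (simp add: algebra_simps)
  show ?thesis unfolding dop_def 1 2 by (simp add: algebra_simps)
qed

lemma symb_mult:
  assumes S: "open S" "x \<in> S" and f: "smooth_on f S" and h: "smooth_on h S"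
  shows "symb a (\<lambda>y. f y * h y) k x = f x * symb a h k x + h x * symb a f k x"
  unfolding symb_def partial_mult[OF S f h] sum_distrib_left sum.distrib[symmetric]
  by (intro sum.cong refl) (simp add: algebra_simps)

section \<open>Smooth functions on a manifold\<close>

text \<open>The square root is not smooth at \<open>0\<close>, but \<open>g\<close> is constant on \<open>[0, 1]\<close>.\<close>

lemma smooth_sqrt_cutoff:
  assumes g: "cutoff g"
  shows "smooth_on (\<lambda>s. g (sqrt \<bar>s\<bar>)) UNIV" "\<And>s. \<bar>s\<bar> \<le> 1 \<Longrightarrow> g (sqrt \<bar>s\<bar>) = 1" "\<And>s. \<bar>s\<bar> > 4 \<Longrightarrow> g (sqrt \<bar>s\<bar>) = 0"
    "\<And>s. 0 \<le> g (sqrt \<bar>s\<bar>)" "\<And>s. g (sqrt \<bar>s\<bar>) \<le> 1"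
proof -
  have gs: "smooth_on g {0<..}" and g1: "\<And>x. x \<in> {0..1} \<Longrightarrow> g x = 1" and g01: "\<And>x. x \<ge> 0 \<Longrightarrow> 0 \<le> g x \<and> g x \<le> 1"
    and g0: "closure {x. x \<ge> 0 \<and> g x \<noteq> 0} \<subseteq> {0..2}"
    using g by (auto simp: cutoff_def)
  have g2: "g x = 0" if "x > 2" for x
  proof (rule ccontr)
    assume "g x \<noteq> 0"
    then have "x \<in> closure {x. x \<ge> 0 \<and> g x \<noteq> 0}" using that by (intro subsetD[OF closure_subset]) auto
    then show False using g0 that by auto
  qed
  have 1: "smooth_on (\<lambda>s. g (sqrt \<bar>s\<bar>)) {0<..}"
  proof (rule smooth_on_cong)
    show "smooth_on (\<lambda>s. g (sqrt s)) {0<..}" by (rule smooth_on_compose[OF _ _ _ gs smooth_on_sqrt]) auto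
  qed auto
  have 2: "smooth_on (\<lambda>s. g (sqrt \<bar>s\<bar>)) {..<0}"
  proof (rule smooth_on_cong)
    show "smooth_on (\<lambda>s. g (sqrt (- s))) {..<0}"
      by (rule smooth_on_compose[OF _ _ _ gs smooth_on_compose[OF _ _ _ smooth_on_sqrt smooth_on_bounded_linear[OF _ bounded_linear_minus[OF bounded_linear_ident] smooth_on_id]]]) auto
  qed auto
  have 3: "smooth_on (\<lambda>s. g (sqrt \<bar>s\<bar>)) {-1<..<1}"
    by (rule smooth_on_cong[OF _ smooth_on_const[of 1]]) (auto intro!: g1)
  have "{0<..} \<union> {..<0} \<union> {-1<..<1} = (UNIV :: real set)" by auto
  then show "smooth_on (\<lambda>s. g (sqrt \<bar>s\<bar>)) UNIV" using smooth_on_Un[OF _ _ smooth_on_Un[OF _ _ 1 2] 3] by (simp add: open_Un)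
  show "g (sqrt \<bar>s\<bar>) = 1" if "\<bar>s\<bar> \<le> 1" for s using that by (intro g1) auto
  show "g (sqrt \<bar>s\<bar>) = 0" if "\<bar>s\<bar> > 4" for s
  proof (rule g2)
    have "sqrt 4 < sqrt \<bar>s\<bar>" using that by (simp only: real_sqrt_less_iff)
    then show "2 < sqrt \<bar>s\<bar>" by simp
  qed
  show "0 \<le> g (sqrt \<bar>s\<bar>)" "g (sqrt \<bar>s\<bar>) \<le> 1" for s using g01[of "sqrt \<bar>s\<bar>"] by auto
qed

text \<open>The given cutoff function also supplies bump functions.\<close>

lemma smooth_bump:
  fixes a :: "'a::euclidean_space"
  assumes g: "cutoff g" and r: "0 < r"
  defines "\<beta> \<equiv> \<lambda>z. g (sqrt \<bar>(z - a) \<bullet> (z - a) / r\<^sup>2\<bar>)"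
  shows "smooth_on \<beta> UNIV" "\<And>z. z \<in> cball a r \<Longrightarrow> \<beta> z = 1" "\<And>z. z \<notin> cball a (2 * r) \<Longrightarrow> \<beta> z = 0" "\<And>z. 0 \<le> \<beta> z"
proof -
  note G = smooth_sqrt_cutoff[OF g]
  have "smooth_on (\<lambda>z. (z - a) \<bullet> (z - a) / r\<^sup>2) UNIV"
    by (rule smooth_on_bounded_linear[OF _ bounded_linear_divide smooth_on_inner]) auto
  then show "smooth_on \<beta> UNIV" unfolding \<beta>_def by (intro smooth_on_compose[OF _ _ _ G(1)]) auto
  have e: "(z - a) \<bullet> (z - a) / r\<^sup>2 = (dist a z / r)\<^sup>2" for z
    unfolding dist_commute[of a] by (simp add: dist_norm power2_norm_eq_inner power_divide)
  show "\<beta> z = 1" if "z \<in> cball a r" for z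
    unfolding \<beta>_def e by (rule G(2)) (use that r in \<open>auto simp: power_le_one_iff abs_square_le_1\<close>)
  show "\<beta> z = 0" if "z \<notin> cball a (2 * r)" for z
    unfolding \<beta>_def e
  proof (rule G(3))
    have "2 < dist a z / r" using that r by (simp add: pos_less_divide_eq)
    then have "2\<^sup>2 < (dist a z / r)\<^sup>2" by (intro power_strict_mono) auto
    then show "4 < \<bar>(dist a z / r)\<^sup>2\<bar>" by simp
  qed
  show "0 \<le> \<beta> z" for z unfolding \<beta>_def by (rule G(4))
qed

locale atlas =
  fixes A :: "('m::{t2_space, second_countable_topology}, 'n::finite) chart set"
  assumes compact_M: "compact (UNIV :: 'm set)" and atlas: "smooth_atlas A"
begin

lemma chartD:
  assumes "c \<in> A"
  shows "open (fst c)" "open (coord_range c)" "continuous_on (fst c) (snd c)" "continuous_on (coord_range c) (coord_inv c)"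
    "\<And>y. y \<in> fst c \<Longrightarrow> snd c y \<in> coord_range c" "\<And>y. y \<in> fst c \<Longrightarrow> coord_inv c (snd c y) = y"
    "\<And>x. x \<in> coord_range c \<Longrightarrow> coord_inv c x \<in> fst c" "\<And>x. x \<in> coord_range c \<Longrightarrow> snd c (coord_inv c x) = x"
proof -
  have "is_chart c" using assms atlas by (simp add: smooth_atlas_def)
  then have "open (fst c)" "open (coord_range c)" and h: "homeomorphism (fst c) (coord_range c) (snd c) (coord_inv c)"
    by (auto simp: is_chart_def)
  then show "open (fst c)" "open (coord_range c)" by auto
  show "continuous_on (fst c) (snd c)" "continuous_on (coord_range c) (coord_inv c)" using h by (auto simp: homeomorphism_def)
  show "y \<in> fst c \<Longrightarrow> snd c y \<in> coord_range c" "y \<in> fst c \<Longrightarrow> coord_inv c (snd c y) = y" for y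
    using h by (auto simp: homeomorphism_def)
  show "x \<in> coord_range c \<Longrightarrow> coord_inv c x \<in> fst c" "x \<in> coord_range c \<Longrightarrow> snd c (coord_inv c x) = x" for x
    using h by (auto simp: homeomorphism_def)
qed

lemma chart_at: obtains c where "c \<in> A" "y \<in> fst c"
  using atlas unfolding smooth_atlas_def by blast

lemma chart_open_image:
  assumes c: "c \<in> A" and V: "open V"
  shows "open (snd c ` (fst c \<inter> V))" "open {x \<in> coord_range c. coord_inv c x \<in> V}"
proof -
  note C = chartD[OF c]
  show o: "open {x \<in> coord_range c. coord_inv c x \<in> V}"
  proof -
    have "open (coord_inv c -` V \<inter> coord_range c)"
      using continuous_on_open_vimage[OF C(2)] C(4) V by blast
    moreover have "coord_inv c -` V \<inter> coord_range c = {x \<in> coord_range c. coord_inv c x \<in> V}" by blast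
    ultimately show ?thesis by simp
  qed
  have "snd c ` (fst c \<inter> V) = {x \<in> coord_range c. coord_inv c x \<in> V}"
  proof (safe)
    fix x assume "x \<in> coord_range c" "coord_inv c x \<in> V"
    then show "x \<in> snd c ` (fst c \<inter> V)" using C(7,8) by (metis IntI image_eqI)
  qed (use C in auto)
  with o show "open (snd c ` (fst c \<inter> V))" by simp
qed

definition Cinf :: "('m \<Rightarrow> real) set" where "Cinf = {f. smooth_fun A f}"

lemma Cinf_D: "f \<in> Cinf \<Longrightarrow> c \<in> A \<Longrightarrow> smooth_on (\<lambda>x. f (coord_inv c x)) (coord_range c)"
  by (simp add: Cinf_def smooth_fun_def comp_def)

lemma Cinf_I: "(\<And>c. c \<in> A \<Longrightarrow> smooth_on (\<lambda>x. f (coord_inv c x)) (coord_range c)) \<Longrightarrow> f \<in> Cinf"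
  by (simp add: Cinf_def smooth_fun_def comp_def)

lemma Cinf_const: "(\<lambda>_. c) \<in> Cinf"
  by (rule Cinf_I) (rule smooth_on_const)

lemma Cinf_add: "f \<in> Cinf \<Longrightarrow> h \<in> Cinf \<Longrightarrow> (\<lambda>x. f x + h x) \<in> Cinf"
  by (rule Cinf_I) (intro smooth_on_add Cinf_D chartD)

lemma Cinf_mult: "f \<in> Cinf \<Longrightarrow> h \<in> Cinf \<Longrightarrow> (\<lambda>x. f x * h x) \<in> Cinf"
  by (rule Cinf_I) (intro smooth_on_mult Cinf_D chartD)

lemma Cinf_compose: "f \<in> Cinf \<Longrightarrow> open U \<Longrightarrow> range f \<subseteq> U \<Longrightarrow> smooth_on \<eta> U \<Longrightarrow> (\<lambda>x. \<eta> (f x) :: real) \<in> Cinf"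
  by (rule Cinf_I, rule smooth_on_compose[where U = U]) (auto intro: Cinf_D chartD)

lemma Cinf_sqrt: "f \<in> Cinf \<Longrightarrow> d > 0 \<Longrightarrow> (\<lambda>x. sqrt ((f x)\<^sup>2 + d\<^sup>2)) \<in> Cinf"
  unfolding power2_eq_square
  by (rule Cinf_compose[of _ "{0<..}"]) (auto intro: Cinf_add Cinf_mult Cinf_const smooth_on_sqrt simp: add_nonneg_pos)

lemma Cinf_complex: "f \<in> Cinf \<Longrightarrow> smooth_fun A (\<lambda>x. of_real (f x) :: complex)"
  unfolding smooth_fun_def comp_def
  by (intro ballI smooth_on_bounded_linear[OF _ bounded_linear_of_real] Cinf_D chartD)

lemma Cinf_continuous:
  assumes f: "f \<in> Cinf" shows "cont f"
proof -
  have "isCont f y" for y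
  proof -
    obtain c where c: "c \<in> A" "y \<in> fst c" by (rule chart_at)
    note C = chartD[OF c(1)]
    have "continuous_on (fst c) (\<lambda>y. f (coord_inv c (snd c y)))"
      by (rule continuous_on_compose2[OF smooth_on_continuous[OF Cinf_D[OF f c(1)]] C(3)]) (use C in auto)
    then have "continuous_on (fst c) f" by (rule continuous_on_eq) (use C in auto)
    then show ?thesis using c C(1) by (simp add: continuous_on_eq_continuous_at)
  qed
  then show ?thesis by (simp add: continuous_at_imp_continuous_on)
qed

text \<open>The image of \<open>K\<close> is compact, hence closed in the Hausdorff space, so the extension is
  smooth both on the chart domain and on the complement of this image.\<close>

lemma Cinf_extend:
  assumes c: "c \<in> A" and h: "smooth_on h (coord_range c)" and K: "compact K" "K \<subseteq> coord_range c"
    and z: "\<And>x. x \<in> coord_range c \<Longrightarrow> x \<notin> K \<Longrightarrow> h x = (0::real)"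
  shows "(\<lambda>y. if y \<in> fst c then h (snd c y) else 0) \<in> Cinf"
proof (rule Cinf_I)
  fix d assume d: "d \<in> A"
  note C = chartD[OF c] and D = chartD[OF d]
  let ?f = "\<lambda>y. if y \<in> fst c then h (snd c y) else 0"
  have "compact (coord_inv c ` K)" by (intro compact_continuous_image K continuous_on_subset[OF C(4)])
  then have cl: "open (- (coord_inv c ` K))" using compact_imp_closed by blast
  define U1 where "U1 = {x \<in> coord_range d. coord_inv d x \<in> fst c}"
  define U2 where "U2 = {x \<in> coord_range d. coord_inv d x \<in> - (coord_inv c ` K)}"
  have o: "open U1" "open U2" unfolding U1_def U2_def by (intro chart_open_image(2)[OF d] C cl)+
  have cov: "coord_range d = U1 \<union> U2" unfolding U1_def U2_def using K(2) C(7) by auto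
  have U1: "U1 = snd d ` (fst d \<inter> fst c)" unfolding U1_def
  proof safe
    fix x assume "x \<in> coord_range d" "coord_inv d x \<in> fst c"
    then show "x \<in> snd d ` (fst d \<inter> fst c)" using D(7,8) by (metis IntI image_eqI)
  qed (use D in auto)
  have "smooth_on (transition d c) U1" using atlas c d unfolding U1 smooth_atlas_def by blast
  then have t: "smooth_on (\<lambda>x. snd c (coord_inv d x)) U1" by (simp add: transition_def comp_def)
  have "smooth_on (\<lambda>x. h (snd c (coord_inv d x))) U1"
    by (rule smooth_on_compose[OF o(1) C(2) _ h t]) (use C in \<open>auto simp: U1_def\<close>)
  then have 1: "smooth_on (\<lambda>x. ?f (coord_inv d x)) U1"
    by (rule smooth_on_cong[OF o(1)]) (auto simp: U1_def)
  have 2: "smooth_on (\<lambda>x. ?f (coord_inv d x)) U2"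
  proof (rule smooth_on_cong[OF o(2) smooth_on_const[of 0]])
    fix x assume "x \<in> U2"
    then have "coord_inv d x \<in> fst c \<Longrightarrow> snd c (coord_inv d x) \<notin> K"
      unfolding U2_def using C(6) by (metis (no_types, lifting) ComplD image_eqI mem_Collect_eq)
    then show "0 = ?f (coord_inv d x)" using z C(5) by auto
  qed
  show "smooth_on (\<lambda>x. ?f (coord_inv d x)) (coord_range d)"
    unfolding cov by (rule smooth_on_Un[OF o 1 2])
qed

end

section \<open>A Nash inequality on convex sets\<close>

definition grad :: "(real^'n::finite \<Rightarrow> real) \<Rightarrow> real^'n \<Rightarrow> real^'n" where
  "grad f z = (\<chi> i. partial i f z)"

lemma derivative_grad:
  assumes "open S" "smooth_on f S" "z \<in> S"
  shows "(f has_derivative (\<lambda>v. v \<bullet> grad f z)) (at z)"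
proof -
  let ?D = "frechet_derivative f (at z)"
  have d: "(f has_derivative ?D) (at z)" by (rule smooth_on_has_derivative[OF assms])
  interpret bounded_linear ?D using d by (rule has_derivative_bounded_linear)
  have "?D v = v \<bullet> grad f z" for v
  proof -
    have "?D v = ?D (\<Sum>i\<in>UNIV. (v $ i) *\<^sub>R axis i 1)"
      using basis_expansion[of v] by (simp add: scalar_mult_eq_scaleR)
    also have "\<dots> = (\<Sum>i\<in>UNIV. v $ i * partial i f z)" by (simp add: sum scaleR partial_def)
    also have "\<dots> = v \<bullet> grad f z" by (simp add: inner_vec_def grad_def)
    finally show ?thesis .
  qed
  then have "?D = (\<lambda>v. v \<bullet> grad f z)" by (rule ext)
  with d show ?thesis by simp
qed

lemma grad_continuous:
  assumes "smooth_on f S" shows "continuous_on S (grad f)"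
  unfolding grad_def by (intro continuous_on_vec_lambda smooth_on_continuous smooth_on_partial assms)

text \<open>The fundamental theorem of calculus and the Cauchy-Schwarz inequality on the segment.\<close>

lemma segment_inequality:
  fixes f :: "real^'n::finite \<Rightarrow> real"
  assumes S: "open S" and f: "smooth_on f S" and seg: "\<And>t. t \<in> {0..1} \<Longrightarrow> x + t *\<^sub>R v \<in> S"
  shows "ennreal ((f (x + v) - f x)\<^sup>2) \<le> (\<integral>\<^sup>+t. ennreal ((v \<bullet> v) * (grad f (x + t *\<^sub>R v) \<bullet> grad f (x + t *\<^sub>R v))) * indicator {0..1} t \<partial>lborel)"
proof -
  define \<phi> where "\<phi> t = v \<bullet> grad f (x + t *\<^sub>R v)" for t :: real
  have "continuous_on {0..1} (\<lambda>t. grad f (x + t *\<^sub>R v))"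
    by (rule continuous_on_compose2[OF grad_continuous[OF f]]) (use seg in \<open>auto intro!: continuous_intros\<close>)
  then have c: "continuous_on {0..1} \<phi>" unfolding \<phi>_def by (intro continuous_intros)
  have d: "((\<lambda>t. f (x + t *\<^sub>R v)) has_vector_derivative \<phi> t) (at t within {0..1})" if "0 \<le> t" "t \<le> 1" for t
  proof -
    have "((\<lambda>t. x + t *\<^sub>R v) has_derivative (\<lambda>s. s *\<^sub>R v)) (at t)" by (auto intro!: derivative_eq_intros)
    from has_derivative_compose[OF this derivative_grad[OF S f seg]] that
    have "((\<lambda>t. f (x + t *\<^sub>R v)) has_derivative (\<lambda>s. (s *\<^sub>R v) \<bullet> grad f (x + t *\<^sub>R v))) (at t)" by simp
    then have "((\<lambda>t. f (x + t *\<^sub>R v)) has_vector_derivative \<phi> t) (at t)"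
      by (simp add: has_vector_derivative_def \<phi>_def)
    then show ?thesis by (rule has_vector_derivative_at_within)
  qed
  define m where "m = f (x + v) - f x"
  have hb: "has_bochner_integral lborel (\<lambda>t. indicator {0..1} t *\<^sub>R \<phi> t) m"
    using has_bochner_integral_FTC_Icc[OF _ d c] by (simp add: m_def)
  have i1: "integrable lborel (\<lambda>t. indicator {0..1} t *\<^sub>R \<phi> t)" and e1: "(\<integral>t. indicator {0..1} t *\<^sub>R \<phi> t \<partial>lborel) = m"
    using hb by (auto simp: has_bochner_integral_iff)
  have i2: "integrable lborel (\<lambda>t. indicator {0..1} t *\<^sub>R (\<phi> t)\<^sup>2)"
    by (rule borel_integrable_compact) (auto intro!: continuous_intros c)
  have i3: "integrable lborel (\<lambda>t::real. indicator {0..1} t *\<^sub>R m\<^sup>2)"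
    by (rule borel_integrable_compact) (auto intro!: continuous_intros)
  have "0 \<le> (\<integral>t. indicator {0..1} t *\<^sub>R (\<phi> t - m)\<^sup>2 \<partial>lborel)" by (intro Bochner_Integration.integral_nonneg) auto
  also have "\<dots> = (\<integral>t. indicator {0..1} t *\<^sub>R (\<phi> t)\<^sup>2 - 2 * m * (indicator {0..1} t *\<^sub>R \<phi> t) + indicator {0..1} t *\<^sub>R m\<^sup>2 \<partial>lborel)"
    by (intro Bochner_Integration.integral_cong) (auto simp: indicator_def power2_eq_square algebra_simps)
  also have "\<dots> = (\<integral>t. indicator {0..1} t *\<^sub>R (\<phi> t)\<^sup>2 \<partial>lborel) - 2 * m * (\<integral>t. indicator {0..1} t *\<^sub>R \<phi> t \<partial>lborel) + (\<integral>t. indicator {0..1::real} t *\<^sub>R m\<^sup>2 \<partial>lborel)"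
    using i1 i2 i3 by (simp only: Bochner_Integration.integral_add Bochner_Integration.integral_diff integrable_mult_right Bochner_Integration.integrable_diff integral_mult_right_zero)
  also have "(\<integral>t. indicator {0..1::real} t *\<^sub>R m\<^sup>2 \<partial>lborel) = m\<^sup>2" by simp
  finally have "m\<^sup>2 \<le> (\<integral>t. indicator {0..1} t *\<^sub>R (\<phi> t)\<^sup>2 \<partial>lborel)" unfolding e1 by (simp add: power2_eq_square)
  then have "ennreal (m\<^sup>2) \<le> ennreal (\<integral>t. indicator {0..1} t *\<^sub>R (\<phi> t)\<^sup>2 \<partial>lborel)" by (rule ennreal_leI)
  also have "\<dots> = (\<integral>\<^sup>+t. ennreal (indicator {0..1} t *\<^sub>R (\<phi> t)\<^sup>2) \<partial>lborel)"
    by (rule nn_integral_eq_integral[symmetric, OF i2]) auto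
  also have "\<dots> \<le> (\<integral>\<^sup>+t. ennreal ((v \<bullet> v) * (grad f (x + t *\<^sub>R v) \<bullet> grad f (x + t *\<^sub>R v))) * indicator {0..1} t \<partial>lborel)"
    by (intro nn_integral_mono) (auto simp: indicator_def \<phi>_def Cauchy_Schwarz_ineq intro!: ennreal_leI)
  finally show ?thesis by (simp add: m_def)
qed

lemma nn_integral_affine:
  fixes H :: "'a::euclidean_space \<Rightarrow> ennreal"
  assumes [measurable]: "H \<in> borel_measurable borel" and c: "c \<noteq> 0"
  shows "(\<integral>\<^sup>+x. H x \<partial>lborel) = ennreal (\<bar>c\<bar> ^ DIM('a)) * (\<integral>\<^sup>+x. H (t + c *\<^sub>R x) \<partial>lborel)"
proof -
  have "(\<integral>\<^sup>+x. H x \<partial>lborel) = (\<integral>\<^sup>+x. H x \<partial>density (distr lborel borel (\<lambda>x. t + c *\<^sub>R x)) (\<lambda>_. \<bar>c\<bar> ^ DIM('a)))"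
    using lborel_affine[OF c, of t] by simp
  also have "\<dots> = ennreal (\<bar>c\<bar> ^ DIM('a)) * (\<integral>\<^sup>+x. H (t + c *\<^sub>R x) \<partial>lborel)"
    by (simp add: nn_integral_density nn_integral_distr nn_integral_cmult)
  finally show ?thesis .
qed

text \<open>The contraction towards \<open>y\<close> has Jacobian \<open>(1 - s) ^ n\<close>, which is at least \<open>1 / 2 ^ n\<close>.\<close>

lemma nn_integral_shrink:
  fixes H :: "'a::euclidean_space \<Rightarrow> ennreal"
  assumes [measurable]: "H \<in> borel_measurable borel" and s: "0 \<le> s" "s \<le> 1 / 2"
  shows "(\<integral>\<^sup>+x. H (x + s *\<^sub>R (y - x)) \<partial>lborel) \<le> ennreal (2 ^ DIM('a)) * (\<integral>\<^sup>+x. H x \<partial>lborel)"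
proof -
  let ?n = "DIM('a)"
  have c: "1 - s \<noteq> 0" using s by simp
  have e: "x + s *\<^sub>R (y - x) = s *\<^sub>R y + (1 - s) *\<^sub>R x" for x by (simp add: algebra_simps)
  have "(\<integral>\<^sup>+x. H (x + s *\<^sub>R (y - x)) \<partial>lborel) = 1 * (\<integral>\<^sup>+x. H (s *\<^sub>R y + (1 - s) *\<^sub>R x) \<partial>lborel)" by (simp add: e)
  also have "\<dots> \<le> ennreal (2 ^ ?n * \<bar>1 - s\<bar> ^ ?n) * (\<integral>\<^sup>+x. H (s *\<^sub>R y + (1 - s) *\<^sub>R x) \<partial>lborel)"
  proof (rule mult_right_mono)
    have "1 \<le> (2 * \<bar>1 - s\<bar>) ^ ?n" using s by (intro one_le_power) auto
    then show "1 \<le> ennreal (2 ^ ?n * \<bar>1 - s\<bar> ^ ?n)" by (simp add: power_mult_distrib)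
  qed simp
  also have "\<dots> = ennreal (2 ^ ?n) * (\<integral>\<^sup>+x. H x \<partial>lborel)"
    unfolding nn_integral_affine[OF assms(1) c, of "s *\<^sub>R y"] by (simp add: ennreal_mult mult.assoc)
  finally show ?thesis .
qed

text \<open>Compare \<open>f x\<close> with \<open>f z\<close> for \<open>z = x + \<delta> (y - x)\<close> and average over \<open>y \<in> K\<close>, using
  \<open>a\<^sup>2 \<le> (a - c)\<^sup>2 + 2 \<bar>a\<bar> \<bar>c\<bar>\<close>. The differences are integrals of the gradient over
  short segments. In the product term the substitution \<open>y \<mapsto> z\<close> has Jacobian \<open>\<delta> ^ n\<close>,
  which produces the square of the \<open>L\<^sub>1\<close> norm divided by \<open>\<delta> ^ n\<close>.\<close>

lemma local_nash:
  fixes f :: "real^'n::finite \<Rightarrow> real"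
  assumes K: "compact K" "convex K" "K \<subseteq> S" and S: "open S" and f: "smooth_on f S"
    and k: "0 < measure lborel K" and D: "0 \<le> D" "\<And>x y. x \<in> K \<Longrightarrow> y \<in> K \<Longrightarrow> (y - x) \<bullet> (y - x) \<le> D"
    and \<delta>: "0 < \<delta>" "\<delta> \<le> 1 / 2"
  shows "ennreal (measure lborel K) * (\<integral>\<^sup>+x. ennreal ((f x)\<^sup>2) * indicator K x \<partial>lborel) \<le>
    ennreal (\<delta>\<^sup>2 * D * 2 ^ CARD('n) * measure lborel K) * (\<integral>\<^sup>+x. ennreal (grad f x \<bullet> grad f x) * indicator K x \<partial>lborel)
    + ennreal (2 / \<delta> ^ CARD('n)) * (\<integral>\<^sup>+x. ennreal \<bar>f x\<bar> * indicator K x \<partial>lborel)\<^sup>2"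
proof -
  let ?n = "CARD('n)"
  have Km[measurable]: "K \<in> sets borel" using K(1) by (simp add: borel_compact)
  have Kfin: "emeasure lborel K < \<infinity>" using K(1) by (rule emeasure_compact_finite)
  define \<kappa> where "\<kappa> = measure lborel K"
  have \<kappa>: "emeasure lborel K = ennreal \<kappa>" using Kfin by (simp add: \<kappa>_def emeasure_eq_ennreal_measure)
  have \<kappa>0: "0 < \<kappa>" using k by (simp add: \<kappa>_def)
  have cf: "continuous_on K f" "continuous_on K (grad f)"
    using smooth_on_continuous[OF f] grad_continuous[OF f] K(3) continuous_on_subset by blast+
  define fK where "fK x = (if x \<in> K then f x else 0)" for x
  define GK where "GK x = (if x \<in> K then grad f x \<bullet> grad f x else 0)" for x
  have fK[measurable]: "fK \<in> borel_measurable borel"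
    unfolding fK_def using borel_measurable_continuous_on_indicator[of K f, OF _ cf(1)] by (simp add: measurable_If_restrict_space_iff borel_measurable_continuous_on_restrict cf)
  have GK[measurable]: "GK \<in> borel_measurable borel"
    unfolding GK_def by (simp add: measurable_If_restrict_space_iff borel_measurable_continuous_on_restrict continuous_on_inner cf)
  have GK0: "0 \<le> GK x" for x by (simp add: GK_def)
  let ?b = "\<integral>\<^sup>+x. ennreal \<bar>fK x\<bar> \<partial>lborel"
  let ?I = "\<integral>\<^sup>+x. ennreal ((fK x)\<^sup>2) \<partial>lborel"
  let ?G = "\<integral>\<^sup>+x. ennreal (GK x) \<partial>lborel"
  have eqs: "(\<integral>\<^sup>+x. ennreal ((f x)\<^sup>2) * indicator K x \<partial>lborel) = ?I" "(\<integral>\<^sup>+x. ennreal (grad f x \<bullet> grad f x) * indicator K x \<partial>lborel) = ?G"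
    "(\<integral>\<^sup>+x. ennreal \<bar>f x\<bar> * indicator K x \<partial>lborel) = ?b"
    by (auto intro!: nn_integral_cong simp: fK_def GK_def indicator_def)
  define P where "P x y = x + \<delta> *\<^sub>R (y - x)" for x y :: "real^'n"
  have PK: "x + s *\<^sub>R (y - x) \<in> K" if "x \<in> K" "y \<in> K" "0 \<le> s" "s \<le> 1" for x y s
  proof -
    have "x + s *\<^sub>R (y - x) = (1 - s) *\<^sub>R x + s *\<^sub>R y" by (simp add: algebra_simps)
    then show ?thesis using K(2) that by (simp add: convex_alt)
  qed
  have Pm[measurable]: "(\<lambda>(x, y). P x y) \<in> borel_measurable (lborel \<Otimes>\<^sub>M lborel)" unfolding P_def by measurable
  define E where "E x y = (fK x - fK (P x y))\<^sup>2 * indicator K x * indicator K y" for x y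
  have Em[measurable]: "(\<lambda>(x, y). E x y) \<in> borel_measurable (lborel \<Otimes>\<^sub>M lborel)" unfolding E_def by measurable
  \<comment> \<open>The bound for the squared difference: the integrand over the segment, at time \<open>t\<close>.\<close>
  let ?g = "\<lambda>t x y. ennreal (\<delta>\<^sup>2 * D) * (ennreal (GK (x + (t * \<delta>) *\<^sub>R (y - x))) * indicator {0..1::real} t)"
  have Ebound: "(\<integral>\<^sup>+x. \<integral>\<^sup>+y. ennreal (E x y) \<partial>lborel \<partial>lborel) \<le> ennreal (\<delta>\<^sup>2 * D * 2 ^ ?n * \<kappa>) * ?G"
  proof -
    have "ennreal (E x y) \<le> (\<integral>\<^sup>+t. ?g t x y \<partial>lborel) * indicator K y" for x y
    proof (cases "x \<in> K \<and> y \<in> K")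
      case True
      let ?v = "\<delta> *\<^sub>R (y - x)"
      have inK: "x + t *\<^sub>R ?v \<in> K" if "t \<in> {0..1}" for t
        using PK[of x y "t * \<delta>"] True that \<delta> mult_le_one[of t \<delta>] by auto
      have "ennreal (E x y) = ennreal ((f (x + ?v) - f x)\<^sup>2)"
        using True inK[of 1] by (simp add: E_def fK_def P_def power2_commute)
      also have "\<dots> \<le> (\<integral>\<^sup>+t. ennreal ((?v \<bullet> ?v) * (grad f (x + t *\<^sub>R ?v) \<bullet> grad f (x + t *\<^sub>R ?v))) * indicator {0..1} t \<partial>lborel)"
        by (rule segment_inequality[OF S f]) (use inK K(3) in blast)
      also have "\<dots> \<le> (\<integral>\<^sup>+t. ?g t x y \<partial>lborel)"
      proof (rule nn_integral_mono)
        fix t :: real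
        show "ennreal ((?v \<bullet> ?v) * (grad f (x + t *\<^sub>R ?v) \<bullet> grad f (x + t *\<^sub>R ?v))) * indicator {0..1} t
          \<le> ?g t x y"
        proof (cases "t \<in> {0..1}")
          case t: True
          have "?v \<bullet> ?v = \<delta>\<^sup>2 * ((y - x) \<bullet> (y - x))" by (simp add: power2_eq_square)
          also have "\<dots> \<le> \<delta>\<^sup>2 * D" using D(2) True by (intro mult_left_mono) auto
          finally have "(?v \<bullet> ?v) * (grad f (x + t *\<^sub>R ?v) \<bullet> grad f (x + t *\<^sub>R ?v)) \<le> (\<delta>\<^sup>2 * D) * GK (x + (t * \<delta>) *\<^sub>R (y - x))"
            using inK[OF t] by (simp add: GK_def mult_right_mono)
          then show ?thesis using t D(1) GK0 by (simp add: ennreal_mult[symmetric] ennreal_leI)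
        qed simp
      qed
      finally show ?thesis using True by simp
    qed (auto simp: E_def indicator_def)
    then have "(\<integral>\<^sup>+x. \<integral>\<^sup>+y. ennreal (E x y) \<partial>lborel \<partial>lborel) \<le>
      (\<integral>\<^sup>+x. \<integral>\<^sup>+y. (\<integral>\<^sup>+t. ?g t x y \<partial>lborel) * indicator K y \<partial>lborel \<partial>lborel)"
      by (intro nn_integral_mono)
    also have "\<dots> = (\<integral>\<^sup>+y. \<integral>\<^sup>+x. (\<integral>\<^sup>+t. ?g t x y \<partial>lborel) * indicator K y \<partial>lborel \<partial>lborel)"
      by (rule lborel_pair.Fubini') measurable
    also have "\<dots> = (\<integral>\<^sup>+y. (\<integral>\<^sup>+x. \<integral>\<^sup>+t. ?g t x y \<partial>lborel \<partial>lborel) * indicator K y \<partial>lborel)"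
      by (intro nn_integral_cong nn_integral_multc) measurable
    also have "\<dots> \<le> (\<integral>\<^sup>+y. (ennreal (\<delta>\<^sup>2 * D) * (ennreal (2 ^ ?n) * ?G)) * indicator K y \<partial>lborel)"
    proof (intro nn_integral_mono mult_right_mono)
      fix y :: "real^'n"
      have "(\<integral>\<^sup>+x. \<integral>\<^sup>+t. ?g t x y \<partial>lborel \<partial>lborel)
        = (\<integral>\<^sup>+t. \<integral>\<^sup>+x. ?g t x y \<partial>lborel \<partial>lborel)"
        by (rule lborel_pair.Fubini') measurable
      also have "\<dots> = (\<integral>\<^sup>+t. ennreal (\<delta>\<^sup>2 * D) * ((\<integral>\<^sup>+x. ennreal (GK (x + (t * \<delta>) *\<^sub>R (y - x))) \<partial>lborel) * indicator {0..1} t) \<partial>lborel)"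
        by (intro nn_integral_cong) (simp add: nn_integral_cmult nn_integral_multc)
      also have "\<dots> \<le> (\<integral>\<^sup>+t. ennreal (\<delta>\<^sup>2 * D) * ((ennreal (2 ^ ?n) * ?G) * indicator {0..1::real} t) \<partial>lborel)"
      proof (intro nn_integral_mono mult_left_mono)
        fix t :: real
        show "(\<integral>\<^sup>+x. ennreal (GK (x + (t * \<delta>) *\<^sub>R (y - x))) \<partial>lborel) * indicator {0..1} t \<le> (ennreal (2 ^ ?n) * ?G) * indicator {0..1} t"
        proof (cases "t \<in> {0..1}")
          case True
          have "t * \<delta> \<le> 1 * (1 / 2)" using True \<delta> by (intro mult_mono) auto
          then show ?thesis using nn_integral_shrink[of "\<lambda>z. ennreal (GK z)" "t * \<delta>" y] True \<delta> by simp
        qed simp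
      qed simp
      also have "\<dots> = ennreal (\<delta>\<^sup>2 * D) * (ennreal (2 ^ ?n) * ?G)"
        by (simp add: nn_integral_cmult)
      finally show "(\<integral>\<^sup>+x. \<integral>\<^sup>+t. ?g t x y \<partial>lborel \<partial>lborel)
        \<le> ennreal (\<delta>\<^sup>2 * D) * (ennreal (2 ^ ?n) * ?G)" .
    qed simp
    also have "\<dots> = (ennreal (\<delta>\<^sup>2 * D) * (ennreal (2 ^ ?n) * ?G)) * ennreal \<kappa>"
      by (simp add: nn_integral_cmult_indicator \<kappa>)
    also have "\<dots> = ennreal (\<delta>\<^sup>2 * D * 2 ^ ?n * \<kappa>) * ?G"
      using D(1) \<kappa>0 by (simp add: ennreal_mult mult_ac)
    finally show ?thesis .
  qed
  \<comment> \<open>Substitution of \<open>P x y\<close> for \<open>y\<close>.\<close>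
  have second: "(\<integral>\<^sup>+y. ennreal \<bar>fK (P x y)\<bar> \<partial>lborel) = ennreal (1 / \<delta> ^ ?n) * ?b" for x
  proof -
    have "?b = ennreal (\<delta> ^ ?n) * (\<integral>\<^sup>+y. ennreal \<bar>fK ((x - \<delta> *\<^sub>R x) + \<delta> *\<^sub>R y)\<bar> \<partial>lborel)"
      using nn_integral_affine[of "\<lambda>z. ennreal \<bar>fK z\<bar>" \<delta> "x - \<delta> *\<^sub>R x"] \<delta>(1) by simp
    also have "(\<lambda>y. (x - \<delta> *\<^sub>R x) + \<delta> *\<^sub>R y) = P x" by (auto simp: P_def algebra_simps)
    then have "(\<integral>\<^sup>+y. ennreal \<bar>fK ((x - \<delta> *\<^sub>R x) + \<delta> *\<^sub>R y)\<bar> \<partial>lborel) = (\<integral>\<^sup>+y. ennreal \<bar>fK (P x y)\<bar> \<partial>lborel)"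
      by (metis)
    finally have b: "?b = ennreal (\<delta> ^ ?n) * (\<integral>\<^sup>+y. ennreal \<bar>fK (P x y)\<bar> \<partial>lborel)" .
    have "ennreal (1 / \<delta> ^ ?n) * ennreal (\<delta> ^ ?n) = 1" using \<delta>(1) by (subst ennreal_mult[symmetric]) auto
    then show ?thesis unfolding b mult.assoc[symmetric] by simp
  qed
  have pt: "ennreal ((fK x)\<^sup>2) * indicator K y \<le> ennreal (E x y) + ennreal 2 * (ennreal \<bar>fK x\<bar> * ennreal \<bar>fK (P x y)\<bar>)" for x y
  proof (cases "x \<in> K \<and> y \<in> K")
    case True
    let ?a = "fK x" and ?c = "fK (P x y)"
    have "?a * ?c \<le> \<bar>?a\<bar> * \<bar>?c\<bar>" by (metis abs_ge_self abs_mult)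
    then have "?a\<^sup>2 \<le> (?a - ?c)\<^sup>2 + 2 * (\<bar>?a\<bar> * \<bar>?c\<bar>)" using zero_le_power2[of ?c] unfolding power2_diff by linarith
    then have "ennreal (?a\<^sup>2) \<le> ennreal ((?a - ?c)\<^sup>2 + 2 * (\<bar>?a\<bar> * \<bar>?c\<bar>))" by (rule ennreal_leI)
    then show ?thesis using True by (simp add: E_def ennreal_mult)
  qed (auto simp: fK_def indicator_def)
  let ?J = "ennreal 2 * (ennreal (1 / \<delta> ^ ?n) * ?b)"
  have "ennreal \<kappa> * ?I = (\<integral>\<^sup>+x. \<integral>\<^sup>+y. ennreal ((fK x)\<^sup>2) * indicator K y \<partial>lborel \<partial>lborel)"
    by (simp add: nn_integral_cmult_indicator \<kappa> nn_integral_multc) (rule mult.commute)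
  also have "\<dots> \<le> (\<integral>\<^sup>+x. \<integral>\<^sup>+y. ennreal (E x y) + ennreal 2 * (ennreal \<bar>fK x\<bar> * ennreal \<bar>fK (P x y)\<bar>) \<partial>lborel \<partial>lborel)"
    by (intro nn_integral_mono pt)
  also have "\<dots> = (\<integral>\<^sup>+x. (\<integral>\<^sup>+y. ennreal (E x y) \<partial>lborel) + ennreal \<bar>fK x\<bar> * ?J \<partial>lborel)"
  proof (intro nn_integral_cong)
    fix x :: "real^'n"
    have [measurable]: "E x \<in> borel_measurable lborel" "P x \<in> borel_measurable lborel" unfolding E_def P_def by measurable
    show "(\<integral>\<^sup>+y. ennreal (E x y) + ennreal 2 * (ennreal \<bar>fK x\<bar> * ennreal \<bar>fK (P x y)\<bar>) \<partial>lborel)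
      = (\<integral>\<^sup>+y. ennreal (E x y) \<partial>lborel) + ennreal \<bar>fK x\<bar> * ?J"
      unfolding second[symmetric, of x] by (simp add: nn_integral_add nn_integral_cmult mult.left_commute)
  qed
  also have "\<dots> = (\<integral>\<^sup>+x. \<integral>\<^sup>+y. ennreal (E x y) \<partial>lborel \<partial>lborel) + ?b * ?J"
    by (subst nn_integral_add) (simp_all add: nn_integral_multc)
  also have "\<dots> \<le> ennreal (\<delta>\<^sup>2 * D * 2 ^ ?n * \<kappa>) * ?G + ?b * ?J" by (intro add_mono Ebound order_refl)
  also have "?b * ?J = (ennreal 2 * ennreal (1 / \<delta> ^ ?n)) * ?b\<^sup>2" by (simp add: mult_ac power2_eq_square)
  also have "ennreal 2 * ennreal (1 / \<delta> ^ ?n) = ennreal (2 / \<delta> ^ ?n)" using \<delta>(1) by (subst ennreal_mult[symmetric]) auto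
  finally show ?thesis unfolding eqs \<kappa>_def[symmetric] .
qed

section \<open>Measure and coordinate patches\<close>

text \<open>Join the matrix to the identity by a segment of positive definite matrices; the
  determinant does not vanish on it.\<close>

lemma pos_def_det_pos:
  fixes M :: "real^'n::finite^'n"
  assumes pd: "\<And>v. v \<noteq> 0 \<Longrightarrow> v \<bullet> (M *v v) > 0"
  shows "0 < det M"
proof -
  define P where "P t = (1 - t) *\<^sub>R mat 1 + t *\<^sub>R M" for t :: real
  have nz: "det (P t) \<noteq> 0" if t: "0 \<le> t" "t \<le> 1" for t
  proof -
    have "inj ((*v) (P t))"
    proof (rule injI)
      fix v w assume "P t *v v = P t *v w"
      then have z: "P t *v (v - w) = 0" by (simp add: matrix_vector_mult_diff_distrib)
      show "v = w"
      proof (rule ccontr)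
        assume "v \<noteq> w"
        then have u: "v - w \<noteq> 0" by simp
        have "(v - w) \<bullet> (P t *v (v - w)) = (1 - t) * ((v - w) \<bullet> (v - w)) + t * ((v - w) \<bullet> (M *v (v - w)))"
          by (simp add: P_def matrix_vector_mult_add_rdistrib scaleR_matrix_vector_assoc[symmetric] inner_add_right)
        also have "\<dots> > 0"
        proof (cases "t = 0")
          case False
          then have "0 < t * ((v - w) \<bullet> (M *v (v - w)))" using t pd[OF u] by simp
          moreover have "0 \<le> (1 - t) * ((v - w) \<bullet> (v - w))" using t by simp
          ultimately show ?thesis by linarith
        qed (use u in simp)
        finally show False using z by simp
      qed
    qed
    then show ?thesis using det_nz_iff_inj[OF matrix_vector_mul_linear, of "P t"] by simp
  qed
  have c: "continuous_on {0..1} (\<lambda>t. det (P t))" unfolding det_def P_def by (intro continuous_intros)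
  show ?thesis
  proof (rule ccontr)
    assume "\<not> 0 < det M"
    then have "det (P 1) \<le> 0" "0 \<le> det (P 0)" by (auto simp: P_def)
    then obtain t where "0 \<le> t" "t \<le> 1" "det (P t) = 0" using IVT2'[of "\<lambda>t. det (P t)" 1 0 0] c by auto
    with nz show False by blast
  qed
qed

locale riemannian = atlas A for A :: "('m::{t2_space, second_countable_topology}, 'n::finite) chart set" +
  fixes G :: "('m, 'n) chart \<Rightarrow> real^'n \<Rightarrow> real^'n^'n" and \<mu> :: "'m measure" and g :: "real \<Rightarrow> real"
  assumes metric: "riemannian_metric A G" and meas: "riemannian_measure A G \<mu>" and g: "cutoff g"
begin

lemma sets_\<mu>: "sets \<mu> = sets borel" and space_\<mu>: "space \<mu> = UNIV"
  using meas sets_eq_imp_space_eq[of \<mu> borel] by (auto simp: riemannian_measure_def)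

abbreviation dens where "dens c x \<equiv> sqrt (det (G c x))"

lemma dens:
  assumes "c \<in> A"
  shows "continuous_on (coord_range c) (dens c)" "\<And>x. x \<in> coord_range c \<Longrightarrow> 0 < dens c x"
proof -
  have "smooth_on (G c) (coord_range c)" using metric assms by (simp add: riemannian_metric_def)
  then have "continuous_on (coord_range c) (G c)" by (rule smooth_on_continuous)
  then show "continuous_on (coord_range c) (dens c)" unfolding det_def by (intro continuous_intros)
  show "0 < dens c x" if "x \<in> coord_range c" for x
    using metric assms that pos_def_det_pos[of "G c x"] by (auto simp: riemannian_metric_def)
qed

lemma image_compact:
  assumes "c \<in> A" "compact K" "K \<subseteq> coord_range c"
  shows "compact (coord_inv c ` K)" "coord_inv c ` K \<in> sets borel" "coord_inv c ` K \<subseteq> fst c"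
proof -
  show k: "compact (coord_inv c ` K)"
    by (intro compact_continuous_image continuous_on_subset[OF chartD(4)] assms)
  show "coord_inv c ` K \<in> sets borel" using compact_imp_closed[OF k] by simp
  show "coord_inv c ` K \<subseteq> fst c" using assms(3) chartD(7)[OF assms(1)] by blast
qed

lemma coord_inv_measurable:
  assumes "c \<in> A" "K \<in> sets borel" "K \<subseteq> coord_range c"
  shows "(\<lambda>x. if x \<in> K then coord_inv c x else undefined) \<in> borel_measurable borel"
proof -
  have "continuous_on K (coord_inv c)" using chartD(4)[OF assms(1)] assms(3) by (rule continuous_on_subset)
  then have "coord_inv c \<in> borel_measurable (restrict_space borel K)" by (rule borel_measurable_continuous_on_restrict)
  then show ?thesis using assms(2) by (subst (asm) measurable_restrict_space_iff) auto
qed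

text \<open>The defining property of the measure, extended from sets to integrands. The coordinate
  inverse is cut off outside \<open>K\<close> to make it measurable.\<close>

lemma chart_integral:
  assumes c: "c \<in> A" and K: "compact K" "K \<subseteq> coord_range c" and f: "f \<in> borel_measurable borel"
  shows "(\<integral>\<^sup>+y. f y * indicator (coord_inv c ` K) y \<partial>\<mu>) =
    (\<integral>\<^sup>+x. ennreal (dens c x) * (f (coord_inv c x) * indicator K x) \<partial>lborel)"
proof -
  note C = chartD[OF c] note IK = image_compact[OF c K]
  have Km[measurable]: "K \<in> sets borel" using K(1) by (rule borel_compact)
  define ci where "ci x = (if x \<in> K then coord_inv c x else undefined)" for x
  have ci[measurable]: "ci \<in> measurable borel borel" unfolding ci_def by (rule coord_inv_measurable[OF c Km K(2)])
  define d where "d x = (if x \<in> K then dens c x else 0)" for x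
  have d[measurable]: "d \<in> borel_measurable borel"
  proof -
    have "dens c \<in> borel_measurable (restrict_space borel K)"
      by (intro borel_measurable_continuous_on_restrict continuous_on_subset[OF dens(1)[OF c] K(2)])
    then show ?thesis unfolding d_def by (subst (asm) measurable_restrict_space_iff) auto
  qed
  define S where "S = coord_inv c ` K"
  have Sm: "S \<in> sets \<mu>" using IK(2) sets_\<mu> by (simp add: S_def)
  have fm: "f \<in> borel_measurable \<mu>" using f sets_\<mu> by (simp cong: measurable_cong_sets)
  have eq: "density \<mu> (indicator S) = distr (density lborel (\<lambda>x. ennreal (d x))) \<mu> ci"
  proof (rule measure_eqI)
    fix B assume "B \<in> sets (density \<mu> (indicator S))"
    then have B: "B \<in> sets \<mu>" "B \<in> sets borel" using sets_\<mu> by auto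
    have SB: "S \<inter> B \<in> sets borel" "S \<inter> B \<subseteq> fst c" using B IK by (auto simp: S_def)
    have "emeasure (density \<mu> (indicator S)) B = emeasure \<mu> (S \<inter> B)"
      using B Sm by (simp add: emeasure_restricted)
    also have "\<dots> = (\<integral>\<^sup>+x. ennreal (dens c x) * indicator (snd c ` (S \<inter> B)) x \<partial>lborel)"
      using meas c SB unfolding riemannian_measure_def by blast
    also have "\<dots> = (\<integral>\<^sup>+x. ennreal (d x) * indicator (ci -` B) x \<partial>lborel)"
    proof (rule nn_integral_cong)
      fix x
      have "x \<in> snd c ` (S \<inter> B) \<longleftrightarrow> x \<in> K \<and> coord_inv c x \<in> B"
        unfolding S_def using C(8) K(2) by (force intro!: image_eqI[of _ _ "coord_inv c x"])
      then show "ennreal (dens c x) * indicator (snd c ` (S \<inter> B)) x = ennreal (d x) * indicator (ci -` B) x"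
        by (auto simp: d_def ci_def indicator_def)
    qed
    also have "\<dots> = emeasure (distr (density lborel (\<lambda>x. ennreal (d x))) \<mu> ci) B"
    proof -
      have "ci \<in> measurable (density lborel (\<lambda>x. ennreal (d x))) \<mu>"
        using ci sets_\<mu> by (simp cong: measurable_cong_sets)
      moreover have "ci -` B \<in> sets borel" using measurable_sets[OF ci B(2)] by simp
      ultimately show ?thesis using B by (simp add: emeasure_distr emeasure_density)
    qed
    finally show "emeasure (density \<mu> (indicator S)) B = emeasure (distr (density lborel (\<lambda>x. ennreal (d x))) \<mu> ci) B" .
  qed simp
  have "(\<integral>\<^sup>+y. f y * indicator S y \<partial>\<mu>) = (\<integral>\<^sup>+y. f y \<partial>density \<mu> (indicator S))"
    using fm Sm by (subst nn_integral_density) (auto simp: mult.commute)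
  also have "\<dots> = (\<integral>\<^sup>+x. f (ci x) \<partial>density lborel (\<lambda>x. ennreal (d x)))"
    unfolding eq using fm ci sets_\<mu> by (subst nn_integral_distr) (auto cong: measurable_cong_sets)
  also have "\<dots> = (\<integral>\<^sup>+x. ennreal (d x) * f (ci x) \<partial>lborel)"
    using f by (subst nn_integral_density) auto
  also have "\<dots> = (\<integral>\<^sup>+x. ennreal (dens c x) * (f (coord_inv c x) * indicator K x) \<partial>lborel)"
    by (intro nn_integral_cong) (auto simp: d_def ci_def indicator_def)
  finally show ?thesis by (simp add: S_def)
qed

text \<open>On a compact set the Riemannian density lies between two positive constants.\<close>

lemma chart_compare:
  assumes c: "c \<in> A" and K: "compact K" "K \<subseteq> coord_range c"
  obtains C :: real where "0 < C"
    "\<forall>f \<in> borel_measurable borel. (\<integral>\<^sup>+y. f y * indicator (coord_inv c ` K) y \<partial>\<mu>) \<le> ennreal C * (\<integral>\<^sup>+x. f (coord_inv c x) * indicator K x \<partial>lborel)"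
    "\<forall>f \<in> borel_measurable borel. (\<integral>\<^sup>+x. f (coord_inv c x) * indicator K x \<partial>lborel) \<le> ennreal C * (\<integral>\<^sup>+y. f y * indicator (coord_inv c ` K) y \<partial>\<mu>)"
proof (cases "K = {}")
  case True
  show ?thesis by (rule that[of 1]) (auto simp: True)
next
  case False
  have cd: "continuous_on K (dens c)" by (rule continuous_on_subset[OF dens(1)[OF c] K(2)])
  obtain x1 where x1: "x1 \<in> K" "\<And>x. x \<in> K \<Longrightarrow> dens c x1 \<le> dens c x" using continuous_attains_inf[OF K(1) False cd] by blast
  obtain x2 where x2: "x2 \<in> K" "\<And>x. x \<in> K \<Longrightarrow> dens c x \<le> dens c x2" using continuous_attains_sup[OF K(1) False cd] by blast
  have pos: "0 < dens c x1" "0 < dens c x2" using x1 x2 K(2) dens(2)[OF c] by blast+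
  define C where "C = max (dens c x2) (1 / dens c x1)"
  have C: "0 < C" "dens c x2 \<le> C" "1 / dens c x1 \<le> C" using pos by (auto simp: C_def less_max_iff_disj simp del: real_sqrt_gt_0_iff)
  have Km[measurable]: "K \<in> sets borel" using K(1) by (rule borel_compact)
  have m: "(\<lambda>x. f (coord_inv c x) * indicator K x) \<in> borel_measurable borel" if f: "f \<in> borel_measurable borel" for f :: "'m \<Rightarrow> ennreal"
  proof -
    have "(\<lambda>x. f (if x \<in> K then coord_inv c x else undefined) * indicator K x) \<in> borel_measurable borel"
      by (intro borel_measurable_times_ennreal measurable_compose[OF coord_inv_measurable[OF c Km K(2)] f]) auto
    also have "(\<lambda>x. f (if x \<in> K then coord_inv c x else undefined) * indicator K x) = (\<lambda>x. f (coord_inv c x) * indicator K x)"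
      by (auto simp: indicator_def)
    finally show ?thesis .
  qed
  show ?thesis
  proof (rule that[OF C(1)]; intro ballI)
    fix f :: "'m \<Rightarrow> ennreal" assume f: "f \<in> borel_measurable borel"
    have "(\<integral>\<^sup>+y. f y * indicator (coord_inv c ` K) y \<partial>\<mu>) \<le> (\<integral>\<^sup>+x. ennreal C * (f (coord_inv c x) * indicator K x) \<partial>lborel)"
      unfolding chart_integral[OF c K f]
    proof (rule nn_integral_mono)
      fix x
      show "ennreal (dens c x) * (f (coord_inv c x) * indicator K x) \<le> ennreal C * (f (coord_inv c x) * indicator K x)"
      proof (cases "x \<in> K")
        case True
        have "dens c x \<le> C" using x2(2)[OF True] C(2) by linarith
        then show ?thesis by (intro mult_right_mono ennreal_leI) auto
      qed simp
    qed
    also have "\<dots> = ennreal C * (\<integral>\<^sup>+x. f (coord_inv c x) * indicator K x \<partial>lborel)"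
      using m[OF f] by (simp add: nn_integral_cmult)
    finally show "(\<integral>\<^sup>+y. f y * indicator (coord_inv c ` K) y \<partial>\<mu>) \<le> \<dots>" .
    have md: "(\<lambda>x. ennreal (dens c x) * (f (coord_inv c x) * indicator K x)) \<in> borel_measurable borel"
    proof -
      have "dens c \<in> borel_measurable (restrict_space borel K)" by (intro borel_measurable_continuous_on_restrict cd)
      then have "(\<lambda>x. if x \<in> K then dens c x else 0) \<in> borel_measurable borel"
        by (subst (asm) measurable_restrict_space_iff) auto
      then have "(\<lambda>x. ennreal (if x \<in> K then dens c x else 0) * (f (coord_inv c x) * indicator K x)) \<in> borel_measurable borel"
        using m[OF f] by measurable
      also have "(\<lambda>x. ennreal (if x \<in> K then dens c x else 0) * (f (coord_inv c x) * indicator K x)) =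
        (\<lambda>x. ennreal (dens c x) * (f (coord_inv c x) * indicator K x))" by (auto simp: indicator_def)
      finally show ?thesis .
    qed
    have "(\<integral>\<^sup>+x. f (coord_inv c x) * indicator K x \<partial>lborel) \<le> (\<integral>\<^sup>+x. ennreal C * (ennreal (dens c x) * (f (coord_inv c x) * indicator K x)) \<partial>lborel)"
    proof (rule nn_integral_mono)
      fix x
      show "f (coord_inv c x) * indicator K x \<le> ennreal C * (ennreal (dens c x) * (f (coord_inv c x) * indicator K x))"
      proof (cases "x \<in> K")
        case True
        have "1 = 1 / dens c x1 * dens c x1" using pos by simp
        also have "\<dots> \<le> C * dens c x" using C(3) x1(2)[OF True] pos less_imp_le[OF C(1)] by (intro mult_mono) auto
        finally have "ennreal 1 \<le> ennreal (C * dens c x)" by (rule ennreal_leI)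
        also have "\<dots> = ennreal C * ennreal (dens c x)" using C(1) x1(2)[OF True] pos by (intro ennreal_mult) auto
        finally have "1 * f (coord_inv c x) \<le> (ennreal C * ennreal (dens c x)) * f (coord_inv c x)"
          by (intro mult_right_mono) auto
        then show ?thesis using True by (simp add: mult.assoc)
      qed simp
    qed
    also have "\<dots> = ennreal C * (\<integral>\<^sup>+y. f y * indicator (coord_inv c ` K) y \<partial>\<mu>)"
      unfolding chart_integral[OF c K f] using md by (simp add: nn_integral_cmult)
    finally show "(\<integral>\<^sup>+x. f (coord_inv c x) * indicator K x \<partial>lborel) \<le> \<dots>" .
  qed
qed

text \<open>The collar between the radii \<open>r\<close> and \<open>2 r\<close> leaves room for a bump function which is \<open>1\<close>
  on the smaller ball.\<close>

definition patch :: "('m, 'n) chart \<Rightarrow> real^'n \<Rightarrow> real \<Rightarrow> bool" where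
  "patch c a r \<longleftrightarrow> c \<in> A \<and> 0 < r \<and> cball a (2 * r) \<subseteq> coord_range c"

lemma patchD: "patch c a r \<Longrightarrow> c \<in> A" "patch c a r \<Longrightarrow> 0 < r" "patch c a r \<Longrightarrow> cball a (2 * r) \<subseteq> coord_range c"
  "patch c a r \<Longrightarrow> cball a r \<subseteq> coord_range c"
proof -
  assume "patch c a r"
  then have "0 < r" "cball a (2 * r) \<subseteq> coord_range c" by (auto simp: patch_def)
  then show "cball a r \<subseteq> coord_range c" by (force simp: subset_iff)
qed (auto simp: patch_def)

lemma patch_at:
  assumes "c \<in> A" "y \<in> fst c" "0 < s"
  obtains r where "patch c (snd c y) r" "r \<le> s"
proof -
  have "snd c y \<in> coord_range c" "open (coord_range c)" using chartD[OF assms(1)] assms(2) by auto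
  then obtain e where e: "0 < e" "cball (snd c y) e \<subseteq> coord_range c" using open_contains_cball by blast
  have "cball (snd c y) (2 * min s (e / 2)) \<subseteq> cball (snd c y) e" by (intro subset_cball) auto
  then show ?thesis using e assms by (intro that[of "min s (e / 2)"]) (auto simp: patch_def)
qed

lemma patch_function:
  assumes p: "patch c a r" and h: "smooth_on h UNIV"
  obtains f where "f \<in> Cinf" "\<And>x. x \<in> cball a r \<Longrightarrow> f (coord_inv c x) = (h x :: real)"
    "\<And>y. y \<notin> coord_inv c ` cball a (2 * r) \<Longrightarrow> f y = 0" "(\<forall>x. 0 \<le> h x) \<Longrightarrow> (\<forall>y. 0 \<le> f y)"
proof -
  note P = patchD[OF p] note C = chartD[OF P(1)]
  define b where "b z = g (sqrt \<bar>(z - a) \<bullet> (z - a) / r\<^sup>2\<bar>)" for z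
  have b: "smooth_on b UNIV" "\<And>z. z \<in> cball a r \<Longrightarrow> b z = 1" "\<And>z. z \<notin> cball a (2 * r) \<Longrightarrow> b z = 0" "\<And>z. 0 \<le> b z"
    using smooth_bump[OF g P(2), where a = a] unfolding b_def[abs_def] by blast+
  define f where "f y = (if y \<in> fst c then b (snd c y) * h (snd c y) else 0)" for y
  have "smooth_on (\<lambda>x. b x * h x) (coord_range c)"
    by (intro smooth_on_mult C smooth_on_subset[OF b(1)] smooth_on_subset[OF h]) auto
  then have "f \<in> Cinf" unfolding f_def
    by (rule Cinf_extend[OF P(1) _ compact_cball P(3)]) (use b(3) in simp)
  moreover have "f (coord_inv c x) = h x" if "x \<in> cball a r" for x
  proof -
    have "x \<in> coord_range c" using that P(4) by blast
    then show ?thesis using C(7,8) b(2)[OF that] by (simp add: f_def)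
  qed
  moreover have "f y = 0" if "y \<notin> coord_inv c ` cball a (2 * r)" for y
    using that C(6) b(3) unfolding f_def by (metis image_eqI mult_zero_left)
  moreover have "\<forall>y. 0 \<le> f y" if "\<forall>x. 0 \<le> h x" using that b(4) by (auto simp: f_def)
  ultimately show ?thesis using that by blast
qed

lemma finite_cover:
  obtains I where "finite I" "\<forall>c a r. (c, a, r) \<in> I \<longrightarrow> patch c a r" "(\<Union>(c, a, r)\<in>I. coord_inv c ` cball a r) = UNIV"
proof -
  define \<U> where "\<U> = {(c, a, r). patch c a r}"
  define O' where "O' = (\<lambda>(c :: ('m, 'n) chart, a :: real^'n, r). {y \<in> fst c. snd c y \<in> ball a r} :: 'm set)"
  have "open (O' p)" if p: "p \<in> \<U>" for p
  proof -
    obtain c a r where cp: "p = (c, a, r)" "patch c a r" using p by (auto simp: \<U>_def)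
    note C = chartD[OF patchD(1)[OF cp(2)]]
    have "open (snd c -` ball a r \<inter> fst c)" using continuous_on_open_vimage[OF C(1)] C(3) open_ball by blast
    moreover have "snd c -` ball a r \<inter> fst c = O' p" by (auto simp: O'_def cp)
    ultimately show ?thesis by simp
  qed
  moreover have "UNIV \<subseteq> (\<Union>p\<in>\<U>. O' p)"
  proof
    fix y :: 'm
    obtain c where c: "c \<in> A" "y \<in> fst c" by (rule chart_at)
    obtain r where r: "patch c (snd c y) r" "r \<le> 1" using patch_at[OF c, of 1] by auto
    then have "(c, snd c y, r) \<in> \<U>" "y \<in> O' (c, snd c y, r)" using c patchD(2)[OF r(1)] by (auto simp: \<U>_def O'_def)
    then show "y \<in> (\<Union>p\<in>\<U>. O' p)" by blast
  qed
  ultimately obtain I where I: "I \<subseteq> \<U>" "finite I" "UNIV \<subseteq> (\<Union>p\<in>I. O' p)" using compactE_image[OF compact_M, of \<U> O'] by blast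
  show ?thesis
  proof (rule that[OF I(2)])
    show pp: "\<forall>c a r. (c, a, r) \<in> I \<longrightarrow> patch c a r" using I(1) by (auto simp: \<U>_def)
    note p = pp[rule_format]
    show "(\<Union>(c, a, r)\<in>I. coord_inv c ` cball a r) = UNIV"
    proof (rule UNIV_eq_I[symmetric])
      fix y
      have "y \<in> (\<Union>p\<in>I. O' p)" using I(3) by blast
      then obtain q where q: "q \<in> I" "y \<in> O' q" by blast
      obtain c a r where "q = (c, a, r)" by (cases q)
      then have cp: "(c, a, r) \<in> I" "y \<in> fst c" "snd c y \<in> ball a r" using q by (auto simp: O'_def)
      have "y = coord_inv c (snd c y)" using chartD(6)[OF patchD(1)[OF p[OF cp(1)]] cp(2)] by simp
      then have "y \<in> coord_inv c ` cball a r" using cp(3) by (intro image_eqI[of _ _ "snd c y"]) auto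
      then show "y \<in> (\<Union>(c, a, r)\<in>I. coord_inv c ` cball a r)" using cp(1) by blast
    qed
  qed
qed

lemma cover_integral:
  assumes I: "finite I" "\<And>c a r. (c, a, r) \<in> I \<Longrightarrow> patch c a r" "(\<Union>(c, a, r)\<in>I. coord_inv c ` cball a r) = UNIV"
    and f: "f \<in> borel_measurable borel"
  shows "(\<integral>\<^sup>+y. f y \<partial>\<mu>) \<le> (\<Sum>(c, a, r)\<in>I. \<integral>\<^sup>+y. f y * indicator (coord_inv c ` cball a r) y \<partial>\<mu>)"
proof -
  have fm: "f \<in> borel_measurable \<mu>" using f sets_\<mu> by (simp cong: measurable_cong_sets)
  have S: "coord_inv c ` cball a r \<in> sets \<mu>" if "(c, a, r) \<in> I" for c a r
    using image_compact(2)[OF patchD(1) compact_cball patchD(4)] I(2)[OF that] sets_\<mu> by blast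
  have "(\<integral>\<^sup>+y. f y \<partial>\<mu>) \<le> (\<integral>\<^sup>+y. (\<Sum>(c, a, r)\<in>I. f y * indicator (coord_inv c ` cball a r) y) \<partial>\<mu>)"
  proof (rule nn_integral_mono)
    fix y :: 'm
    have "y \<in> (\<Union>(c, a, r)\<in>I. coord_inv c ` cball a r)" using I(3) by simp
    then obtain c a r where p: "(c, a, r) \<in> I" "y \<in> coord_inv c ` cball a r" by blast
    have "f y = (case (c, a, r) of (c, a, r) \<Rightarrow> f y * indicator (coord_inv c ` cball a r) y)" using p(2) by simp
    also have "\<dots> \<le> (\<Sum>(c, a, r)\<in>I. f y * indicator (coord_inv c ` cball a r) y)"
      by (rule member_le_sum[OF p(1) _ I(1)]) auto
    finally show "f y \<le> (\<Sum>(c, a, r)\<in>I. f y * indicator (coord_inv c ` cball a r) y)" .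
  qed
  also have "\<dots> = (\<Sum>p\<in>I. \<integral>\<^sup>+y. (case p of (c, a, r) \<Rightarrow> f y * indicator (coord_inv c ` cball a r) y) \<partial>\<mu>)"
    using fm S by (intro nn_integral_sum) auto
  also have "\<dots> = (\<Sum>(c, a, r)\<in>I. \<integral>\<^sup>+y. f y * indicator (coord_inv c ` cball a r) y \<partial>\<mu>)"
    by (intro sum.cong) auto
  finally show ?thesis .
qed

text \<open>Inequalities with a constant, uniform over a family of integrands, pass from the patches
  of a finite cover to the manifold.\<close>

lemma cover_bound:
  fixes R :: "'i \<Rightarrow> real"
  assumes I: "finite I" "\<And>c a r. (c, a, r) \<in> I \<Longrightarrow> patch c a r" "(\<Union>(c, a, r)\<in>I. coord_inv c ` cball a r) = UNIV"
    and f: "\<And>i. i \<in> S \<Longrightarrow> f i \<in> borel_measurable borel" and R: "\<And>i. i \<in> S \<Longrightarrow> 0 \<le> R i"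
    and loc: "\<And>c a r. (c, a, r) \<in> I \<Longrightarrow>
      \<exists>C>0. \<forall>i\<in>S. (\<integral>\<^sup>+y. f i y * indicator (coord_inv c ` cball a r) y \<partial>\<mu>) \<le> ennreal (C * R i)"
  obtains C where "0 < C" "\<forall>i\<in>S. (\<integral>\<^sup>+y. f i y \<partial>\<mu>) \<le> ennreal (C * R i)"
proof -
  have "\<forall>q\<in>I. \<exists>C. 0 < C \<and> (\<forall>i\<in>S. (case q of (c, a, r) \<Rightarrow> \<integral>\<^sup>+y. f i y * indicator (coord_inv c ` cball a r) y \<partial>\<mu>) \<le> ennreal (C * R i))"
    using loc by auto
  from bchoice[OF this] obtain C where C: "\<forall>q\<in>I. 0 < C q \<and>
      (\<forall>i\<in>S. (case q of (c, a, r) \<Rightarrow> \<integral>\<^sup>+y. f i y * indicator (coord_inv c ` cball a r) y \<partial>\<mu>) \<le> ennreal (C q * R i))" ..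
  have C0: "0 \<le> C q" if "q \<in> I" for q using C that by (simp add: less_imp_le)
  have S0: "0 \<le> (\<Sum>q\<in>I. C q)" using C0 by (intro sum_nonneg)
  show ?thesis
  proof (rule that[of "(\<Sum>q\<in>I. C q) + 1"], use S0 in simp, intro ballI)
    fix i assume i: "i \<in> S"
    have "(\<integral>\<^sup>+y. f i y \<partial>\<mu>) \<le> (\<Sum>(c, a, r)\<in>I. \<integral>\<^sup>+y. f i y * indicator (coord_inv c ` cball a r) y \<partial>\<mu>)"
      by (rule cover_integral[OF I f[OF i]])
    also have "\<dots> \<le> (\<Sum>q\<in>I. ennreal (C q * R i))" using C i by (intro sum_mono) blast
    also have "\<dots> = ennreal ((\<Sum>q\<in>I. C q) * R i)"
      using C0 R[OF i] by (simp add: sum_ennreal sum_distrib_right)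
    also have "\<dots> \<le> ennreal (((\<Sum>q\<in>I. C q) + 1) * R i)" using R[OF i] by (intro ennreal_leI mult_right_mono) auto
    finally show "(\<integral>\<^sup>+y. f i y \<partial>\<mu>) \<le> ennreal (((\<Sum>q\<in>I. C q) + 1) * R i)" .
  qed
qed

lemma patch_measure_finite:
  assumes p: "patch c a r" shows "emeasure \<mu> (coord_inv c ` cball a r) < \<infinity>"
proof -
  note P = patchD[OF p]
  obtain C where "0 < C" and C: "\<forall>f \<in> borel_measurable borel. (\<integral>\<^sup>+y. f y * indicator (coord_inv c ` cball a r) y \<partial>\<mu>) \<le> ennreal C * (\<integral>\<^sup>+x. f (coord_inv c x) * indicator (cball a r) x \<partial>lborel)"
    by (rule chart_compare[OF P(1) compact_cball P(4)])
  have S: "coord_inv c ` cball a r \<in> sets \<mu>" using image_compact(2)[OF P(1) compact_cball P(4)] sets_\<mu> by simp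
  have "emeasure \<mu> (coord_inv c ` cball a r) = (\<integral>\<^sup>+y. 1 * indicator (coord_inv c ` cball a r) y \<partial>\<mu>)" using S by simp
  also have "\<dots> \<le> ennreal C * (\<integral>\<^sup>+x. 1 * indicator (cball a r) x \<partial>lborel)" using C by (rule bspec) simp
  also have "\<dots> < \<infinity>" using emeasure_compact_finite[OF compact_cball, of a r] by (simp add: ennreal_mult_less_top)
  finally show ?thesis .
qed

lemma finite_measure_\<mu>: "finite_measure \<mu>"
proof
  obtain I where I0: "finite I" "\<forall>c a r. (c, a, r) \<in> I \<longrightarrow> patch c a r" "(\<Union>(c, a, r)\<in>I. coord_inv c ` cball a r) = UNIV"
    by (rule finite_cover)
  note I = I0(1) I0(2)[rule_format] I0(3)
  have "emeasure \<mu> (space \<mu>) = (\<integral>\<^sup>+y. 1 \<partial>\<mu>)" by simp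
  also have "\<dots> \<le> (\<Sum>(c, a, r)\<in>I. \<integral>\<^sup>+y. 1 * indicator (coord_inv c ` cball a r) y \<partial>\<mu>)"
    by (rule cover_integral[OF I]) auto
  also have "\<dots> < \<infinity>"
  proof -
    have "(\<integral>\<^sup>+y. 1 * indicator (coord_inv c ` cball a r) y \<partial>\<mu>) < \<infinity>" if "(c, a, r) \<in> I" for c a r
      using patch_measure_finite[OF I(2)[OF that]] image_compact(2)[OF patchD(1) compact_cball patchD(4)] I(2)[OF that] sets_\<mu> by simp
    then show ?thesis using I(1) by (auto simp: sum_Pinfty less_top split: prod.splits)
  qed
  finally show "emeasure \<mu> (space \<mu>) \<noteq> \<infinity>" by simp
qed

lemma open_measure_pos:
  assumes U: "open U" "U \<noteq> {}" shows "0 < measure \<mu> U"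
proof -
  obtain y where y: "y \<in> U" using U by auto
  obtain c where c: "c \<in> A" "y \<in> fst c" by (rule chart_at)
  note C = chartD[OF c(1)]
  have "open (snd c ` (fst c \<inter> U))" by (rule chart_open_image(1)[OF c(1) U(1)])
  moreover have "snd c y \<in> snd c ` (fst c \<inter> U)" using y c by auto
  ultimately obtain e where e: "0 < e" "cball (snd c y) e \<subseteq> snd c ` (fst c \<inter> U)" using open_contains_cball by blast
  let ?K = "cball (snd c y) e"
  have K: "?K \<subseteq> coord_range c" using e(2) C(5) by auto
  obtain D where D: "0 < D" and D2: "\<forall>f \<in> borel_measurable borel. (\<integral>\<^sup>+x. f (coord_inv c x) * indicator ?K x \<partial>lborel) \<le> ennreal D * (\<integral>\<^sup>+y. f y * indicator (coord_inv c ` ?K) y \<partial>\<mu>)"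
    by (rule chart_compare[OF c(1) compact_cball K])
  have S: "coord_inv c ` ?K \<in> sets \<mu>" using image_compact(2)[OF c(1) compact_cball K] sets_\<mu> by simp
  have "emeasure lborel ?K = ennreal (measure lborel ?K)"
    using emeasure_compact_finite[OF compact_cball, of "snd c y" e] by (intro emeasure_eq_ennreal_measure) auto
  then have "0 < emeasure lborel ?K" using content_cball_pos[OF e(1), of "snd c y"] by simp
  also have "emeasure lborel ?K \<le> ennreal D * emeasure \<mu> (coord_inv c ` ?K)"
    using bspec[OF D2, of "\<lambda>_. 1"] S by simp
  finally have "0 < emeasure \<mu> (coord_inv c ` ?K)" by (auto simp: ennreal_zero_less_mult_iff)
  also have "\<dots> \<le> emeasure \<mu> U"
  proof (rule emeasure_mono)
    show "coord_inv c ` ?K \<subseteq> U" using e(2) C(6) by fastforce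
    show "U \<in> sets \<mu>" using U sets_\<mu> by simp
  qed
  finally show ?thesis
    using finite_measure.emeasure_eq_measure[OF finite_measure_\<mu>, of U] by simp
qed

text \<open>The Stone-Weierstrass theorem; bump functions separate points.\<close>

lemma Cinf_dense:
  assumes f: "cont f" and e: "0 < e"
  shows "\<exists>h\<in>Cinf. \<forall>x. \<bar>f x - h x\<bar> < (e::real)"
proof -
  interpret function_ring_on Cinf UNIV
  proof
    fix x y :: 'm assume ne: "x \<noteq> y"
    obtain c where c: "c \<in> A" "x \<in> fst c" by (rule chart_at)
    note C = chartD[OF c(1)]
    define s where "s = (if y \<in> fst c then dist (snd c x) (snd c y) / 3 else 1)"
    have s: "0 < s"
    proof (cases "y \<in> fst c")
      case True
      then have "snd c x \<noteq> snd c y" using ne C(6) c by metis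
      then show ?thesis by (simp add: s_def)
    qed (simp add: s_def)
    obtain r where r: "patch c (snd c x) r" "r \<le> s" by (rule patch_at[OF c s])
    note P = patchD[OF r(1)]
    obtain h where h: "h \<in> Cinf" "\<And>z. z \<in> cball (snd c x) r \<Longrightarrow> h (coord_inv c z) = 1"
      "\<And>y. y \<notin> coord_inv c ` cball (snd c x) (2 * r) \<Longrightarrow> h y = 0"
      using patch_function[OF r(1) smooth_on_const[of 1]] by metis
    have "h x = 1" using h(2)[of "snd c x"] C(6)[OF c(2)] P(2) by simp
    moreover have "h y = 0"
    proof (rule h(3), rule notI)
      assume "y \<in> coord_inv c ` cball (snd c x) (2 * r)"
      then obtain z where z: "z \<in> cball (snd c x) (2 * r)" "y = coord_inv c z" by blast
      have zr: "z \<in> coord_range c" using z(1) P(3) by blast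
      have yf: "y \<in> fst c" "snd c y = z" using C(7,8)[OF zr] z by auto
      then have "3 * s \<le> 2 * r" using z(1) by (simp add: s_def)
      then show False using r(2) s by linarith
    qed
    ultimately show "\<exists>f\<in>Cinf. f x \<noteq> f y" using h(1) by (intro bexI[of _ h]) auto
  qed (auto intro: compact_M Cinf_continuous Cinf_add Cinf_mult Cinf_const)
  show ?thesis using Stone_Weierstrass_basic[OF f e] by auto
qed

end

section \<open>The real form of the operator\<close>

text \<open>The hypotheses on the operator. The cutoff function is a parameter because it provides
  the bump functions.\<close>

locale elliptic_setting = riemannian A G \<mu> g
  for A :: "('m::{t2_space, second_countable_topology}, 'n::finite) chart set" and G \<mu> g +
  fixes L :: "('m \<Rightarrow> complex) \<Rightarrow> 'm \<Rightarrow> complex" and sqrtL :: "'m graph" and lam :: "nat \<Rightarrow> real" and u :: "nat \<Rightarrow> 'm \<Rightarrow> real"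
  assumes ell: "elliptic_operator_2 A L"
    and sa: "self_adjoint \<mu> (L2_realization A \<mu> L)"
    and nonneg: "non_negative \<mu> (L2_realization A \<mu> L)"
    and sqrtL: "positive_sqrt \<mu> (L2_realization A \<mu> L) sqrtL"
    and basis: "eigenbasis A \<mu> sqrtL lam u"
begin

sublocale compact_measure \<mu>
  using finite_measure_\<mu> compact_M sets_\<mu> by (intro compact_measure.intro compact_measure_axioms.intro)

definition Lr :: "('m \<Rightarrow> real) \<Rightarrow> 'm \<Rightarrow> real" where "Lr f y = Re (L (\<lambda>x. of_real (f x)) y)"
definition Li :: "('m \<Rightarrow> real) \<Rightarrow> 'm \<Rightarrow> real" where "Li f y = Im (L (\<lambda>x. of_real (f x)) y)"

lemma L_Complex: "L (\<lambda>x. of_real (f x)) y = Complex (Lr f y) (Li f y)"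
  by (simp add: Lr_def Li_def)

text \<open>The operator in the coordinates of a chart, separated into its real and imaginary parts
  on real functions. At this stage the imaginary part is not yet known to vanish.\<close>

definition coefficients :: "('m, 'n) chart \<Rightarrow> ('n \<Rightarrow> 'n \<Rightarrow> real^'n \<Rightarrow> complex) \<Rightarrow> ('n \<Rightarrow> real^'n \<Rightarrow> complex) \<Rightarrow> (real^'n \<Rightarrow> complex) \<Rightarrow> bool" where
  "coefficients c a b e \<longleftrightarrow>
     (\<forall>i j. smooth_on (a i j) (coord_range c)) \<and> (\<forall>i. smooth_on (b i) (coord_range c)) \<and> smooth_on e (coord_range c) \<and>
     (\<forall>x\<in>coord_range c. \<forall>\<xi>. \<xi> \<noteq> 0 \<longrightarrow> (\<Sum>i\<in>UNIV. \<Sum>j\<in>UNIV. a i j x * of_real (\<xi> $ i * \<xi> $ j)) \<noteq> 0) \<and>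
     (\<forall>f\<in>Cinf. \<forall>x\<in>coord_range c.
        Lr f (coord_inv c x) = dop (\<lambda>i j. Re (a i j x)) (\<lambda>i. Re (b i x)) (Re (e x)) (\<lambda>x. f (coord_inv c x)) x \<and>
        Li f (coord_inv c x) = dop (\<lambda>i j. Im (a i j x)) (\<lambda>i. Im (b i x)) (Im (e x)) (\<lambda>x. f (coord_inv c x)) x)"

lemma coefficientsD:
  assumes "coefficients c a b e"
  shows "smooth_on (a i j) (coord_range c)" "smooth_on (b i) (coord_range c)" "smooth_on e (coord_range c)"
    "x \<in> coord_range c \<Longrightarrow> \<xi> \<noteq> 0 \<Longrightarrow> (\<Sum>i\<in>UNIV. \<Sum>j\<in>UNIV. a i j x * of_real (\<xi> $ i * \<xi> $ j)) \<noteq> 0"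
    "f \<in> Cinf \<Longrightarrow> x \<in> coord_range c \<Longrightarrow>
       Lr f (coord_inv c x) = dop (\<lambda>i j. Re (a i j x)) (\<lambda>i. Re (b i x)) (Re (e x)) (\<lambda>x. f (coord_inv c x)) x"
    "f \<in> Cinf \<Longrightarrow> x \<in> coord_range c \<Longrightarrow>
       Li f (coord_inv c x) = dop (\<lambda>i j. Im (a i j x)) (\<lambda>i. Im (b i x)) (Im (e x)) (\<lambda>x. f (coord_inv c x)) x"
  using assms unfolding coefficients_def by blast+

lemma coefficients_exist:
  assumes c: "c \<in> A"
  obtains a b e where "coefficients c a b e"
proof -
  note C = chartD[OF c]
  obtain a b e where s: "\<forall>i j. smooth_on (a i j) (coord_range c)" "\<forall>i. smooth_on (b i) (coord_range c)" "smooth_on e (coord_range c)"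
    and el: "\<forall>x\<in>coord_range c. \<forall>\<xi>. \<xi> \<noteq> 0 \<longrightarrow> (\<Sum>i\<in>UNIV. \<Sum>j\<in>UNIV. a i j x * of_real (\<xi> $ i * \<xi> $ j)) \<noteq> (0::complex)"
    and form: "\<forall>f. smooth_fun A f \<longrightarrow> (\<forall>x\<in>coord_range c. L f (coord_inv c x) =
             (\<Sum>i\<in>UNIV. \<Sum>j\<in>UNIV. a i j x * partial i (partial j (f \<circ> coord_inv c)) x)
             + (\<Sum>i\<in>UNIV. b i x * partial i (f \<circ> coord_inv c) x) + e x * f (coord_inv c x))"
    using ell c unfolding elliptic_operator_2_def by blast
  have key: "L (\<lambda>y. of_real (f y)) (coord_inv c x) = (\<Sum>i\<in>UNIV. \<Sum>j\<in>UNIV. a i j x * of_real (partial i (partial j (\<lambda>x. f (coord_inv c x))) x))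
             + (\<Sum>i\<in>UNIV. b i x * of_real (partial i (\<lambda>x. f (coord_inv c x)) x)) + e x * of_real (f (coord_inv c x))"
    if f: "f \<in> Cinf" and x: "x \<in> coord_range c" for f x
  proof -
    let ?f = "\<lambda>x. f (coord_inv c x)"
    have sf: "smooth_on ?f (coord_range c)" by (rule Cinf_D[OF f c])
    have sc: "smooth_on (\<lambda>x. of_real (?f x) :: complex) (coord_range c)"
      by (intro smooth_on_bounded_linear[OF C(2) bounded_linear_of_real] sf)
    have p1: "partial j (\<lambda>x. of_real (?f x) :: complex) y = of_real (partial j ?f y)" if "y \<in> coord_range c" for j y
      by (rule partial_of_real[OF C(2) that sf])
    have p2: "partial i (partial j (\<lambda>x. of_real (?f x) :: complex)) x = of_real (partial i (partial j ?f) x)" for i j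
    proof -
      have "partial i (partial j (\<lambda>x. of_real (?f x) :: complex)) x = partial i (\<lambda>y. of_real (partial j ?f y)) x"
        by (rule partial_cong[OF C(2) x smooth_on_partial[OF sc] p1])
      also have "\<dots> = of_real (partial i (partial j ?f) x)"
        by (rule partial_of_real[OF C(2) x smooth_on_partial[OF sf]])
      finally show ?thesis .
    qed
    show ?thesis using form[rule_format, OF Cinf_complex[OF f] x] p1[OF x] p2 by (simp add: comp_def)
  qed
  have "coefficients c a b e" unfolding coefficients_def
  proof (intro conjI ballI)
    fix f x assume f: "f \<in> Cinf" and x: "x \<in> coord_range c"
    show "Lr f (coord_inv c x) = dop (\<lambda>i j. Re (a i j x)) (\<lambda>i. Re (b i x)) (Re (e x)) (\<lambda>x. f (coord_inv c x)) x"
      unfolding Lr_def key[OF f x] dop_def by simp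
    show "Li f (coord_inv c x) = dop (\<lambda>i j. Im (a i j x)) (\<lambda>i. Im (b i x)) (Im (e x)) (\<lambda>x. f (coord_inv c x)) x"
      unfolding Li_def key[OF f x] dop_def by simp
  qed (use s el in blast)+
  then show ?thesis by (rule that)
qed

lemma continuous_by_charts:
  assumes "\<And>c. c \<in> A \<Longrightarrow> continuous_on (coord_range c) (\<lambda>x. f (coord_inv c x) :: real)"
  shows "cont f"
proof -
  have "isCont f y" for y
  proof -
    obtain c where c: "c \<in> A" "y \<in> fst c" by (rule chart_at)
    note C = chartD[OF c(1)]
    have "continuous_on (fst c) (\<lambda>y. f (coord_inv c (snd c y)))"
      by (rule continuous_on_compose2[OF assms[OF c(1)] C(3)]) (use C in auto)
    then have "continuous_on (fst c) f" by (rule continuous_on_eq) (use C in auto)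
    then show ?thesis using c C(1) by (simp add: continuous_on_eq_continuous_at)
  qed
  then show ?thesis by (simp add: continuous_at_imp_continuous_on)
qed

lemma dop_continuous:
  assumes f: "smooth_on f S" and a: "\<And>i j. continuous_on S (a i j)" "\<And>i. continuous_on S (b i)" "continuous_on S e"
  shows "continuous_on S (\<lambda>x. dop (\<lambda>i j. a i j x) (\<lambda>i. b i x) (e x) f x)"
  unfolding dop_def
  by (intro continuous_intros a smooth_on_continuous[OF smooth_on_partial] smooth_on_partial f smooth_on_continuous[OF f])

lemma Lr_continuous: "f \<in> Cinf \<Longrightarrow> cont (Lr f)"
  and Li_continuous: "f \<in> Cinf \<Longrightarrow> cont (Li f)"
proof -
  assume f: "f \<in> Cinf"
  have "continuous_on (coord_range c) (\<lambda>x. Lr f (coord_inv c x)) \<and> continuous_on (coord_range c) (\<lambda>x. Li f (coord_inv c x))"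
    if c: "c \<in> A" for c
  proof -
    obtain a b e where co: "coefficients c a b e" by (rule coefficients_exist[OF c])
    note sc = coefficientsD(1-3)[OF co, THEN smooth_on_continuous]
    have "continuous_on (coord_range c) (\<lambda>x. dop (\<lambda>i j. Re (a i j x)) (\<lambda>i. Re (b i x)) (Re (e x)) (\<lambda>x. f (coord_inv c x)) x)"
      "continuous_on (coord_range c) (\<lambda>x. dop (\<lambda>i j. Im (a i j x)) (\<lambda>i. Im (b i x)) (Im (e x)) (\<lambda>x. f (coord_inv c x)) x)"
      by (intro dop_continuous Cinf_D[OF f c] continuous_intros sc)+
    then show ?thesis using coefficientsD(5,6)[OF co f] by (auto cong: continuous_on_cong)
  qed
  then show "cont (Lr f)" "cont (Li f)" by (auto intro!: continuous_by_charts)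
qed

lemma point_in_chart:
  obtains c x where "c \<in> A" "x \<in> coord_range c" "y = coord_inv c x"
  by (metis chart_at chartD(5,6))

lemma Lr_add:
  assumes f: "f \<in> Cinf" and h: "h \<in> Cinf" shows "Lr (\<lambda>x. f x + h x) y = Lr f y + Lr h y"
proof -
  obtain c x where c: "c \<in> A" "x \<in> coord_range c" "y = coord_inv c x" by (rule point_in_chart)
  obtain a b e where co: "coefficients c a b e" by (rule coefficients_exist[OF c(1)])
  show ?thesis
    unfolding c(3) using coefficientsD(5)[OF co] f h Cinf_add[OF f h] c(2) dop_add[OF chartD(2)[OF c(1)] c(2) Cinf_D[OF f c(1)] Cinf_D[OF h c(1)]] by auto
qed

lemma dop_cmult:
  assumes S: "open S" "x \<in> S" and f: "smooth_on f S"
  shows "dop a b e (\<lambda>y. k * f y) x = k * dop a b e f x"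
  using dop_mult[OF S smooth_on_const[of k] f, of a b e] by (simp add: dop_const symb_def partial_const)

lemma Lr_cmult:
  assumes f: "f \<in> Cinf" shows "Lr (\<lambda>x. k * f x) y = k * Lr f y"
proof -
  obtain c x where c: "c \<in> A" "x \<in> coord_range c" "y = coord_inv c x" by (rule point_in_chart)
  obtain a b e where co: "coefficients c a b e" by (rule coefficients_exist[OF c(1)])
  show ?thesis unfolding c(3) using coefficientsD(5)[OF co] f Cinf_mult[OF Cinf_const[of k] f] c(2) dop_cmult[OF chartD(2)[OF c(1)] c(2) Cinf_D[OF f c(1)]] by auto
qed

abbreviation \<Gamma>r where "\<Gamma>r \<equiv> carre Lr"

text \<open>Only the principal part enters, by the product rule for second order operators.\<close>

lemma carre_coordinates:
  assumes c: "c \<in> A" and co: "coefficients c a b e"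
    and x: "x \<in> coord_range c" and f: "f \<in> Cinf" and h: "h \<in> Cinf"
  shows "\<Gamma>r f h (coord_inv c x) = - symb (\<lambda>i j. Re (a i j x)) (\<lambda>x. f (coord_inv c x)) (\<lambda>x. h (coord_inv c x)) x / 2"
  unfolding carre_def coefficientsD(5)[OF co f x] coefficientsD(5)[OF co h x] coefficientsD(5)[OF co Cinf_mult[OF f h] x]
    coefficientsD(5)[OF co Cinf_const x] dop_const dop_mult[OF chartD(2)[OF c] x Cinf_D[OF f c] Cinf_D[OF h c]]
  by (simp add: field_simps)

lemma carre_derivation_r:
  assumes f: "f \<in> Cinf" and h: "h \<in> Cinf" and k: "k \<in> Cinf"
  shows "\<Gamma>r (\<lambda>y. f y * h y) k y = f y * \<Gamma>r h k y + h y * \<Gamma>r f k y"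
proof -
  obtain c x where c: "c \<in> A" "x \<in> coord_range c" "y = coord_inv c x" by (rule point_in_chart)
  obtain a b e where co: "coefficients c a b e" by (rule coefficients_exist[OF c(1)])
  show ?thesis
    unfolding c(3) carre_coordinates[OF c(1) co c(2) Cinf_mult[OF f h] k] carre_coordinates[OF c(1) co c(2) h k] carre_coordinates[OF c(1) co c(2) f k]
      symb_mult[OF chartD(2)[OF c(1)] c(2) Cinf_D[OF f c(1)] Cinf_D[OF h c(1)]] by (simp add: field_simps)
qed

lemma carre_chain:
  assumes f: "f \<in> Cinf" and k: "k \<in> Cinf" and \<eta>: "(\<lambda>y. \<eta> (f y)) \<in> Cinf" and d: "(\<eta> has_real_derivative d) (at (f y))"
  shows "\<Gamma>r (\<lambda>y. \<eta> (f y)) k y = d * \<Gamma>r f k y"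
proof -
  obtain c x where c: "c \<in> A" "x \<in> coord_range c" "y = coord_inv c x" by (rule point_in_chart)
  obtain a b e where co: "coefficients c a b e" by (rule coefficients_exist[OF c(1)])
  have p: "partial i (\<lambda>x. \<eta> (f (coord_inv c x))) x = d * partial i (\<lambda>x. f (coord_inv c x)) x" for i
    by (rule partial_compose[OF chartD(2)[OF c(1)] c(2) Cinf_D[OF f c(1)]]) (use d c(3) in simp)
  have "symb (\<lambda>i j. Re (a i j x)) (\<lambda>x. \<eta> (f (coord_inv c x))) (\<lambda>x. k (coord_inv c x)) x =
    d * symb (\<lambda>i j. Re (a i j x)) (\<lambda>x. f (coord_inv c x)) (\<lambda>x. k (coord_inv c x)) x"
    unfolding symb_def p sum_distrib_left by (intro sum.cong refl) (simp add: algebra_simps)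
  then show ?thesis
    unfolding c(3) carre_coordinates[OF c(1) co c(2) \<eta> k] carre_coordinates[OF c(1) co c(2) f k] by simp
qed

lemma ereal_two: "(2::ereal) \<noteq> \<infinity>" "real_of_ereal 2 = 2"
  using real_of_ereal.simps(1)[of 2] by simp_all

lemma Lp_space_2: "f \<in> Lp_space \<mu> 2 \<longleftrightarrow> f \<in> borel_measurable \<mu> \<and> integrable \<mu> (\<lambda>x. (norm (f x))\<^sup>2)"
  unfolding Lp_space_def ereal_two using ereal_two(1) by simp

lemma Lp_norm_2: "Lp_norm \<mu> 2 f = sqrt (LINT x|\<mu>. (norm (f x))\<^sup>2)"
  unfolding Lp_norm_def ereal_two using ereal_two(1) by (simp add: powr_half_sqrt)

lemma Lp2_I:
  assumes "cont f" "cont h"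
  shows "(\<lambda>x. Complex (f x) (h x)) \<in> Lp_space \<mu> 2"
proof -
  have "(norm (Complex (f x) (h x)))\<^sup>2 = (f x)\<^sup>2 + (h x)\<^sup>2" for x
    by (simp add: cmod_def)
  moreover have "(\<lambda>x. Complex (f x) (h x)) \<in> borel_measurable \<mu>"
    using borel_measurable_continuous[OF assms(1)] borel_measurable_continuous[OF assms(2)] unfolding borel_measurable_complex_iff by simp
  ultimately show ?thesis unfolding Lp_space_2
    using assms by (auto intro!: integrable_continuous continuous_intros)
qed

lemma graph_L:
  assumes f: "f \<in> Cinf" shows "((\<lambda>x. of_real (f x)), L (\<lambda>x. of_real (f x))) \<in> L2_realization A \<mu> L"
proof -
  have 1: "(\<lambda>x. of_real (f x)) \<in> Lp_space \<mu> 2"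
    using Lp2_I[OF Cinf_continuous[OF f] continuous_on_const[of _ 0]] by (simp add: complex_of_real_def)
  have 2: "L (\<lambda>x. of_real (f x)) \<in> Lp_space \<mu> 2"
  proof -
    have "L (\<lambda>x. of_real (f x)) = (\<lambda>x. Complex (Lr f x) (Li f x))" using L_Complex[of f] by auto
    then show ?thesis using Lp2_I[OF Lr_continuous[OF f] Li_continuous[OF f]] by (simp only:)
  qed
  have z: "Lp_norm \<mu> 2 (\<lambda>x. h x - h x) = 0" for h :: "'m \<Rightarrow> complex" unfolding Lp_norm_2 by simp
  let ?f = "\<lambda>x. complex_of_real (f x)"
  have 3: "\<forall>n::nat. (?f, L ?f) \<in> {(f, L f) |f. smooth_fun A f}" using Cinf_complex[OF f] by blast
  have "\<exists>F H. (\<forall>n::nat. (F n, H n) \<in> {(f, L f) |f. smooth_fun A f}) \<and>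
      (\<lambda>n. Lp_norm \<mu> 2 (\<lambda>x. F n x - ?f x)) \<longlonglongrightarrow> 0 \<and> (\<lambda>n. Lp_norm \<mu> 2 (\<lambda>x. H n x - L ?f x)) \<longlonglongrightarrow> 0"
    by (rule exI[of _ "\<lambda>_. ?f"], rule exI[of _ "\<lambda>_. L ?f"]) (unfold z, intro conjI 3 tendsto_const)
  then show ?thesis unfolding L2_realization_def op_closure_def using 1 2 by blast
qed

lemma pairing_Complex:
  assumes "integrable \<mu> (\<lambda>x. f x * k x)" "integrable \<mu> (\<lambda>x. h x * k x)"
  shows "pairing \<mu> (\<lambda>x. Complex (f x) (h x)) (\<lambda>x. of_real (k x)) = Complex (LINT x|\<mu>. f x * k x) (LINT x|\<mu>. h x * k x)"
proof -
  have i: "integrable \<mu> (\<lambda>x. Complex (f x * k x) (h x * k x))"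
  proof -
    have "integrable \<mu> (\<lambda>x. complex_of_real (f x * k x) + \<i> * complex_of_real (h x * k x))"
      using assms by (intro Bochner_Integration.integrable_add integrable_mult_right integrable_of_real)
    then show ?thesis by (simp add: Complex_eq)
  qed
  have "pairing \<mu> (\<lambda>x. Complex (f x) (h x)) (\<lambda>x. of_real (k x)) = (LINT x|\<mu>. Complex (f x * k x) (h x * k x))"
    unfolding pairing_def by (intro Bochner_Integration.integral_cong) (auto simp: complex_eq_iff)
  also have "\<dots> = Complex (LINT x|\<mu>. f x * k x) (LINT x|\<mu>. h x * k x)"
    using integral_Re[OF i] integral_Im[OF i] by (simp add: complex_eq_iff)
  finally show ?thesis .
qed

lemma pairing_cnj: "pairing \<mu> f h = cnj (pairing \<mu> h f)"
proof -
  have "cnj (pairing \<mu> h f) = (LINT x|\<mu>. cnj (h x * cnj (f x)))"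
    unfolding pairing_def by (rule Bochner_Integration.integral_cnj[symmetric])
  then show ?thesis unfolding pairing_def by (simp add: mult.commute)
qed

lemma pairing_L:
  assumes f: "f \<in> Cinf" and k: "cont k"
  shows "pairing \<mu> (L (\<lambda>x. of_real (f x))) (\<lambda>x. of_real (k x)) = Complex (LINT x|\<mu>. Lr f x * k x) (LINT x|\<mu>. Li f x * k x)"
proof -
  have "L (\<lambda>x. of_real (f x)) = (\<lambda>x. Complex (Lr f x) (Li f x))" using L_Complex[of f] by auto
  then show ?thesis
    using pairing_Complex[of "Lr f" k "Li f"] f k by (simp add: integrable_continuous continuous_intros Lr_continuous Li_continuous)
qed

lemma pairing_real:
  assumes "integrable \<mu> (\<lambda>x. f x * k x)"
  shows "pairing \<mu> (\<lambda>x. of_real (f x)) (\<lambda>x. of_real (k x)) = of_real (LINT x|\<mu>. f x * k x)"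
  using pairing_Complex[of f k "\<lambda>_. 0"] assms by (simp add: complex_of_real_def)

lemma Lr_sym:
  assumes f: "f \<in> Cinf" and h: "h \<in> Cinf"
  shows "(LINT x|\<mu>. f x * Lr h x) = (LINT x|\<mu>. h x * Lr f x)"
proof -
  let ?T = "L2_realization A \<mu> L"
  have "((\<lambda>x. of_real (f x)), L (\<lambda>x. of_real (f x))) \<in> op_adjoint \<mu> ?T"
    using graph_L[OF f] sa by (simp add: self_adjoint_def)
  then have "pairing \<mu> (L (\<lambda>x. of_real (h x))) (\<lambda>x. of_real (f x)) = pairing \<mu> (\<lambda>x. of_real (h x)) (L (\<lambda>x. of_real (f x)))"
    using graph_L[OF h] unfolding op_adjoint_def by blast
  then have "Re (pairing \<mu> (L (\<lambda>x. of_real (h x))) (\<lambda>x. of_real (f x))) = Re (pairing \<mu> (L (\<lambda>x. of_real (f x))) (\<lambda>x. of_real (h x)))"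
    using pairing_cnj[of "\<lambda>x. of_real (h x)" "L (\<lambda>x. of_real (f x))"] by simp
  then show ?thesis
    using pairing_L[OF h Cinf_continuous[OF f]] pairing_L[OF f Cinf_continuous[OF h]] by (simp add: mult.commute)
qed

lemma Lr_nonneg:
  assumes f: "f \<in> Cinf" shows "0 \<le> (LINT x|\<mu>. f x * Lr f x)"
proof -
  have "0 \<le> Re (pairing \<mu> (L (\<lambda>x. of_real (f x))) (\<lambda>x. of_real (f x)))"
    using graph_L[OF f] nonneg unfolding non_negative_def by blast
  then show ?thesis using pairing_L[OF f Cinf_continuous[OF f]] by (simp add: mult.commute)
qed

section \<open>Eigenfunctions and the reality of the operator\<close>

lemma u_FF: "u l \<in> Cinf"
  using basis by (simp add: eigenbasis_def Cinf_def)

lemma u_orthonormal: "(LINT x|\<mu>. u l x * u m x) = (if l = m then 1 else 0)"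
  using basis by (simp add: eigenbasis_def)

lemma real_complete:
  assumes f: "f \<in> borel_measurable \<mu>" "integrable \<mu> (\<lambda>x. (f x)\<^sup>2)"
  shows "(\<lambda>N. LINT x|\<mu>. (f x - (\<Sum>l<N. (LINT y|\<mu>. f y * u l y) * u l x))\<^sup>2) \<longlonglongrightarrow> 0"
proof -
  let ?f = "\<lambda>x. complex_of_real (f x)"
  have f1: "integrable \<mu> (\<lambda>x. f x * u l x)" for l
  proof (rule Bochner_Integration.integrable_bound[of \<mu> "\<lambda>x. (f x)\<^sup>2 + (u l x)\<^sup>2"])
    show "integrable \<mu> (\<lambda>x. (f x)\<^sup>2 + (u l x)\<^sup>2)"
      by (rule Bochner_Integration.integrable_add[OF f(2)]) (intro integrable_continuous continuous_intros Cinf_continuous u_FF)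
    show "(\<lambda>x. f x * u l x) \<in> borel_measurable \<mu>" using f(1) borel_measurable_continuous[OF Cinf_continuous[OF u_FF]] by measurable
    show "AE x in \<mu>. norm (f x * u l x) \<le> norm ((f x)\<^sup>2 + (u l x)\<^sup>2)"
    proof (rule AE_I2)
      fix x
      have "2 * (\<bar>f x\<bar> * \<bar>u l x\<bar>) \<le> (f x)\<^sup>2 + (u l x)\<^sup>2" using sum_squares_bound[of "\<bar>f x\<bar>" "\<bar>u l x\<bar>"] by simp
      moreover have "0 \<le> \<bar>f x\<bar> * \<bar>u l x\<bar>" by simp
      ultimately have "\<bar>f x\<bar> * \<bar>u l x\<bar> \<le> (f x)\<^sup>2 + (u l x)\<^sup>2" by linarith
      then show "norm (f x * u l x) \<le> norm ((f x)\<^sup>2 + (u l x)\<^sup>2)" by (simp add: abs_mult)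
    qed
  qed
  have "?f \<in> Lp_space \<mu> 2" unfolding Lp_space_2 using f by simp
  then have lim: "(\<lambda>N. Lp_norm \<mu> 2 (\<lambda>x. ?f x - (\<Sum>l<N. pairing \<mu> ?f (\<lambda>y. of_real (u l y)) * of_real (u l x)))) \<longlonglongrightarrow> 0"
    using basis by (simp add: eigenbasis_def)
  define E where "E N = (LINT x|\<mu>. (f x - (\<Sum>l<N. (LINT y|\<mu>. f y * u l y) * u l x))\<^sup>2)" for N
  have E0: "0 \<le> E N" for N unfolding E_def by (intro Bochner_Integration.integral_nonneg) simp
  have "Lp_norm \<mu> 2 (\<lambda>x. ?f x - (\<Sum>l<N. pairing \<mu> ?f (\<lambda>y. of_real (u l y)) * of_real (u l x))) = sqrt (E N)" for N
  proof -
    have "?f x - (\<Sum>l<N. pairing \<mu> ?f (\<lambda>y. of_real (u l y)) * of_real (u l x)) = of_real (f x - (\<Sum>l<N. (LINT y|\<mu>. f y * u l y) * u l x))" for x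
      by (simp add: pairing_real[OF f1])
    then show ?thesis unfolding Lp_norm_2 by (simp only: norm_of_real power2_abs E_def)
  qed
  then have "(\<lambda>N. sqrt (E N)) \<longlonglongrightarrow> 0" using lim by simp
  then have "(\<lambda>N. (sqrt (E N))\<^sup>2) \<longlonglongrightarrow> 0\<^sup>2" by (rule tendsto_power)
  then show ?thesis using E0 by (simp add: E_def)
qed

lemma zero_by_coefficients:
  assumes h: "cont h" and z: "\<And>l. (LINT y|\<mu>. h y * u l y) = 0"
  shows "h x = 0"
proof -
  have hi: "integrable \<mu> (\<lambda>x. (h x)\<^sup>2)" by (intro integrable_continuous continuous_intros h)
  have "(\<lambda>N. LINT x|\<mu>. (h x - (\<Sum>l<N. (LINT y|\<mu>. h y * u l y) * u l x))\<^sup>2) \<longlonglongrightarrow> 0"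
    by (rule real_complete[OF borel_measurable_continuous[OF h] hi])
  then have "(LINT x|\<mu>. (h x)\<^sup>2) = 0" by (simp add: z LIMSEQ_const_iff)
  then show ?thesis using continuous_square_zero[OF finite_measure_axioms sets_\<mu> _ h hi] open_measure_pos by blast
qed

text \<open>The eigenvector of \<open>\<surd>L\<close> also satisfies the eigenvalue equation for the square: by
  self-adjointness a multiple of it is in the domain again.\<close>

lemma eigenvector_graph: "((\<lambda>x. of_real (u l x)), (\<lambda>x. of_real ((lam l)\<^sup>2 * u l x))) \<in> L2_realization A \<mu> L"
proof -
  let ?u = "\<lambda>x. complex_of_real (u l x)" and ?lu = "\<lambda>x. complex_of_real (lam l * u l x)" and ?llu = "\<lambda>x. complex_of_real ((lam l)\<^sup>2 * u l x)"
  have S: "(?u, ?lu) \<in> sqrtL" using basis by (simp add: eigenbasis_def)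
  have saS: "op_adjoint \<mu> sqrtL = sqrtL" and SS: "sqrtL O sqrtL = L2_realization A \<mu> L"
    using sqrtL by (auto simp: positive_sqrt_def self_adjoint_def)
  have Lp: "(\<lambda>x. complex_of_real (k * u l x)) \<in> Lp_space \<mu> 2" for k
    using Lp2_I[OF continuous_on_mult_left[OF Cinf_continuous[OF u_FF]] continuous_on_const[of _ 0], of k l] by (simp add: complex_of_real_def)
  have "pairing \<mu> w ?lu = pairing \<mu> v ?llu" if vw: "(v, w) \<in> sqrtL" for v w
  proof -
    have "(?u, ?lu) \<in> op_adjoint \<mu> sqrtL" unfolding saS by (rule S)
    then have 1: "pairing \<mu> w ?u = pairing \<mu> v ?lu" using vw unfolding op_adjoint_def by blast
    have c: "pairing \<mu> z (\<lambda>x. complex_of_real (lam l * k x)) = lam l * pairing \<mu> z (\<lambda>x. complex_of_real (k x))" for z k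
    proof -
      have "pairing \<mu> z (\<lambda>x. complex_of_real (lam l * k x)) = (LINT x|\<mu>. of_real (lam l) * (z x * cnj (complex_of_real (k x))))"
        unfolding pairing_def by (intro Bochner_Integration.integral_cong) auto
      then show ?thesis unfolding pairing_def by simp
    qed
    have "pairing \<mu> w ?lu = lam l * pairing \<mu> w ?u" by (rule c)
    also have "\<dots> = pairing \<mu> v (\<lambda>x. complex_of_real (lam l * (lam l * u l x)))" unfolding 1 by (rule c[symmetric])
    finally show ?thesis by (simp add: power2_eq_square mult.assoc)
  qed
  then have "(?lu, ?llu) \<in> op_adjoint \<mu> sqrtL"
    unfolding op_adjoint_def mem_Collect_eq prod.case using Lp[of "lam l"] Lp[of "(lam l)\<^sup>2"] by blast
  then show ?thesis using S saS SS by blast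
qed

text \<open>Self-adjointness transfers \<open>L\<close> to the eigenfunction, which is real, with a real
  eigenvalue.\<close>

lemma L_coefficients:
  assumes f: "f \<in> Cinf"
  shows "(LINT x|\<mu>. Lr f x * u l x) = (lam l)\<^sup>2 * (LINT x|\<mu>. f x * u l x)" "(LINT x|\<mu>. Li f x * u l x) = 0"
proof -
  have "((\<lambda>x. of_real (u l x)), (\<lambda>x. of_real ((lam l)\<^sup>2 * u l x))) \<in> op_adjoint \<mu> (L2_realization A \<mu> L)"
    using eigenvector_graph sa by (simp add: self_adjoint_def)
  then have "pairing \<mu> (L (\<lambda>x. of_real (f x))) (\<lambda>x. of_real (u l x)) = pairing \<mu> (\<lambda>x. of_real (f x)) (\<lambda>x. of_real ((lam l)\<^sup>2 * u l x))"
    using graph_L[OF f] unfolding op_adjoint_def by blast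
  moreover have "pairing \<mu> (\<lambda>x. of_real (f x)) (\<lambda>x. of_real ((lam l)\<^sup>2 * u l x)) = of_real (LINT x|\<mu>. f x * ((lam l)\<^sup>2 * u l x))"
    by (intro pairing_real integrable_continuous continuous_intros Cinf_continuous f u_FF)
  ultimately have "Complex (LINT x|\<mu>. Lr f x * u l x) (LINT x|\<mu>. Li f x * u l x) = of_real (LINT x|\<mu>. (lam l)\<^sup>2 * (f x * u l x))"
    unfolding pairing_L[OF f Cinf_continuous[OF u_FF]] by (simp add: mult.left_commute)
  then show "(LINT x|\<mu>. Lr f x * u l x) = (lam l)\<^sup>2 * (LINT x|\<mu>. f x * u l x)" "(LINT x|\<mu>. Li f x * u l x) = 0"
    by (simp_all add: complex_eq_iff)
qed

text \<open>All coefficients of the imaginary part vanish.\<close>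

lemma Li_zero: "f \<in> Cinf \<Longrightarrow> Li f x = 0"
  by (rule zero_by_coefficients[OF Li_continuous]) (auto simp: L_coefficients)

lemma Lr_u: "Lr (u l) = (\<lambda>x. (lam l)\<^sup>2 * u l x)"
proof
  fix x
  have c: "cont (Lr (u l))" "cont (u m)" for m by (intro Lr_continuous Cinf_continuous u_FF)+
  have "Lr (u l) x - (lam l)\<^sup>2 * u l x = 0"
  proof (rule zero_by_coefficients)
    show "cont (\<lambda>x. Lr (u l) x - (lam l)\<^sup>2 * u l x)" by (intro continuous_intros c)
    fix m
    have "(LINT y|\<mu>. (Lr (u l) y - (lam l)\<^sup>2 * u l y) * u m y) = (LINT y|\<mu>. Lr (u l) y * u m y - (lam l)\<^sup>2 * (u l y * u m y))"
      by (intro Bochner_Integration.integral_cong) (auto simp: algebra_simps)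
    also have "\<dots> = (LINT y|\<mu>. Lr (u l) y * u m y) - (lam l)\<^sup>2 * (LINT y|\<mu>. u l y * u m y)"
      using c by (simp add: integrable_continuous continuous_intros)
    also have "\<dots> = 0" unfolding L_coefficients(1)[OF u_FF] u_orthonormal by simp
    finally show "(LINT y|\<mu>. (Lr (u l) y - (lam l)\<^sup>2 * u l y) * u m y) = 0" .
  qed
  then show "Lr (u l) x = (lam l)\<^sup>2 * u l x" by simp
qed

section \<open>Ellipticity and the global Nash inequality\<close>

lemma carre_r_sym: "\<Gamma>r f h x = \<Gamma>r h f x"
  unfolding carre_def by (simp add: mult.commute add.commute)

lemma carre_r_continuous: "f \<in> Cinf \<Longrightarrow> h \<in> Cinf \<Longrightarrow> cont (\<Gamma>r f h)"
  unfolding carre_def[abs_def]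
  by (intro continuous_intros Cinf_continuous Lr_continuous Cinf_mult Cinf_const) auto

text \<open>The mixed terms for cosine and sine cancel, since \<open>cos\<^sup>2 + sin\<^sup>2\<close> is constant; what
  remains of the rapid oscillation is the symbol, multiplied by \<open>s\<^sup>2\<close>.\<close>

lemma oscillation_identity:
  fixes s :: real
  assumes f: "f \<in> Cinf" and w: "w \<in> Cinf"
  defines "c \<equiv> \<lambda>x. cos (s * w x)" and "t \<equiv> \<lambda>x. sin (s * w x)"
  shows "c \<in> Cinf" "t \<in> Cinf"
    "(f x * c x) * Lr (\<lambda>y. f y * c y) x + (f x * t x) * Lr (\<lambda>y. f y * t y) x = f x * Lr f x + s\<^sup>2 * ((f x)\<^sup>2 * \<Gamma>r w w x)"
proof -
  have sm: "smooth_on (\<lambda>z. cos (s * z)) UNIV" "smooth_on (\<lambda>z. sin (s * z)) UNIV"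
    by (intro smooth_on_compose[OF _ _ _ smooth_on_cos] smooth_on_compose[OF _ _ _ smooth_on_sin] smooth_on_bounded_linear[OF _ bounded_linear_mult_right] smooth_on_id; simp)+
  show c: "c \<in> Cinf" and t: "t \<in> Cinf" unfolding c_def t_def
    using Cinf_compose[OF w _ _ sm(1)] Cinf_compose[OF w _ _ sm(2)] by simp_all
  have L_mult: "Lr (\<lambda>y. h y * k y) x = h x * Lr k x + k x * Lr h x - 2 * \<Gamma>r h k x - h x * k x * Lr (\<lambda>_. 1) x" for h k
    unfolding carre_def by (simp add: field_simps)
  have ck: "\<Gamma>r c k x = - s * t x * \<Gamma>r w k x" if "k \<in> Cinf" for k
    unfolding c_def t_def by (rule carre_chain[OF w that c[unfolded c_def], of _ x]) (auto intro!: derivative_eq_intros)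
  have tk: "\<Gamma>r t k x = s * c x * \<Gamma>r w k x" if "k \<in> Cinf" for k
    unfolding c_def t_def by (rule carre_chain[OF w that t[unfolded t_def], of _ x]) (auto intro!: derivative_eq_intros)
  have one: "(c y)\<^sup>2 + (t y)\<^sup>2 = 1" for y by (simp add: c_def t_def)
  have "Lr (\<lambda>_. 1) x = Lr (\<lambda>y. c y * c y + t y * t y) x" using one by (simp add: power2_eq_square)
  also have "\<dots> = Lr (\<lambda>y. c y * c y) x + Lr (\<lambda>y. t y * t y) x" by (rule Lr_add[OF Cinf_mult[OF c c] Cinf_mult[OF t t]])
  finally have 1: "2 * (c x * Lr c x + t x * Lr t x) = 2 * (\<Gamma>r c c x + \<Gamma>r t t x) + Lr (\<lambda>_. 1) x * (1 + ((c x)\<^sup>2 + (t x)\<^sup>2))"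
    unfolding L_mult by (simp add: power2_eq_square algebra_simps)
  have 2: "\<Gamma>r c c x + \<Gamma>r t t x = s\<^sup>2 * \<Gamma>r w w x * ((c x)\<^sup>2 + (t x)\<^sup>2)"
    unfolding ck[OF c] tk[OF t] carre_r_sym[of w c] carre_r_sym[of w t] ck[OF w] tk[OF w]
    by (simp add: power2_eq_square algebra_simps)
  have 4: "c x * Lr c x + t x * Lr t x = s\<^sup>2 * \<Gamma>r w w x + Lr (\<lambda>_. 1) x"
    using 1 unfolding 2 one by simp
  have 3: "c x * \<Gamma>r f c x + t x * \<Gamma>r f t x = 0"
    unfolding carre_r_sym[of f c] carre_r_sym[of f t] ck[OF f] tk[OF f] by (simp add: algebra_simps)
  have "(f x * c x) * Lr (\<lambda>y. f y * c y) x + (f x * t x) * Lr (\<lambda>y. f y * t y) x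
     = (f x)\<^sup>2 * (c x * Lr c x + t x * Lr t x) + ((c x)\<^sup>2 + (t x)\<^sup>2) * (f x * Lr f x)
       - 2 * f x * (c x * \<Gamma>r f c x + t x * \<Gamma>r f t x) - (f x)\<^sup>2 * ((c x)\<^sup>2 + (t x)\<^sup>2) * Lr (\<lambda>_. 1) x"
    unfolding L_mult by (simp add: power2_eq_square algebra_simps)
  also have "\<dots> = f x * Lr f x + s\<^sup>2 * ((f x)\<^sup>2 * \<Gamma>r w w x)"
    unfolding 3 4 one by (simp add: algebra_simps)
  finally show "(f x * c x) * Lr (\<lambda>y. f y * c y) x + (f x * t x) * Lr (\<lambda>y. f y * t y) x = f x * Lr f x + s\<^sup>2 * ((f x)\<^sup>2 * \<Gamma>r w w x)" .
qed

text \<open>Otherwise the quadratic form of \<open>L\<close> would become negative on an oscillating function for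
  large \<open>s\<close>.\<close>

lemma weighted_carre_nonneg:
  assumes f: "f \<in> Cinf" and w: "w \<in> Cinf"
  shows "0 \<le> (LINT x|\<mu>. (f x)\<^sup>2 * \<Gamma>r w w x)"
proof (rule ccontr)
  let ?I = "LINT x|\<mu>. (f x)\<^sup>2 * \<Gamma>r w w x" and ?E = "LINT x|\<mu>. f x * Lr f x"
  assume "\<not> 0 \<le> ?I"
  then have neg: "?I < 0" by simp
  have cf: "cont f" "cont (Lr f)" "cont (\<Gamma>r w w)"
    by (intro Cinf_continuous Lr_continuous carre_r_continuous f w)+
  have "0 \<le> ?E + s\<^sup>2 * ?I" for s
  proof -
    define c where "c = (\<lambda>x. cos (s * w x))"
    define t where "t = (\<lambda>x. sin (s * w x))"
    note O = oscillation_identity(1,2)[OF f w, where s = s, folded c_def t_def]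
    have O3: "(f x * c x) * Lr (\<lambda>y. f y * c y) x + (f x * t x) * Lr (\<lambda>y. f y * t y) x = f x * Lr f x + s\<^sup>2 * ((f x)\<^sup>2 * \<Gamma>r w w x)" for x
      unfolding c_def t_def by (rule oscillation_identity(3)[OF f w])
    have FFs: "(\<lambda>y. f y * c y) \<in> Cinf" "(\<lambda>y. f y * t y) \<in> Cinf" by (intro Cinf_mult f O(1,2))+
    have i: "integrable \<mu> (\<lambda>x. (f x * c x) * Lr (\<lambda>y. f y * c y) x)" "integrable \<mu> (\<lambda>x. (f x * t x) * Lr (\<lambda>y. f y * t y) x)"
      by (intro integrable_continuous continuous_on_mult Cinf_continuous[OF FFs(1)] Cinf_continuous[OF FFs(2)] Lr_continuous FFs)+
    have "0 \<le> (LINT x|\<mu>. (f x * c x) * Lr (\<lambda>y. f y * c y) x) + (LINT x|\<mu>. (f x * t x) * Lr (\<lambda>y. f y * t y) x)"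
      using Lr_nonneg[OF FFs(1)] Lr_nonneg[OF FFs(2)] by linarith
    also have "\<dots> = (LINT x|\<mu>. (f x * c x) * Lr (\<lambda>y. f y * c y) x + (f x * t x) * Lr (\<lambda>y. f y * t y) x)"
      using i by simp
    also have "\<dots> = (LINT x|\<mu>. f x * Lr f x + s\<^sup>2 * ((f x)\<^sup>2 * \<Gamma>r w w x))"
      by (intro Bochner_Integration.integral_cong refl O3)
    also have "\<dots> = ?E + s\<^sup>2 * ?I" using cf by (simp add: integrable_continuous continuous_intros)
    finally show ?thesis .
  qed
  note q = this
  define k where "k = (\<bar>?E\<bar> + 1) / - ?I"
  have "0 \<le> k" using neg unfolding k_def by (intro divide_nonneg_pos) auto
  moreover have "k * ?I = - (\<bar>?E\<bar> + 1)" using neg by (simp add: k_def)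
  ultimately show False using q[of "sqrt k"] by simp
qed

lemma bump_near:
  assumes U: "open U" "y \<in> U"
  obtains \<phi> where "\<phi> \<in> Cinf" "\<phi> y = 1" "\<forall>z. z \<notin> U \<longrightarrow> \<phi> z = 0"
proof -
  obtain c where c: "c \<in> A" "y \<in> fst c" by (rule chart_at)
  note C = chartD[OF c(1)]
  have "open {x \<in> coord_range c. coord_inv c x \<in> U}" by (rule chart_open_image(2)[OF c(1) U(1)])
  moreover have "snd c y \<in> {x \<in> coord_range c. coord_inv c x \<in> U}" using c C U by simp
  ultimately obtain e where e: "0 < e" "cball (snd c y) e \<subseteq> {x \<in> coord_range c. coord_inv c x \<in> U}" using open_contains_cball by blast
  obtain r where r: "patch c (snd c y) r" "r \<le> e / 2" using patch_at[OF c, of "e / 2"] e(1) by auto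
  obtain h where h: "h \<in> Cinf" "\<And>z. z \<in> cball (snd c y) r \<Longrightarrow> h (coord_inv c z) = 1"
      "\<And>z. z \<notin> coord_inv c ` cball (snd c y) (2 * r) \<Longrightarrow> h z = 0"
    using patch_function[OF r(1) smooth_on_const[of 1]] by metis
  have "h y = 1" using h(2)[of "snd c y"] C(6)[OF c(2)] patchD(2)[OF r(1)] by simp
  moreover have "h z = 0" if "z \<notin> U" for z
  proof (rule h(3))
    have "cball (snd c y) (2 * r) \<subseteq> cball (snd c y) e" using r(2) by (intro subset_cball) auto
    then show "z \<notin> coord_inv c ` cball (snd c y) (2 * r)" using e(2) that by blast
  qed
  ultimately show ?thesis using that h(1) by blast
qed

text \<open>Localise the integrated inequality with a bump function.\<close>

lemma carre_r_nonneg: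
  assumes w: "w \<in> Cinf" shows "0 \<le> \<Gamma>r w w y"
proof (rule ccontr)
  assume "\<not> 0 \<le> \<Gamma>r w w y"
  then have y: "y \<in> {z. \<Gamma>r w w z < 0}" by simp
  have cw: "cont (\<Gamma>r w w)" by (rule carre_r_continuous[OF w w])
  have U: "open {z. \<Gamma>r w w z < 0}" by (intro open_Collect_less cw continuous_on_const)
  obtain \<phi> where \<phi>: "\<phi> \<in> Cinf" "\<phi> y = 1" "\<forall>z. z \<notin> {z. \<Gamma>r w w z < 0} \<longrightarrow> \<phi> z = 0" by (rule bump_near[OF U y])
  \<comment> \<open>A continuous function whose square integrates to at most \<open>0\<close>, although it is not zero at \<open>y\<close>.\<close>
  define h where "h z = sqrt (- ((\<phi> z)\<^sup>2 * \<Gamma>r w w z))" for z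
  have np: "0 \<le> - ((\<phi> z)\<^sup>2 * \<Gamma>r w w z)" for z using \<phi>(3)[rule_format, of z] by (cases "\<Gamma>r w w z < 0") (auto simp: mult_le_0_iff)
  have h2: "(h z)\<^sup>2 = - ((\<phi> z)\<^sup>2 * \<Gamma>r w w z)" for z using np[of z] unfolding h_def by simp
  have ch: "cont h" unfolding h_def by (intro continuous_intros Cinf_continuous \<phi>(1) cw)
  have hi: "integrable \<mu> (\<lambda>z. (h z)\<^sup>2)" by (intro integrable_continuous continuous_intros ch)
  have "(LINT z|\<mu>. (h z)\<^sup>2) \<le> 0" unfolding h2 using weighted_carre_nonneg[OF \<phi>(1) w] by simp
  then have "(LINT z|\<mu>. (h z)\<^sup>2) = 0" by (simp add: antisym)
  then have "h y = 0" using continuous_square_zero[OF finite_measure_axioms sets_\<mu> _ ch hi] open_measure_pos by blast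
  then show False using h2[of y] \<phi>(2) y by simp
qed

sublocale diffusion \<mu> Cinf Lr
  by unfold_locales (auto intro: Cinf_const Cinf_add Cinf_mult Cinf_sqrt Cinf_continuous Lr_continuous Lr_sym carre_derivation_r carre_r_nonneg simp: Lr_add Lr_cmult)

lemma symb_linear:
  assumes x: "x \<in> ball a r" and f: "smooth_on f (ball a r)" "\<And>z. z \<in> ball a r \<Longrightarrow> f z = z \<bullet> \<xi>"
  shows "symb k f f x = 2 * (\<Sum>i\<in>UNIV. \<Sum>j\<in>UNIV. k i j * (\<xi> $ i * \<xi> $ j))"
proof -
  have "partial i f x = \<xi> $ i" for i
    using partial_cong[OF open_ball x f] partial_linear[of i \<xi> x] by simp
  then show ?thesis unfolding symb_def sum_distrib_left by (intro sum.cong refl) (simp add: mult.commute)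
qed

text \<open>Test \<open>\<Gamma> \<ge> 0\<close> on a function that is linear near the point. The imaginary part of the
  symbol vanishes with that of \<open>L\<close>, so ellipticity, which says that the complex symbol
  is not zero, forces a strict sign.\<close>

lemma symbol_positive:
  assumes c: "c \<in> A" and x: "x \<in> coord_range c" and \<xi>: "\<xi> \<noteq> 0"
    and co: "coefficients c a b e"
  shows "(\<Sum>i\<in>UNIV. \<Sum>j\<in>UNIV. Re (a i j x) * (\<xi> $ i * \<xi> $ j)) < 0"
proof -
  note C = chartD[OF c]
  obtain s where p: "patch c x s" "s \<le> 1" using patch_at[OF c C(7)[OF x], of 1] C(8)[OF x] by auto
  have s: "0 < s" by (rule patchD(2)[OF p(1)])
  have sl: "smooth_on (\<lambda>z. z \<bullet> \<xi>) UNIV" by (intro smooth_on_bounded_linear[OF _ bounded_linear_inner_left] smooth_on_id) auto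
  obtain f where f: "f \<in> Cinf" "\<And>z. z \<in> cball x s \<Longrightarrow> f (coord_inv c z) = z \<bullet> \<xi>" using patch_function[OF p(1) sl] by metis
  have sf: "smooth_on (\<lambda>z. f (coord_inv c z)) (coord_range c)" by (rule Cinf_D[OF f(1) c])
  have sb: "smooth_on (\<lambda>z. f (coord_inv c z)) (ball x s)"
    by (rule smooth_on_subset[OF sf]) (use patchD(4)[OF p(1)] ball_subset_cball in blast)
  have x': "x \<in> ball x s" using s by simp
  have sym: "symb k (\<lambda>z. f (coord_inv c z)) (\<lambda>z. f (coord_inv c z)) x = 2 * (\<Sum>i\<in>UNIV. \<Sum>j\<in>UNIV. k i j * (\<xi> $ i * \<xi> $ j))" for k
    by (rule symb_linear[OF x' sb]) (use f(2) in auto)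
  have "0 \<le> \<Gamma>r f f (coord_inv c x)" by (rule carre_r_nonneg[OF f(1)])
  then have 1: "(\<Sum>i\<in>UNIV. \<Sum>j\<in>UNIV. Re (a i j x) * (\<xi> $ i * \<xi> $ j)) \<le> 0"
    unfolding carre_coordinates[OF c co x f(1) f(1)] sym by simp
  have "Im (e x) = 0" using coefficientsD(6)[OF co Cinf_const[of 1] x] Li_zero[OF Cinf_const[of 1]] by (simp add: dop_const)
  moreover have "dop (\<lambda>i j. Im (a i j x)) (\<lambda>i. Im (b i x)) (Im (e x)) (\<lambda>z. f (coord_inv c z)) x = 0"
    "dop (\<lambda>i j. Im (a i j x)) (\<lambda>i. Im (b i x)) (Im (e x)) (\<lambda>z. f (coord_inv c z) * f (coord_inv c z)) x = 0"
    using coefficientsD(6)[OF co f(1) x] coefficientsD(6)[OF co Cinf_mult[OF f(1) f(1)] x] Li_zero[OF f(1)] Li_zero[OF Cinf_mult[OF f(1) f(1)]] by simp_all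
  ultimately have 2: "(\<Sum>i\<in>UNIV. \<Sum>j\<in>UNIV. Im (a i j x) * (\<xi> $ i * \<xi> $ j)) = 0"
    using dop_mult[OF C(2) x sf sf, of "\<lambda>i j. Im (a i j x)" "\<lambda>i. Im (b i x)" "Im (e x)"] unfolding sym by simp
  have "Complex (\<Sum>i\<in>UNIV. \<Sum>j\<in>UNIV. Re (a i j x) * (\<xi> $ i * \<xi> $ j)) (\<Sum>i\<in>UNIV. \<Sum>j\<in>UNIV. Im (a i j x) * (\<xi> $ i * \<xi> $ j))
    = (\<Sum>i\<in>UNIV. \<Sum>j\<in>UNIV. a i j x * of_real (\<xi> $ i * \<xi> $ j))"
    by (simp add: complex_eq_iff)
  then have "(\<Sum>i\<in>UNIV. \<Sum>j\<in>UNIV. Re (a i j x) * (\<xi> $ i * \<xi> $ j)) \<noteq> 0"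
    using 2 coefficientsD(4)[OF co x \<xi>] by (auto simp: complex_eq_iff)
  with 1 show ?thesis by simp
qed

text \<open>The symbol attains a positive minimum on the product of the ball with the unit sphere.\<close>

lemma patch_elliptic:
  assumes p: "patch c a0 r0"
  obtains \<kappa> where "0 < \<kappa>"
    "\<forall>f\<in>Cinf. \<forall>x\<in>cball a0 r0. \<kappa> * (grad (\<lambda>z. f (coord_inv c z)) x \<bullet> grad (\<lambda>z. f (coord_inv c z)) x) \<le> \<Gamma>r f f (coord_inv c x)"
proof -
  note P = patchD[OF p]
  obtain a b e where co: "coefficients c a b e" by (rule coefficients_exist[OF P(1)])
  define q where "q x \<xi> = - (\<Sum>i\<in>UNIV. \<Sum>j\<in>UNIV. Re (a i j x) * (\<xi> $ i * \<xi> $ j))" for x and \<xi> :: "real^'n"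
  have q: "0 < q x \<xi>" if "x \<in> coord_range c" "\<xi> \<noteq> 0" for x \<xi>
    using symbol_positive[OF P(1) that co] by (simp add: q_def)
  let ?D = "cball a0 r0 \<times> sphere (0::real^'n) 1"
  have ne: "?D \<noteq> {}" using P(2) norm_axis_1 by auto
  have cd: "compact ?D" by (intro compact_Times compact_cball compact_sphere)
  have ca: "continuous_on ?D (\<lambda>z. a i j (fst z))" for i j
    by (rule continuous_on_compose2[OF smooth_on_continuous[OF coefficientsD(1)[OF co, of i j]] continuous_on_fst[OF continuous_on_id]]) (use P(4) in auto)
  have cq: "continuous_on ?D (\<lambda>z. q (fst z) (snd z))" unfolding q_def
    by (intro continuous_intros ca)
  obtain z where z: "z \<in> ?D" "\<And>w. w \<in> ?D \<Longrightarrow> q (fst z) (snd z) \<le> q (fst w) (snd w)"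
    using continuous_attains_inf[OF cd ne cq] by blast
  define \<kappa> where "\<kappa> = q (fst z) (snd z)"
  have \<kappa>: "0 < \<kappa>" unfolding \<kappa>_def using z(1) P(4) by (intro q) auto
  have qh: "q x (t *\<^sub>R \<xi>) = t\<^sup>2 * q x \<xi>" for x t \<xi>
    by (simp add: q_def sum_distrib_left power2_eq_square mult_ac)
  have bound: "\<kappa> * (\<xi> \<bullet> \<xi>) \<le> q x \<xi>" if x: "x \<in> cball a0 r0" for x \<xi>
  proof (cases "\<xi> = 0")
    case False
    have "\<kappa> \<le> q x ((1 / norm \<xi>) *\<^sub>R \<xi>)" using z(2)[of "(x, (1 / norm \<xi>) *\<^sub>R \<xi>)"] x False by (auto simp: \<kappa>_def)
    then show ?thesis unfolding qh using False by (simp add: power2_norm_eq_inner[symmetric] field_simps)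
  qed (simp add: q_def)
  show ?thesis
  proof (rule that[OF \<kappa>], intro ballI)
    fix f x assume f: "f \<in> Cinf" and x: "x \<in> cball a0 r0"
    have x': "x \<in> coord_range c" using x P(4) by blast
    let ?f = "\<lambda>z. f (coord_inv c z)"
    have "symb (\<lambda>i j. Re (a i j x)) ?f ?f x = 2 * (\<Sum>i\<in>UNIV. \<Sum>j\<in>UNIV. Re (a i j x) * (grad ?f x $ i * grad ?f x $ j))"
      unfolding symb_def sum_distrib_left by (intro sum.cong refl) (simp add: grad_def mult.commute)
    then have "\<Gamma>r f f (coord_inv c x) = q x (grad ?f x)"
      unfolding carre_coordinates[OF P(1) co x' f f] q_def by simp
    then show "\<kappa> * (grad ?f x \<bullet> grad ?f x) \<le> \<Gamma>r f f (coord_inv c x)" using bound[OF x] by simp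
  qed
qed

text \<open>The Euclidean Nash inequality on the ball, transported by the chart; ellipticity
  replaces the gradient by \<open>\<Gamma>\<close>.\<close>

lemma patch_nash:
  assumes p: "patch c a r"
  obtains C where "0 < C"
    "\<forall>h \<delta>. h \<in> Cinf \<longrightarrow> 0 < \<delta> \<longrightarrow> \<delta> \<le> 1 \<longrightarrow> (\<integral>\<^sup>+y. ennreal ((h y)\<^sup>2) * indicator (coord_inv c ` cball a r) y \<partial>\<mu>) \<le>
      ennreal (C * (\<delta>\<^sup>2 * (LINT x|\<mu>. \<Gamma>r h h x) + (LINT x|\<mu>. \<bar>h x\<bar>)\<^sup>2 / \<delta> ^ CARD('n)))"
proof -
  note P = patchD[OF p] note Ch = chartD[OF P(1)]
  let ?K = "cball a r" and ?n = "CARD('n)"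
  let ?M = "coord_inv c ` ?K"
  obtain C0 where C0: "0 < C0" and up: "\<forall>f \<in> borel_measurable borel. (\<integral>\<^sup>+y. f y * indicator ?M y \<partial>\<mu>) \<le> ennreal C0 * (\<integral>\<^sup>+x. f (coord_inv c x) * indicator ?K x \<partial>lborel)"
    and lo: "\<forall>f \<in> borel_measurable borel. (\<integral>\<^sup>+x. f (coord_inv c x) * indicator ?K x \<partial>lborel) \<le> ennreal C0 * (\<integral>\<^sup>+y. f y * indicator ?M y \<partial>\<mu>)"
    by (rule chart_compare[OF P(1) compact_cball P(4)])
  obtain \<kappa> where \<kappa>: "0 < \<kappa>" and el: "\<forall>f\<in>Cinf. \<forall>x\<in>cball a r. \<kappa> * (grad (\<lambda>z. f (coord_inv c z)) x \<bullet> grad (\<lambda>z. f (coord_inv c z)) x) \<le> \<Gamma>r f f (coord_inv c x)"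
    by (rule patch_elliptic[OF p])
  define m where "m = measure lborel ?K"
  have m: "0 < m" unfolding m_def by (rule content_cball_pos[OF P(2)])
  define D where "D = (2 * r)\<^sup>2"
  have D: "0 \<le> D" "(y - x) \<bullet> (y - x) \<le> D" if "x \<in> ?K" "y \<in> ?K" for x y
  proof -
    have "norm (y - x) \<le> 2 * r" using that dist_triangle[of y x a] by (simp add: dist_norm norm_minus_commute)
    then show "(y - x) \<bullet> (y - x) \<le> D" unfolding D_def power2_norm_eq_inner[symmetric] by (intro power_mono) auto
  qed (simp add: D_def)
  have D0: "0 \<le> D" by (simp add: D_def)
  define C1 where "C1 = C0 * (D * 2 ^ ?n / 4) * (C0 / \<kappa>)"
  define C2 where "C2 = C0 * (2 * 2 ^ ?n) * C0\<^sup>2 / m"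
  have C12: "0 \<le> C1" "0 < C2" using C0 \<kappa> m D0 by (auto simp: C1_def C2_def)
  show ?thesis
  proof (rule that[of "C1 + C2"], use C12 in simp, intro allI impI)
    fix h \<delta> assume h: "h \<in> Cinf" and \<delta>: "0 < \<delta>" "\<delta> \<le> (1::real)"
    let ?h = "\<lambda>z. h (coord_inv c z)"
    let ?E = "LINT x|\<mu>. \<Gamma>r h h x" and ?S = "LINT x|\<mu>. \<bar>h x\<bar>"
    have cont: "cont h" "cont (\<Gamma>r h h)" by (intro Cinf_continuous carre_r_continuous h)+
    have E0: "0 \<le> ?E" and S0: "0 \<le> ?S" using carre_r_nonneg[OF h] by simp_all
    have full: "(\<integral>\<^sup>+y. ennreal (k y) * indicator ?M y \<partial>\<mu>) \<le> ennreal (LINT x|\<mu>. k x)" if k: "cont k" "\<And>x. 0 \<le> k x" for k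
    proof -
      have "(\<integral>\<^sup>+y. ennreal (k y) * indicator ?M y \<partial>\<mu>) \<le> (\<integral>\<^sup>+y. ennreal (k y) \<partial>\<mu>)" by (intro nn_integral_mono) (simp add: indicator_def)
      also have "\<dots> = ennreal (LINT x|\<mu>. k x)" using k by (intro nn_integral_eq_integral integrable_continuous) auto
      finally show ?thesis .
    qed
    have mb: "(\<lambda>y. ennreal (k y)) \<in> borel_measurable borel" if "cont k" for k :: "'m \<Rightarrow> real"
      using borel_measurable_continuous_onI[OF that] by measurable
    define Y where "Y = (\<integral>\<^sup>+x. ennreal ((?h x)\<^sup>2) * indicator ?K x \<partial>lborel)"
    define Gd where "Gd = (\<integral>\<^sup>+x. ennreal (grad ?h x \<bullet> grad ?h x) * indicator ?K x \<partial>lborel)"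
    define W where "W = (\<integral>\<^sup>+x. ennreal \<bar>?h x\<bar> * indicator ?K x \<partial>lborel)"
    have W: "W \<le> ennreal (C0 * ?S)"
    proof -
      have "W \<le> ennreal C0 * (\<integral>\<^sup>+y. ennreal \<bar>h y\<bar> * indicator ?M y \<partial>\<mu>)"
        unfolding W_def by (rule lo[rule_format, of "\<lambda>y. ennreal \<bar>h y\<bar>"]) (intro mb continuous_intros cont)
      also have "\<dots> \<le> ennreal C0 * ennreal ?S" by (intro mult_left_mono full continuous_intros cont) auto
      finally show ?thesis using C0 S0 by (simp add: ennreal_mult)
    qed
    have Gd: "Gd \<le> ennreal (C0 / \<kappa> * ?E)"
    proof -
      have "Gd \<le> (\<integral>\<^sup>+x. ennreal (\<Gamma>r h h (coord_inv c x) / \<kappa>) * indicator ?K x \<partial>lborel)" unfolding Gd_def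
      proof (rule nn_integral_mono)
        fix x
        show "ennreal (grad ?h x \<bullet> grad ?h x) * indicator ?K x \<le> ennreal (\<Gamma>r h h (coord_inv c x) / \<kappa>) * indicator ?K x"
        proof (cases "x \<in> ?K")
          case True
          have "grad ?h x \<bullet> grad ?h x \<le> \<Gamma>r h h (coord_inv c x) / \<kappa>" using el[rule_format, OF h True] \<kappa> by (simp add: field_simps)
          then show ?thesis using True by (simp add: ennreal_leI)
        qed simp
      qed
      also have "\<dots> \<le> ennreal C0 * (\<integral>\<^sup>+y. ennreal (\<Gamma>r h h y / \<kappa>) * indicator ?M y \<partial>\<mu>)"
        by (rule lo[rule_format, of "\<lambda>y. ennreal (\<Gamma>r h h y / \<kappa>)"]) (intro mb continuous_intros cont, use \<kappa> in auto)
      also have "\<dots> \<le> ennreal C0 * ennreal (LINT y|\<mu>. \<Gamma>r h h y / \<kappa>)"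
        by (intro mult_left_mono full continuous_intros cont) (use \<kappa> carre_r_nonneg[OF h] in auto)
      also have "\<dots> = ennreal (C0 / \<kappa> * ?E)" using C0 \<kappa> E0 by (simp add: ennreal_mult[symmetric])
      finally show ?thesis .
    qed
    have "ennreal m * Y \<le> ennreal ((\<delta> / 2)\<^sup>2 * D * 2 ^ ?n * m) * Gd + ennreal (2 / (\<delta> / 2) ^ ?n) * W\<^sup>2"
      unfolding m_def Y_def Gd_def W_def
      by (rule local_nash[OF compact_cball convex_cball P(4) Ch(2) Cinf_D[OF h P(1)] m[unfolded m_def] D0 D(2)]) (use \<delta> in auto)
    also have "\<dots> \<le> ennreal ((\<delta> / 2)\<^sup>2 * D * 2 ^ ?n * m) * ennreal (C0 / \<kappa> * ?E) + ennreal (2 / (\<delta> / 2) ^ ?n) * (ennreal (C0 * ?S))\<^sup>2"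
      by (intro add_mono mult_left_mono power_mono Gd W) auto
    also have "\<dots> = ennreal ((\<delta> / 2)\<^sup>2 * D * 2 ^ ?n * m * (C0 / \<kappa> * ?E) + 2 / (\<delta> / 2) ^ ?n * (C0 * ?S)\<^sup>2)"
    proof -
      have e: "ennreal \<alpha> * ennreal \<beta> + ennreal \<gamma> * (ennreal \<eta>)\<^sup>2 = ennreal (\<alpha> * \<beta> + \<gamma> * \<eta>\<^sup>2)"
        if "0 \<le> \<alpha>" "0 \<le> \<beta>" "0 \<le> \<gamma>" "0 \<le> \<eta>" for \<alpha> \<beta> \<gamma> \<eta> :: real
        using that by (simp add: ennreal_mult ennreal_power ennreal_plus)
      show ?thesis by (rule e) (use D0 m C0 \<kappa> E0 S0 \<delta> in auto)
    qed
    finally have mY: "ennreal m * Y \<le> ennreal ((\<delta> / 2)\<^sup>2 * D * 2 ^ ?n * m * (C0 / \<kappa> * ?E) + 2 / (\<delta> / 2) ^ ?n * (C0 * ?S)\<^sup>2)" .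
    have "(\<integral>\<^sup>+y. ennreal ((h y)\<^sup>2) * indicator ?M y \<partial>\<mu>) \<le> ennreal C0 * Y"
      unfolding Y_def by (rule up[rule_format, of "\<lambda>y. ennreal ((h y)\<^sup>2)"]) (intro mb continuous_intros cont)
    also have "\<dots> = ennreal (C0 / m) * (ennreal m * Y)"
      using m C0 by (simp add: mult.assoc[symmetric] ennreal_mult[symmetric])
    also have "\<dots> \<le> ennreal (C0 / m) * ennreal ((\<delta> / 2)\<^sup>2 * D * 2 ^ ?n * m * (C0 / \<kappa> * ?E) + 2 / (\<delta> / 2) ^ ?n * (C0 * ?S)\<^sup>2)"
      by (intro mult_left_mono mY) simp
    also have "\<dots> = ennreal (C0 / m * ((\<delta> / 2)\<^sup>2 * D * 2 ^ ?n * m * (C0 / \<kappa> * ?E) + 2 / (\<delta> / 2) ^ ?n * (C0 * ?S)\<^sup>2))"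
      by (intro ennreal_mult[symmetric] add_nonneg_nonneg mult_nonneg_nonneg divide_nonneg_nonneg) (use D0 m C0 \<kappa> E0 S0 \<delta> in auto)
    also have "C0 / m * ((\<delta> / 2)\<^sup>2 * D * 2 ^ ?n * m * (C0 / \<kappa> * ?E) + 2 / (\<delta> / 2) ^ ?n * (C0 * ?S)\<^sup>2) = C1 * (\<delta>\<^sup>2 * ?E) + C2 * (?S\<^sup>2 / \<delta> ^ ?n)"
      using m \<kappa> \<delta> by (simp add: C1_def C2_def power_divide power_mult_distrib field_simps)
    also have "ennreal (C1 * (\<delta>\<^sup>2 * ?E) + C2 * (?S\<^sup>2 / \<delta> ^ ?n)) \<le> ennreal ((C1 + C2) * (\<delta>\<^sup>2 * ?E + ?S\<^sup>2 / \<delta> ^ ?n))"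
    proof (rule ennreal_leI)
      have "0 \<le> C1 * (?S\<^sup>2 / \<delta> ^ ?n)" "0 \<le> C2 * (\<delta>\<^sup>2 * ?E)" using C12 \<delta> E0 by auto
      then show "C1 * (\<delta>\<^sup>2 * ?E) + C2 * (?S\<^sup>2 / \<delta> ^ ?n) \<le> (C1 + C2) * (\<delta>\<^sup>2 * ?E + ?S\<^sup>2 / \<delta> ^ ?n)"
        unfolding distrib_left distrib_right by linarith
    qed
    finally show "(\<integral>\<^sup>+y. ennreal ((h y)\<^sup>2) * indicator ?M y \<partial>\<mu>) \<le> ennreal ((C1 + C2) * (\<delta>\<^sup>2 * ?E + ?S\<^sup>2 / \<delta> ^ ?n))" .
  qed
qed

lemma global_nash:
  obtains C where "0 < C" "nash_inequality CARD('n) C"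
proof -
  obtain I where I0: "finite I" "\<forall>c a r. (c, a, r) \<in> I \<longrightarrow> patch c a r" "(\<Union>(c, a, r)\<in>I. coord_inv c ` cball a r) = UNIV"
    by (rule finite_cover)
  note I = I0(1) I0(2)[rule_format] I0(3)
  let ?S = "{(h, \<delta>). h \<in> Cinf \<and> 0 < \<delta> \<and> \<delta> \<le> (1::real)}"
  let ?R = "\<lambda>(h, \<delta>). \<delta>\<^sup>2 * (LINT x|\<mu>. \<Gamma>r h h x) + (LINT x|\<mu>. \<bar>h x\<bar>)\<^sup>2 / \<delta> ^ CARD('n)"
  have sq: "cont (\<lambda>x. (h x)\<^sup>2)" if "h \<in> Cinf" for h
    by (intro continuous_intros Cinf_continuous that)
  have R0: "0 \<le> ?R i" if "i \<in> ?S" for i using that by (auto simp: carre_r_nonneg)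
  obtain C where C: "0 < C" "\<forall>i\<in>?S. (\<integral>\<^sup>+y. ennreal ((fst i y)\<^sup>2) \<partial>\<mu>) \<le> ennreal (C * ?R i)"
  proof (rule cover_bound[OF I, where S = ?S and f = "\<lambda>i y. ennreal ((fst i y)\<^sup>2)" and R = ?R])
    show "(\<lambda>y. ennreal ((fst i y)\<^sup>2)) \<in> borel_measurable borel" if "i \<in> ?S" for i
    proof -
      have "fst i \<in> Cinf" using that by auto
      from borel_measurable_continuous_onI[OF sq[OF this]] show ?thesis by measurable
    qed
    show "\<exists>C>0. \<forall>i\<in>?S. (\<integral>\<^sup>+y. ennreal ((fst i y)\<^sup>2) * indicator (coord_inv c ` cball a r) y \<partial>\<mu>) \<le> ennreal (C * ?R i)"
      if "(c, a, r) \<in> I" for c a r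
      by (rule patch_nash[OF I(2)[OF that]]) auto
  qed (use R0 in auto)
  have "nash_inequality CARD('n) C" unfolding nash_inequality_def
  proof (intro allI impI)
    fix h \<delta> assume h: "h \<in> Cinf" and \<delta>: "0 < \<delta>" "\<delta> \<le> (1::real)"
    have "ennreal (LINT x|\<mu>. (h x)\<^sup>2) = (\<integral>\<^sup>+x. ennreal ((h x)\<^sup>2) \<partial>\<mu>)"
      by (intro nn_integral_eq_integral[symmetric] integrable_continuous sq h) auto
    also have "\<dots> \<le> ennreal (C * ?R (h, \<delta>))" using bspec[OF C(2), of "(h, \<delta>)"] h \<delta> by simp
    finally show "(LINT x|\<mu>. (h x)\<^sup>2) \<le> C * (\<delta>\<^sup>2 * (LINT x|\<mu>. \<Gamma>r h h x) + (LINT x|\<mu>. \<bar>h x\<bar>)\<^sup>2 / \<delta> ^ CARD('n))"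
      using R0[of "(h, \<delta>)"] C(1) h \<delta> by (subst (asm) ennreal_le_iff) auto
  qed
  with C(1) show ?thesis by (rule that)
qed

end

section \<open>Weights built from coordinate functions\<close>

context diffusion
begin

lemma finite_family_bounded:
  fixes K :: "('m \<Rightarrow> real) set"
  assumes "finite K" "\<And>f. f \<in> K \<Longrightarrow> cont f"
  obtains M where "0 \<le> M" "\<forall>f\<in>K. \<forall>x. \<bar>f x\<bar> \<le> M"
proof -
  have "\<exists>M\<ge>0. \<forall>f\<in>K. \<forall>x. \<bar>f x\<bar> \<le> M" using assms
  proof (induction K rule: finite_induct)
    case (insert f K)
    then obtain M where M: "M \<ge> 0" "\<forall>f\<in>K. \<forall>x. \<bar>f x\<bar> \<le> M" by auto
    obtain B where B: "\<And>x. \<bar>f x\<bar> \<le> B" using continuous_bounded[of f] insert.prems by (metis insertI1)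
    show ?case using M B by (intro exI[of _ "max M B"]) (auto simp: le_max_iff_disj)
  qed auto
  then show ?thesis using that by blast
qed

lemma carre_sum_right:
  "k \<in> F \<Longrightarrow> (\<And>i. i \<in> I \<Longrightarrow> f i \<in> F) \<Longrightarrow> \<Gamma> k (\<lambda>y. \<Sum>i\<in>I. f i y) x = (\<Sum>i\<in>I. \<Gamma> k (f i) x)"
  by (induction I rule: infinite_finite_induct) (auto simp: carre_const carre_add_right F_sum)

text \<open>With \<open>s\<^sub>k = \<psi>\<^sub>k - \<psi>\<^sub>k x\<^sub>0\<close>, bounded together with \<open>L s\<^sub>k\<close> and \<open>\<Gamma> s\<^sub>k s\<^sub>l\<close>, one has
  \<open>\<epsilon>\<^sup>2 L (s\<^sub>k\<^sup>2 / \<epsilon>\<^sup>2) = O(1)\<close>, and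
  \<open>\<epsilon>\<^sup>2 \<Gamma> (s\<^sub>k\<^sup>2 / \<epsilon>\<^sup>2) (s\<^sub>l\<^sup>2 / \<epsilon>\<^sup>2) = O(s\<^sub>k s\<^sub>l / \<epsilon>\<^sup>2)\<close>, where \<open>\<bar>s\<^sub>k s\<^sub>l\<bar> / \<epsilon>\<^sup>2 \<le> \<rho>\<close>.\<close>

lemma distance_weight:
  assumes J: "finite J" and \<psi>: "\<And>k. k \<in> J \<Longrightarrow> \<psi> k \<in> F"
  obtains B where "0 \<le> B"
    "\<forall>\<epsilon> x0. 0 < \<epsilon> \<longrightarrow> \<epsilon> \<le> 1 \<longrightarrow> weight B \<epsilon> (\<lambda>y. 1 + (\<Sum>k\<in>J. ((\<psi> k y - \<psi> k x0) / \<epsilon>)\<^sup>2))"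
proof -
  let ?fam = "insert (L (\<lambda>_. 1)) (\<psi> ` J \<union> (\<lambda>k. L (\<psi> k)) ` J \<union> (\<lambda>(k, l). \<Gamma> (\<psi> k) (\<psi> l)) ` (J \<times> J))"
  obtain M where M0: "0 \<le> M" and M: "\<forall>f\<in>?fam. \<forall>x. \<bar>f x\<bar> \<le> M"
  proof (rule finite_family_bounded[of ?fam])
    show "cont f" if "f \<in> ?fam" for f
      using that \<psi> by (auto intro: L_continuous F_continuous carre_continuous F_const)
  qed (use J in auto)
  have M1: "\<bar>L (\<lambda>_. 1) x\<bar> \<le> M" for x using M by auto
  have M\<psi>: "\<bar>\<psi> k x\<bar> \<le> M" "\<bar>L (\<psi> k) x\<bar> \<le> M" if "k \<in> J" for k x using M that by auto
  have M\<Gamma>: "\<bar>\<Gamma> (\<psi> k) (\<psi> l) x\<bar> \<le> M" if "k \<in> J" "l \<in> J" for k l x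
  proof -
    have "\<Gamma> (\<psi> k) (\<psi> l) \<in> ?fam" using that by (intro insertI2 UnI2 image_eqI[of _ _ "(k, l)"]) auto
    then show ?thesis using M by blast
  qed
  define M2 where "M2 = 2 * (2 * M * (M + M * M)) + 2 * M + (2 * M) * (2 * M) * M"
  have M20: "0 \<le> M2" using M0 by (simp add: M2_def)
  define B where "B = M + real (card J) * M2 + real (card J) * (real (card J) * (4 * M))"
  have B: "0 \<le> B" "M \<le> B" "M + real (card J) * M2 \<le> B" "real (card J) * (real (card J) * (4 * M)) \<le> B"
    using M0 M20 by (auto simp: B_def)
  show ?thesis
  proof (rule that[OF B(1)], intro allI impI)
    fix \<epsilon> :: real and x0 assume \<epsilon>: "0 < \<epsilon>" "\<epsilon> \<le> 1"
    define s where "s k y = \<psi> k y + - \<psi> k x0" for k y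
    have sF: "s k \<in> F" if "k \<in> J" for k unfolding s_def[abs_def] by (intro F_add F_const \<psi> that)
    have s_bound: "\<bar>s k y\<bar> \<le> 2 * M" if "k \<in> J" for k y
      using M\<psi>(1)[OF that, of y] M\<psi>(1)[OF that, of x0] by (simp add: s_def)
    have Ls: "\<bar>L (s k) y\<bar> \<le> M + M * M" if k: "k \<in> J" for k y
    proof -
      have "L (s k) y = L (\<psi> k) y + - \<psi> k x0 * L (\<lambda>_. 1) y"
        unfolding s_def[abs_def] L_add[OF \<psi>[OF k] F_const] using L_cmult[OF F_const[of 1], of "- \<psi> k x0"] by simp
      moreover have "\<bar>\<psi> k x0 * L (\<lambda>_. 1) y\<bar> \<le> M * M" unfolding abs_mult by (intro mult_mono M1 M\<psi> k) (use M0 in auto)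
      ultimately show ?thesis using M\<psi>(2)[OF k, of y] by (auto simp: abs_le_iff)
    qed
    have \<Gamma>s: "\<Gamma> (s k) (s l) y = \<Gamma> (\<psi> k) (\<psi> l) y" if k: "k \<in> J" and l: "l \<in> J" for k l y
    proof -
      have 1: "\<Gamma> f (s l) y = \<Gamma> f (\<psi> l) y" if "f \<in> F" "l \<in> J" for f l
        unfolding s_def[abs_def] carre_add_right[OF \<psi>[OF that(2)] F_const that(1)] carre_const[OF that(1)] by simp
      have "\<Gamma> (s k) (s l) y = \<Gamma> (\<psi> l) (s k) y" unfolding 1[OF sF[OF k] l] by (rule carre_sym)
      also have "\<dots> = \<Gamma> (\<psi> k) (\<psi> l) y" unfolding 1[OF \<psi>[OF l] k] by (rule carre_sym)
      finally show ?thesis .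
    qed
    have L2: "\<bar>L (\<lambda>y. s k y * s k y) y\<bar> \<le> M2" if k: "k \<in> J" for k y
    proof -
      have "\<bar>s k y * L (s k) y\<bar> \<le> 2 * M * (M + M * M)" unfolding abs_mult by (intro mult_mono s_bound Ls k) (use M0 in auto)
      moreover have "\<bar>\<Gamma> (s k) (s k) y\<bar> \<le> M" unfolding \<Gamma>s[OF k k] by (rule M\<Gamma>[OF k k])
      moreover have "\<bar>s k y * s k y * L (\<lambda>_. 1) y\<bar> \<le> (2 * M) * (2 * M) * M" unfolding abs_mult by (intro mult_mono s_bound M1 k) (use M0 in auto)
      ultimately show ?thesis unfolding L_mult M2_def by linarith
    qed
    define f where "f k y = (1 / \<epsilon>\<^sup>2) * (s k y * s k y)" for k y
    have fF: "f k \<in> F" if "k \<in> J" for k unfolding f_def[abs_def] by (intro F_cmult F_mult sF that)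
    have FS: "(\<lambda>y. \<Sum>k\<in>J. f k y) \<in> F" by (intro F_sum fF)
    have LS: "L (\<lambda>y. \<Sum>k\<in>J. f k y) = (\<lambda>y. \<Sum>k\<in>J. L (f k) y)" by (intro L_sum fF)
    define \<rho> where "\<rho> y = 1 + (\<Sum>k\<in>J. f k y)" for y
    have \<rho>_eq: "(\<lambda>y. 1 + (\<Sum>k\<in>J. ((\<psi> k y - \<psi> k x0) / \<epsilon>)\<^sup>2)) = \<rho>"
      by (rule ext) (simp add: \<rho>_def f_def s_def power_divide power2_eq_square)
    have \<rho>F: "\<rho> \<in> F" unfolding \<rho>_def[abs_def] by (intro F_add F_const F_sum fF)
    have f0: "0 \<le> f k y" for k y by (simp add: f_def)
    have f\<rho>: "f k y \<le> \<rho> y" if "k \<in> J" for k y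
      using member_le_sum[OF that, of "\<lambda>k. f k y"] J f0 by (simp add: \<rho>_def)
    have \<rho>1: "1 \<le> \<rho> y" for y using sum_nonneg[of J "\<lambda>k. f k y"] f0 by (simp add: \<rho>_def)
    have "\<epsilon>\<^sup>2 * \<bar>L \<rho> y\<bar> \<le> B * \<rho> y" for y
    proof -
      have "L \<rho> y = L (\<lambda>_. 1) y + (\<Sum>k\<in>J. L (f k) y)"
        unfolding \<rho>_def[abs_def] L_add[OF F_const FS] LS ..
      also have "(\<Sum>k\<in>J. L (f k) y) = (1 / \<epsilon>\<^sup>2) * (\<Sum>k\<in>J. L (\<lambda>y. s k y * s k y) y)"
        unfolding sum_distrib_left f_def[abs_def] by (intro sum.cong refl fun_cong[OF L_cmult] F_mult sF)
      finally have "\<epsilon>\<^sup>2 * L \<rho> y = \<epsilon>\<^sup>2 * L (\<lambda>_. 1) y + (\<Sum>k\<in>J. L (\<lambda>y. s k y * s k y) y)" using \<epsilon> by (simp add: field_simps)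
      moreover have "\<bar>\<Sum>k\<in>J. L (\<lambda>y. s k y * s k y) y\<bar> \<le> real (card J) * M2"
        by (intro order_trans[OF sum_abs] sum_bounded_above L2)
      moreover have "\<bar>\<epsilon>\<^sup>2 * L (\<lambda>_. 1) y\<bar> \<le> 1 * M"
        unfolding abs_mult by (rule mult_mono) (use M1 \<epsilon> in \<open>auto simp: power_le_one\<close>)
      ultimately have "\<bar>\<epsilon>\<^sup>2 * L \<rho> y\<bar> \<le> B * 1" using B(3) by linarith
      also have "\<dots> \<le> B * \<rho> y" by (intro mult_left_mono \<rho>1 B)
      finally show ?thesis by (simp add: abs_mult)
    qed
    moreover have "\<epsilon>\<^sup>2 * \<Gamma> \<rho> \<rho> y \<le> B * \<rho> y" for y
    proof -
      have \<Gamma>\<rho>: "\<Gamma> k \<rho> y = (\<Sum>l\<in>J. \<Gamma> k (f l) y)" if "k \<in> F" for k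
        unfolding \<rho>_def[abs_def] carre_add_right[OF F_const FS that] carre_const[OF that] using carre_sum_right[OF that fF, of J "\<lambda>k. k"] by simp
      have ff: "\<epsilon>\<^sup>2 * \<Gamma> (f k) (f l) y \<le> 4 * M * \<rho> y" if k: "k \<in> J" and l: "l \<in> J" for k l
      proof -
        have d: "\<Gamma> (\<lambda>y. s k y * s k y) h y = 2 * s k y * \<Gamma> (s k) h y" if "h \<in> F" "k \<in> J" for h k
          using carre_derivation[OF sF[OF that(2)] sF[OF that(2)] that(1)] by simp
        have cl: "\<Gamma> (\<lambda>y. \<alpha> * h y) w y = \<alpha> * \<Gamma> w h y" if "h \<in> F" "w \<in> F" for \<alpha> h w
          unfolding carre_sym[of "\<lambda>y. \<alpha> * h y"] by (rule carre_cmult_right[OF that])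
        have "\<Gamma> (f k) (f l) y = (1 / \<epsilon>\<^sup>2) * \<Gamma> (f l) (\<lambda>y. s k y * s k y) y"
          unfolding f_def[of k, abs_def] by (intro cl F_mult sF fF k l)
        also have "\<Gamma> (f l) (\<lambda>y. s k y * s k y) y = (1 / \<epsilon>\<^sup>2) * \<Gamma> (\<lambda>y. s k y * s k y) (\<lambda>y. s l y * s l y) y"
          unfolding f_def[of l, abs_def] by (intro cl F_mult sF k l)
        also have "\<Gamma> (\<lambda>y. s k y * s k y) (\<lambda>y. s l y * s l y) y = 4 * (s k y * s l y) * \<Gamma> (s k) (s l) y"
          unfolding d[OF F_mult[OF sF[OF l] sF[OF l]] k] carre_sym[of "s k"] d[OF sF[OF k] l] by (simp add: carre_sym)
        finally have "\<epsilon>\<^sup>2 * \<Gamma> (f k) (f l) y = 4 * (s k y * s l y / \<epsilon>\<^sup>2 * \<Gamma> (s k) (s l) y)" using \<epsilon> by (simp add: field_simps)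
        also have "s k y * s l y / \<epsilon>\<^sup>2 * \<Gamma> (s k) (s l) y \<le> \<bar>s k y * s l y / \<epsilon>\<^sup>2\<bar> * \<bar>\<Gamma> (s k) (s l) y\<bar>" by (metis abs_ge_self abs_mult)
        also have "\<dots> \<le> \<rho> y * M"
        proof (rule mult_mono)
          have "\<bar>s k y * s l y / \<epsilon>\<^sup>2\<bar> \<le> (f k y + f l y) / 2"
            using sum_squares_bound[of "\<bar>s k y / \<epsilon>\<bar>" "\<bar>s l y / \<epsilon>\<bar>"] by (simp add: f_def power2_eq_square abs_mult field_simps)
          also have "\<dots> \<le> \<rho> y" using add_mono[OF f\<rho>[OF k, of y] f\<rho>[OF l, of y]] by simp
          finally show "\<bar>s k y * s l y / \<epsilon>\<^sup>2\<bar> \<le> \<rho> y" .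
          show "\<bar>\<Gamma> (s k) (s l) y\<bar> \<le> M" unfolding \<Gamma>s[OF k l] by (rule M\<Gamma>[OF k l])
          show "0 \<le> \<rho> y" using \<rho>1[of y] by simp
        qed simp
        finally show ?thesis by (simp add: mult_ac)
      qed
      have "\<epsilon>\<^sup>2 * \<Gamma> \<rho> \<rho> y = (\<Sum>k\<in>J. \<Sum>l\<in>J. \<epsilon>\<^sup>2 * \<Gamma> (f k) (f l) y)"
        unfolding \<Gamma>\<rho>[OF \<rho>F] sum_distrib_left by (intro sum.cong refl) (simp add: carre_sym[of \<rho>] \<Gamma>\<rho>[OF fF] sum_distrib_left)
      also have "\<dots> \<le> (\<Sum>k\<in>J. \<Sum>l\<in>J. 4 * M * \<rho> y)" by (intro sum_mono ff)
      also have "\<dots> = real (card J) * (real (card J) * (4 * M)) * \<rho> y" by simp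
      also have "\<dots> \<le> B * \<rho> y" using B(4) \<rho>1[of y] by (intro mult_right_mono) auto
      finally show ?thesis .
    qed
    moreover have "\<bar>L (\<lambda>_. 1) y\<bar> \<le> B" for y using M1[of y] B(2) by linarith
    ultimately show "weight B \<epsilon> (\<lambda>y. 1 + (\<Sum>k\<in>J. ((\<psi> k y - \<psi> k x0) / \<epsilon>)\<^sup>2))"
      unfolding \<rho>_eq weight_def using \<rho>F \<epsilon> B(1) \<rho>1 by blast
  qed
qed

end

lemma nn_integral_Cauchy_density: "(\<integral>\<^sup>+t. ennreal (1 / (1 + t\<^sup>2)) \<partial>lborel) < \<infinity>"
proof -
  let ?f = "\<lambda>t::real. ennreal (1 / (1 + t\<^sup>2))"
  have nz: "1 + t\<^sup>2 \<noteq> 0" for t :: real using zero_le_power2[of t] by linarith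
  have half: "(\<integral>\<^sup>+t. ?f t * indicator {0..} t \<partial>lborel) = ennreal (pi / 2 - arctan 0)"
  proof (rule nn_integral_FTC_atLeast)
    show "(\<lambda>t::real. 1 / (1 + t\<^sup>2)) \<in> borel_measurable borel" by measurable
    show "DERIV arctan t :> 1 / (1 + t\<^sup>2)" for t using DERIV_arctan[of t] by (simp add: inverse_eq_divide)
    show "(arctan \<longlongrightarrow> pi / 2) at_top" by (rule tendsto_arctan_at_top)
  qed simp
  have "(\<integral>\<^sup>+t. ?f t * indicator {..0} t \<partial>lborel) = (\<integral>\<^sup>+t. ?f t * indicator {0..} t \<partial>lborel)"
    by (subst nn_integral_real_affine[where c = "-1" and t = 0]) (auto simp: indicator_def)
  moreover have "(\<integral>\<^sup>+t. ?f t \<partial>lborel) \<le> (\<integral>\<^sup>+t. ?f t * indicator {..0} t + ?f t * indicator {0..} t \<partial>lborel)"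
    by (intro nn_integral_mono) (auto simp: indicator_def)
  moreover have "\<dots> = (\<integral>\<^sup>+t. ?f t * indicator {..0} t \<partial>lborel) + (\<integral>\<^sup>+t. ?f t * indicator {0..} t \<partial>lborel)"
    by (rule nn_integral_add) measurable
  ultimately have "(\<integral>\<^sup>+t. ?f t \<partial>lborel) \<le> ennreal (pi / 2 - arctan 0) + ennreal (pi / 2 - arctan 0)"
    using half by simp
  also have "\<dots> < \<infinity>" by simp
  finally show ?thesis .
qed

text \<open>The integrand is dominated by a product of one-dimensional Cauchy densities.\<close>

lemma nn_integral_decay:
  "(\<integral>\<^sup>+x. ennreal (1 / (1 + x \<bullet> x) ^ (2 * DIM('a))) \<partial>(lborel :: 'a::euclidean_space measure)) < \<infinity>"
proof -
  have "(\<integral>\<^sup>+x. ennreal (1 / (1 + x \<bullet> x) ^ (2 * DIM('a))) \<partial>(lborel :: 'a measure)) \<le> (\<integral>\<^sup>+x. (\<Prod>b\<in>Basis. ennreal (1 / (1 + (x \<bullet> b)\<^sup>2))) \<partial>(lborel :: 'a measure))"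
  proof (rule nn_integral_mono)
    fix x :: 'a
    have "(\<Prod>b\<in>Basis. 1 + (x \<bullet> b)\<^sup>2) \<le> (\<Prod>b\<in>(Basis :: 'a set). 1 + x \<bullet> x)"
    proof (rule prod_mono)
      fix b :: 'a assume "b \<in> Basis"
      then have "\<bar>x \<bullet> b\<bar>\<^sup>2 \<le> (norm x)\<^sup>2" by (intro power_mono Basis_le_norm) auto
      then show "0 \<le> 1 + (x \<bullet> b)\<^sup>2 \<and> 1 + (x \<bullet> b)\<^sup>2 \<le> 1 + x \<bullet> x" by (simp add: power2_norm_eq_inner)
    qed
    also have "\<dots> = (1 + x \<bullet> x) ^ DIM('a)" by simp
    also have "\<dots> \<le> (1 + x \<bullet> x) ^ (2 * DIM('a))" by (intro power_increasing) auto
    finally have le: "(\<Prod>b\<in>Basis. 1 + (x \<bullet> b)\<^sup>2) \<le> (1 + x \<bullet> x) ^ (2 * DIM('a))" .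
    have pos: "0 < (\<Prod>b\<in>Basis. 1 + (x \<bullet> b)\<^sup>2)" by (intro prod_pos) (simp add: add_pos_nonneg)
    have "ennreal (1 / (1 + x \<bullet> x) ^ (2 * DIM('a))) \<le> ennreal (\<Prod>b\<in>Basis. 1 / (1 + (x \<bullet> b)\<^sup>2))"
      unfolding prod_dividef prod.neutral_const using le pos by (intro ennreal_leI divide_left_mono mult_pos_pos) auto
    also have "\<dots> = (\<Prod>b\<in>Basis. ennreal (1 / (1 + (x \<bullet> b)\<^sup>2)))" by (rule prod_ennreal[symmetric]) simp
    finally show "ennreal (1 / (1 + x \<bullet> x) ^ (2 * DIM('a))) \<le> (\<Prod>b\<in>Basis. ennreal (1 / (1 + (x \<bullet> b)\<^sup>2)))" .
  qed
  also have "\<dots> = (\<Prod>b\<in>(Basis :: 'a set). \<integral>\<^sup>+t. ennreal (1 / (1 + t\<^sup>2)) \<partial>lborel)"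
    by (rule nn_integral_lborel_prod) auto
  also have "\<dots> < \<infinity>" using nn_integral_Cauchy_density by (simp add: power_less_top_ennreal)
  finally show ?thesis .
qed

context elliptic_setting
begin

text \<open>Rescaling by \<open>\<epsilon>\<close> around \<open>\<xi>\<close> in coordinates. The centre \<open>\<xi>\<close> is arbitrary: it need not be
  the coordinate of a point of the patch.\<close>

lemma patch_volume:
  assumes p: "patch c a r"
  obtains C where "0 < C"
    "\<forall>\<rho> \<epsilon> \<xi>. \<rho> \<in> borel_measurable borel \<longrightarrow> 0 < \<epsilon> \<longrightarrow>
       (\<forall>z\<in>cball a r. 1 + ((z - \<xi>) \<bullet> (z - \<xi>)) / \<epsilon>\<^sup>2 \<le> \<rho> (coord_inv c z)) \<longrightarrow>
       (\<integral>\<^sup>+y. ennreal (1 / \<rho> y ^ (2 * CARD('n))) * indicator (coord_inv c ` cball a r) y \<partial>\<mu>) \<le> ennreal (C * \<epsilon> ^ CARD('n))"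
proof -
  note P = patchD[OF p]
  let ?K = "cball a r" and ?n = "CARD('n)"
  let ?M = "coord_inv c ` ?K"
  obtain C0 where C0: "0 < C0" and up: "\<forall>f \<in> borel_measurable borel. (\<integral>\<^sup>+y. f y * indicator ?M y \<partial>\<mu>) \<le> ennreal C0 * (\<integral>\<^sup>+x. f (coord_inv c x) * indicator ?K x \<partial>lborel)"
    by (rule chart_compare[OF P(1) compact_cball P(4)])
  let ?V = "\<integral>\<^sup>+x. ennreal (1 / (1 + x \<bullet> x) ^ (2 * ?n)) \<partial>(lborel :: (real^'n) measure)"
  have V: "?V < \<infinity>" using nn_integral_decay[where 'a = "real^'n"] by simp
  define v where "v = enn2real ?V"
  have v: "0 \<le> v" "?V = ennreal v" using V by (simp_all add: v_def less_top)
  show ?thesis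
  proof (rule that[of "C0 * (v + 1)"], use C0 v in simp, intro allI impI)
    fix \<rho> :: "'m \<Rightarrow> real" and \<epsilon> :: real and \<xi> :: "real^'n"
    assume [measurable]: "\<rho> \<in> borel_measurable borel" and \<epsilon>: "0 < \<epsilon>" and le: "\<forall>z\<in>cball a r. 1 + ((z - \<xi>) \<bullet> (z - \<xi>)) / \<epsilon>\<^sup>2 \<le> \<rho> (coord_inv c z)"
    let ?H = "\<lambda>z. ennreal (1 / (1 + ((z - \<xi>) \<bullet> (z - \<xi>)) / \<epsilon>\<^sup>2) ^ (2 * ?n))"
    have "(\<integral>\<^sup>+y. ennreal (1 / \<rho> y ^ (2 * ?n)) * indicator ?M y \<partial>\<mu>) \<le> ennreal C0 * (\<integral>\<^sup>+x. ennreal (1 / \<rho> (coord_inv c x) ^ (2 * ?n)) * indicator ?K x \<partial>lborel)"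
      by (rule up[rule_format, of "\<lambda>y. ennreal (1 / \<rho> y ^ (2 * ?n))"]) measurable
    also have "\<dots> \<le> ennreal C0 * (\<integral>\<^sup>+z. ?H z \<partial>lborel)"
    proof (intro mult_left_mono nn_integral_mono)
      fix z
      show "ennreal (1 / \<rho> (coord_inv c z) ^ (2 * ?n)) * indicator ?K z \<le> ?H z"
      proof (cases "z \<in> ?K")
        case True
        have p1: "0 < 1 + ((z - \<xi>) \<bullet> (z - \<xi>)) / \<epsilon>\<^sup>2" by (intro add_pos_nonneg) auto
        have p2: "0 < \<rho> (coord_inv c z)" using le True p1 by fastforce
        have "1 / \<rho> (coord_inv c z) ^ (2 * ?n) \<le> 1 / (1 + ((z - \<xi>) \<bullet> (z - \<xi>)) / \<epsilon>\<^sup>2) ^ (2 * ?n)"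
          using le True p1 p2 by (intro divide_left_mono power_mono mult_pos_pos zero_less_power) auto
        then show ?thesis using True by (simp add: ennreal_leI)
      qed simp
    qed simp
    also have "(\<integral>\<^sup>+z. ?H z \<partial>lborel) = ennreal (\<bar>\<epsilon>\<bar> ^ DIM(real^'n)) * (\<integral>\<^sup>+x. ?H (\<xi> + \<epsilon> *\<^sub>R x) \<partial>lborel)"
      by (rule nn_integral_affine) (use \<epsilon> in \<open>simp_all\<close>)
    also have "(\<integral>\<^sup>+x. ?H (\<xi> + \<epsilon> *\<^sub>R x) \<partial>lborel) = ?V" using \<epsilon> by (simp add: power2_eq_square)
    also have "ennreal C0 * (ennreal (\<bar>\<epsilon>\<bar> ^ DIM(real^'n)) * ?V) = ennreal (C0 * (\<epsilon> ^ ?n * v))"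
      unfolding v(2) using C0 \<epsilon> v(1) by (simp add: ennreal_mult)
    also have "\<dots> \<le> ennreal (C0 * (v + 1) * \<epsilon> ^ ?n)"
      using C0 \<epsilon> by (intro ennreal_leI) (simp add: algebra_simps)
    finally show "(\<integral>\<^sup>+y. ennreal (1 / \<rho> y ^ (2 * ?n)) * indicator ?M y \<partial>\<mu>) \<le> ennreal (C0 * (v + 1) * \<epsilon> ^ ?n)" .
  qed
qed

text \<open>The weight uses, for every patch of a finite cover, globally defined functions which
  agree on the patch with its coordinates. On each patch it is therefore at least one
  plus the squared Euclidean distance from some point, in units of \<open>\<epsilon>\<close>.\<close>

lemma global_weights:
  obtains B CV and wt :: "real \<Rightarrow> 'm \<Rightarrow> 'm \<Rightarrow> real" where "0 \<le> B" "0 \<le> CV"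
    "\<forall>\<epsilon> x. 0 < \<epsilon> \<longrightarrow> \<epsilon> \<le> 1 \<longrightarrow> weight B \<epsilon> (wt \<epsilon> x)" "\<forall>\<epsilon> x. wt \<epsilon> x x = 1"
    "\<forall>\<epsilon> x. 0 < \<epsilon> \<longrightarrow> \<epsilon> \<le> 1 \<longrightarrow> (LINT y|\<mu>. 1 / wt \<epsilon> x y ^ (2 * CARD('n))) \<le> CV * \<epsilon> ^ CARD('n)"
proof -
  obtain I where I0: "finite I" "\<forall>c a r. (c, a, r) \<in> I \<longrightarrow> patch c a r" "(\<Union>(c, a, r)\<in>I. coord_inv c ` cball a r) = UNIV"
    by (rule finite_cover)
  note I = I0(1) I0(2)[rule_format] I0(3)
  let ?n = "CARD('n)"
  have "\<exists>f. f \<in> Cinf \<and> (\<forall>z\<in>cball a r. f (coord_inv c z) = z $ i)" if "(c, a, r) \<in> I" for c a r and i :: 'n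
  proof -
    have "smooth_on (\<lambda>z. z $ i) (UNIV :: (real^'n) set)"
      by (intro smooth_on_bounded_linear[OF _ bounded_linear_vec_nth] smooth_on_id) auto
    then show ?thesis using patch_function[OF I(2)[OF that], of "\<lambda>z. z $ i"] by metis
  qed
  then have "\<forall>k\<in>I \<times> UNIV. \<exists>f. f \<in> Cinf \<and> (case k of ((c, a, r), i :: 'n) \<Rightarrow> \<forall>z\<in>cball a r. f (coord_inv c z) = z $ i)" by auto
  then obtain \<psi> where \<psi>: "\<forall>k\<in>I \<times> UNIV. \<psi> k \<in> Cinf \<and> (case k of ((c, a, r), i :: 'n) \<Rightarrow> \<forall>z\<in>cball a r. \<psi> k (coord_inv c z) = z $ i)"
    unfolding bchoice_iff by blast
  let ?J = "I \<times> (UNIV :: 'n set)"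
  have J: "finite ?J" using I(1) by simp
  define wt where "wt \<epsilon> x y = 1 + (\<Sum>k\<in>?J. ((\<psi> k y - \<psi> k x) / \<epsilon>)\<^sup>2)" for \<epsilon> x y
  obtain B where B: "0 \<le> B" "\<forall>\<epsilon> x0. 0 < \<epsilon> \<longrightarrow> \<epsilon> \<le> 1 \<longrightarrow> weight B \<epsilon> (\<lambda>y. 1 + (\<Sum>k\<in>?J. ((\<psi> k y - \<psi> k x0) / \<epsilon>)\<^sup>2))"
    by (rule distance_weight[OF J, of \<psi>]) (use \<psi> in blast)
  have wt: "weight B \<epsilon> (wt \<epsilon> x)" if "0 < \<epsilon>" "\<epsilon> \<le> 1" for \<epsilon> x using B(2) that unfolding wt_def[abs_def] by blast
  let ?S = "{(\<epsilon>, x :: 'm). 0 < \<epsilon> \<and> \<epsilon> \<le> (1::real)}"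
  let ?f = "\<lambda>i y. ennreal (1 / wt (fst i) (snd i) y ^ (2 * ?n))"
  have wc: "cont (wt \<epsilon> x)" if "0 < \<epsilon>" "\<epsilon> \<le> 1" for \<epsilon> x
    by (rule Cinf_continuous[OF weightD(1)[OF wt[OF that]]])
  have wm: "wt \<epsilon> x \<in> borel_measurable borel" if "0 < \<epsilon>" "\<epsilon> \<le> 1" for \<epsilon> x
    by (rule borel_measurable_continuous_onI[OF wc[OF that]])
  obtain C where C: "0 < C" "\<forall>i\<in>?S. (\<integral>\<^sup>+y. ?f i y \<partial>\<mu>) \<le> ennreal (C * fst i ^ ?n)"
  proof (rule cover_bound[OF I, where S = ?S and f = ?f and R = "\<lambda>i. fst i ^ ?n"])
    show "?f i \<in> borel_measurable borel" if "i \<in> ?S" for i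
    proof -
      have [measurable]: "wt (fst i) (snd i) \<in> borel_measurable borel" using that by (intro wm) auto
      show ?thesis by measurable
    qed
    fix c a r assume q: "(c, a, r) \<in> I"
    obtain C where C: "0 < C" "\<forall>\<rho> \<epsilon> \<xi>. \<rho> \<in> borel_measurable borel \<longrightarrow> 0 < \<epsilon> \<longrightarrow>
       (\<forall>z\<in>cball a r. 1 + ((z - \<xi>) \<bullet> (z - \<xi>)) / \<epsilon>\<^sup>2 \<le> \<rho> (coord_inv c z)) \<longrightarrow>
       (\<integral>\<^sup>+y. ennreal (1 / \<rho> y ^ (2 * ?n)) * indicator (coord_inv c ` cball a r) y \<partial>\<mu>) \<le> ennreal (C * \<epsilon> ^ ?n)"
      by (rule patch_volume[OF I(2)[OF q]])
    have "(\<integral>\<^sup>+y. ?f (\<epsilon>, x) y * indicator (coord_inv c ` cball a r) y \<partial>\<mu>) \<le> ennreal (C * \<epsilon> ^ ?n)" if \<epsilon>: "0 < \<epsilon>" "\<epsilon> \<le> 1" for \<epsilon> x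
    proof -
      let ?q = "(c, a, r)"
      \<comment> \<open>The point \<open>x\<close> may lie outside the patch, where these functions are no longer coordinates.\<close>
      define \<xi> where "\<xi> = (\<chi> i. \<psi> (?q, i) x)"
      have le: "1 + ((z - \<xi>) \<bullet> (z - \<xi>)) / \<epsilon>\<^sup>2 \<le> wt \<epsilon> x (coord_inv c z)" if z: "z \<in> cball a r" for z
      proof -
        have "((z - \<xi>) \<bullet> (z - \<xi>)) / \<epsilon>\<^sup>2 = (\<Sum>i\<in>UNIV. ((\<psi> (?q, i) (coord_inv c z) - \<psi> (?q, i) x) / \<epsilon>)\<^sup>2)"
          unfolding inner_vec_def sum_divide_distrib
        proof (intro sum.cong refl)
          fix i :: 'n
          have "\<psi> (?q, i) (coord_inv c z) = z $ i" using bspec[OF \<psi>, of "(?q, i)"] q z by auto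
          then show "(z - \<xi>) $ i \<bullet> (z - \<xi>) $ i / \<epsilon>\<^sup>2 = ((\<psi> (?q, i) (coord_inv c z) - \<psi> (?q, i) x) / \<epsilon>)\<^sup>2"
            by (simp add: \<xi>_def power2_eq_square)
        qed
        also have "\<dots> = (\<Sum>k\<in>Pair ?q ` UNIV. ((\<psi> k (coord_inv c z) - \<psi> k x) / \<epsilon>)\<^sup>2)"
          by (simp add: sum.reindex inj_on_def)
        also have "\<dots> \<le> (\<Sum>k\<in>?J. ((\<psi> k (coord_inv c z) - \<psi> k x) / \<epsilon>)\<^sup>2)"
          by (intro sum_mono2 J) (use q in auto)
        finally show ?thesis by (simp add: wt_def)
      qed
      show ?thesis unfolding fst_conv snd_conv by (rule C(2)[rule_format, OF wm[OF \<epsilon>] \<epsilon>(1) le])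
    qed
    then show "\<exists>C>0. \<forall>i\<in>?S. (\<integral>\<^sup>+y. ?f i y * indicator (coord_inv c ` cball a r) y \<partial>\<mu>) \<le> ennreal (C * fst i ^ ?n)"
      using C(1) by (intro exI[of _ C]) auto
  qed auto
  have vol: "(LINT y|\<mu>. 1 / wt \<epsilon> x y ^ (2 * ?n)) \<le> C * \<epsilon> ^ ?n" if \<epsilon>: "0 < \<epsilon>" "\<epsilon> \<le> 1" for \<epsilon> x
  proof -
    have pos: "0 < wt \<epsilon> x y" for y using weightD(6)[OF wt[OF \<epsilon>]] .
    have "ennreal (LINT y|\<mu>. 1 / wt \<epsilon> x y ^ (2 * ?n)) = (\<integral>\<^sup>+y. ennreal (1 / wt \<epsilon> x y ^ (2 * ?n)) \<partial>\<mu>)"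
      using pos by (intro nn_integral_eq_integral[symmetric] integrable_continuous continuous_intros wc \<epsilon> AE_I2) (auto simp: less_imp_le less_imp_neq[symmetric])
    also have "\<dots> \<le> ennreal (C * \<epsilon> ^ ?n)" using bspec[OF C(2), of "(\<epsilon>, x)"] \<epsilon> by simp
    finally show ?thesis using C(1) \<epsilon> by (subst (asm) ennreal_le_iff) auto
  qed
  have self: "wt \<epsilon> x x = 1" for \<epsilon> x by (simp add: wt_def)
  show ?thesis by (rule that[OF B(1) less_imp_le[OF C(1)], of wt]) (use wt vol self in blast)+
qed

section \<open>The dyadic series\<close>

text \<open>The operator \<open>g (2 powr (- j) \<surd>L)\<close> on real functions.\<close>

definition low_pass :: "nat \<Rightarrow> ('m \<Rightarrow> real) \<Rightarrow> 'm \<Rightarrow> real" where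
  "low_pass j f x = (\<Sum>l. g (lam l / 2 ^ j) * (LINT y|\<mu>. f y * u l y) * u l x)"

lemma lam_unbounded: "filterlim lam at_top sequentially"
  using basis by (simp add: eigenbasis_def)

lemma lam_nonneg: "lam 0 = 0 \<Longrightarrow> 0 \<le> lam l"
  using basis monoD[of lam 0 l] by (simp add: eigenbasis_def)

lemma g_zero: "2 < t \<Longrightarrow> g t = 0"
proof -
  assume t: "2 < t"
  have "2\<^sup>2 < t\<^sup>2" by (rule power_strict_mono[OF t]) auto
  then have "g (sqrt \<bar>t\<^sup>2\<bar>) = 0" by (intro smooth_sqrt_cutoff(3)[OF g]) simp
  then show ?thesis using t by simp
qed

text \<open>The abstract convergence results for the symbol \<open>\<phi> s = g (sqrt \<bar>s\<bar>)\<close>.\<close>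

lemma spectral_convergence:
  assumes lam0: "lam 0 = 0"
  shows "\<And>f e. cont f \<Longrightarrow> 0 < e \<Longrightarrow> eventually (\<lambda>j. \<forall>x. \<bar>low_pass j f x - f x\<bar> < e) sequentially"
    and "\<And>(f :: 'm \<Rightarrow> real) p. 1 \<le> p \<Longrightarrow> f \<in> borel_measurable \<mu> \<Longrightarrow> integrable \<mu> (\<lambda>x. \<bar>f x\<bar> powr p) \<Longrightarrow> integrable \<mu> f"
    and "\<And>f p j. 1 \<le> p \<Longrightarrow> f \<in> borel_measurable \<mu> \<Longrightarrow> integrable \<mu> (\<lambda>x. \<bar>f x\<bar> powr p) \<Longrightarrow>
      integrable \<mu> (\<lambda>x. \<bar>low_pass j f x - f x\<bar> powr p)"
    and "\<And>f p. 1 \<le> p \<Longrightarrow> f \<in> borel_measurable \<mu> \<Longrightarrow> integrable \<mu> (\<lambda>x. \<bar>f x\<bar> powr p) \<Longrightarrow>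
      (\<lambda>j. LINT x|\<mu>. \<bar>low_pass j f x - f x\<bar> powr p) \<longlonglongrightarrow> 0"
proof -
  obtain CN where CN: "0 < CN" and nash: "nash_inequality CARD('n) CN"
    by (rule global_nash)
  obtain B CV wt where B: "0 \<le> B" "0 \<le> CV"
    and wt: "\<forall>\<epsilon> x. 0 < \<epsilon> \<longrightarrow> \<epsilon> \<le> 1 \<longrightarrow> weight B \<epsilon> (wt \<epsilon> x)" "\<forall>\<epsilon> x. wt \<epsilon> x x = 1"
    "\<forall>\<epsilon> x. 0 < \<epsilon> \<longrightarrow> \<epsilon> \<le> 1 \<longrightarrow> (LINT y|\<mu>. 1 / wt \<epsilon> x y ^ (2 * CARD('n))) \<le> CV * \<epsilon> ^ CARD('n)"
    by (rule global_weights)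
  interpret S: spectral_diffusion \<mu> Cinf Lr "\<lambda>l. (lam l)\<^sup>2" u
    by unfold_locales (auto simp: u_FF Lr_u u_orthonormal)
  interpret N: nash_diffusion \<mu> Cinf Lr "\<lambda>l. (lam l)\<^sup>2" u "CARD('n)" CN CV B wt
  proof
    show "filterlim (\<lambda>l. (lam l)\<^sup>2) at_top sequentially"
      using filterlim_pow_at_top[OF _ lam_unbounded, of 2] by simp
    show "(\<lambda>N. LINT x|\<mu>. (f x - S.comb N (\<lambda>l. LINT y|\<mu>. f y * u l y) x)\<^sup>2) \<longlonglongrightarrow> 0"
      if "f \<in> borel_measurable \<mu>" "integrable \<mu> (\<lambda>x. (f x)\<^sup>2)" for f
      unfolding S.comb_def by (rule real_complete[OF that])
    show "0 < measure \<mu> U" if "open U" "U \<noteq> {}" for U by (rule open_measure_pos[OF that])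
    show "\<exists>h\<in>Cinf. \<forall>x. \<bar>f x - h x\<bar> < e" if "cont f" "0 < e" for f e by (rule Cinf_dense[OF that])
  qed (use CN B wt nash in \<open>auto simp: Suc_le_eq\<close>)
  define \<phi> where "\<phi> s = g (sqrt \<bar>s\<bar>)" for s
  have \<phi>: "N.approx_id \<phi>" unfolding N.approx_id_def N.bump_symbol_def
  proof (intro conjI exI[of _ 5] allI impI)
    show "smooth_on \<phi> UNIV" unfolding \<phi>_def[abs_def] by (rule smooth_sqrt_cutoff(1)[OF g])
    show "\<phi> s = 0" if "5 \<le> \<bar>s\<bar>" for s unfolding \<phi>_def by (rule smooth_sqrt_cutoff(3)[OF g]) (use that in simp)
    show "\<phi> s = 1" if "\<bar>s\<bar> \<le> 1" for s unfolding \<phi>_def by (rule smooth_sqrt_cutoff(2)[OF g that])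
  qed simp
  have eq: "low_pass j f x = N.multop \<phi> (1 / 2 ^ j) f x" for j f x
  proof -
    have \<phi>l: "\<phi> ((1 / 2 ^ j)\<^sup>2 * (lam l)\<^sup>2) = g (lam l / 2 ^ j)" for l
    proof -
      have "(1 / 2 ^ j)\<^sup>2 * (lam l)\<^sup>2 = (lam l / 2 ^ j)\<^sup>2" by (simp add: power_divide)
      then show ?thesis using lam_nonneg[OF lam0, of l] by (simp add: \<phi>_def)
    qed
    have bs: "N.bump_symbol \<phi>" using \<phi> by (simp add: N.approx_id_def)
    have "low_pass j f x = (\<Sum>l<N.cut_index \<phi> (1 / 2 ^ j). g (lam l / 2 ^ j) * (LINT y|\<mu>. f y * u l y) * u l x)"
      unfolding low_pass_def
    proof (rule suminf_finite)
      fix l assume "l \<notin> {..<N.cut_index \<phi> (1 / 2 ^ j)}"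
      then have "\<phi> ((1 / 2 ^ j)\<^sup>2 * (lam l)\<^sup>2) = 0" by (intro N.cut_index[OF bs]) auto
      then show "g (lam l / 2 ^ j) * (LINT y|\<mu>. f y * u l y) * u l x = 0" unfolding \<phi>l by simp
    qed simp
    then show ?thesis unfolding N.multop_def S.comb_def N.coef_def \<phi>l by simp
  qed
  show "eventually (\<lambda>j. \<forall>x. \<bar>low_pass j f x - f x\<bar> < e) sequentially" if "cont f" "0 < e" for f e
    unfolding eq by (rule N.multop_uniform[OF \<phi> that])
  show "integrable \<mu> f" if "1 \<le> p" "f \<in> borel_measurable \<mu>" "integrable \<mu> (\<lambda>x. \<bar>f x\<bar> powr p)" for f :: "'m \<Rightarrow> real" and p
    by (rule N.integrable_powr_imp[OF that])
  show "(\<lambda>j. LINT x|\<mu>. \<bar>low_pass j f x - f x\<bar> powr p) \<longlonglongrightarrow> 0" if "1 \<le> p" "f \<in> borel_measurable \<mu>" "integrable \<mu> (\<lambda>x. \<bar>f x\<bar> powr p)" for f p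
    unfolding eq by (rule N.multop_Lp_converges[OF \<phi> that])
  show "integrable \<mu> (\<lambda>x. \<bar>low_pass j f x - f x\<bar> powr p)" if p: "1 \<le> p" and f: "f \<in> borel_measurable \<mu>" "integrable \<mu> (\<lambda>x. \<bar>f x\<bar> powr p)" for f p j
  proof -
    have c: "cont (low_pass j f)"
      unfolding eq[abs_def] N.multop_def S.comb_def by (intro continuous_intros Cinf_continuous u_FF)
    show ?thesis
      using N.integrable_powr_add[OF p borel_measurable_continuous[OF c], of "\<lambda>x. - f x"] N.integrable_powr_continuous[OF p c] f by simp
  qed
qed

lemma spectral_fun_finite:
  assumes "\<And>l. N \<le> l \<Longrightarrow> F (lam l) = 0"
  shows "spectral_fun \<mu> lam u F f x = (\<Sum>l<N. of_real (F (lam l)) * pairing \<mu> f (\<lambda>y. of_real (u l y)) * of_real (u l x))"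
  unfolding spectral_fun_def by (rule suminf_finite) (use assms in auto)

lemma dyadic_zero: "2 * 2 ^ j < t \<Longrightarrow> dyadic g j t = 0"
proof -
  assume t: "2 * 2 ^ j < t"
  then have 1: "2 < t / 2 ^ j" by (simp add: field_simps)
  then have "2 < 2 * (t / 2 ^ j)" by linarith
  then show ?thesis using g_zero[OF 1] g_zero[of "2 * (t / 2 ^ j)"] by (auto simp: dyadic_def Let_def)
qed

lemma dyadic_telescope: "(\<Sum>j<Suc N. dyadic g j t) = g (t / 2 ^ N)"
  by (induction N) (simp_all add: dyadic_def Let_def)

lemma dyadic_support:
  obtains K where "\<forall>j\<le>N. \<forall>l\<ge>K. dyadic g j (lam l) = 0" "\<forall>l\<ge>K. g (lam l / 2 ^ N) = 0"
proof -
  obtain K where K: "\<And>l. l \<ge> K \<Longrightarrow> 2 * 2 ^ N + 1 \<le> lam l"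
    using lam_unbounded unfolding filterlim_at_top eventually_sequentially by blast
  show ?thesis
  proof (rule that[of K]; intro allI impI)
    fix j l assume "j \<le> N" "K \<le> l"
    then have "(2::real) ^ j \<le> 2 ^ N" "2 * 2 ^ N + 1 \<le> lam l" using K by auto
    then show "dyadic g j (lam l) = 0" by (intro dyadic_zero) linarith
  next
    fix l assume "K \<le> l"
    then show "g (lam l / 2 ^ N) = 0" using K[of l] by (intro g_zero) (simp add: field_simps)
  qed
qed

lemma continuous_in_Lp:
  fixes k :: "'m \<Rightarrow> complex"
  assumes k: "cont k" and p: "1 \<le> p" shows "k \<in> Lp_space \<mu> p"
proof (cases p)
  case (real r)
  then have r: "1 \<le> r" using p by simp
  have "k \<in> borel_measurable \<mu>" using borel_measurable_continuous_onI[OF k] sets_\<mu> by (simp cong: measurable_cong_sets)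
  moreover have "integrable \<mu> (\<lambda>x. norm (k x) powr r)" using r by (intro integrable_continuous continuous_on_powr' continuous_intros k) auto
  ultimately show ?thesis unfolding Lp_space_def real by simp
qed (use p k in \<open>auto simp: Lp_space_def\<close>)

lemma dyadic_operator_in_Lp:
  assumes p: "1 \<le> p" shows "spectral_fun \<mu> lam u (dyadic g j) f \<in> Lp_space \<mu> p"
proof (rule continuous_in_Lp[OF _ p])
  obtain K where K: "\<forall>i\<le>j. \<forall>l\<ge>K. dyadic g i (lam l) = 0" "\<forall>l\<ge>K. g (lam l / 2 ^ j) = 0" by (rule dyadic_support)
  have "spectral_fun \<mu> lam u (dyadic g j) f = (\<lambda>x. \<Sum>l<K. of_real (dyadic g j (lam l)) * pairing \<mu> f (\<lambda>y. of_real (u l y)) * of_real (u l x))"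
    by (rule ext, rule spectral_fun_finite) (use K in auto)
  then show "cont (spectral_fun \<mu> lam u (dyadic g j) f)"
    by (auto intro!: continuous_intros Cinf_continuous u_FF)
qed

text \<open>Telescoping, separately for the real and imaginary parts. All series are finite sums
  with a common number of terms.\<close>

lemma dyadic_partial_sum:
  assumes f: "integrable \<mu> (\<lambda>x. Re (f x))" "integrable \<mu> (\<lambda>x. Im (f x))"
  shows "(\<Sum>j<Suc N. spectral_fun \<mu> lam u (dyadic g j) f x) = Complex (low_pass N (\<lambda>x. Re (f x)) x) (low_pass N (\<lambda>x. Im (f x)) x)"
proof -
  obtain K where K: "\<forall>j\<le>N. \<forall>l\<ge>K. dyadic g j (lam l) = 0" "\<forall>l\<ge>K. g (lam l / 2 ^ N) = 0" by (rule dyadic_support)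
  have iu: "integrable \<mu> (\<lambda>y. h y * u l y)" if "integrable \<mu> h" for h l
    by (rule integrable_mult_continuous[OF that Cinf_continuous[OF u_FF]])
  have pair: "pairing \<mu> f (\<lambda>y. of_real (u l y)) = Complex (LINT y|\<mu>. Re (f y) * u l y) (LINT y|\<mu>. Im (f y) * u l y)" for l
    using pairing_Complex[OF iu[OF f(1)] iu[OF f(2)]] by simp
  have s: "low_pass N h x = (\<Sum>l<K. g (lam l / 2 ^ N) * (LINT y|\<mu>. h y * u l y) * u l x)" for h
    unfolding low_pass_def by (rule suminf_finite) (use K(2) in auto)
  have "(\<Sum>j<Suc N. spectral_fun \<mu> lam u (dyadic g j) f x) =
    (\<Sum>j<Suc N. \<Sum>l<K. of_real (dyadic g j (lam l)) * pairing \<mu> f (\<lambda>y. of_real (u l y)) * of_real (u l x))"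
    by (intro sum.cong refl spectral_fun_finite) (use K(1) in auto)
  also have "\<dots> = (\<Sum>l<K. of_real (\<Sum>j<Suc N. dyadic g j (lam l)) * pairing \<mu> f (\<lambda>y. of_real (u l y)) * of_real (u l x))"
    unfolding of_real_sum sum_distrib_right by (rule sum.swap)
  also have "\<dots> = Complex (low_pass N (\<lambda>x. Re (f x)) x) (low_pass N (\<lambda>x. Im (f x)) x)"
    unfolding dyadic_telescope s pair by (simp add: complex_eq_iff)
  finally show ?thesis .
qed

text \<open>The real results applied to the real and imaginary parts. The first term of the
  sequence, an empty sum, is dropped so that the telescoping formula applies.\<close>

lemma Littlewood_Paley_converges:
  assumes lam0: "lam 0 = 0" and p: "1 \<le> p" and f: "f \<in> Lp_space \<mu> p"
  shows "(\<lambda>N. Lp_norm \<mu> p (\<lambda>x. (\<Sum>j<N. spectral_fun \<mu> lam u (dyadic g j) f x) - f x)) \<longlonglongrightarrow> 0"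
proof (rule LIMSEQ_imp_Suc)
  note conv = spectral_convergence[OF lam0]
  let ?f1 = "\<lambda>x. Re (f x)" and ?f2 = "\<lambda>x. Im (f x)"
  let ?D = "\<lambda>N x. Complex (low_pass N ?f1 x - ?f1 x) (low_pass N ?f2 x - ?f2 x)"
  have diff: "(\<lambda>x. (\<Sum>j<Suc N. spectral_fun \<mu> lam u (dyadic g j) f x) - f x) = ?D N"
    if "integrable \<mu> ?f1" "integrable \<mu> ?f2" for N
    by (rule ext) (unfold dyadic_partial_sum[OF that], simp add: complex_eq_iff)
  have norm_D: "norm (?D N x) \<le> \<bar>low_pass N ?f1 x - ?f1 x\<bar> + \<bar>low_pass N ?f2 x - ?f2 x\<bar>" for N x
    using cmod_le[of "?D N x"] by simp
  show "(\<lambda>N. Lp_norm \<mu> p (\<lambda>x. (\<Sum>j<Suc N. spectral_fun \<mu> lam u (dyadic g j) f x) - f x)) \<longlonglongrightarrow> 0"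
  proof (cases p)
    case (real r)
    have r: "1 \<le> r" using p real by simp
    have fm: "f \<in> borel_measurable \<mu>" and fi: "integrable \<mu> (\<lambda>x. norm (f x) powr r)"
      using f unfolding Lp_space_def real by auto
    have m: "?f1 \<in> borel_measurable \<mu>" "?f2 \<in> borel_measurable \<mu>" using fm by (simp_all add: borel_measurable_complex_iff)
    have i: "integrable \<mu> (\<lambda>x. \<bar>?f1 x\<bar> powr r)" "integrable \<mu> (\<lambda>x. \<bar>?f2 x\<bar> powr r)"
      using m r by (auto intro!: Bochner_Integration.integrable_bound[OF fi] AE_I2 powr_mono2 abs_Re_le_cmod abs_Im_le_cmod)
    have J: "integrable \<mu> ?f1" "integrable \<mu> ?f2" using conv(2)[OF r] m i by blast+
    define a where "a N = 3 powr r * ((LINT x|\<mu>. \<bar>low_pass N ?f1 x - ?f1 x\<bar> powr r) + (LINT x|\<mu>. \<bar>low_pass N ?f2 x - ?f2 x\<bar> powr r))" for N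
    have "a \<longlonglongrightarrow> 3 powr r * (0 + 0)" unfolding a_def[abs_def]
      by (intro tendsto_intros conv(4)[OF r m(1) i(1)] conv(4)[OF r m(2) i(2)])
    then have a: "a \<longlonglongrightarrow> 0" by simp
    have le: "(LINT x|\<mu>. norm (?D N x) powr r) \<le> a N" for N
    proof -
      let ?d = "\<lambda>x. 3 powr r * (\<bar>low_pass N ?f1 x - ?f1 x\<bar> powr r + \<bar>low_pass N ?f2 x - ?f2 x\<bar> powr r)"
      have di: "integrable \<mu> (\<lambda>x. \<bar>low_pass N ?f1 x - ?f1 x\<bar> powr r)" "integrable \<mu> (\<lambda>x. \<bar>low_pass N ?f2 x - ?f2 x\<bar> powr r)"
        by (intro conv(3)[OF r] m i)+
      have "(LINT x|\<mu>. norm (?D N x) powr r) \<le> (LINT x|\<mu>. ?d x)"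
      proof (rule integral_mono')
        show "integrable \<mu> ?d" using di by simp
        fix x
        have "norm (?D N x) powr r \<le> \<bar>\<bar>low_pass N ?f1 x - ?f1 x\<bar> + \<bar>low_pass N ?f2 x - ?f2 x\<bar>\<bar> powr r"
          using norm_D[of N x] r by (intro powr_mono2) auto
        also have "\<dots> \<le> ?d x" using powr_three[OF r, of "\<bar>low_pass N ?f1 x - ?f1 x\<bar>" "\<bar>low_pass N ?f2 x - ?f2 x\<bar>" 0] by simp
        finally show "norm (?D N x) powr r \<le> ?d x" .
      qed simp
      also have "\<dots> = a N" using di by (simp add: a_def)
      finally show ?thesis .
    qed
    have "(\<lambda>N. LINT x|\<mu>. norm (?D N x) powr r) \<longlonglongrightarrow> 0"
      by (rule tendsto_sandwich[OF _ _ tendsto_const a]) (use le in auto)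
    then have "(\<lambda>N. (LINT x|\<mu>. norm (?D N x) powr r) powr (1 / r)) \<longlonglongrightarrow> 0"
      by (rule tendsto_zero_powrI[OF _ tendsto_const]) (use r in auto)
    then show ?thesis unfolding diff[OF J] Lp_norm_def real by simp
  next
    case PInf
    have fc: "cont f" using f PInf by (simp add: Lp_space_def)
    have c: "cont ?f1" "cont ?f2" by (intro continuous_intros fc)+
    have J: "integrable \<mu> ?f1" "integrable \<mu> ?f2" by (intro integrable_continuous c)+
    show ?thesis unfolding diff[OF J] Lp_norm_def PInf
    proof (simp only: if_True refl, rule LIMSEQ_I)
      fix e :: real assume "0 < e"
      then have e: "0 < e / 4" by simp
      obtain N1 where N1: "\<forall>N\<ge>N1. \<forall>x. \<bar>low_pass N ?f1 x - ?f1 x\<bar> < e / 4" using conv(1)[OF c(1) e] unfolding eventually_sequentially by blast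
      obtain N2 where N2: "\<forall>N\<ge>N2. \<forall>x. \<bar>low_pass N ?f2 x - ?f2 x\<bar> < e / 4" using conv(1)[OF c(2) e] unfolding eventually_sequentially by blast
      show "\<exists>N0. \<forall>N\<ge>N0. norm ((SUP x. norm (?D N x)) - 0) < e"
      proof (intro exI[of _ "max N1 N2"] allI impI)
        fix N assume N: "max N1 N2 \<le> N"
        have b: "norm (?D N x) \<le> e / 2" for x
          using norm_D[of N x] N1[rule_format, of N x] N2[rule_format, of N x] N by auto
        have "(SUP x. norm (?D N x)) \<le> e / 2" by (intro cSUP_least b) simp
        moreover have "0 \<le> (SUP x. norm (?D N x))"
          by (rule cSUP_upper2[OF _ UNIV_I[of undefined]]) (use b in \<open>auto intro!: bdd_aboveI[of _ "e / 2"]\<close>)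
        ultimately show "norm ((SUP x. norm (?D N x)) - 0) < e" using \<open>0 < e\<close> by simp
      qed
    qed
  qed (use p in simp)
qed

end

theorem theorem7p4:
  fixes A :: "('m::{t2_space, second_countable_topology}, 'n::finite) chart set"
    and G :: "('m, 'n) chart \<Rightarrow> real^'n \<Rightarrow> real^'n^'n"
    and \<mu> :: "'m measure"
    and L :: "('m \<Rightarrow> complex) \<Rightarrow> 'm \<Rightarrow> complex"
    and sqrtL :: "'m graph"
    and lam :: "nat \<Rightarrow> real"
    and u :: "nat \<Rightarrow> 'm \<Rightarrow> real"
    and g :: "real \<Rightarrow> real"
    and p :: ereal
  assumes "compact_riemannian_manifold A G"
    and "connected (UNIV :: 'm set)"
    and "riemannian_measure A G \<mu>"
    and "elliptic_operator_2 A L"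
    and "self_adjoint \<mu> (L2_realization A \<mu> L)"
    and "non_negative \<mu> (L2_realization A \<mu> L)"
    and "positive_sqrt \<mu> (L2_realization A \<mu> L) sqrtL"
    and "eigenbasis A \<mu> sqrtL lam u"
    and "lam 0 = 0" and "0 < lam 1"
    and "cutoff g"
    and "1 \<le> p"
  shows "\<forall>f\<in>Lp_space \<mu> p.
    (\<forall>j. spectral_fun \<mu> lam u (dyadic g j) f \<in> Lp_space \<mu> p) \<and>
    (\<lambda>N. Lp_norm \<mu> p (\<lambda>x. (\<Sum>j<N. spectral_fun \<mu> lam u (dyadic g j) f x) - f x))
      \<longlonglongrightarrow> 0"
proof -
  interpret elliptic_setting A G \<mu> g L sqrtL lam u
    using assms by unfold_locales (auto simp: compact_riemannian_manifold_def)
  show ?thesis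
    using dyadic_operator_in_Lp[OF \<open>1 \<le> p\<close>] Littlewood_Paley_converges[OF \<open>lam 0 = 0\<close> \<open>1 \<le> p\<close>] by blast
qed

end
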